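(* Let $d\ge 3$ be an integer and let $\delta>0$. Let $(z_0(x),\dots,z_{d-1}(x),q(x))$ be the solution of the initial value problem $$z_j'(x)=f_j(x,z_0,\dots,z_{d-1})\ (0\le j\le d-1),\quad q'(x)=f_d(x,z_0,\dots,z_{d-1}),$$ $$z_0(0)=1,\quad z_j(0)=0\ (1\le j\le d-1),\quad q(0)=0,$$ with $f_0,\dots,f_d$ as defined in the context, and let $x^*=\inf\{x>0: z_0(x)=0\}$. Then a random graph $G\in\mathcal G_{n,d}$ asymptotically almost surely contains a total dominating set $D_T\subseteq V(G)$ such that $$|D_T|\le n\,(q(x^* )+\delta).$$
   Context: Graphs are finite and simple. A total dominating set of a graph $G=(V,E)$ is a set $S\subseteq V$ such that every vertex $v\in V$ is adjacent to a vertex of $S$. $\mathcal G_{n,d}$ is the uniform probability space on the set of all labelled $d$-regular graphs on $n$ vertices (with $nd$ even). An event holds asymptotically almost surely if its probability tends to $1$ as $n\to\infty$ (over $n$ with $nd$ even), for fixed $d$ and $\delta$. Functions $f_j$. Fix an integer $d\ge 3$. For real variables $(x,z_0,\dots,z_{d-1})$ put $s_k=\sum_{i=k}^{d-1}(d-i)z_i$ for $k\in\{0,1\}$, $\rho=s_1/s_0$, and for $k\in\{0,1\}$, $0\le j\le d-1$, $$\phi_j^{k}=\begin{cases}(d-j+1)z_{j-1}-(d-j)z_j & j>k,\\ -(d-j)z_j & j=k,\\ 0 & j<k.\end{cases}$$ Write $\mathbf 1_A$ for $1$ if $A$ holds and $0$ otherwise. For $0\le j\le d-1$ define, wherever $s_0\neq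 0$ (there is no explicit dependence on $x$), $$\begin{aligned} f_j={}&\sum_{i=1}^{d-1}\frac{(d-i)z_i}{s_0}\Big[-\mathbf 1_{j=0}+\mathbf 1_{j=1}-\mathbf 1_{j=i}+(d-i-1)\frac{\phi_j^0}{s_0}\Big]\\ &+\frac{dz_0}{s_0}\Big\{(1-\rho^{d-1})\Big(-2\cdot\mathbf 1_{j=0}+(d-1)\frac{\phi_j^0}{s_0}\Big)+(d-1)\Big(\frac{\phi_j^0}{s_0}-\rho^{d-2}\frac{\phi_j^1}{s_0}\Big)\Big\}\\ &+\frac{dz_0}{s_0}\Big\{\rho^{d-1}(1-\rho^{d-1})\Big(-2\cdot\mathbf 1_{j=0}-\mathbf 1_{j=1}+(d-1)\frac{\phi_j^0}{s_0}\Big)+(d-1)\rho^{d-2}(1-\rho^{d-1})\frac{\phi_j^1}{s_0}\\ &\qquad\quad+(d-1)\rho^{d-1}\Big(\frac{\phi_j^0}{s_0}-\rho^{d-2}\frac{\phi_j^1}{s_0}\Big)\Big\}\\ &+\frac{dz_0}{s_0}\Big\{-2\cdot\mathbf 1_{j=0}\,\rho^{2d-2}+2(d-2)\rho^{2d-3}\frac{\phi_j^1}{s_0}+2\rho^{2d-3}\sum_{m=1}^{d-1}\frac{(d-m)z_m}{s_0}\Big[-\mathbf 1_{j=m}+(d-m-1)\frac{\phi_j^0}{s_0}\Big]\Big\},\end{aligned}$$ and $$f_d=\frac{s_1}{s_0}+\frac{2dz_0}{s_0}.$$ The solution of the initial value problem is taken for $x\ge 0$ on its interval of existence in $\{s_0>0\}$,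 extended by continuity (limits) to the right endpoint if needed. *)

theory Defs
  imports "HOL-Probability.Probability"
begin

text \<open>
  A labelled simple graph on the vertex set \<open>{..<n}\<close> is identified with its set of edges, each edge
  being a two-element subset of \<open>{..<n}\<close>.
\<close>

definition regular_graphs :: "nat \<Rightarrow> nat \<Rightarrow> nat set set set" where
  "regular_graphs n d =
     {E. E \<subseteq> {e. e \<subseteq> {..<n} \<and> card e = 2} \<and> (\<forall>v<n. card {u. {u, v} \<in> E} = d)}"

definition total_dominating :: "'a set \<Rightarrow> 'a set set \<Rightarrow> 'a set \<Rightarrow> bool" where
  "total_dominating V E S \<longleftrightarrow> S \<subseteq> V \<and> (\<forall>v\<in>V. \<exists>u\<in>S. {u, v} \<in> E)"

text \<open>
  Only meaningful when \<open>d\<close>-regular graphs on \<open>n\<close> vertices exist; for \<open>n * d\<close> even this holds for all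
  \<open>n > d\<close>, which suffices for statements about limits.
\<close>

definition random_regular_graph :: "nat \<Rightarrow> nat \<Rightarrow> nat set set pmf" where
  "random_regular_graph n d = pmf_of_set (regular_graphs n d)"

definition asymptotically_almost_surely :: "nat \<Rightarrow> (nat \<Rightarrow> nat set set \<Rightarrow> bool) \<Rightarrow> bool" where
  "asymptotically_almost_surely d P \<longleftrightarrow>
     ((\<lambda>n. measure_pmf.prob (random_regular_graph n d) {E. P n E}) \<longlongrightarrow> 1)
       (inf sequentially (principal {n. even (n * d)}))"

text \<open>
  The vector \<open>(z\<^sub>0, \<dots>, z\<^bsub>d-1\<^esub>)\<close> is a function \<open>w :: nat \<Rightarrow> real\<close> of which only the values below \<open>d\<close>
  are used. The right-hand sides do not depend on the time variable, which is therefore omitted.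
\<close>

definition s_fun :: "nat \<Rightarrow> nat \<Rightarrow> (nat \<Rightarrow> real) \<Rightarrow> real" where
  "s_fun d k w = (\<Sum>i=k..d-1. (real d - real i) * w i)"

definition rho :: "nat \<Rightarrow> (nat \<Rightarrow> real) \<Rightarrow> real" where
  "rho d w = s_fun d 1 w / s_fun d 0 w"

definition phi :: "nat \<Rightarrow> nat \<Rightarrow> nat \<Rightarrow> (nat \<Rightarrow> real) \<Rightarrow> real" where
  "phi d k j w =
     (if j > k then (real d - real j + 1) * w (j - 1) - (real d - real j) * w j
      else if j = k then - (real d - real j) * w j
      else 0)"

definition f_fun :: "nat \<Rightarrow> nat \<Rightarrow> (nat \<Rightarrow> real) \<Rightarrow> real" where
  "f_fun d j w =
    (let s0 = s_fun d 0 w; r = rho d w; p0 = phi d 0 j w; p1 = phi d 1 j w in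
      (\<Sum>i=1..d-1. (real d - real i) * w i / s0 *
          (- of_bool (j = 0) + of_bool (j = 1) - of_bool (j = i)
           + (real d - real i - 1) * (p0 / s0)))
      + real d * w 0 / s0 *
          ((1 - r ^ (d - 1)) * (- 2 * of_bool (j = 0) + (real d - 1) * (p0 / s0))
           + (real d - 1) * (p0 / s0 - r ^ (d - 2) * (p1 / s0)))
      + real d * w 0 / s0 *
          (r ^ (d - 1) * (1 - r ^ (d - 1)) *
             (- 2 * of_bool (j = 0) - of_bool (j = 1) + (real d - 1) * (p0 / s0))
           + (real d - 1) * r ^ (d - 2) * (1 - r ^ (d - 1)) * (p1 / s0)
           + (real d - 1) * r ^ (d - 1) * (p0 / s0 - r ^ (d - 2) * (p1 / s0)))
      + real d * w 0 / s0 *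
          (- 2 * of_bool (j = 0) * r ^ (2 * d - 2)
           + 2 * (real d - 2) * r ^ (2 * d - 3) * (p1 / s0)
           + 2 * r ^ (2 * d - 3) *
               (\<Sum>m=1..d-1. (real d - real m) * w m / s0 *
                  (- of_bool (j = m) + (real d - real m - 1) * (p0 / s0)))))"

definition f_last :: "nat \<Rightarrow> (nat \<Rightarrow> real) \<Rightarrow> real" where
  "f_last d w = s_fun d 1 w / s_fun d 0 w + 2 * real d * w 0 / s_fun d 0 w"

text \<open>
  The interval of existence is \<open>[0, T)\<close> with \<open>T\<close> possibly infinite; \<open>z j x\<close> is the value of the
  \<open>j\<close>-th coordinate at time \<open>x\<close>.
\<close>

definition ivp_solution ::
    "nat \<Rightarrow> ereal \<Rightarrow> (nat \<Rightarrow> real \<Rightarrow> real) \<Rightarrow> (real \<Rightarrow> real) \<Rightarrow> bool" where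
  "ivp_solution d T z q \<longleftrightarrow>
     0 < T \<and>
     z 0 0 = 1 \<and> (\<forall>j\<in>{1..d-1}. z j 0 = 0) \<and> q 0 = 0 \<and>
     (\<forall>x. 0 \<le> x \<and> ereal x < T \<longrightarrow>
        s_fun d 0 (\<lambda>i. z i x) > 0 \<and>
        (\<forall>j<d. (z j has_real_derivative f_fun d j (\<lambda>i. z i x))
                  (at x within {t. 0 \<le> t \<and> ereal t < T})) \<and>
        (q has_real_derivative f_last d (\<lambda>i. z i x))
                  (at x within {t. 0 \<le> t \<and> ereal t < T}))"

definition maximal_ivp_solution ::
    "nat \<Rightarrow> ereal \<Rightarrow> (nat \<Rightarrow> real \<Rightarrow> real) \<Rightarrow> (real \<Rightarrow> real) \<Rightarrow> bool" where
  "maximal_ivp_solution d T z q \<longleftrightarrow>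
     ivp_solution d T z q \<and>
     \<not> (\<exists>T' z' q'. T < T' \<and> ivp_solution d T' z' q' \<and>
          (\<forall>x. 0 \<le> x \<and> ereal x < T \<longrightarrow> (\<forall>j<d. z' j x = z j x) \<and> q' x = q x))"

text \<open>
  A function on \<open>[0, T)\<close> is extended to a finite right endpoint \<open>T\<close> by its left limit, if there is
  one: \<open>extended_value T g x y\<close> says that the extension is defined at \<open>x\<close> and has the value \<open>y\<close>.
\<close>

definition extended_value :: "ereal \<Rightarrow> (real \<Rightarrow> real) \<Rightarrow> real \<Rightarrow> real \<Rightarrow> bool" where
  "extended_value T g x y \<longleftrightarrow>
     (ereal x < T \<and> g x = y) \<or> (ereal x = T \<and> (g \<longlongrightarrow> y) (at_left x))"

definition x_star :: "ereal \<Rightarrow> (nat \<Rightarrow> real \<Rightarrow> real) \<Rightarrow> real" where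
  "x_star T z = Inf {x. 0 < x \<and> extended_value T (z 0) x 0}"

definition q_star :: "ereal \<Rightarrow> (nat \<Rightarrow> real \<Rightarrow> real) \<Rightarrow> (real \<Rightarrow> real) \<Rightarrow> real" where
  "q_star T z q = (THE y. extended_value T q (x_star T z) y)"

end

theory Submission
  imports Defs "HOL-Combinatorics.Multiset_Permutations"
begin

text \<open>
  Expose a uniformly random perfect matching of the points \<open>{..<n} \<times> {..<d}\<close> (the configuration
  model) step by step. A step of the greedy algorithm picks a vertex without exposed points, reveals
  some of the edges around it and puts one or two vertices into the total dominating set; averaging
  over the answers shows that \<open>f_fun\<close> and \<open>f_last\<close> are the expected changes per step, up to
  \<open>O(1/n)\<close>, of the numbers of vertices with \<open>j\<close> exposed points and of the size of the dominating
  set. As long as \<open>z 0\<close> stays away from \<open>0\<close>, an exponential moment of the squared distance between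
  the process and the solution grows only by a bounded factor, so the process leaves a
  neighbourhood of the solution with exponentially small probability. Shortly before \<open>x_star\<close> only
  few vertices are untouched, and one neighbour is added for each of them.

  The probability that the matching projects to a simple graph is at least polynomially small: the
  partial simple matchings are extended by counting as long as many points are free, and by
  switchings at the end. Since every simple \<open>d\<close>-regular graph comes from exactly \<open>(d!) ^ n\<close>
  matchings, exponentially small failure probabilities carry over to random regular graphs.
\<close>

section \<open>Exposing a random perfect matching\<close>

text \<open>No random process is constructed. The failure probability is a function of the unexposed
  points and of the number of chosen vertices; averaging over the next answers gives a one-step
  inequality, which is used by backward induction. Exponential bounds are required because passing
  from matchings to simple graphs costs a factor polynomial in \<open>n\<close>. An answer at a
  vertex already visited would spoil the exact formula for the change of the degree counts. Such a
  step is abandoned, and all vertices it visited are put into the dominating set. This, and the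
  difference between drawing with and without replacement, perturbs the mean change per step by
  \<open>O(1/n)\<close>, which the concentration estimate tolerates. After each step all vertices
  with an exposed point are dominated, so only untouched vertices create work. That
  \<open>z 0\<close> tends to 0 rests on two facts: while \<open>z 0\<close> is positive,
  \<open>z 0 + q\<close> is nonincreasing and \<open>q\<close> has slope at least 1, and a solution
  on which \<open>z 0\<close> stays away from 0 can be continued.\<close>

declare split_paired_All [simp del] split_paired_Ex [simp del]

section \<open>Perfect matchings and the uniform distribution on them\<close>

definition pmatchings :: "'a set \<Rightarrow> 'a set set set" where
  "pmatchings P = {M. (\<forall>e\<in>M. card e = 2) \<and> disjoint M \<and> \<Union>M = P}"

text \<open>The uniform probability of \<open>S\<close> on \<open>A\<close>, as a plain quotient of
  cardinalities. It is 0 for empty \<open>A\<close>, a case that occurs for the perfect matchings of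
  an odd number of points.\<close>

definition fr :: "'a set \<Rightarrow> ('a \<Rightarrow> bool) \<Rightarrow> real" where
  "fr A S = real (card {a\<in>A. S a}) / real (card A)"

lemma fr_le_1: "finite A \<Longrightarrow> fr A S \<le> 1"
  unfolding fr_def by (cases "card A = 0") (auto intro!: divide_le_eq_1_pos[THEN iffD2] card_mono)

lemma fr_nonneg: "0 \<le> fr A S"
  by (simp add: fr_def)

lemma fr_mono: "finite A \<Longrightarrow> (\<And>a. a \<in> A \<Longrightarrow> S a \<Longrightarrow> S' a) \<Longrightarrow> fr A S \<le> fr A S'"
  unfolding fr_def by (intro divide_right_mono of_nat_mono card_mono) auto

lemma finite_pmatchings: "finite P \<Longrightarrow> finite (pmatchings P)"
  by (rule finite_subset[of _ "Pow (Pow P)"]) (auto simp: pmatchings_def)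

lemma pmatchings_insert:
  assumes "x \<in> P" "y \<in> P" "x \<noteq> y" "M \<in> pmatchings (P - {x, y})"
  shows "insert {x, y} M \<in> pmatchings P"
proof -
  have u: "\<Union>M = P - {x,y}" using assms(4) by (simp add: pmatchings_def)
  have "disjoint (insert {x,y} M)"
    unfolding pairwise_insert
  proof (intro conjI allI impI)
    show "disjoint M" using assms(4) by (simp add: pmatchings_def)
    fix e assume "e \<in> M \<and> e \<noteq> {x, y}"
    then have "e \<subseteq> P - {x, y}" using u by blast
    then show "disjnt {x, y} e" "disjnt e {x, y}" by (auto simp: disjnt_def)
  qed
  then show ?thesis using assms u by (auto simp: pmatchings_def)
qed

lemma pmatchings_remove:
  assumes "x \<in> P" "M \<in> pmatchings P"
  obtains y where "y \<in> P" "y \<noteq> x" "{x, y} \<in> M" "M - {{x, y}} \<in> pmatchings (P - {x, y})"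
proof -
  obtain e where e: "e \<in> M" "x \<in> e" using assms by (auto simp: pmatchings_def)
  have "card e = 2" using e assms by (auto simp: pmatchings_def)
  then obtain y where y: "e = {x, y}" "x \<noteq> y"
    using e(2) by (auto simp: card_2_iff doubleton_eq_iff)
  have dj: "\<And>f. f \<in> M \<Longrightarrow> f \<noteq> e \<Longrightarrow> f \<inter> e = {}"
    using assms(2) e(1) by (auto simp: pmatchings_def pairwise_def disjnt_def)
  have "\<Union>(M - {e}) = P - e"
    using assms(2) dj e(1) by (auto simp: pmatchings_def)
  then have "M - {e} \<in> pmatchings (P - e)"
    using assms(2) by (auto simp: pmatchings_def pairwise_def)
  moreover have "y \<in> P" using assms(2) e y by (auto simp: pmatchings_def)
  ultimately show ?thesis using that[of y] y e by auto
qed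

text \<open>The matchings are classified by the partner \<open>y\<close> of the fixed point
  \<open>x\<close>; removing the edge is a bijection onto the matchings of the other points.\<close>

lemma card_pmatchings_filter:
  assumes "finite P" "x \<in> P"
  shows "card {M \<in> pmatchings P. S M}
       = (\<Sum>y\<in>P - {x}. card {M \<in> pmatchings (P - {x, y}). S (insert {x, y} M)})"
proof -
  define B where "B y = {M \<in> pmatchings (P - {x, y}). S (insert {x, y} M)}" for y
  have eq: "{M \<in> pmatchings P. S M} = (\<Union>y\<in>P - {x}. insert {x, y} ` B y)"
  proof (intro set_eqI iffI)
    fix M assume M: "M \<in> {M \<in> pmatchings P. S M}"
    then obtain y where y: "y \<in> P" "y \<noteq> x" "{x, y} \<in> M" "M - {{x, y}} \<in> pmatchings (P - {x, y})"
      using pmatchings_remove[OF assms(2)] by blast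
    have "insert {x,y} (M - {{x, y}}) = M" using y by auto
    then show "M \<in> (\<Union>y\<in>P - {x}. insert {x, y} ` B y)"
      using y M unfolding B_def by (intro UN_I[of y] image_eqI[of _ _ "M - {{x,y}}"]) auto
  next
    fix M assume "M \<in> (\<Union>y\<in>P - {x}. insert {x, y} ` B y)"
    then show "M \<in> {M \<in> pmatchings P. S M}"
      using pmatchings_insert[OF assms(2)] by (auto simp: B_def)
  qed
  have notin: "{x, y'} \<notin> M" if "M \<in> B y" for M y y'
    using that by (auto simp: B_def pmatchings_def)
  have fin: "finite (B y)" for y
    using assms finite_pmatchings[of "P - {x, y}"] by (simp add: B_def)
  have "card (\<Union>y\<in>P - {x}. insert {x, y} ` B y) = (\<Sum>y\<in>P - {x}. card (insert {x, y} ` B y))"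
  proof (rule card_UN_disjoint)
    show "\<forall>i\<in>P - {x}. \<forall>j\<in>P - {x}. i \<noteq> j \<longrightarrow> insert {x, i} ` B i \<inter> insert {x, j} ` B j = {}"
    proof (intro ballI impI)
      fix i j assume ij: "i \<in> P - {x}" "j \<in> P - {x}" "i \<noteq> j"
      have "{x, i} \<noteq> {x, j}" using ij by (auto simp: doubleton_eq_iff)
      then have "insert {x, i} M \<noteq> insert {x, j} M'" if "M' \<in> B j" for M M'
        using notin[OF that] by blast
      then show "insert {x, i} ` B i \<inter> insert {x, j} ` B j = {}" by blast
    qed
  qed (use assms fin in auto)
  also have "\<dots> = (\<Sum>y\<in>P - {x}. card (B y))"
  proof (rule sum.cong[OF refl], rule card_image, rule inj_onI)
    fix y M M' assume "M \<in> B y" "M' \<in> B y" "insert {x, y} M = insert {x, y} M'"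
    then show "M = M'" using notin[of M y y] notin[of M' y y] by (simp add: insert_ident)
  qed
  finally show ?thesis using eq by (simp add: B_def)
qed

text \<open>The double factorial of \<open>n - 1\<close> for even \<open>n\<close>, and 0 for odd
  \<open>n\<close>.\<close>

fun pmc :: "nat \<Rightarrow> nat" where
  "pmc 0 = 1" | "pmc (Suc 0) = 0" | "pmc (Suc (Suc n)) = Suc n * pmc n"

lemma card_pmatchings: "finite P \<Longrightarrow> card (pmatchings P) = pmc (card P)"
proof (induction "card P" arbitrary: P rule: pmc.induct)
  case 1
  then have "P = {}" by simp
  have "M = {}" if "M \<in> pmatchings P" for M
  proof (rule ccontr)
    assume "M \<noteq> {}"
    then obtain e where "e \<in> M" by auto
    then have "e = {}" "card e = 2" using that \<open>P = {}\<close> by (auto simp: pmatchings_def)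
    then show False by simp
  qed
  moreover have "{} \<in> pmatchings P" using \<open>P = {}\<close> by (simp add: pmatchings_def)
  ultimately have "pmatchings P = {{}}" by blast
  then show ?case using 1 by simp
next
  case 2
  then obtain x where x: "P = {x}" by (metis card_1_singletonE One_nat_def)
  show ?case using card_pmatchings_filter[of P x "\<lambda>_. True"] x by simp
next
  case (3 n)
  then obtain x where x: "x \<in> P" by fastforce
  have "card (P - {x, y}) = n" if "y \<in> P - {x}" for y
    using that x 3 by (subst card_Diff_subset) auto
  then have "card (pmatchings (P - {x, y})) = pmc n" if "y \<in> P - {x}" for y
    using that 3 by auto
  then show ?case
    using card_pmatchings_filter[of P x "\<lambda>_. True"] x 3(2)[symmetric] 3(3) by simp
qed

text \<open>The partner of \<open>x\<close> is uniform, because the number of matchings of the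
  remaining points depends only on how many they are. Given the partner, the rest is again a uniform
  matching; this makes step-by-step exposure possible.\<close>

lemma fr_pmatchings_step:
  assumes "finite P" "x \<in> P"
  shows "fr (pmatchings P) S
       = (\<Sum>y\<in>P - {x}. fr (pmatchings (P - {x, y})) (\<lambda>M. S (insert {x, y} M))) / card (P - {x})"
proof (cases "P - {x} = {}")
  case True
  then have "P = {x}" using assms by auto
  moreover have "card (pmatchings {x}) = 0" by (simp add: card_pmatchings)
  ultimately show ?thesis by (simp add: fr_def)
next
  case False
  then obtain y0 where "y0 \<in> P" "y0 \<noteq> x" by auto
  then have "2 \<le> card P" using assms card_mono[of P "{x,y0}"] by auto
  then obtain k where k: "card P = Suc (Suc k)" by (metis add_2_eq_Suc le_iff_add)
  have c: "card (pmatchings (P - {x, y})) = pmc k" if "y \<in> P - {x}" for y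
    using that assms k by (subst card_pmatchings) (auto simp: card_Diff_subset)
  have "(\<Sum>y\<in>P - {x}. fr (pmatchings (P - {x, y})) (\<lambda>M. S (insert {x, y} M)))
      = (\<Sum>y\<in>P - {x}. real (card {M \<in> pmatchings (P - {x, y}). S (insert {x, y} M)}) / pmc k)"
    using c by (intro sum.cong) (auto simp: fr_def)
  then show ?thesis
    using assms k unfolding fr_def card_pmatchings_filter[OF assms]
    by (simp add: card_pmatchings sum_divide_distrib field_simps)
qed

text \<open>
  An expectation over outcomes in \<open>S\<close>, given only by linearity, monotonicity and normalisation.
\<close>

definition expect :: "(('s \<Rightarrow> real) \<Rightarrow> real) \<Rightarrow> 's set \<Rightarrow> bool" where
  "expect E S \<longleftrightarrow> (\<forall>f g. E (\<lambda>s. f s + g s) = E f + E g) \<and> (\<forall>c f. E (\<lambda>s. c * f s) = c * E f) \<and>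
     (\<forall>f g. (\<forall>s\<in>S. f s \<le> g s) \<longrightarrow> E f \<le> E g) \<and> E (\<lambda>_. 1) = 1"

type_synonym point = "nat \<times> nat"
type_synonym history = "(point \<times> point) list"

text \<open>
  A strategy for exposing a matching: \<open>Ask x\<close> reveals the partner of the point \<open>x\<close>. The history lists
  the revealed pairs, the latest one first. In \<open>rv\<close> and \<open>outs\<close> a strategy is abandoned, with result
  \<open>None\<close>, as soon as an answer lies at a vertex that was visited before; this has probability \<open>O(1/n)\<close>.
\<close>

datatype 'a dtree = Ret 'a | Ask point "point \<Rightarrow> 'a dtree"

definition pts :: "history \<Rightarrow> point set" where
  "pts H = fst ` set H \<union> snd ` set H"

definition vts :: "history \<Rightarrow> nat set" where
  "vts H = fst ` pts H"

definition edges :: "history \<Rightarrow> point set set" where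
  "edges H = (\<lambda>(x, y). {x, y}) ` set H"

lemma pts_simps [simp]: "pts [] = {}" "pts ((x, y) # H) = {x, y} \<union> pts H"
  by (auto simp: pts_def)

lemma vts_simps [simp]: "vts [] = {}" "vts ((x, y) # H) = {fst x, fst y} \<union> vts H"
  by (auto simp: vts_def)

lemma edges_simps [simp]: "edges [] = {}" "edges ((x, y) # H) = insert {x, y} (edges H)"
  by (auto simp: edges_def)

lemma finite_pts [simp]: "finite (pts H)" by (simp add: pts_def)
lemma finite_vts [simp]: "finite (vts H)" by (simp add: vts_def)

lemma card_pts: "card (pts H) \<le> 2 * length H"
  by (induction H) (auto simp: card_insert_if intro: le_SucI)

lemma card_vts: "card (vts H) \<le> 2 * length H"
  unfolding vts_def using card_image_le[OF finite_pts, of fst H] card_pts[of H] by simp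

text \<open>The expectation for the true exposure, in which a partner is uniform among the unexposed
  points. The history is handed to \<open>f\<close> because an abandoned strategy returns no result,
  only what it has revealed.\<close>

primrec rv :: "'a dtree \<Rightarrow> point set \<Rightarrow> ('a option \<times> history \<Rightarrow> real) \<Rightarrow> history \<Rightarrow> real" where
  "rv (Ret a) P f H = f (Some a, H)"
| "rv (Ask x t) P f H =
     (\<Sum>y\<in>P - pts H - {x}.
        if fst y \<in> insert (fst x) (vts H) then f (None, (x, y) # H) else rv (t y) P f ((x, y) # H))
     / card (P - pts H - {x})"

primrec outs :: "'a dtree \<Rightarrow> point set \<Rightarrow> history \<Rightarrow> ('a option \<times> history) set" where
  "outs (Ret a) P H = {(Some a, H)}"
| "outs (Ask x t) P H =
     (\<Union>y\<in>P - pts H - {x}.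
        if fst y \<in> insert (fst x) (vts H) then {(None, (x, y) # H)} else outs (t y) P ((x, y) # H))"

text \<open>Every question after the first must concern a visited vertex. This is what makes a
  history without collisions a tree.\<close>

primrec wft :: "'a dtree \<Rightarrow> point set \<Rightarrow> history \<Rightarrow> bool" where
  "wft (Ret a) P H = True"
| "wft (Ask x t) P H =
     (x \<in> P - pts H \<and> (H = [] \<or> fst x \<in> vts H) \<and> (\<forall>y\<in>P - pts H - {x}. fst y \<notin> insert (fst x) (vts H) \<longrightarrow> wft (t y) P ((x, y) # H)))"

primrec dep :: "'a dtree \<Rightarrow> nat \<Rightarrow> bool" where
  "dep (Ret a) k = True"
| "dep (Ask x t) k = (k > 0 \<and> (\<forall>y. dep (t y) (k - 1)))"

text \<open>
  The value of a strategy if its answers were independent and uniform on \<open>P\<close>, without collisions.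
\<close>

primrec iv :: "'a dtree \<Rightarrow> point set \<Rightarrow> ('a \<Rightarrow> real) \<Rightarrow> real" where
  "iv (Ret a) P g = g a"
| "iv (Ask x t) P g = (\<Sum>y\<in>P. iv (t y) P g) / card P"

lemma dep_mono: "dep t k \<Longrightarrow> k \<le> l \<Longrightarrow> dep t l"
proof (induction t arbitrary: k l)
  case (Ask x t)
  have "dep (t y) (l - 1)" for y
    using Ask.IH[of "t y" "k - 1" "l - 1"] Ask.prems by auto
  then show ?case using Ask.prems by auto
qed simp

text \<open>Iterating \<open>fr_pmatchings_step\<close> along the strategy turns the probability
  into an average over its outcomes, so a bound valid after each outcome may be averaged. The
  matching still to be drawn and the revealed \<open>edges\<close> together form the full
  matching.\<close>

lemma fr_le_rv:
  assumes "finite P" "wft t P H"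
    and "\<And>r H'. (r, H') \<in> outs t P H \<Longrightarrow>
           fr (pmatchings (P - pts H')) (\<lambda>M. S (M \<union> edges H')) \<le> f (r, H')"
  shows "fr (pmatchings (P - pts H)) (\<lambda>M. S (M \<union> edges H)) \<le> rv t P f H"
  using assms(2,3)
proof (induction t arbitrary: H)
  case (Ret a)
  then show ?case by simp
next
  case (Ask x t)
  let ?Q = "P - pts H"
  have x: "x \<in> ?Q" using Ask.prems by simp
  have "fr (pmatchings (?Q - {x, y})) (\<lambda>M. S (insert {x, y} M \<union> edges H))
      \<le> (if fst y \<in> insert (fst x) (vts H) then f (None, (x, y) # H) else rv (t y) P f ((x, y) # H))"
    if y: "y \<in> ?Q - {x}" for y
  proof -
    have eq: "?Q - {x, y} = P - pts ((x, y) # H)"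
      "\<And>M. insert {x, y} M \<union> edges H = M \<union> edges ((x, y) # H)" by auto
    show ?thesis
    proof (cases "fst y \<in> insert (fst x) (vts H)")
      case True
      then show ?thesis using Ask.prems(2)[of None "(x, y) # H"] y unfolding eq by auto
    next
      case False
      have "fr (pmatchings (P - pts ((x, y) # H))) (\<lambda>M. S (M \<union> edges ((x, y) # H)))
          \<le> rv (t y) P f ((x, y) # H)"
      proof (rule Ask.IH)
        show "wft (t y) P ((x, y) # H)" using Ask.prems(1) y False by auto
        show "fr (pmatchings (P - pts H')) (\<lambda>M. S (M \<union> edges H')) \<le> f (r, H')"
          if "(r, H') \<in> outs (t y) P ((x, y) # H)" for r H'
          using that Ask.prems(2)[of r H'] y False by auto
      qed simp
      then show ?thesis using False unfolding eq by simp
    qed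
  qed
  then show ?case
    unfolding rv.simps
    by (subst fr_pmatchings_step[OF _ x]) (auto simp: assms(1) intro!: divide_right_mono sum_mono)
qed

lemma card_Diff_pts_pos:
  assumes "finite P" "2 * length H + 1 < card P"
  shows "P - pts H - {x} \<noteq> {}"
proof
  assume "P - pts H - {x} = {}"
  then have "P \<subseteq> insert x (pts H)" by auto
  then have "card P \<le> card (insert x (pts H))" by (intro card_mono) auto
  also have "\<dots> \<le> Suc (card (pts H))" by (simp add: card_insert_if)
  finally show False using assms card_pts[of H] by simp
qed

text \<open>The size condition keeps every set that is averaged over nonempty; otherwise the average
  of 1 would be 0 and normalisation would fail.\<close>

lemma expect_rv:
  assumes "finite P" "dep t k" "2 * (length H + k) < card P"
  shows "expect (\<lambda>f. rv t P f H) (outs t P H)"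
  using assms(2,3)
proof (induction t arbitrary: H k)
  case (Ret a)
  then show ?case by (simp add: expect_def)
next
  case (Ask x t)
  let ?S = "P - pts H - {x}"
  have k: "k > 0" using Ask by simp
  have S: "?S \<noteq> {}" "finite ?S"
    using card_Diff_pts_pos[OF assms(1), of H x] Ask.prems k assms(1) by auto
  have IH: "expect (\<lambda>f. rv (t y) P f ((x, y) # H)) (outs (t y) P ((x, y) # H))" for y
    using Ask.prems k by (intro Ask.IH[of _ "k - 1"]) auto
  show ?case
    unfolding expect_def rv.simps
  proof (intro conjI allI impI)
    fix f g :: "'a option \<times> history \<Rightarrow> real" and c
    show "(\<Sum>y\<in>?S. if fst y \<in> insert (fst x) (vts H) then f (None, (x, y) # H) + g (None, (x, y) # H)
           else rv (t y) P (\<lambda>s. f s + g s) ((x, y) # H)) / card ?S =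
        (\<Sum>y\<in>?S. if fst y \<in> insert (fst x) (vts H) then f (None, (x, y) # H) else rv (t y) P f ((x, y) # H)) / card ?S +
        (\<Sum>y\<in>?S. if fst y \<in> insert (fst x) (vts H) then g (None, (x, y) # H) else rv (t y) P g ((x, y) # H)) / card ?S"
      unfolding add_divide_distrib[symmetric] sum.distrib[symmetric]
      using IH by (intro arg_cong2[where f="(/)"] sum.cong) (auto simp: expect_def)
    show "(\<Sum>y\<in>?S. if fst y \<in> insert (fst x) (vts H) then c * f (None, (x, y) # H)
           else rv (t y) P (\<lambda>s. c * f s) ((x, y) # H)) / card ?S =
        c * ((\<Sum>y\<in>?S. if fst y \<in> insert (fst x) (vts H) then f (None, (x, y) # H) else rv (t y) P f ((x, y) # H)) / card ?S)"
      unfolding times_divide_eq_right sum_distrib_left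
      using IH by (intro arg_cong2[where f="(/)"] sum.cong) (auto simp: expect_def)
    assume le: "\<forall>s\<in>outs (Ask x t) P H. f s \<le> g s"
    have "rv (t y) P f ((x, y) # H) \<le> rv (t y) P g ((x, y) # H)"
      if "y \<in> ?S" "fst y \<notin> insert (fst x) (vts H)" for y
    proof -
      have "outs (t y) P ((x, y) # H) \<subseteq> outs (Ask x t) P H" using that by auto
      then show ?thesis using IH[of y] le unfolding expect_def by blast
    qed
    moreover have "f (None, (x, y) # H) \<le> g (None, (x, y) # H)"
      if "y \<in> ?S" "fst y \<in> insert (fst x) (vts H)" for y
      using le that by auto
    ultimately show "(\<Sum>y\<in>?S. if fst y \<in> insert (fst x) (vts H) then f (None, (x, y) # H) else rv (t y) P f ((x, y) # H)) / card ?S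
       \<le> (\<Sum>y\<in>?S. if fst y \<in> insert (fst x) (vts H) then g (None, (x, y) # H) else rv (t y) P g ((x, y) # H)) / card ?S"
      by (intro divide_right_mono sum_mono) auto
  next
    have "(\<Sum>y\<in>?S. if fst y \<in> insert (fst x) (vts H) then 1 else rv (t y) P (\<lambda>_. 1) ((x, y) # H)) = (\<Sum>y\<in>?S. 1)"
      using IH by (intro sum.cong) (auto simp: expect_def)
    then show "(\<Sum>y\<in>?S. if fst y \<in> insert (fst x) (vts H) then 1 else rv (t y) P (\<lambda>_. 1) ((x, y) # H)) / card ?S = 1"
      using S by simp
  qed
qed

lemma outs_length: "(r, H') \<in> outs t P H \<Longrightarrow> dep t k \<Longrightarrow> length H' \<le> length H + k"
proof (induction t arbitrary: H k)
  case (Ask x t)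
  then obtain y where "y \<in> P - pts H - {x}" and y: "(r, H') \<in> (if fst y \<in> insert (fst x) (vts H) then {(None, (x, y) # H)} else outs (t y) P ((x, y) # H))"
    by (auto simp only: outs.simps UN_iff)
  show ?case
  proof (cases "fst y \<in> insert (fst x) (vts H)")
    case True
    then show ?thesis using y Ask.prems by auto
  next
    case False
    then have "length H' \<le> length ((x, y) # H) + (k - 1)"
      using y Ask.prems by (intro Ask.IH) auto
    then show ?thesis using Ask.prems by auto
  qed
qed simp

section \<open>Comparison with independent uniform answers\<close>

lemma abs_avg_le:
  fixes f :: "'a \<Rightarrow> real"
  assumes "\<And>y. y \<in> S \<Longrightarrow> \<bar>f y\<bar> \<le> B" "0 \<le> B"
  shows "\<bar>(\<Sum>y\<in>S. f y) / card S\<bar> \<le> B"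
proof (cases "card S = 0")
  case False
  have "\<bar>\<Sum>y\<in>S. f y\<bar> \<le> (\<Sum>y\<in>S. B)"
    using assms(1) by (intro sum_norm_le[of S f "\<lambda>_. B", unfolded real_norm_def])
  then show ?thesis using False by (simp add: field_simps abs_divide)
qed (use assms(2) in auto)

text \<open>On the good set \<open>G\<close> the two functions differ by at most \<open>e\<close>,
  and at most \<open>m\<close> points lie outside it. The three contributions
  \<open>m * B / card P\<close> come from the bad points in either sum and from replacing the
  divisor \<open>card S\<close> by \<open>card P\<close>.\<close>

lemma avg_close:
  fixes A C :: "'a \<Rightarrow> real"
  assumes "finite P" "S \<subseteq> P" "S \<noteq> {}" "G \<subseteq> S" "real (card (P - G)) \<le> m"
    and A: "\<And>y. y \<in> S \<Longrightarrow> \<bar>A y\<bar> \<le> B" and C: "\<And>y. y \<in> P \<Longrightarrow> \<bar>C y\<bar> \<le> B"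
    and e: "\<And>y. y \<in> G \<Longrightarrow> \<bar>A y - C y\<bar> \<le> e" and "0 \<le> B" "0 \<le> e"
  shows "\<bar>(\<Sum>y\<in>S. A y) / card S - (\<Sum>y\<in>P. C y) / card P\<bar> \<le> e + 3 * m * B / card P"
proof -
  have fS: "finite S" "finite G"
    using finite_subset[OF assms(2,1)] finite_subset[OF assms(4)] by auto
  define p where "p = real (card P)"
  define s where "s = real (card S)"
  have s: "0 < s" using fS assms(3) by (simp add: s_def card_gt_0_iff)
  have sp: "s \<le> p" using assms by (simp add: s_def p_def card_mono)
  have "card (P - S) \<le> card (P - G)" using assms by (intro card_mono) auto
  then have "real (card (P - S)) \<le> m" using assms(5) by linarith
  then have ps: "p - s \<le> m"
    using assms(1,2) fS by (simp add: card_Diff_subset s_def p_def card_mono of_nat_diff)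
  have "card (S - G) \<le> card (P - G)" using assms by (intro card_mono) auto
  then have SG: "real (card (S - G)) \<le> m" using assms by simp
  have a1: "\<bar>\<Sum>y\<in>S. A y\<bar> \<le> s * B"
    using A sum_norm_le[of S A "\<lambda>_. B"] by (simp add: s_def)
  have a2: "\<bar>\<Sum>y\<in>S - G. A y\<bar> \<le> m * B"
    using A sum_norm_le[of "S - G" A "\<lambda>_. B"] mult_right_mono[OF SG \<open>0 \<le> B\<close>] by simp
  have a3: "\<bar>\<Sum>y\<in>P - G. C y\<bar> \<le> m * B"
    using C sum_norm_le[of "P - G" C "\<lambda>_. B"] mult_right_mono[OF assms(5) \<open>0 \<le> B\<close>] by simp
  have "card G \<le> card P" using assms by (intro card_mono) auto
  then have "real (card G) \<le> p" by (simp add: p_def)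
  then have a4: "\<bar>\<Sum>y\<in>G. A y - C y\<bar> \<le> p * e"
    using e sum_norm_le[of G "\<lambda>y. A y - C y" "\<lambda>_. e"] mult_right_mono[of "real (card G)" p e] \<open>0 \<le> e\<close> by simp
  have d1: "(\<Sum>y\<in>S. A y) = (\<Sum>y\<in>S - G. A y) + (\<Sum>y\<in>G. A y)"
    using sum.subset_diff[OF assms(4) fS(1), of A] .
  have d2: "(\<Sum>y\<in>P. C y) = (\<Sum>y\<in>P - G. C y) + (\<Sum>y\<in>G. C y)"
    using sum.subset_diff[of G P C] assms by auto
  have "\<bar>(\<Sum>y\<in>S. A y) - (\<Sum>y\<in>P. C y)\<bar> \<le> p * e + 2 * (m * B)"
    using a2 a3 a4 unfolding d1 d2 sum_subtractf by linarith
  then have b1: "\<bar>((\<Sum>y\<in>S. A y) - (\<Sum>y\<in>P. C y)) / p\<bar> \<le> e + 2 * (m * B) / p"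
    using s sp by (simp add: field_simps abs_divide)
  have "\<bar>(\<Sum>y\<in>S. A y) * (p - s)\<bar> \<le> s * B * m"
    unfolding abs_mult using a1 ps sp s \<open>0 \<le> B\<close> by (intro mult_mono) auto
  then have "\<bar>(\<Sum>y\<in>S. A y) * (p - s) / (s * p)\<bar> \<le> (s * B * m) / (s * p)"
    using s sp divide_right_mono[of "\<bar>(\<Sum>y\<in>S. A y) * (p - s)\<bar>" "s * B * m" "s * p"]
    by (simp only: abs_divide) (simp add: abs_of_pos)
  moreover have "(s * B * m) / (s * p) = m * B / p" using s sp by simp
  ultimately have b2: "\<bar>(\<Sum>y\<in>S. A y) / s - (\<Sum>y\<in>S. A y) / p\<bar> \<le> m * B / p"
    using s sp by (simp add: field_simps)
  have "(\<Sum>y\<in>S. A y) / s - (\<Sum>y\<in>P. C y) / p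
     = ((\<Sum>y\<in>S. A y) / s - (\<Sum>y\<in>S. A y) / p) + ((\<Sum>y\<in>S. A y) - (\<Sum>y\<in>P. C y)) / p"
    by (simp add: diff_divide_distrib)
  moreover have "3 * m * B / p = m * B / p + 2 * (m * B) / p"
    by (simp add: add_divide_distrib[symmetric])
  moreover have "\<bar>X + Y\<bar> \<le> \<bar>X\<bar> + \<bar>Y\<bar>" for X Y :: real by (rule abs_triangle_ineq)
  ultimately show ?thesis using add_mono[OF b2 b1] unfolding s_def[symmetric] p_def[symmetric]
    by (smt (verit))
qed

lemma abs_iv_le:
  assumes "\<And>a. a \<in> set_dtree t \<Longrightarrow> \<bar>g a\<bar> \<le> B" "0 \<le> B"
  shows "\<bar>iv t P g\<bar> \<le> B"
  using assms
proof (induction t)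
  case (Ask x t)
  have "\<bar>iv (t y) P g\<bar> \<le> B" for y using Ask by auto
  then show ?case unfolding iv.simps by (intro abs_avg_le) (use Ask.prems in auto)
qed simp

lemma abs_rv_le:
  assumes "\<And>a. a \<in> outs t P H \<Longrightarrow> \<bar>f a\<bar> \<le> B" "0 \<le> B"
  shows "\<bar>rv t P f H\<bar> \<le> B"
  using assms
proof (induction t arbitrary: H)
  case (Ask x t)
  have "\<bar>if fst y \<in> insert (fst x) (vts H) then f (None, (x, y) # H) else rv (t y) P f ((x, y) # H)\<bar> \<le> B"
    if "y \<in> P - pts H - {x}" for y
  proof (cases "fst y \<in> insert (fst x) (vts H)")
    case True
    then show ?thesis using Ask.prems(1)[of "(None, (x, y) # H)"] that by auto
  next
    case False
    have "outs (t y) P ((x, y) # H) \<subseteq> outs (Ask x t) P H" using that False by auto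
    then have "\<bar>rv (t y) P f ((x, y) # H)\<bar> \<le> B" using Ask.prems by (intro Ask.IH) blast+
    then show ?thesis using False by simp
  qed
  then show ?case unfolding rv.simps by (intro abs_avg_le) (use Ask.prems in auto)
qed simp

text \<open>An answer is bad if it lies at a visited vertex or at the asked one; this includes all
  exposed points. There are at most \<open>2 * K + 1\<close> such vertices with at most
  \<open>d\<close> points each, so by \<open>avg_close\<close> each of the at most \<open>k\<close>
  questions costs \<open>3 * (d * (2 * K + 1)) * B / card P\<close>.\<close>

lemma rv_iv_close:
  assumes "finite P" and deg: "\<And>v. card {p \<in> P. fst p = v} \<le> d" and "2 * K < card P" "0 \<le> B"
    and "dep t k" "wft t P H" "length H + k \<le> K"
    and "\<And>s. s \<in> outs t P H \<Longrightarrow> \<bar>f s\<bar> \<le> B" "\<And>a. a \<in> set_dtree t \<Longrightarrow> \<bar>g a\<bar> \<le> B"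
    and "\<And>a H'. (Some a, H') \<in> outs t P H \<Longrightarrow> f (Some a, H') = g a"
  shows "\<bar>rv t P f H - iv t P g\<bar> \<le> 3 * real k * real (d * (2 * K + 1)) * B / real (card P)"
  using assms(5-)
proof (induction t arbitrary: k H)
  case (Ret a)
  then show ?case using assms(3,4) by simp
next
  case (Ask x t)
  let ?S = "P - pts H - {x}"
  define V where "V = insert (fst x) (vts H)"
  define G where "G = {y \<in> P. fst y \<notin> V}"
  define m where "m = d * (2 * K + 1)"
  define R where "R y = (if fst y \<in> insert (fst x) (vts H) then f (None, (x, y) # H) else rv (t y) P f ((x, y) # H))" for y
  have k: "k > 0" using Ask by simp
  have S: "?S \<noteq> {}"
    using card_Diff_pts_pos[OF assms(1), of H x] Ask.prems k assms(3) by auto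
  have GS: "G \<subseteq> ?S" by (auto simp: G_def V_def vts_def)
  have "P - G = (\<Union>v\<in>V. {p \<in> P. fst p = v})" by (auto simp: G_def)
  then have "card (P - G) \<le> (\<Sum>v\<in>V. card {p \<in> P. fst p = v})"
    using card_UN_le[of V] by (simp add: V_def)
  also have "\<dots> \<le> card V * d" using sum_bounded_above[of V _ d] deg by simp
  also have "card V \<le> 2 * K + 1" using card_vts[of H] Ask.prems(3) by (auto simp: V_def card_insert_if)
  finally have m: "card (P - G) \<le> m" by (simp add: m_def mult.commute)
  have sub: "outs (t y) P ((x, y) # H) \<subseteq> outs (Ask x t) P H" if "y \<in> G" for y
    using that GS by (auto simp: G_def V_def)
  have RB: "\<bar>R y\<bar> \<le> B" if "y \<in> ?S" for y
  proof (cases "fst y \<in> insert (fst x) (vts H)")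
    case True
    then show ?thesis using Ask.prems(4)[of "(None, (x, y) # H)"] that by (auto simp: R_def)
  next
    case False
    then have "y \<in> G" using that by (auto simp: G_def V_def)
    have "\<bar>rv (t y) P f ((x, y) # H)\<bar> \<le> B"
      using sub[OF \<open>y \<in> G\<close>] Ask.prems(4) assms(4) by (intro abs_rv_le) blast+
    then show ?thesis using False by (simp add: R_def)
  qed
  have IB: "\<bar>iv (t y) P g\<bar> \<le> B" for y
    by (rule abs_iv_le) (use Ask.prems(5) assms(4) in auto)
  have close: "\<bar>R y - iv (t y) P g\<bar> \<le> 3 * real (k - 1) * real m * B / real (card P)" if "y \<in> G" for y
  proof -
    have y: "fst y \<notin> insert (fst x) (vts H)" "y \<in> ?S" using that GS by (auto simp: G_def V_def)
    have "\<bar>rv (t y) P f ((x, y) # H) - iv (t y) P g\<bar> \<le> 3 * real (k - 1) * real (d * (2 * K + 1)) * B / real (card P)"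
    proof (rule Ask.IH)
      show "dep (t y) (k - 1)" "wft (t y) P ((x, y) # H)" "length ((x, y) # H) + (k - 1) \<le> K"
        using Ask.prems k y by auto
      show "\<bar>f s\<bar> \<le> B" if "s \<in> outs (t y) P ((x, y) # H)" for s
        using that sub[OF \<open>y \<in> G\<close>] Ask.prems(4) by blast
      show "f (Some a, H') = g a" if "(Some a, H') \<in> outs (t y) P ((x, y) # H)" for a H'
        using that sub[OF \<open>y \<in> G\<close>] Ask.prems(6) by blast
    qed (use Ask.prems(5) in auto)
    then show ?thesis using y by (simp add: R_def m_def)
  qed
  have "\<bar>(\<Sum>y\<in>?S. R y) / card ?S - (\<Sum>y\<in>P. iv (t y) P g) / card P\<bar>
      \<le> 3 * real (k - 1) * real m * B / real (card P) + 3 * real m * B / real (card P)"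
    using RB IB close GS S m assms(1,4) by (intro avg_close[where G = G]) auto
  also have "\<dots> = 3 * real k * real m * B / real (card P)"
    using k by (simp add: add_divide_distrib[symmetric] of_nat_diff algebra_simps)
  finally show ?case unfolding R_def m_def by simp
qed

section \<open>Outcomes without collisions\<close>

text \<open>A weakest precondition: besides well-formedness it requires \<open>Q\<close> at every
  leaf reached without collision. Abandoned outcomes carry no obligation.\<close>

primrec wp :: "'a dtree \<Rightarrow> point set \<Rightarrow> history \<Rightarrow> ('a \<Rightarrow> history \<Rightarrow> bool) \<Rightarrow> bool" where
  "wp (Ret a) P H Q = Q a H"
| "wp (Ask x t) P H Q = (x \<in> P - pts H \<and> (H = [] \<or> fst x \<in> vts H) \<and>
     (\<forall>y\<in>P - pts H - {x}. fst y \<notin> insert (fst x) (vts H) \<longrightarrow> wp (t y) P ((x, y) # H) Q))"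

lemma wp_wft: "wp t P H Q \<Longrightarrow> wft t P H"
  by (induction t arbitrary: H) auto

lemma wp_outs: "wp t P H Q \<Longrightarrow> (Some a, H') \<in> outs t P H \<Longrightarrow> Q a H'"
proof (induction t arbitrary: H)
  case (Ask x t)
  then obtain y where "y \<in> P - pts H - {x}" "(Some a, H') \<in> (if fst y \<in> insert (fst x) (vts H) then {(None, (x, y) # H)} else outs (t y) P ((x, y) # H))"
    by (auto simp only: outs.simps UN_iff)
  then show ?case using Ask.prems(1) by (intro Ask.IH[of "t y" "(x, y) # H"]) (auto split: if_splits)
qed simp

lemma outs_pts: "wft t P H \<Longrightarrow> pts H \<subseteq> P \<Longrightarrow> (r, H') \<in> outs t P H \<Longrightarrow> pts H' \<subseteq> P"
proof (induction t arbitrary: H)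
  case (Ask x t)
  then obtain y where y: "y \<in> P - pts H - {x}" "(r, H') \<in> (if fst y \<in> insert (fst x) (vts H) then {(None, (x, y) # H)} else outs (t y) P ((x, y) # H))"
    by (auto simp only: outs.simps UN_iff)
  have sub: "pts ((x, y) # H) \<subseteq> P" using Ask.prems y(1) by simp
  show ?case
  proof (cases "fst y \<in> insert (fst x) (vts H)")
    case True
    then show ?thesis using y(2) sub by auto
  next
    case False
    then show ?thesis using y Ask.prems(1) sub by (intro Ask.IH[of "t y" "(x, y) # H"]) auto
  qed
qed auto

text \<open>
  Histories without collisions: the pairs form a tree on the visited vertices.
\<close>

primrec nc :: "point set \<Rightarrow> history \<Rightarrow> bool" where
  "nc P [] = True"
| "nc P (e # H) = (fst e \<in> P - pts H \<and> (H = [] \<or> fst (fst e) \<in> vts H) \<and>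
     snd e \<in> P - pts H - {fst e} \<and> fst (snd e) \<notin> insert (fst (fst e)) (vts H) \<and> nc P H)"

lemma pts_map: "pts H = set (map fst H) \<union> set (map snd H)"
  by (simp add: pts_def)

lemma nc_pts: "nc P H \<Longrightarrow> pts H \<subseteq> P"
proof (induction H)
  case (Cons e H)
  then show ?case by (cases e) auto
qed simp

text \<open>The last list entry is the pair revealed first, so its asked vertex is the root. Every
  pair adds the vertex of its answer and nothing else, as later questions concern visited
  vertices.\<close>

lemma nc_vts: "nc P H \<Longrightarrow> H \<noteq> [] \<Longrightarrow> vts H = insert (fst (fst (last H))) (fst ` snd ` set H)"
proof (induction H)
  case (Cons e H)
  then show ?case by (cases e; cases "H = []") auto
qed simp

lemma nc_distinct: "nc P H \<Longrightarrow> distinct (map (fst \<circ> snd) H)"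
proof (induction H)
  case (Cons e H)
  have "fst ` snd ` set H \<subseteq> vts H" by (auto simp: vts_def pts_def)
  then show ?case using Cons by (auto simp: image_image)
qed simp

lemma nc_root: "nc P H \<Longrightarrow> H \<noteq> [] \<Longrightarrow> fst (fst (last H)) \<notin> fst ` snd ` set H"
proof (induction H)
  case (Cons e H)
  show ?case
  proof (cases "H = []")
    case False
    have "last H \<in> set H" using False by simp
    then have "fst (fst (last H)) \<in> vts H" by (force simp: vts_def pts_def)
    then show ?thesis using Cons False by auto
  qed (use Cons in auto)
qed simp

lemma nc_inj: "nc P H \<Longrightarrow> inj_on fst (set (map snd H))"
  using nc_distinct[of P H] by (simp only: map_map[symmetric] distinct_map)

lemma nc_distinct_snd: "nc P H \<Longrightarrow> distinct (map snd H)"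
  using nc_distinct[of P H] by (simp only: map_map[symmetric] distinct_map)

text \<open>A vertex entered through the answer \<open>w\<close> and never asked about has
  \<open>w\<close> as its only exposed point, since distinct answers lie at distinct
  vertices.\<close>

lemma nc_pts_at:
  assumes "nc P H" "w \<in> set (map snd H)" "fst w \<notin> fst ` set (map fst H)" "p \<in> pts H" "fst p = fst w"
  shows "p = w"
proof -
  have "p \<in> set (map snd H)" using assms(3-5) unfolding pts_map by (metis UnE imageI)
  then show ?thesis using nc_inj[OF assms(1)] assms(2,5) by (auto simp only: inj_on_def)
qed

primrec asks :: "point list \<Rightarrow> (point list \<Rightarrow> 'a dtree) \<Rightarrow> 'a dtree" where
  "asks [] k = k []"
| "asks (x # xs) k = Ask x (\<lambda>y. asks xs (\<lambda>ys. k (y # ys)))"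

text \<open>A list of questions fixed in advance stays legitimate: the questions lie at visited
  vertices and a collision-free answer does not, so no answer uses up a later question. The list is
  reversed because histories grow at the front.\<close>

lemma wp_asks:
  assumes "nc P H" "distinct xs" "set xs \<subseteq> P - pts H" "fst ` set xs \<subseteq> vts H"
    and "\<And>ys. length ys = length xs \<Longrightarrow> nc P (rev (zip xs ys) @ H) \<Longrightarrow> wp (k ys) P (rev (zip xs ys) @ H) Q"
  shows "wp (asks xs k) P H Q"
  using assms
proof (induction xs arbitrary: k H)
  case Nil
  then show ?case by simp
next
  case (Cons x xs)
  have "wp (asks xs (\<lambda>ys. k (y # ys))) P ((x, y) # H) Q"
    if y: "y \<in> P - pts H - {x}" "fst y \<notin> insert (fst x) (vts H)" for y
  proof (rule Cons.IH)
    show nc: "nc P ((x, y) # H)" using Cons.prems y by auto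
    have "y \<notin> set xs" using Cons.prems(4) y by auto
    then show "set xs \<subseteq> P - pts ((x, y) # H)" using Cons.prems by auto
    show "wp (k (y # ys)) P (rev (zip xs ys) @ (x, y) # H) Q"
      if "length ys = length xs" "nc P (rev (zip xs ys) @ (x, y) # H)" for ys
      using Cons.prems(5)[of "y # ys"] that by simp
  qed (use Cons.prems in auto)
  then show ?case using Cons.prems by auto
qed

lemma dep_asks:
  "(\<And>ys. length ys = length xs \<Longrightarrow> dep (k ys) l) \<Longrightarrow> dep (asks xs k) (length xs + l)"
proof (induction xs arbitrary: k)
  case (Cons x xs)
  show ?case using Cons.IH[of "\<lambda>ys. k (_ # ys)"] Cons.prems by auto
qed (use dep_mono in auto)

lemma set_dtree_asks:
  "a \<in> set_dtree (asks xs k) \<Longrightarrow> \<exists>ys. length ys = length xs \<and> a \<in> set_dtree (k ys)"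
proof (induction xs arbitrary: k)
  case (Cons x xs)
  then obtain y where "a \<in> set_dtree (asks xs (\<lambda>ys. k (y # ys)))" by auto
  from Cons.IH[OF this] obtain ys where "length ys = length xs" "a \<in> set_dtree (k (y # ys))" by auto
  then show ?case by (intro exI[of _ "y # ys"]) auto
qed auto

text \<open>
  Here \<open>cnt P v\<close> counts the points of \<open>v\<close> that are still unexposed, so \<open>dg d P y\<close> is the current degree
  of the vertex of \<open>y\<close>, and \<open>Zc d n P j\<close> is the number of vertices of current degree \<open>j\<close>. Exposing one
  more point of the vertex of \<open>y\<close> changes \<open>Zc\<close> by \<open>ej d P j y\<close>.
\<close>

definition cnt :: "point set \<Rightarrow> nat \<Rightarrow> nat" where
  "cnt P v = card {p \<in> P. fst p = v}"

definition dg :: "nat \<Rightarrow> point set \<Rightarrow> point \<Rightarrow> nat" where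
  "dg d P y = d - cnt P (fst y)"

text \<open>The questions by which the vertex of \<open>y\<close>, reached through \<open>y\<close>,
  gets exposed completely.\<close>

definition rest :: "nat \<Rightarrow> point set \<Rightarrow> point \<Rightarrow> point list" where
  "rest d P y = filter (\<lambda>p. p \<in> P \<and> p \<noteq> y) (map (Pair (fst y)) [0..<d])"

definition ej :: "nat \<Rightarrow> point set \<Rightarrow> nat \<Rightarrow> point \<Rightarrow> real" where
  "ej d P j y = of_bool (dg d P y + 1 = j) - of_bool (dg d P y = j)"

definition Zc :: "nat \<Rightarrow> nat \<Rightarrow> point set \<Rightarrow> nat \<Rightarrow> real" where
  "Zc d n P j = (\<Sum>v<n. of_bool (cnt P v + j = d))"

definition pspace :: "nat \<Rightarrow> nat \<Rightarrow> point set" where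
  "pspace n d = {..<n} \<times> {..<d}"

lemma finite_pspace [simp]: "finite (pspace n d)" by (simp add: pspace_def)

lemma cnt_le: "P \<subseteq> pspace n d \<Longrightarrow> cnt P v \<le> d"
proof -
  assume P: "P \<subseteq> pspace n d"
  have "{p \<in> P. fst p = v} \<subseteq> Pair v ` {..<d}" using P by (force simp: pspace_def)
  then have "card {p \<in> P. fst p = v} \<le> card (Pair v ` {..<d})" by (intro card_mono) auto
  also have "\<dots> \<le> d" using card_image_le[of "{..<d}" "Pair v"] by simp
  finally show ?thesis by (simp add: cnt_def)
qed

lemma cnt_pos: "finite P \<Longrightarrow> y \<in> P \<Longrightarrow> 0 < cnt P (fst y)"
  by (auto simp: cnt_def card_gt_0_iff)

lemma cnt_full: "P \<subseteq> pspace n d \<Longrightarrow> cnt P v = d \<Longrightarrow> i < d \<Longrightarrow> (v, i) \<in> P"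
proof -
  assume P: "P \<subseteq> pspace n d" and c: "cnt P v = d" and i: "i < d"
  have sub: "{p \<in> P. fst p = v} \<subseteq> Pair v ` {..<d}" using P by (force simp: pspace_def)
  have "card (Pair v ` {..<d}) = d" by (subst card_image) (auto simp: inj_on_def)
  then have "{p \<in> P. fst p = v} = Pair v ` {..<d}"
    using c sub by (intro card_subset_eq) (auto simp: cnt_def)
  then show ?thesis using i by auto
qed

lemma set_rest: "P \<subseteq> pspace n d \<Longrightarrow> set (rest d P y) = {p \<in> P. fst p = fst y \<and> p \<noteq> y}"
  by (force simp: rest_def pspace_def)

lemma distinct_rest: "distinct (rest d P y)"
  by (auto simp: rest_def distinct_map inj_on_def)

lemma length_rest_le: "length (rest d P y) \<le> d"
  unfolding rest_def by (rule order_trans[OF length_filter_le]) simp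

lemma length_rest:
  assumes "P \<subseteq> pspace n d" "y \<in> P"
  shows "length (rest d P y) = cnt P (fst y) - 1"
proof -
  have fin: "finite {p \<in> P. fst p = fst y}"
    using assms finite_subset[OF assms(1)] by simp
  have "length (rest d P y) = card (set (rest d P y))"
    by (simp add: distinct_card distinct_rest)
  also have "set (rest d P y) = {p \<in> P. fst p = fst y} - {y}"
    using set_rest[OF assms(1)] by auto
  also have "card \<dots> = cnt P (fst y) - 1"
    using assms fin by (simp add: cnt_def card_Diff_singleton)
  finally show ?thesis .
qed

lemma cnt_outside: "v \<notin> vts H \<Longrightarrow> cnt (P - pts H) v = cnt P v"
  unfolding cnt_def by (rule arg_cong[where f = card]) (auto simp: vts_def)

lemma Zc_diff:
  assumes "vts H \<subseteq> {..<n}"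
  shows "Zc d n (P - pts H) j - Zc d n P j
       = (\<Sum>v\<in>vts H. of_bool (cnt (P - pts H) v + j = d) - of_bool (cnt P v + j = d))"
  unfolding Zc_def sum_subtractf[symmetric]
  using assms by (intro sum.mono_neutral_right) (auto simp: cnt_outside)

lemma vts_subset: "pts H \<subseteq> P \<Longrightarrow> P \<subseteq> pspace n d \<Longrightarrow> vts H \<subseteq> {..<n}"
  by (force simp: vts_def pspace_def)

lemma abs_Zc_diff_le:
  assumes "pts H \<subseteq> P" "P \<subseteq> pspace n d"
  shows "\<bar>Zc d n (P - pts H) j - Zc d n P j\<bar> \<le> 2 * real (length H)"
proof -
  have "\<bar>Zc d n (P - pts H) j - Zc d n P j\<bar> \<le> (\<Sum>v\<in>vts H. 1)"
    unfolding Zc_diff[OF vts_subset[OF assms]]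
    by (intro order_trans[OF sum_abs] sum_mono) (simp add: of_bool_def)
  then show ?thesis using card_vts[of H] by simp
qed

text \<open>\<open>X\<close> holds the answers whose vertices get exposed completely. These leave
  the counts, because degree \<open>d\<close> is not counted for \<open>j < d\<close>; the vertex of
  any other answer loses exactly that point, which is the change \<open>ej\<close>. The vertices of
  the answers are distinct and differ from the root \<open>u\<close>, so the changes add up.\<close>

lemma Zc_diff_nc:
  assumes P: "P \<subseteq> pspace n d" and nc: "nc P H" "H \<noteq> []" and "j < d"
    and X: "\<And>y. y \<in> set (map snd H) \<Longrightarrow> y \<in> X \<Longrightarrow> cnt (P - pts H) (fst y) = 0"
      "\<And>y. y \<in> set (map snd H) \<Longrightarrow> y \<notin> X \<Longrightarrow> fst y \<notin> fst ` set (map fst H)"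
    and u: "u = fst (fst (last H))"
  shows "Zc d n (P - pts H) j - Zc d n P j
       = of_bool (cnt (P - pts H) u + j = d) - of_bool (cnt P u + j = d)
         + (\<Sum>y\<leftarrow>map snd H. if y \<in> X then - of_bool (dg d P y = j) else ej d P j y)"
proof -
  define \<tau> where "\<tau> v = (of_bool (cnt (P - pts H) v + j = d) - of_bool (cnt P v + j = d) :: real)" for v
  have finP: "finite P" using finite_subset[OF P] by simp
  have tm: "\<tau> (fst y) = (if y \<in> X then - of_bool (dg d P y = j) else ej d P j y)"
    if y: "y \<in> set (map snd H)" for y
  proof -
    have yP: "y \<in> P" using y nc_pts[OF nc(1)] by (auto simp: pts_map)
    have c: "0 < cnt P (fst y)" "cnt P (fst y) \<le> d"
      using cnt_pos[OF finP yP] cnt_le[OF P] by auto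
    show ?thesis
    proof (cases "y \<in> X")
      case True
      then show ?thesis using X(1)[OF y True] c \<open>j < d\<close>
        by (auto simp: \<tau>_def dg_def)
    next
      case False
      have "{p \<in> P - pts H. fst p = fst y} = {p \<in> P. fst p = fst y} - {y}"
        using nc_pts_at[OF nc(1) y X(2)[OF y False]] y by (auto simp: pts_map)
      then have "cnt (P - pts H) (fst y) = cnt P (fst y) - 1"
        using yP finP by (simp add: cnt_def card_Diff_singleton)
      then show ?thesis using False c by (auto simp: \<tau>_def ej_def dg_def)
    qed
  qed
  have v: "vts H = insert u (set (map (fst \<circ> snd) H))"
    using nc_vts[OF nc] by (simp add: u image_image comp_def)
  have "u \<notin> set (map (fst \<circ> snd) H)"
    using nc_root[OF nc] by (simp add: u image_image comp_def)
  then have "(\<Sum>v\<in>vts H. \<tau> v) = \<tau> u + (\<Sum>v\<in>set (map (fst \<circ> snd) H). \<tau> v)"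
    unfolding v by (subst sum.insert) auto
  also have "(\<Sum>v\<in>set (map (fst \<circ> snd) H). \<tau> v) = (\<Sum>v\<leftarrow>map (fst \<circ> snd) H. \<tau> v)"
    using nc_distinct[OF nc(1)] by (simp only: sum_list_distinct_conv_sum_set)
  also have "\<dots> = (\<Sum>y\<leftarrow>map snd H. \<tau> (fst y))" by (simp add: comp_def)
  also have "\<dots> = (\<Sum>y\<leftarrow>map snd H. if y \<in> X then - of_bool (dg d P y = j) else ej d P j y)"
    using tm by (intro arg_cong[where f = sum_list] map_cong) auto
  finally show ?thesis
    unfolding Zc_diff[OF vts_subset[OF nc_pts[OF nc(1)] P]] \<tau>_def[symmetric] by simp
qed

section \<open>One step of the greedy algorithm\<close>

definition Ssum :: "nat \<Rightarrow> point set \<Rightarrow> nat \<Rightarrow> point list \<Rightarrow> real" where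
  "Ssum d P j ys = (\<Sum>y\<leftarrow>ys. ej d P j y)"

definition isf :: "nat \<Rightarrow> point set \<Rightarrow> point \<Rightarrow> bool" where
  "isf d P y \<longleftrightarrow> cnt P (fst y) = d"

type_synonym leaf = "nat set \<times> real \<times> (nat \<Rightarrow> real)"

text \<open>The partner of \<open>(u, 0)\<close> lies at a touched vertex. That vertex is chosen and
  exposed completely, so it leaves the counts, while \<open>u\<close> has just one exposed point and
  moves from degree 0 to degree 1.\<close>

definition leaf1 :: "nat \<Rightarrow> point set \<Rightarrow> point \<Rightarrow> point list \<Rightarrow> leaf" where
  "leaf1 d P y zs = ({fst y}, 1,
     \<lambda>j. - of_bool (j = 0) + of_bool (j = 1) - of_bool (j = dg d P y) + Ssum d P j zs)"

text \<open>The partner vertex \<open>fst y\<close> is untouched too and has an untouched neighbour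
  besides \<open>u\<close>. Choosing \<open>u\<close> and \<open>fst y\<close> dominates them and
  all their neighbours; both are exposed completely and leave degree 0.\<close>

definition leaf2 :: "nat \<Rightarrow> point set \<Rightarrow> nat \<Rightarrow> point \<Rightarrow> point list \<Rightarrow> point list \<Rightarrow> leaf" where
  "leaf2 d P u y ys us = ({u, fst y}, 2,
     \<lambda>j. - 2 * of_bool (j = 0) + Ssum d P j ys + Ssum d P j us)"

text \<open>Besides \<open>u\<close>, the vertex \<open>fst y\<close> has no untouched neighbour,
  but \<open>u\<close> has a further one, \<open>fst w\<close>; so \<open>u\<close> and
  \<open>fst w\<close> are chosen. The sum over \<open>us\<close> counts \<open>fst w\<close> as
  moving from degree 0 to 1, although it gets exposed completely; \<open>- of_bool (j = 1)\<close>
  corrects this.\<close>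

definition leaf3 :: "nat \<Rightarrow> point set \<Rightarrow> nat \<Rightarrow> point \<Rightarrow> point list \<Rightarrow> point list \<Rightarrow> point list \<Rightarrow> leaf" where
  "leaf3 d P u w ys us ws = ({u, fst w}, 2,
     \<lambda>j. - 2 * of_bool (j = 0) - of_bool (j = 1) + Ssum d P j ys + Ssum d P j us + Ssum d P j ws)"

text \<open>Neither \<open>u\<close> nor its partner vertex has a further untouched neighbour. Each
  gets one of its touched neighbours, \<open>hd us\<close> or \<open>hd ys\<close>, as dominator.
  These are exposed completely and may dominate untouched vertices in turn; they leave the counts,
  so the sums over neighbours run over the tails.\<close>

definition leaf4 :: "nat \<Rightarrow> point set \<Rightarrow> point list \<Rightarrow> point list \<Rightarrow> point list \<Rightarrow> point list \<Rightarrow> leaf" where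
  "leaf4 d P ys us as bs = ({fst (hd ys), fst (hd us)}, 2,
     \<lambda>j. - 2 * of_bool (j = 0) + Ssum d P j (tl ys) + Ssum d P j (tl us)
          - of_bool (j = dg d P (hd ys)) - of_bool (j = dg d P (hd us)) + Ssum d P j as + Ssum d P j bs)"

text \<open>
  The results of the four cases of a step are triples of the vertices added to the dominating set,
  their number, and the change of the degree counts.
\<close>

definition step :: "nat \<Rightarrow> point set \<Rightarrow> nat \<Rightarrow> leaf dtree" where
  "step d P u = Ask (u, 0) (\<lambda>y.
     if \<not> isf d P y then asks (rest d P y) (\<lambda>zs. Ret (leaf1 d P y zs))
     else asks (rest d P y) (\<lambda>ys. asks (rest d P (u, 0)) (\<lambda>us.
       if \<exists>p\<in>set ys. isf d P p then Ret (leaf2 d P u y ys us)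
       else if \<exists>p\<in>set us. isf d P p
       then asks (rest d P (hd (filter (isf d P) us)))
              (\<lambda>ws. Ret (leaf3 d P u (hd (filter (isf d P) us)) ys us ws))
       else asks (rest d P (hd ys)) (\<lambda>as. asks (rest d P (hd us)) (\<lambda>bs. Ret (leaf4 d P ys us as bs))))))"

definition covers :: "history \<Rightarrow> nat set \<Rightarrow> nat \<Rightarrow> bool" where
  "covers H D v \<longleftrightarrow> (\<exists>p p'. {p, p'} \<in> edges H \<and> fst p = v \<and> fst p' \<in> D)"

text \<open>The contract of a completed step: the untouched vertices it meets are covered through
  edges revealed in this very step. Thus later steps only have to care about the vertices that are
  still untouched.\<close>

definition leafok :: "nat \<Rightarrow> nat \<Rightarrow> point set \<Rightarrow> leaf \<Rightarrow> history \<Rightarrow> bool" where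
  "leafok d n P a H \<longleftrightarrow> (case a of (D, c, \<delta>) \<Rightarrow>
     D \<subseteq> {..<n} \<and> real (card D) \<le> c \<and> (\<forall>v\<in>vts H. cnt P v = d \<longrightarrow> covers H D v) \<and>
     (\<forall>j<d. Zc d n (P - pts H) j - Zc d n P j = \<delta> j))"

lemma covers_snd: "(x, y) \<in> set H \<Longrightarrow> fst x \<in> D \<Longrightarrow> covers H D (fst y)"
  unfolding covers_def edges_def by (intro exI[of _ y] exI[of _ x]) (auto simp: insert_commute intro!: rev_image_eqI)

lemma covers_fst: "(x, y) \<in> set H \<Longrightarrow> fst y \<in> D \<Longrightarrow> covers H D (fst x)"
  unfolding covers_def edges_def by (intro exI[of _ x] exI[of _ y]) (auto intro!: rev_image_eqI)

lemma covers_zip: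
  assumes "y \<in> set ys" "length ys = length xs" "set (zip xs ys) \<subseteq> set H" "fst ` set xs \<subseteq> D"
  shows "covers H D (fst y)"
proof -
  obtain x where "(x, y) \<in> set (zip xs ys)"
    using in_set_impl_in_set_zip2[OF assms(2)[symmetric] assms(1)] by blast
  moreover have "x \<in> set xs" using calculation by (rule set_zip_leftD)
  ultimately show ?thesis using assms(3,4) by (intro covers_snd) auto
qed

lemma sum_list_if_notin:
  "(\<And>p. p \<in> set ps \<Longrightarrow> p \<notin> X) \<Longrightarrow> (\<Sum>p\<leftarrow>ps. if p \<in> X then a p else b p) = (\<Sum>p\<leftarrow>ps. b p)"
  by (intro arg_cong[where f = sum_list] map_cong) auto

lemma sum_list_if_in:
  fixes a b :: "'a \<Rightarrow> real"
  assumes "distinct ps" "w \<in> set ps" "\<And>p. p \<in> set ps \<Longrightarrow> p \<in> X \<longleftrightarrow> p = w"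
  shows "(\<Sum>p\<leftarrow>ps. if p \<in> X then a p else b p) = (\<Sum>p\<leftarrow>ps. b p) + a w - b w"
proof -
  have "(\<Sum>p\<leftarrow>ps. if p \<in> X then a p else b p) = (\<Sum>p\<in>set ps. b p + (if p = w then a w - b w else 0))"
    unfolding sum_list_distinct_conv_sum_set[OF assms(1)] using assms(3) by (intro sum.cong) auto
  then show ?thesis
    using assms(2) by (simp add: sum.distrib sum_list_distinct_conv_sum_set[OF assms(1)])
qed

context
  fixes d n u :: nat and P :: "point set"
  assumes P: "P \<subseteq> pspace n d" and d: "3 \<le> d" and u: "cnt P u = d"
begin

lemma finP: "finite P" using finite_subset[OF P] by simp

lemma u_points: "i < d \<Longrightarrow> (u, i) \<in> P" using cnt_full[OF P u] .

lemma fst_rest: "p \<in> set (rest d P y) \<Longrightarrow> fst p = fst y"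
  by (simp add: set_rest[OF P])

lemma fst_rest_image: "fst ` set (rest d P y) \<subseteq> {fst y}"
  using fst_rest by auto

lemma cnt_exhausted:
  assumes "y \<in> pts H" "set (rest d P y) \<subseteq> pts H"
  shows "cnt (P - pts H) (fst y) = 0"
proof -
  have "{p \<in> P - pts H. fst p = fst y} = {}"
    using assms unfolding set_rest[OF P] by auto
  then show ?thesis by (simp only: cnt_def card.empty)
qed

lemma fst_less: "p \<in> P \<Longrightarrow> fst p < n"
  using P by (auto simp: pspace_def)

lemma rest_fresh:
  assumes "nc P H" "w \<in> set (map snd H)" "fst w \<notin> fst ` set (map fst H)"
  shows "set (rest d P w) \<subseteq> P - pts H" "fst ` set (rest d P w) \<subseteq> vts H"
proof -
  show "set (rest d P w) \<subseteq> P - pts H"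
    using nc_pts_at[OF assms] unfolding set_rest[OF P] by blast
  have "fst w \<in> vts H" using assms(2) by (auto simp: vts_def pts_def)
  then show "fst ` set (rest d P w) \<subseteq> vts H" using fst_rest_image[of w] by auto
qed

lemma leaf1_ok:
  assumes H: "H = rev (zip (rest d P y) zs) @ [((u, 0), y)]" and "nc P H"
    and len: "length zs = length (rest d P y)" and y: "\<not> isf d P y"
  shows "leafok d n P (leaf1 d P y zs) H"
proof -
  have mf: "map fst H = rev (rest d P y) @ [(u, 0)]" and ms: "map snd H = rev zs @ [y]"
    using len by (simp_all add: H rev_map[symmetric])
  have ne: "H \<noteq> []" and lst: "fst (fst (last H)) = u" by (simp_all add: H)
  have dist: "distinct (rev zs @ [y])" using nc_distinct_snd[OF assms(2)] ms by simp
  have uy: "u \<notin> fst ` set (map snd H)" using nc_root[OF assms(2) ne] lst by simp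
  have yu: "fst y \<noteq> u" using uy ms by auto
  have yP: "y \<in> P" using nc_pts[OF assms(2)] by (auto simp: pts_map ms)
  have ansP: "p \<in> P" if "p \<in> set (map snd H)" for p
    using nc_pts[OF assms(2)] that by (auto simp: pts_map)
  have vt: "vts H = insert u (fst ` set (map snd H))"
    using nc_vts[OF assms(2) ne] lst by simp
  have cov: "covers H {fst y} v" if v: "v \<in> vts H" "cnt P v = d" for v
  proof -
    consider "v = u" | "v = fst y" | p where "p \<in> set zs" "v = fst p"
      using v(1) unfolding vt ms by auto
    then show ?thesis
    proof cases
      case 1
      then show ?thesis using covers_fst[of "(u, 0)" y H "{fst y}"] by (simp add: H)
    next
      case 2
      then show ?thesis using y v by (simp add: isf_def)
    next
      case 3
      then show ?thesis using covers_zip[OF 3(1) len, of H "{fst y}"] fst_rest_image[of y]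
        by (auto simp: H)
    qed
  qed
  have "{p \<in> P - pts H. fst p = u} = {p \<in> P. fst p = u} - {(u, 0)}"
    using uy yu fst_rest[of _ y] unfolding pts_map mf by force
  then have cu: "cnt (P - pts H) u = d - 1"
    using u u_points[of 0] d finP unfolding cnt_def by (simp add: card_Diff_singleton)
  have "Zc d n (P - pts H) j - Zc d n P j = - of_bool (j = 0) + of_bool (j = 1) - of_bool (j = dg d P y) + Ssum d P j zs"
    if j: "j < d" for j
  proof -
    have "Zc d n (P - pts H) j - Zc d n P j
       = of_bool (cnt (P - pts H) u + j = d) - of_bool (cnt P u + j = d)
         + (\<Sum>p\<leftarrow>map snd H. if p \<in> {y} then - of_bool (dg d P p = j) else ej d P j p)"
    proof (rule Zc_diff_nc[OF P assms(2) ne j])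
      show "cnt (P - pts H) (fst p) = 0" if "p \<in> set (map snd H)" "p \<in> {y}" for p
        using that cnt_exhausted[of y H] by (auto simp: pts_map mf ms)
      show "fst p \<notin> fst ` set (map fst H)" if p: "p \<in> set (map snd H)" "p \<notin> {y}" for p
      proof -
        have "fst p \<noteq> fst y" using nc_inj[OF assms(2)] p ms unfolding inj_on_def by auto
        moreover have "fst p \<noteq> u" using p(1) uy by (metis imageI)
        moreover have "fst ` set (map fst H) \<subseteq> {u, fst y}"
          using fst_rest_image[of "y"] unfolding mf by auto
        ultimately show ?thesis by blast
      qed
    qed (use lst in simp)
    moreover have "(\<Sum>p\<leftarrow>rev zs. if p \<in> {y} then - of_bool (dg d P p = j) else ej d P j p) = (\<Sum>p\<leftarrow>rev zs. ej d P j p)"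
      using dist by (intro sum_list_if_notin) auto
    moreover have "(\<Sum>p\<leftarrow>rev zs. ej d P j p) = Ssum d P j zs"
      by (simp add: Ssum_def rev_map[symmetric])
    ultimately show ?thesis using cu u d by (auto simp: ms)
  qed
  then show ?thesis
    using cov fst_less[OF yP] by (auto simp: leafok_def leaf1_def)
qed

lemma leaf2_ok:
  assumes H: "H = rev (zip (rest d P (u, 0)) us) @ rev (zip (rest d P y) ys) @ [((u, 0), y)]" and "nc P H"
    and len: "length ys = length (rest d P y)" "length us = length (rest d P (u, 0))" and y: "isf d P y"
  shows "leafok d n P (leaf2 d P u y ys us) H"
proof -
  have mf: "map fst H = rev (rest d P (u, 0)) @ rev (rest d P y) @ [(u, 0)]"
    and ms: "map snd H = rev us @ rev ys @ [y]"
    using len by (simp_all add: H rev_map[symmetric])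
  have ne: "H \<noteq> []" and lst: "fst (fst (last H)) = u" by (simp_all add: H)
  have dist: "distinct (rev us @ rev ys @ [y])" using nc_distinct_snd[OF assms(2)] ms by simp
  have uy: "u \<notin> fst ` set (map snd H)" using nc_root[OF assms(2) ne] lst by simp
  have yP: "y \<in> P" using nc_pts[OF assms(2)] by (auto simp: pts_map ms)
  have un: "u < n" using fst_less[OF u_points[of 0]] d by simp
  have vt: "vts H = insert u (fst ` set (map snd H))"
    using nc_vts[OF assms(2) ne] lst by simp
  let ?D = "{u, fst y}"
  have cov: "covers H ?D v" if v: "v \<in> vts H" "cnt P v = d" for v
  proof -
    consider "v = u" | "v = fst y" | p where "p \<in> set ys" "v = fst p" | p where "p \<in> set us" "v = fst p"
      using v(1) unfolding vt ms by auto
    then show ?thesis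
    proof cases
      case 1
      then show ?thesis using covers_fst[of "(u, 0)" y H ?D] by (simp add: H)
    next
      case 2
      then show ?thesis using covers_snd[of "(u, 0)" y H ?D] by (simp add: H)
    next
      case 3
      then show ?thesis using covers_zip[OF 3(1) len(1), of H ?D] fst_rest_image[of y]
        by (auto simp: H)
    next
      case 4
      then show ?thesis using covers_zip[OF 4(1) len(2), of H ?D] fst_rest_image[of "(u, 0)"]
        by (auto simp: H)
    qed
  qed
  have cu: "cnt (P - pts H) u = 0"
    using cnt_exhausted[of "(u, 0)" H] by (auto simp: pts_map mf)
  have "Zc d n (P - pts H) j - Zc d n P j = - 2 * of_bool (j = 0) + Ssum d P j ys + Ssum d P j us"
    if j: "j < d" for j
  proof -
    have "Zc d n (P - pts H) j - Zc d n P j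
       = of_bool (cnt (P - pts H) u + j = d) - of_bool (cnt P u + j = d)
         + (\<Sum>p\<leftarrow>map snd H. if p \<in> {y} then - of_bool (dg d P p = j) else ej d P j p)"
    proof (rule Zc_diff_nc[OF P assms(2) ne j])
      show "cnt (P - pts H) (fst p) = 0" if "p \<in> set (map snd H)" "p \<in> {y}" for p
        using that cnt_exhausted[of y H] by (auto simp: pts_map mf ms)
      show "fst p \<notin> fst ` set (map fst H)" if p: "p \<in> set (map snd H)" "p \<notin> {y}" for p
      proof -
        have "fst p \<noteq> fst y" using nc_inj[OF assms(2)] p ms unfolding inj_on_def by auto
        moreover have "fst p \<noteq> u" using p(1) uy by (metis imageI)
        moreover have "fst ` set (map fst H) \<subseteq> {u, fst y}"
          using fst_rest_image[of "y"] fst_rest_image[of "(u, 0)"] unfolding mf by auto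
        ultimately show ?thesis by blast
      qed
    qed (use lst in simp)
    moreover have "(\<Sum>p\<leftarrow>rev us @ rev ys. if p \<in> {y} then - of_bool (dg d P p = j) else ej d P j p) = (\<Sum>p\<leftarrow>rev us @ rev ys. ej d P j p)"
      using dist by (intro sum_list_if_notin) auto
    moreover have "(\<Sum>p\<leftarrow>rev us @ rev ys. ej d P j p) = Ssum d P j ys + Ssum d P j us"
      by (simp add: Ssum_def rev_map[symmetric])
    moreover have "dg d P y = 0" using y by (simp add: isf_def dg_def)
    ultimately show ?thesis using cu u d j by (auto simp: ms)
  qed
  moreover have "real (card ?D) \<le> 2" using card_insert_le_m1[of 2 "{fst y}" u] by (simp add: card_insert_if)
  ultimately show ?thesis
    using cov fst_less[OF yP] un by (auto simp: leafok_def leaf2_def)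
qed

lemma leaf3_ok:
  assumes H: "H = rev (zip (rest d P w) ws) @ rev (zip (rest d P (u, 0)) us) @ rev (zip (rest d P y) ys) @ [((u, 0), y)]"
    and "nc P H" and len: "length ys = length (rest d P y)" "length us = length (rest d P (u, 0))"
      "length ws = length (rest d P w)" and y: "isf d P y"
    and nf: "\<And>p. p \<in> set ys \<Longrightarrow> \<not> isf d P p" and w: "w \<in> set us" "isf d P w"
  shows "leafok d n P (leaf3 d P u w ys us ws) H"
proof -
  have mf: "map fst H = rev (rest d P w) @ rev (rest d P (u, 0)) @ rev (rest d P y) @ [(u, 0)]"
    and ms: "map snd H = rev ws @ rev us @ rev ys @ [y]"
    using len by (simp_all add: H rev_map[symmetric])
  have ne: "H \<noteq> []" and lst: "fst (fst (last H)) = u" by (simp_all add: H)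
  have dist: "distinct (rev ws @ rev us @ rev ys @ [y])" using nc_distinct_snd[OF assms(2)] ms by simp
  have uy: "u \<notin> fst ` set (map snd H)" using nc_root[OF assms(2) ne] lst by simp
  have wP: "w \<in> P" using nc_pts[OF assms(2)] w(1) by (auto simp: pts_map ms)
  have un: "u < n" using fst_less[OF u_points[of 0]] d by simp
  have vt: "vts H = insert u (fst ` set (map snd H))"
    using nc_vts[OF assms(2) ne] lst by simp
  let ?D = "{u, fst w}"
  obtain x where x: "(x, w) \<in> set (zip (rest d P (u, 0)) us)"
    using in_set_impl_in_set_zip2[OF len(2)[symmetric] w(1)] by blast
  have xu: "fst x = u" using fst_rest[OF set_zip_leftD[OF x]] by simp
  have cov: "covers H ?D v" if v: "v \<in> vts H" "cnt P v = d" for v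
  proof -
    consider "v = u" | "v = fst y" | p where "p \<in> set ys" "v = fst p" | p where "p \<in> set us" "v = fst p"
      | p where "p \<in> set ws" "v = fst p"
      using v(1) unfolding vt ms by auto
    then show ?thesis
    proof cases
      case 1
      then show ?thesis using covers_fst[of x w H ?D] x xu by (simp add: H)
    next
      case 2
      then show ?thesis using covers_snd[of "(u, 0)" y H ?D] by (simp add: H)
    next
      case 3
      then show ?thesis using nf v by (simp add: isf_def)
    next
      case 4
      then show ?thesis using covers_zip[OF 4(1) len(2), of H ?D] fst_rest_image[of "(u, 0)"]
        by (auto simp: H)
    next
      case 5
      then show ?thesis using covers_zip[OF 5(1) len(3), of H ?D] fst_rest_image[of w]
        by (auto simp: H)
    qed
  qed
  have cu: "cnt (P - pts H) u = 0"
    using cnt_exhausted[of "(u, 0)" H] by (auto simp: pts_map mf)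
  have "Zc d n (P - pts H) j - Zc d n P j
      = - 2 * of_bool (j = 0) - of_bool (j = 1) + Ssum d P j ys + Ssum d P j us + Ssum d P j ws"
    if j: "j < d" for j
  proof -
    have "Zc d n (P - pts H) j - Zc d n P j
       = of_bool (cnt (P - pts H) u + j = d) - of_bool (cnt P u + j = d)
         + (\<Sum>p\<leftarrow>map snd H. if p \<in> {y, w} then - of_bool (dg d P p = j) else ej d P j p)"
    proof (rule Zc_diff_nc[OF P assms(2) ne j])
      show "cnt (P - pts H) (fst p) = 0" if "p \<in> set (map snd H)" "p \<in> {y, w}" for p
        using that cnt_exhausted[of y H] cnt_exhausted[of w H] w(1) by (auto simp: pts_map mf ms)
      show "fst p \<notin> fst ` set (map fst H)" if p: "p \<in> set (map snd H)" "p \<notin> {y, w}" for p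
      proof -
        have "fst p \<noteq> fst y" "fst p \<noteq> fst w"
          using nc_inj[OF assms(2)] p ms w(1) unfolding inj_on_def by auto
        moreover have "fst p \<noteq> u" using p(1) uy by (metis imageI)
        moreover have "fst ` set (map fst H) \<subseteq> {u, fst y, fst w}"
          using fst_rest_image[of "y"] fst_rest_image[of "w"] fst_rest_image[of "(u, 0)"] unfolding mf by auto
        ultimately show ?thesis by blast
      qed
    qed (use lst in simp)
    moreover have "(\<Sum>p\<leftarrow>rev ws. if p \<in> {y, w} then - of_bool (dg d P p = j) else ej d P j p) = (\<Sum>p\<leftarrow>rev ws. ej d P j p)"
      using dist w(1) by (intro sum_list_if_notin) auto
    moreover have "(\<Sum>p\<leftarrow>rev ys. if p \<in> {y, w} then - of_bool (dg d P p = j) else ej d P j p) = (\<Sum>p\<leftarrow>rev ys. ej d P j p)"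
      using dist w(1) by (intro sum_list_if_notin) auto
    moreover have "(\<Sum>p\<leftarrow>rev us. if p \<in> {y, w} then - of_bool (dg d P p = j) else ej d P j p)
        = (\<Sum>p\<leftarrow>rev us. ej d P j p) + - of_bool (dg d P w = j) - ej d P j w"
      using dist w(1) by (intro sum_list_if_in) auto
    moreover have "(\<Sum>p\<leftarrow>rev us. ej d P j p) = Ssum d P j us" "(\<Sum>p\<leftarrow>rev ys. ej d P j p) = Ssum d P j ys"
      "(\<Sum>p\<leftarrow>rev ws. ej d P j p) = Ssum d P j ws"
      by (simp_all add: Ssum_def rev_map[symmetric])
    moreover have "dg d P y = 0" "dg d P w = 0" using y w(2) by (simp_all add: isf_def dg_def)
    moreover have "- of_bool (0 = j) - ej d P j w = - of_bool (j = 1)"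
      using \<open>dg d P w = 0\<close> by (auto simp: ej_def)
    ultimately show ?thesis using cu u d j by (simp add: ms)
  qed
  moreover have "real (card ?D) \<le> 2" by (simp add: card_insert_if)
  ultimately show ?thesis
    using cov fst_less[OF wP] un by (auto simp: leafok_def leaf3_def)
qed

lemma leaf4_ok:
  assumes H: "H = rev (zip (rest d P (hd us)) bs) @ rev (zip (rest d P (hd ys)) as) @
      rev (zip (rest d P (u, 0)) us) @ rev (zip (rest d P y) ys) @ [((u, 0), y)]"
    and "nc P H" and len: "length ys = length (rest d P y)" "length us = length (rest d P (u, 0))"
      "length as = length (rest d P (hd ys))" "length bs = length (rest d P (hd us))" and y: "isf d P y"
    and nf: "\<And>p. p \<in> set ys \<Longrightarrow> \<not> isf d P p" "\<And>p. p \<in> set us \<Longrightarrow> \<not> isf d P p"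
    and nempty: "ys \<noteq> []" "us \<noteq> []"
  shows "leafok d n P (leaf4 d P ys us as bs) H"
proof -
  define a where "a = hd ys"
  define b where "b = hd us"
  obtain ys' where ys: "ys = a # ys'" using nempty by (cases ys) (auto simp: a_def)
  obtain us' where us: "us = b # us'" using nempty by (cases us) (auto simp: b_def)
  note H = H[folded a_def b_def] and len = len[folded a_def b_def]
  have mf: "map fst H = rev (rest d P b) @ rev (rest d P a) @ rev (rest d P (u, 0)) @ rev (rest d P y) @ [(u, 0)]"
    and ms: "map snd H = rev bs @ rev as @ rev us @ rev ys @ [y]"
    using len by (simp_all add: H rev_map[symmetric])
  have ne: "H \<noteq> []" and lst: "fst (fst (last H)) = u" by (simp_all add: H)
  have dist: "distinct (rev bs @ rev as @ rev us @ rev ys @ [y])" using nc_distinct_snd[OF assms(2)] ms by simp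
  have uy: "u \<notin> fst ` set (map snd H)" using nc_root[OF assms(2) ne] lst by simp
  have abP: "a \<in> P" "b \<in> P" using nc_pts[OF assms(2)] by (auto simp: pts_map ms ys us)
  have vt: "vts H = insert u (fst ` set (map snd H))"
    using nc_vts[OF assms(2) ne] lst by simp
  let ?D = "{fst a, fst b}"
  have "b \<in> set us" "a \<in> set ys" by (simp_all add: us ys)
  obtain x where x: "(x, b) \<in> set (zip (rest d P (u, 0)) us)"
    using in_set_impl_in_set_zip2[OF len(2)[symmetric] \<open>b \<in> set us\<close>] by blast
  have xu: "fst x = u" using fst_rest[OF set_zip_leftD[OF x]] by simp
  obtain x' where x': "(x', a) \<in> set (zip (rest d P y) ys)"
    using in_set_impl_in_set_zip2[OF len(1)[symmetric] \<open>a \<in> set ys\<close>] by blast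
  have xy: "fst x' = fst y" using fst_rest[OF set_zip_leftD[OF x']] by simp
  have cov: "covers H ?D v" if v: "v \<in> vts H" "cnt P v = d" for v
  proof -
    consider "v = u" | "v = fst y" | p where "p \<in> set ys" "v = fst p" | p where "p \<in> set us" "v = fst p"
      | p where "p \<in> set as" "v = fst p" | p where "p \<in> set bs" "v = fst p"
      using v(1) unfolding vt ms by auto
    then show ?thesis
    proof cases
      case 1
      then show ?thesis using covers_fst[of x b H ?D] x xu by (simp add: H)
    next
      case 2
      then show ?thesis using covers_fst[of x' a H ?D] x' xy by (simp add: H)
    next
      case 3
      then show ?thesis using nf v by (simp add: isf_def)
    next
      case 4
      then show ?thesis using nf v by (simp add: isf_def)
    next
      case 5
      then show ?thesis using covers_zip[OF 5(1) len(3), of H ?D] fst_rest_image[of a]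
        by (auto simp: H)
    next
      case 6
      then show ?thesis using covers_zip[OF 6(1) len(4), of H ?D] fst_rest_image[of b]
        by (auto simp: H)
    qed
  qed
  have cu: "cnt (P - pts H) u = 0"
    using cnt_exhausted[of "(u, 0)" H] by (auto simp: pts_map mf)
  have "Zc d n (P - pts H) j - Zc d n P j
      = - 2 * of_bool (j = 0) + Ssum d P j ys' + Ssum d P j us'
          - of_bool (j = dg d P a) - of_bool (j = dg d P b) + Ssum d P j as + Ssum d P j bs"
    if j: "j < d" for j
  proof -
    let ?h = "\<lambda>p. if p \<in> {y, a, b} then - of_bool (dg d P p = j) else ej d P j p"
    have "Zc d n (P - pts H) j - Zc d n P j
       = of_bool (cnt (P - pts H) u + j = d) - of_bool (cnt P u + j = d) + (\<Sum>p\<leftarrow>map snd H. ?h p)"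
    proof (rule Zc_diff_nc[OF P assms(2) ne j])
      show "cnt (P - pts H) (fst p) = 0" if "p \<in> set (map snd H)" "p \<in> {y, a, b}" for p
        using that cnt_exhausted[of y H] cnt_exhausted[of a H] cnt_exhausted[of b H]
        by (auto simp: pts_map mf ms ys us)
      show "fst p \<notin> fst ` set (map fst H)" if p: "p \<in> set (map snd H)" "p \<notin> {y, a, b}" for p
      proof -
        have "fst p \<noteq> fst y" "fst p \<noteq> fst a" "fst p \<noteq> fst b"
          using nc_inj[OF assms(2)] p ms \<open>b \<in> set us\<close> \<open>a \<in> set ys\<close> unfolding inj_on_def by auto
        moreover have "fst p \<noteq> u" using p(1) uy by (metis imageI)
        moreover have "fst ` set (map fst H) \<subseteq> {u, fst y, fst a, fst b}"
          using fst_rest_image[of "y"] fst_rest_image[of "a"] fst_rest_image[of "b"] fst_rest_image[of "(u, 0)"] unfolding mf by auto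
        ultimately show ?thesis by blast
      qed
    qed (use lst in simp)
    moreover have "(\<Sum>p\<leftarrow>rev bs. ?h p) = (\<Sum>p\<leftarrow>rev bs. ej d P j p)" "(\<Sum>p\<leftarrow>rev as. ?h p) = (\<Sum>p\<leftarrow>rev as. ej d P j p)"
      "(\<Sum>p\<leftarrow>rev us'. ?h p) = (\<Sum>p\<leftarrow>rev us'. ej d P j p)" "(\<Sum>p\<leftarrow>rev ys'. ?h p) = (\<Sum>p\<leftarrow>rev ys'. ej d P j p)"
      using dist ys us by (intro sum_list_if_notin; force)+
    moreover have "(\<Sum>p\<leftarrow>rev us'. ej d P j p) = Ssum d P j us'" "(\<Sum>p\<leftarrow>rev ys'. ej d P j p) = Ssum d P j ys'"
      "(\<Sum>p\<leftarrow>rev as. ej d P j p) = Ssum d P j as" "(\<Sum>p\<leftarrow>rev bs. ej d P j p) = Ssum d P j bs"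
      by (simp_all add: Ssum_def rev_map[symmetric])
    moreover have "dg d P y = 0" using y by (simp_all add: isf_def dg_def)
    ultimately show ?thesis using cu u d j
      by (simp add: ms us ys eq_commute[of "dg d P a" j] eq_commute[of "dg d P b" j] eq_commute[of 0 j])
  qed
  moreover have "real (card ?D) \<le> 2" by (simp add: card_insert_if)
  ultimately show ?thesis
    using cov fst_less[OF abP(1)] fst_less[OF abP(2)]
    by (auto simp: leafok_def leaf4_def a_def[symmetric] b_def[symmetric] ys us)
qed

text \<open>The leaves are handled by \<open>leaf1_ok\<close> to \<open>leaf4_ok\<close>. What
  remains is to check that each list of questions concerns unexposed points of visited vertices, by
  \<open>rest_fresh\<close>.\<close>

lemma wp_step: "wp (step d P u) P [] (leafok d n P)"
proof -
  have u0: "(u, 0) \<in> P" using u_points[of 0] d by simp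
  have lu: "length (rest d P (u, 0)) = d - 1" using length_rest[OF P u0] u by simp
  have "wp (if \<not> isf d P y then asks (rest d P y) (\<lambda>zs. Ret (leaf1 d P y zs))
     else asks (rest d P y) (\<lambda>ys. asks (rest d P (u, 0)) (\<lambda>us.
       if \<exists>p\<in>set ys. isf d P p then Ret (leaf2 d P u y ys us)
       else if \<exists>p\<in>set us. isf d P p
       then asks (rest d P (hd (filter (isf d P) us)))
              (\<lambda>ws. Ret (leaf3 d P u (hd (filter (isf d P) us)) ys us ws))
       else asks (rest d P (hd ys)) (\<lambda>as. asks (rest d P (hd us)) (\<lambda>bs. Ret (leaf4 d P ys us as bs))))))
    P [((u, 0), y)] (leafok d n P)"
    if y: "y \<in> P - {(u, 0)}" "fst y \<noteq> u" for y
  proof -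
    let ?H1 = "[((u, 0), y)]"
    have nc1: "nc P ?H1" using y u0 by auto
    have fr1: "set (rest d P y) \<subseteq> P - pts ?H1" "fst ` set (rest d P y) \<subseteq> vts ?H1"
      using rest_fresh[OF nc1, of y] y by auto
    show ?thesis
    proof (cases "isf d P y")
      case False
      have "wp (asks (rest d P y) (\<lambda>zs. Ret (leaf1 d P y zs))) P ?H1 (leafok d n P)"
        by (rule wp_asks[OF nc1 distinct_rest fr1]) (simp add: leaf1_ok False)
      then show ?thesis using False by simp
    next
      case True
      have ly: "length (rest d P y) = d - 1" using length_rest[OF P, of y] y True by (simp add: isf_def)
      have "wp (asks (rest d P y) (\<lambda>ys. asks (rest d P (u, 0)) (\<lambda>us.
       if \<exists>p\<in>set ys. isf d P p then Ret (leaf2 d P u y ys us)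
       else if \<exists>p\<in>set us. isf d P p
       then asks (rest d P (hd (filter (isf d P) us)))
              (\<lambda>ws. Ret (leaf3 d P u (hd (filter (isf d P) us)) ys us ws))
       else asks (rest d P (hd ys)) (\<lambda>as. asks (rest d P (hd us)) (\<lambda>bs. Ret (leaf4 d P ys us as bs))))))
        P ?H1 (leafok d n P)"
      proof (rule wp_asks[OF nc1 distinct_rest fr1], goal_cases)
        case (1 ys)
        let ?H2 = "rev (zip (rest d P y) ys) @ ?H1"
        have f2: "map fst ?H2 = rev (rest d P y) @ [(u, 0)]" and s2: "map snd ?H2 = rev ys @ [y]"
          using 1(1) by (simp_all add: rev_map[symmetric])
        have l2: "last ?H2 = ((u, 0), y)" "?H2 \<noteq> []" by simp_all
        have root2: "u \<notin> fst ` set (map snd ?H2)"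
          using nc_root[OF 1(2) l2(2)] by (simp only: l2(1) fst_conv set_map) simp
        have fr2: "set (rest d P (u, 0)) \<subseteq> P - pts ?H2" "fst ` set (rest d P (u, 0)) \<subseteq> vts ?H2"
        proof -
          have "p \<notin> pts ?H2" if p: "fst p = u" "p \<noteq> (u, 0)" for p
            using p root2 fst_rest[of p y] y(2) unfolding pts_map f2 by auto
          then show "set (rest d P (u, 0)) \<subseteq> P - pts ?H2" unfolding set_rest[OF P] by auto
          show "fst ` set (rest d P (u, 0)) \<subseteq> vts ?H2"
            using fst_rest_image[of "(u, 0)"] by (auto simp: vts_def pts_def)
        qed
        show ?case
        proof (rule wp_asks[OF 1(2) distinct_rest fr2], goal_cases)
          case us: (1 us)
          let ?H3 = "rev (zip (rest d P (u, 0)) us) @ ?H2"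
          have f3: "map fst ?H3 = rev (rest d P (u, 0)) @ rev (rest d P y) @ [(u, 0)]"
            and s3: "map snd ?H3 = rev us @ rev ys @ [y]"
            using 1(1) us(1) by (simp_all add: rev_map[symmetric])
          have asked3: "fst ` set (map fst ?H3) \<subseteq> {u, fst y}"
            unfolding f3 using fst_rest_image[of "(u, 0)"] fst_rest_image[of y] by auto
          have l3: "last ?H3 = ((u, 0), y)" "?H3 \<noteq> []" by simp_all
          have root3: "u \<notin> fst ` set (map snd ?H3)"
            using nc_root[OF us(2) l3(2)] by (simp only: l3(1) fst_conv set_map) simp
          have dist3: "distinct (map snd ?H3)" using nc_distinct_snd[OF us(2)] .
          have fresh3: "fst w \<notin> fst ` set (map fst ?H3)" if "w \<in> set us \<union> set ys" for w
          proof -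
            have w: "w \<in> set (map snd ?H3)" "y \<in> set (map snd ?H3)" using that unfolding s3 by auto
            have "w \<noteq> y" using dist3 that unfolding s3 by auto
            then have "fst w \<noteq> fst y" using nc_inj[OF us(2)] w unfolding inj_on_def by blast
            moreover have "fst w \<noteq> u" using root3 w(1) by auto
            ultimately show ?thesis using asked3 by auto
          qed
          consider (B) "\<exists>p\<in>set ys. isf d P p" | (C) "\<not> (\<exists>p\<in>set ys. isf d P p)" "\<exists>p\<in>set us. isf d P p"
            | (D) "\<not> (\<exists>p\<in>set ys. isf d P p)" "\<not> (\<exists>p\<in>set us. isf d P p)" by blast
          then show ?case
          proof cases
            case B
            have "leafok d n P (leaf2 d P u y ys us) ?H3"
              by (rule leaf2_ok[OF _ us(2)]) (use 1 us True in auto)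
            then show ?thesis using B by simp
          next
            case C
            define w where "w = hd (filter (isf d P) us)"
            have "filter (isf d P) us \<noteq> []" using C(2) by (auto simp: filter_empty_conv)
            then have "w \<in> set (filter (isf d P) us)" unfolding w_def by (rule hd_in_set)
            then have w: "w \<in> set us" "isf d P w" by auto
            have "w \<in> set (map snd ?H3)" unfolding s3 using w by auto
            note fr3 = rest_fresh[OF us(2) this fresh3]
            have "wp (asks (rest d P w) (\<lambda>ws. Ret (leaf3 d P u w ys us ws))) P ?H3 (leafok d n P)"
            proof (rule wp_asks[OF us(2) distinct_rest fr3], goal_cases)
              case (3 ws)
              have "leafok d n P (leaf3 d P u w ys us ws) (rev (zip (rest d P w) ws) @ ?H3)"
                by (rule leaf3_ok[OF _ 3(2)]) (use 1 us 3 True w C in auto)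
              then show ?case by simp
            qed (use w in auto)
            then show ?thesis using C by (simp add: w_def)
          next
            case D
            \<comment> \<open>Both \<open>u\<close> and the vertex of \<open>y\<close> were
              untouched, so each list has \<open>d - 1\<close> entries, at least two. Hence the
              heads used in the fourth case exist.\<close>
            have ne: "ys \<noteq> []" "us \<noteq> []" using d ly lu 1(1) us(1) by auto
            then have ab: "hd ys \<in> set ys" "hd us \<in> set us" by auto
            have "hd ys \<in> set (map snd ?H3)" unfolding s3 using ab by auto
            note fr3 = rest_fresh[OF us(2) this fresh3]
            have "wp (asks (rest d P (hd ys)) (\<lambda>as. asks (rest d P (hd us)) (\<lambda>bs. Ret (leaf4 d P ys us as bs))))
              P ?H3 (leafok d n P)"
            proof (rule wp_asks[OF us(2) distinct_rest fr3], goal_cases)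
              case as: (3 as)
              let ?H4 = "rev (zip (rest d P (hd ys)) as) @ ?H3"
              have f4: "map fst ?H4 = rev (rest d P (hd ys)) @ map fst ?H3"
                and s4: "map snd ?H4 = rev as @ map snd ?H3"
                using as(1) by (simp_all add: rev_map[symmetric])
              have m: "hd us \<in> set (map snd ?H4)" "hd ys \<in> set (map snd ?H4)" unfolding s4 s3 using ab by auto
              have "hd us \<noteq> hd ys" using dist3 ab unfolding s3 by auto
              then have "fst (hd us) \<noteq> fst (hd ys)"
                using nc_inj[OF as(2)] m unfolding inj_on_def by blast
              then have "fst (hd us) \<notin> fst ` set (map fst ?H4)"
                using fresh3[of "hd us"] ab fst_rest_image[of "hd ys"] unfolding f4 by auto
              note fr4 = rest_fresh[OF as(2) m(1) this]
              show ?case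
              proof (rule wp_asks[OF as(2) distinct_rest fr4], goal_cases)
                case (1 bs)
                have "leafok d n P (leaf4 d P ys us as bs) (rev (zip (rest d P (hd us)) bs) @ ?H4)"
                  by (rule leaf4_ok[OF _ 1(2)]) (use 1 us as True D ne \<open>length ys = length (rest d P y)\<close> in auto)
                then show ?case by simp
              qed
            qed (use ab in auto)
            then show ?thesis using D by simp
          qed
        qed
      qed
      then show ?thesis using True by simp
    qed
  qed
  then show ?thesis using u0 by (auto simp: step_def)
qed

end

section \<open>Averages over lists of independent uniform points\<close>

primrec lav :: "point set \<Rightarrow> nat \<Rightarrow> (point list \<Rightarrow> real) \<Rightarrow> real" where
  "lav P 0 h = h []"
| "lav P (Suc l) h = (\<Sum>y\<in>P. lav P l (\<lambda>ys. h (y # ys))) / real (card P)"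

definition av :: "point set \<Rightarrow> (point \<Rightarrow> real) \<Rightarrow> real" where
  "av P h = (\<Sum>y\<in>P. h y) / real (card P)"

lemma iv_asks: "iv (asks xs k) P g = lav P (length xs) (\<lambda>ys. iv (k ys) P g)"
  by (induction xs arbitrary: k) simp_all

lemma lav_cong:
  "(\<And>ys. length ys = l \<Longrightarrow> set ys \<subseteq> P \<Longrightarrow> h ys = h' ys) \<Longrightarrow> lav P l h = lav P l h'"
proof (induction l arbitrary: h h')
  case (Suc l)
  have "lav P l (\<lambda>ys. h (y # ys)) = lav P l (\<lambda>ys. h' (y # ys))" if "y \<in> P" for y
    using that Suc.prems by (intro Suc.IH) auto
  then show ?case by simp
qed simp

lemma lav_add: "lav P l (\<lambda>ys. h ys + h' ys) = lav P l h + lav P l h'"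
  by (induction l arbitrary: h h') (simp_all add: sum.distrib add_divide_distrib)

lemma lav_cmult: "lav P l (\<lambda>ys. c * h ys) = c * lav P l h"
  by (induction l arbitrary: h) (simp_all add: sum_distrib_left[symmetric])

lemma lav_const: "card P > 0 \<Longrightarrow> lav P l (\<lambda>ys. c) = c"
  by (induction l) simp_all

lemma av_cong: "(\<And>y. y \<in> P \<Longrightarrow> h y = h' y) \<Longrightarrow> av P h = av P h'"
  by (simp add: av_def cong: sum.cong)

lemma av_add: "av P (\<lambda>y. h y + h' y) = av P h + av P h'"
  by (simp add: av_def sum.distrib add_divide_distrib)

lemma av_cmult: "av P (\<lambda>y. c * h y) = c * av P h"
  by (simp add: av_def sum_distrib_left)

lemma av_cmult_right: "av P (\<lambda>y. h y * c) = av P h * c"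
  by (simp add: av_def sum_distrib_right)

lemma av_const: "card P > 0 \<Longrightarrow> av P (\<lambda>y. c) = c"
  by (simp add: av_def)

lemma lav_Suc: "lav P (Suc l) h = av P (\<lambda>y. lav P l (\<lambda>ys. h (y # ys)))"
  by (simp add: av_def)

declare lav.simps(2) [simp del]

context
  fixes P :: "point set" and A :: "point \<Rightarrow> bool" and e \<kappa> :: "point \<Rightarrow> real"
  assumes P: "card P > 0"
begin

lemma lav_sum: "lav P l (\<lambda>ys. \<Sum>y\<leftarrow>ys. e y) = real l * av P e"
  by (induction l) (simp_all add: lav_Suc lav_add lav_const[OF P] av_add av_const[OF P] algebra_simps)

lemma lav_all: "lav P l (\<lambda>ys. of_bool (\<forall>y\<in>set ys. A y)) = av P (\<lambda>y. of_bool (A y)) ^ l"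
proof (induction l)
  case (Suc l)
  then show ?case
    by (simp add: lav_Suc of_bool_conj lav_cmult av_cmult_right)
qed simp

text \<open>Each of the \<open>l\<close> summands must satisfy \<open>A\<close> together with the
  \<open>l - 1\<close> other entries, which are independent of it.\<close>

lemma lav_all_sum: "lav P l (\<lambda>ys. of_bool (\<forall>y\<in>set ys. A y) * (\<Sum>y\<leftarrow>ys. e y))
   = real l * av P (\<lambda>y. of_bool (A y)) ^ (l - 1) * av P (\<lambda>y. of_bool (A y) * e y)"
proof (induction l)
  case (Suc l)
  let ?r = "av P (\<lambda>y. of_bool (A y))" and ?e1 = "av P (\<lambda>y. of_bool (A y) * e y)"
  have "lav P (Suc l) (\<lambda>ys. of_bool (\<forall>y\<in>set ys. A y) * (\<Sum>y\<leftarrow>ys. e y))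
      = av P (\<lambda>y. lav P l (\<lambda>ys. (of_bool (A y) * e y) * of_bool (\<forall>y\<in>set ys. A y)
          + of_bool (A y) * (of_bool (\<forall>y\<in>set ys. A y) * (\<Sum>y\<leftarrow>ys. e y))))"
    unfolding lav_Suc by (simp add: of_bool_conj algebra_simps)
  also have "\<dots> = av P (\<lambda>y. ?r ^ l * (of_bool (A y) * e y) + real l * ?r ^ (l - 1) * ?e1 * of_bool (A y))"
    unfolding lav_add lav_cmult lav_all Suc by (simp add: mult.commute)
  also have "\<dots> = ?r ^ l * ?e1 + real l * ?r ^ (l - 1) * ?e1 * ?r"
    unfolding av_add av_cmult ..
  also have "\<dots> = real (Suc l) * ?r ^ l * ?e1"
    by (cases l) (simp_all add: algebra_simps)
  finally show ?case by simp
qed simp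

lemma lav_all_sum_tl: "lav P (Suc l) (\<lambda>ys. of_bool (\<forall>y\<in>set ys. A y) * (\<Sum>y\<leftarrow>tl ys. e y))
   = av P (\<lambda>y. of_bool (A y)) * (real l * av P (\<lambda>y. of_bool (A y)) ^ (l - 1) * av P (\<lambda>y. of_bool (A y) * e y))"
proof -
  have "lav P (Suc l) (\<lambda>ys. of_bool (\<forall>y\<in>set ys. A y) * (\<Sum>y\<leftarrow>tl ys. e y))
     = av P (\<lambda>y. lav P l (\<lambda>ys. of_bool (A y) * (of_bool (\<forall>y\<in>set ys. A y) * (\<Sum>y\<leftarrow>ys. e y))))"
    unfolding lav_Suc by (simp add: of_bool_conj mult_ac)
  then show ?thesis unfolding lav_cmult lav_all_sum av_cmult_right .
qed

lemma lav_all_hd: "lav P (Suc l) (\<lambda>ys. of_bool (\<forall>y\<in>set ys. A y) * \<kappa> (hd ys))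
   = av P (\<lambda>y. of_bool (A y) * \<kappa> y) * av P (\<lambda>y. of_bool (A y)) ^ l"
proof -
  have "lav P (Suc l) (\<lambda>ys. of_bool (\<forall>y\<in>set ys. A y) * \<kappa> (hd ys))
     = av P (\<lambda>y. lav P l (\<lambda>ys. (of_bool (A y) * \<kappa> y) * of_bool (\<forall>y\<in>set ys. A y)))"
    unfolding lav_Suc by (simp add: of_bool_conj mult_ac)
  also have "\<dots> = av P (\<lambda>y. (av P (\<lambda>y. of_bool (A y)) ^ l) * (of_bool (A y) * \<kappa> y))"
    unfolding lav_cmult lav_all by (simp add: mult.commute)
  finally show ?thesis unfolding av_cmult by (simp add: mult.commute)
qed

text \<open>The case distinction of a step becomes a linear combination of these six functions of a
  list. Averaging over one list gives such a combination for the other, so the formula serves twice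
  in \<open>full_pair_average\<close>.\<close>

lemma lav_combination:
  fixes c :: "nat \<Rightarrow> real"
  shows "lav P (Suc (Suc l)) (\<lambda>ys. c 0 + c 1 * (\<Sum>y\<leftarrow>ys. e y) + c 2 * of_bool (\<forall>y\<in>set ys. A y)
       + c 3 * (of_bool (\<forall>y\<in>set ys. A y) * (\<Sum>y\<leftarrow>ys. e y))
       + c 4 * (of_bool (\<forall>y\<in>set ys. A y) * (\<Sum>y\<leftarrow>tl ys. e y))
       + c 5 * (of_bool (\<forall>y\<in>set ys. A y) * \<kappa> (hd ys)))
   = c 0 + c 1 * (real (l + 2) * av P e) + c 2 * av P (\<lambda>y. of_bool (A y)) ^ (l + 2)
       + c 3 * (real (l + 2) * av P (\<lambda>y. of_bool (A y)) ^ (l + 1) * av P (\<lambda>y. of_bool (A y) * e y))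
       + c 4 * (real (l + 1) * av P (\<lambda>y. of_bool (A y)) ^ (l + 1) * av P (\<lambda>y. of_bool (A y) * e y))
       + c 5 * (av P (\<lambda>y. of_bool (A y) * \<kappa> y) * av P (\<lambda>y. of_bool (A y)) ^ (l + 1))"
  unfolding lav_add lav_cmult lav_sum lav_all lav_all_sum lav_all_sum_tl lav_all_hd lav_const[OF P]
  by (simp add: algebra_simps)

end

text \<open>With \<open>d = l + 3\<close> and \<open>A\<close> meaning that a vertex is touched, the
  three summands are the last three brackets of \<open>f_fun\<close>: \<open>r\<close> plays the
  role of \<open>rho\<close>, \<open>e0\<close> and \<open>e1\<close> those of the quotients of
  \<open>phi\<close>, and \<open>k1\<close> is the inner sum over \<open>m\<close>.\<close>

lemma full_pair_average:
  fixes e :: "point \<Rightarrow> real" and A :: "point \<Rightarrow> bool" and \<kappa> :: "point \<Rightarrow> real" and c0 c1 :: real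
  assumes P: "card P > 0"
  defines "r \<equiv> av P (\<lambda>y. of_bool (A y))" and "e0 \<equiv> av P e" and "e1 \<equiv> av P (\<lambda>y. of_bool (A y) * e y)"
    and "k1 \<equiv> av P (\<lambda>y. of_bool (A y) * \<kappa> y)"
  assumes G: "\<And>ys us. length ys = l + 2 \<Longrightarrow> length us = l + 2 \<Longrightarrow> set ys \<subseteq> P \<Longrightarrow> set us \<subseteq> P \<Longrightarrow> G ys us =
     (if \<exists>y\<in>set ys. \<not> A y then - 2 * c0 + (\<Sum>y\<leftarrow>ys. e y) + (\<Sum>y\<leftarrow>us. e y)
      else if \<exists>y\<in>set us. \<not> A y then - 2 * c0 - c1 + (\<Sum>y\<leftarrow>ys. e y) + (\<Sum>y\<leftarrow>us. e y) + real (l + 2) * e0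
      else - 2 * c0 + (\<Sum>y\<leftarrow>tl ys. e y) + (\<Sum>y\<leftarrow>tl us. e y) + \<kappa> (hd ys) + \<kappa> (hd us))"
  shows "lav P (l + 2) (\<lambda>ys. lav P (l + 2) (G ys)) =
     ((1 - r ^ (l + 2)) * (- 2 * c0 + real (l + 2) * e0) + real (l + 2) * (e0 - r ^ (l + 1) * e1))
     + (r ^ (l + 2) * (1 - r ^ (l + 2)) * (- 2 * c0 - c1 + real (l + 2) * e0)
        + real (l + 2) * r ^ (l + 1) * (1 - r ^ (l + 2)) * e1
        + real (l + 2) * r ^ (l + 2) * (e0 - r ^ (l + 1) * e1))
     + (- 2 * c0 * r ^ (2 * l + 4) + 2 * real (l + 1) * r ^ (2 * l + 3) * e1 + 2 * r ^ (2 * l + 3) * k1)"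
proof -
  let ?A = "\<lambda>ys. of_bool (\<forall>y\<in>set ys. A y) :: real"
  let ?S = "\<lambda>ys. \<Sum>y\<leftarrow>ys. e y"
  let ?L = "real (l + 2)"
  have inner: "lav P (l + 2) (G ys) =
      (- 2 * c0 + ?L * e0) + 1 * ?S ys
      + (- c1 + ?L * e0 + r ^ (l + 2) * (c1 - ?L * e0) - ?L * r ^ (l + 1) * e1 + real (l + 1) * r ^ (l + 1) * e1 + k1 * r ^ (l + 1)) * ?A ys
      + (- (r ^ (l + 2))) * (?A ys * ?S ys)
      + r ^ (l + 2) * (?A ys * ?S (tl ys)) + r ^ (l + 2) * (?A ys * \<kappa> (hd ys))"
    if ys: "length ys = l + 2" "set ys \<subseteq> P" for ys
  proof -
    \<comment> \<open>An existential condition is one minus the indicator that all entries satisfy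
      \<open>A\<close>. This turns the nested conditional into a polynomial in the indicators for
      \<open>ys\<close> and \<open>us\<close>, whose coefficients are listed here for fixed
      \<open>ys\<close>.\<close>
    define c where "c = (\<lambda>i. [(- 2 * c0 + ?S ys) + ?A ys * (- c1 + ?L * e0), 1,
        ?A ys * (c1 - ?S ys - ?L * e0 + ?S (tl ys) + \<kappa> (hd ys)), - ?A ys, ?A ys, ?A ys] ! i)"
    have "lav P (l + 2) (G ys) = lav P (Suc (Suc l)) (\<lambda>us. c 0 + c 1 * ?S us + c 2 * ?A us + c 3 * (?A us * ?S us)
       + c 4 * (?A us * ?S (tl us)) + c 5 * (?A us * \<kappa> (hd us)))"
      unfolding add_2_eq_Suc'
    proof (rule lav_cong)
      fix us assume us: "length us = Suc (Suc l)" "set us \<subseteq> P"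
      show "G ys us = c 0 + c 1 * ?S us + c 2 * ?A us + c 3 * (?A us * ?S us)
       + c 4 * (?A us * ?S (tl us)) + c 5 * (?A us * \<kappa> (hd us))"
        using G[of ys us] ys us by (auto simp: c_def algebra_simps)
    qed
    then show ?thesis
      unfolding lav_combination[OF P] r_def[symmetric] e0_def[symmetric] e1_def[symmetric] k1_def[symmetric]
      by (simp add: c_def algebra_simps)
  qed
  define c where "c = (\<lambda>i. [- 2 * c0 + ?L * e0, 1,
      - c1 + ?L * e0 + r ^ (l + 2) * (c1 - ?L * e0) - ?L * r ^ (l + 1) * e1 + real (l + 1) * r ^ (l + 1) * e1 + k1 * r ^ (l + 1),
      - (r ^ (l + 2)), r ^ (l + 2), r ^ (l + 2)] ! i)"
  have "lav P (l + 2) (\<lambda>ys. lav P (l + 2) (G ys)) = lav P (Suc (Suc l)) (\<lambda>ys. c 0 + c 1 * ?S ys + c 2 * ?A ys + c 3 * (?A ys * ?S ys)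
       + c 4 * (?A ys * ?S (tl ys)) + c 5 * (?A ys * \<kappa> (hd ys)))"
    using inner unfolding add_2_eq_Suc' by (intro lav_cong) (simp add: c_def)
  then show ?thesis
    unfolding lav_combination[OF P] r_def[symmetric] e0_def[symmetric] e1_def[symmetric] k1_def[symmetric]
    by (simp add: c_def algebra_simps power_add power2_eq_square power3_eq_cube power4_eq_xxxx power_mult)
qed


text \<open>Double counting: a vertex of current degree \<open>i\<close> owns \<open>d - i\<close>
  unexposed points. Vertices of degree \<open>d\<close> own none, so the sum stops at
  \<open>d - 1\<close>.\<close>

lemma sum_dg:
  assumes P: "P \<subseteq> pspace n d" and "0 < d"
  shows "(\<Sum>y\<in>P. h (dg d P y)) = (\<Sum>i=0..d-1. (real d - real i) * Zc d n P i * h i)"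
proof -
  have fin: "finite P" using finite_subset[OF P] by simp
  have "(\<Sum>y\<in>P. h (dg d P y)) = (\<Sum>v<n. \<Sum>y\<in>{p \<in> P. fst p = v}. h (dg d P y))"
    using P fin by (intro sum.group[symmetric]) (auto simp: pspace_def)
  also have "\<dots> = (\<Sum>v<n. real (cnt P v) * h (d - cnt P v))"
    by (intro sum.cong refl) (simp add: dg_def cnt_def)
  also have "\<dots> = (\<Sum>v<n. \<Sum>i=0..d-1. (real d - real i) * of_bool (cnt P v + i = d) * h i)"
  proof (rule sum.cong[OF refl])
    fix v
    have c: "cnt P v \<le> d" using cnt_le[OF P] .
    show "real (cnt P v) * h (d - cnt P v) = (\<Sum>i=0..d-1. (real d - real i) * of_bool (cnt P v + i = d) * h i)"
    proof (cases "cnt P v = 0")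
      case True
      then have "(\<Sum>i=0..d-1. (real d - real i) * of_bool (cnt P v + i = d) * h i) = 0"
        using assms(2) by (intro sum.neutral) auto
      then show ?thesis using True by simp
    next
      case False
      have "(\<Sum>i=0..d-1. (real d - real i) * of_bool (cnt P v + i = d) * h i)
          = (\<Sum>i=0..d-1. if d - cnt P v = i then (real d - real i) * h i else 0)"
        using c by (intro sum.cong) (auto simp: of_bool_def)
      also have "\<dots> = real (cnt P v) * h (d - cnt P v)"
        using False c by (simp add: of_nat_diff)
      finally show ?thesis by simp
    qed
  qed
  also have "\<dots> = (\<Sum>i=0..d-1. \<Sum>v<n. (real d - real i) * of_bool (cnt P v + i = d) * h i)"
    by (rule sum.swap)
  also have "\<dots> = (\<Sum>i=0..d-1. (real d - real i) * Zc d n P i * h i)"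
    by (simp only: Zc_def sum_distrib_left sum_distrib_right)
  finally show ?thesis .
qed

lemma card_eq_s_fun:
  assumes "P \<subseteq> pspace n d" "0 < d" "0 < n"
  shows "real (card P) = real n * s_fun d 0 (\<lambda>i. Zc d n P i / real n)"
  using sum_dg[OF assms(1,2), of "\<lambda>_. 1"] assms(3)
  by (simp add: s_fun_def sum_distrib_left)

lemma av_dg:
  assumes "P \<subseteq> pspace n d" "0 < d" "0 < n"
  defines "w \<equiv> \<lambda>i. Zc d n P i / real n"
  shows "av P (\<lambda>y. h (dg d P y)) = (\<Sum>i=0..d-1. (real d - real i) * w i * h i) / s_fun d 0 w"
proof -
  have "(\<Sum>y\<in>P. h (dg d P y)) = real n * (\<Sum>i=0..d-1. (real d - real i) * w i * h i)"
    using assms(3) by (simp add: sum_dg[OF assms(1,2)] w_def sum_distrib_left)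
  then show ?thesis
    using assms(3) unfolding av_def card_eq_s_fun[OF assms(1-3)] w_def by simp
qed

text \<open>Up to the factor \<open>s_fun d 0 w\<close>, \<open>phi d 0 j w\<close> is the mean of
  \<open>ej\<close> at a uniform unexposed point, and \<open>phi d 1 j w\<close> is the part of it
  coming from touched vertices.\<close>

lemma sum_shift_phi:
  assumes "j < d"
  shows "(\<Sum>i=0..d-1. (real d - real i) * w i * (of_bool (i + 1 = j) - of_bool (i = j))) = phi d 0 j w"
    "(\<Sum>i=0..d-1. (real d - real i) * w i * (of_bool (1 \<le> i) * (of_bool (i + 1 = j) - of_bool (i = j)))) = phi d 1 j w"
proof -
  have s: "(\<Sum>i=0..d-1. if i + 1 = j then g i else 0) = (if 0 < j then g (j - 1) else 0)" for g :: "nat \<Rightarrow> real"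
  proof (cases j)
    case (Suc k)
    have "(\<Sum>i=0..d-1. if i + 1 = j then g i else 0) = (\<Sum>i=0..d-1. if k = i then g i else 0)"
      using Suc by (intro sum.cong) auto
    then show ?thesis using Suc assms by simp
  qed simp
  have s': "(\<Sum>i=0..d-1. if i = j then g i else 0) = g j" for g :: "nat \<Rightarrow> real"
    using assms by (simp add: sum.delta)
  have "(\<Sum>i=0..d-1. (real d - real i) * w i * (of_bool (i + 1 = j) - of_bool (i = j)))
    = (\<Sum>i=0..d-1. if i + 1 = j then (real d - real i) * w i else 0) - (\<Sum>i=0..d-1. if i = j then (real d - real i) * w i else 0)"
    unfolding sum_subtractf[symmetric] by (intro sum.cong) auto
  then show "(\<Sum>i=0..d-1. (real d - real i) * w i * (of_bool (i + 1 = j) - of_bool (i = j))) = phi d 0 j w"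
    unfolding s s' by (cases j) (auto simp: phi_def)
  have "(\<Sum>i=0..d-1. (real d - real i) * w i * (of_bool (1 \<le> i) * (of_bool (i + 1 = j) - of_bool (i = j))))
    = (\<Sum>i=0..d-1. if i + 1 = j then of_bool (1 \<le> i) * ((real d - real i) * w i) else 0) - (\<Sum>i=0..d-1. if i = j then of_bool (1 \<le> i) * ((real d - real i) * w i) else 0)"
    unfolding sum_subtractf[symmetric] by (intro sum.cong) auto
  then show "(\<Sum>i=0..d-1. (real d - real i) * w i * (of_bool (1 \<le> i) * (of_bool (i + 1 = j) - of_bool (i = j)))) = phi d 1 j w"
    unfolding s s' by (cases j) (auto simp: phi_def of_bool_def algebra_simps)
qed

lemma Ssum_average:
  assumes "card P > 0"
  shows "lav P l (\<lambda>ys. c + Ssum d P j ys) = c + real l * av P (ej d P j)"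
  using lav_sum[OF assms, of l "ej d P j"] by (simp add: lav_add lav_const[OF assms] Ssum_def)

text \<open>A uniform point lies at an untouched vertex with probability
  \<open>real d * w 0 / s_fun d 0 w\<close>. The first block of \<open>f_fun\<close> belongs to a
  touched partner and the other three, which carry this probability as a factor, to an untouched
  one. One vertex is chosen in the former case and two in the latter, which gives
  \<open>f_last\<close>.\<close>

lemma iv_step:
  assumes P: "P \<subseteq> pspace n d" "P \<noteq> {}" and d: "3 \<le> d" and n: "0 < n" and u: "cnt P u = d" and j: "j < d"
  defines "w \<equiv> \<lambda>i. Zc d n P i / real n"
  shows "iv (step d P u) P (\<lambda>(D, c, \<delta>). \<delta> j) = f_fun d j w"
    and "iv (step d P u) P (\<lambda>(D, c, \<delta>). c) = f_last d w"
proof -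
  have fin: "finite P" using finite_subset[OF P(1)] by simp
  have cP: "card P > 0" using fin P(2) by (simp add: card_gt_0_iff)
  have "0 < real (card P)" using cP by simp
  also have "real (card P) = real n * s_fun d 0 w"
    using card_eq_s_fun[OF P(1) _ n, folded w_def] d by simp
  finally have s0: "s_fun d 0 w > 0" using n by (simp add: zero_less_mult_iff)
  define A where "A y = (\<not> isf d P y)" for y
  have A: "A y \<longleftrightarrow> 1 \<le> dg d P y" if "y \<in> P" for y
    using cnt_le[OF P(1), of "fst y"] by (auto simp: A_def isf_def dg_def)
  have avd: "av P (\<lambda>y. h (dg d P y)) = (\<Sum>i=0..d-1. (real d - real i) * w i * h i) / s_fun d 0 w" for h
    unfolding w_def by (rule av_dg[OF P(1) _ n]) (use d in simp)
  define e0 where "e0 = av P (ej d P j)"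
  define e1 where "e1 = av P (\<lambda>y. of_bool (A y) * ej d P j y)"
  define r where "r = av P (\<lambda>y. of_bool (A y))"
  define \<kappa> where "\<kappa> y = - of_bool (j = dg d P y) + (real d - real (dg d P y) - 1) * e0" for y
  define k1 where "k1 = av P (\<lambda>y. of_bool (A y) * \<kappa> y)"
  have e0: "e0 = phi d 0 j w / s_fun d 0 w"
    using avd[of "\<lambda>i. of_bool (i + 1 = j) - of_bool (i = j)"] d sum_shift_phi(1)[OF j, of w]
    unfolding e0_def ej_def by simp
  have "e1 = av P (\<lambda>y. of_bool (1 \<le> dg d P y) * (of_bool (dg d P y + 1 = j) - of_bool (dg d P y = j)))"
    unfolding e1_def ej_def by (rule av_cong) (simp add: A)
  also have "\<dots> = phi d 1 j w / s_fun d 0 w"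
    using avd[of "\<lambda>i. of_bool (1 \<le> i) * (of_bool (i + 1 = j) - of_bool (i = j))"] d sum_shift_phi(2)[OF j, of w]
    by simp
  finally have e1: "e1 = phi d 1 j w / s_fun d 0 w" .
  have avA: "av P (\<lambda>y. of_bool (A y) * h (dg d P y)) = (\<Sum>i=1..d-1. (real d - real i) * w i / s_fun d 0 w * h i)" for h
  proof -
    have "av P (\<lambda>y. of_bool (A y) * h (dg d P y)) = av P (\<lambda>y. of_bool (1 \<le> dg d P y) * h (dg d P y))"
      by (rule av_cong) (simp add: A)
    also have "\<dots> = (\<Sum>i=0..d-1. (real d - real i) * w i * (of_bool (1 \<le> i) * h i)) / s_fun d 0 w"
      using avd[of "\<lambda>i. of_bool (1 \<le> i) * h i"] d by simp
    also have "(\<Sum>i=0..d-1. (real d - real i) * w i * (of_bool (1 \<le> i) * h i)) = (\<Sum>i=1..d-1. (real d - real i) * w i * h i)"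
      by (rule sum.mono_neutral_cong_right) auto
    finally show ?thesis by (simp add: sum_divide_distrib)
  qed
  have r: "r = rho d w"
    using avA[of "\<lambda>_. 1"] by (simp add: r_def rho_def s_fun_def sum_divide_distrib)
  have k1: "k1 = (\<Sum>m=1..d-1. (real d - real m) * w m / s_fun d 0 w * (- of_bool (j = m) + (real d - real m - 1) * (phi d 0 j w / s_fun d 0 w)))"
    unfolding k1_def \<kappa>_def using avA[of "\<lambda>i. - of_bool (j = i) + (real d - real i - 1) * e0"] by (simp add: e0)
  have split: "s_fun d 0 w = real d * w 0 + s_fun d 1 w"
    unfolding s_fun_def by (subst sum.atLeast_Suc_atMost) auto
  have "av P (\<lambda>y. of_bool (\<not> A y)) = av P (\<lambda>y. 1 + (-1) * of_bool (A y))"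
    by (rule av_cong) auto
  also have "\<dots> = 1 - r"
    unfolding av_add av_cmult av_const[OF cP] r_def by simp
  also have "\<dots> = (s_fun d 0 w - s_fun d 1 w) / s_fun d 0 w"
    using s0 by (simp add: r rho_def diff_divide_distrib)
  also have "s_fun d 0 w - s_fun d 1 w = real d * w 0" using split by simp
  finally have F: "av P (\<lambda>y. of_bool (\<not> A y)) = real d * w 0 / s_fun d 0 w" .
  have lr: "length (rest d P y) = d - dg d P y - 1" if "y \<in> P" for y
    using length_rest[OF P(1) that] cnt_le[OF P(1), of "fst y"] by (simp add: dg_def)
  have lrr: "real (length (rest d P y)) = real d - real (dg d P y) - 1" if "y \<in> P" for y
    using length_rest[OF P(1) that] cnt_le[OF P(1), of "fst y"] cnt_pos[OF fin that] by (simp add: dg_def of_nat_diff)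
  obtain l where l: "d = l + 3" using d by (metis add.commute le_Suc_ex)
  have lf: "length (rest d P y) = l + 2" if "y \<in> P" "\<not> A y" for y
    using length_rest[OF P(1) that(1)] that l by (simp add: A_def isf_def)
  have u0: "(u, 0) \<in> P" "\<not> A (u, 0)" using cnt_full[OF P(1) u, of 0] d u by (simp_all add: A_def isf_def)
  \<comment> \<open>The dummy point \<open>(0,0)\<close> replaces \<open>y\<close>: in
    \<open>leaf2\<close> it affects only the chosen set and not the change of the counts, so one
    function \<open>G\<close> serves all untouched partners.\<close>
  define G where "G ys us = iv (if \<exists>p\<in>set ys. isf d P p then Ret (leaf2 d P u (0,0) ys us)
       else if \<exists>p\<in>set us. isf d P p
       then asks (rest d P (hd (filter (isf d P) us)))
              (\<lambda>ws. Ret (leaf3 d P u (hd (filter (isf d P) us)) ys us ws))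
       else asks (rest d P (hd ys)) (\<lambda>as. asks (rest d P (hd us)) (\<lambda>bs. Ret (leaf4 d P ys us as bs))))
      P (\<lambda>(D, c, \<delta>). \<delta> j)" for ys us
  have G: "G ys us = (if \<exists>y\<in>set ys. \<not> A y then - 2 * of_bool (j = 0) + (\<Sum>y\<leftarrow>ys. ej d P j y) + (\<Sum>y\<leftarrow>us. ej d P j y)
      else if \<exists>y\<in>set us. \<not> A y then - 2 * of_bool (j = 0) - of_bool (j = 1) + (\<Sum>y\<leftarrow>ys. ej d P j y) + (\<Sum>y\<leftarrow>us. ej d P j y) + real (l + 2) * e0
      else - 2 * of_bool (j = 0) + (\<Sum>y\<leftarrow>tl ys. ej d P j y) + (\<Sum>y\<leftarrow>tl us. ej d P j y) + \<kappa> (hd ys) + \<kappa> (hd us))"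
    if "length ys = l + 2" "length us = l + 2" "set ys \<subseteq> P" "set us \<subseteq> P" for ys us
  proof -
    consider (B) "\<exists>p\<in>set ys. isf d P p" | (C) "\<not> (\<exists>p\<in>set ys. isf d P p)" "\<exists>p\<in>set us. isf d P p"
            | (D) "\<not> (\<exists>p\<in>set ys. isf d P p)" "\<not> (\<exists>p\<in>set us. isf d P p)" by blast
    then show ?thesis
    proof cases
      case B
      then show ?thesis by (simp add: G_def leaf2_def A_def Ssum_def)
    next
      case C
      define v where "v = hd (filter (isf d P) us)"
      have "filter (isf d P) us \<noteq> []" using C(2) by (auto simp: filter_empty_conv)
      then have "v \<in> set (filter (isf d P) us)" unfolding v_def by (rule hd_in_set)
      then have v: "v \<in> P" "\<not> A v" using that by (auto simp: A_def)
      show ?thesis using C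
        by (simp add: G_def iv_asks leaf3_def A_def v_def[symmetric] lf[OF v] Ssum_average[OF cP])
          (simp add: Ssum_def e0_def)
    next
      case D
      have ne: "ys \<noteq> []" "us \<noteq> []" using that by auto
      then have ab: "hd ys \<in> P" "hd us \<in> P" using that by (metis hd_in_set subsetD)+
      have "G ys us = lav P (length (rest d P (hd ys))) (\<lambda>as. lav P (length (rest d P (hd us)))
         (\<lambda>bs. (- 2 * of_bool (j = 0) + Ssum d P j (tl ys) + Ssum d P j (tl us)
          - of_bool (j = dg d P (hd ys)) - of_bool (j = dg d P (hd us)) + Ssum d P j as) + Ssum d P j bs))"
        using D by (simp add: G_def iv_asks leaf4_def)
      also have "\<dots> = lav P (length (rest d P (hd ys))) (\<lambda>as. (- 2 * of_bool (j = 0) + Ssum d P j (tl ys) + Ssum d P j (tl us)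
          - of_bool (j = dg d P (hd ys)) - of_bool (j = dg d P (hd us)) + real (length (rest d P (hd us))) * e0) + Ssum d P j as)"
        by (rule lav_cong, subst Ssum_average[OF cP]) (simp add: e0_def)
      also have "\<dots> = - 2 * of_bool (j = 0) + Ssum d P j (tl ys) + Ssum d P j (tl us)
          - of_bool (j = dg d P (hd ys)) - of_bool (j = dg d P (hd us)) + real (length (rest d P (hd us))) * e0 + real (length (rest d P (hd ys))) * e0"
        by (subst Ssum_average[OF cP]) (simp add: e0_def)
      finally show ?thesis using D
        unfolding lrr[OF ab(1)] lrr[OF ab(2)] by (simp add: A_def Ssum_def \<kappa>_def)
    qed
  qed
  define FC where "FC = lav P (l + 2) (\<lambda>ys. lav P (l + 2) (G ys))"
  define F1 where "F1 = (1 - r ^ (l + 2)) * (- 2 * of_bool (j = 0) + real (l + 2) * e0) + real (l + 2) * (e0 - r ^ (l + 1) * e1)"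
  define F2 where "F2 = r ^ (l + 2) * (1 - r ^ (l + 2)) * (- 2 * of_bool (j = 0) - of_bool (j = 1) + real (l + 2) * e0)
        + real (l + 2) * r ^ (l + 1) * (1 - r ^ (l + 2)) * e1
        + real (l + 2) * r ^ (l + 2) * (e0 - r ^ (l + 1) * e1)"
  define F3 where "F3 = - 2 * of_bool (j = 0) * r ^ (2 * l + 4) + 2 * real (l + 1) * r ^ (2 * l + 3) * e1 + 2 * r ^ (2 * l + 3) * k1"
  have FC: "FC = F1 + F2 + F3"
    unfolding FC_def F1_def F2_def F3_def r_def e0_def e1_def k1_def
    by (rule full_pair_average[OF cP G[unfolded e0_def]])
  define M where "M i = - of_bool (j = 0) + of_bool (j = 1) - of_bool (j = i) + (real d - real i - 1) * e0" for i
  have "iv (step d P u) P (\<lambda>(D, c, \<delta>). \<delta> j) = av P (\<lambda>y. of_bool (A y) * M (dg d P y) + of_bool (\<not> A y) * FC)"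
    unfolding step_def iv.simps av_def[symmetric]
  proof (rule av_cong)
    fix y assume y: "y \<in> P"
    show "iv (if \<not> isf d P y then asks (rest d P y) (\<lambda>zs. Ret (leaf1 d P y zs))
     else asks (rest d P y) (\<lambda>ys. asks (rest d P (u, 0)) (\<lambda>us.
       if \<exists>p\<in>set ys. isf d P p then Ret (leaf2 d P u y ys us)
       else if \<exists>p\<in>set us. isf d P p
       then asks (rest d P (hd (filter (isf d P) us)))
              (\<lambda>ws. Ret (leaf3 d P u (hd (filter (isf d P) us)) ys us ws))
       else asks (rest d P (hd ys)) (\<lambda>as. asks (rest d P (hd us)) (\<lambda>bs. Ret (leaf4 d P ys us as bs))))))
       P (\<lambda>(D, c, \<delta>). \<delta> j) = of_bool (A y) * M (dg d P y) + of_bool (\<not> A y) * FC"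
    proof (cases "A y")
      case True
      then show ?thesis
        by (simp add: A_def iv_asks leaf1_def Ssum_average[OF cP] M_def lrr[OF y] e0_def)
    next
      case False
      have "iv (if \<exists>p\<in>set ys. isf d P p then Ret (leaf2 d P u y ys us)
       else if \<exists>p\<in>set us. isf d P p
       then asks (rest d P (hd (filter (isf d P) us)))
              (\<lambda>ws. Ret (leaf3 d P u (hd (filter (isf d P) us)) ys us ws))
       else asks (rest d P (hd ys)) (\<lambda>as. asks (rest d P (hd us)) (\<lambda>bs. Ret (leaf4 d P ys us as bs))))
       P (\<lambda>(D, c, \<delta>). \<delta> j) = G ys us" for ys us
        unfolding G_def by (auto simp: leaf2_def)
      then show ?thesis
        using False lf[OF y False] lf[OF u0] by (simp add: A_def iv_asks FC_def)
    qed
  qed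
  also have "\<dots> = (\<Sum>i=1..d-1. (real d - real i) * w i / s_fun d 0 w * M i) + real d * w 0 / s_fun d 0 w * FC"
    unfolding av_add av_cmult_right avA F ..
  finally have main: "iv (step d P u) P (\<lambda>(D, c, \<delta>). \<delta> j)
     = (\<Sum>i=1..d-1. (real d - real i) * w i / s_fun d 0 w * M i) + real d * w 0 / s_fun d 0 w * FC" .
  have ld: "d - 1 = l + 2" "d - 2 = l + 1" "2 * d - 2 = 2 * l + 4" "2 * d - 3 = 2 * l + 3"
    "real (l + 2) = real d - 1" "real (l + 1) = real d - 2" using l by auto
  have f: "f_fun d j w = (\<Sum>i=1..d-1. (real d - real i) * w i / s_fun d 0 w * M i)
      + real d * w 0 / s_fun d 0 w * F1 + real d * w 0 / s_fun d 0 w * F2 + real d * w 0 / s_fun d 0 w * F3"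
    unfolding f_fun_def Let_def M_def F1_def F2_def F3_def k1 r[symmetric] e0[symmetric] e1[symmetric] ld ..
  show "iv (step d P u) P (\<lambda>(D, c, \<delta>). \<delta> j) = f_fun d j w"
    unfolding main f FC by (simp only: distrib_left add.assoc)
  have "iv (step d P u) P (\<lambda>(D, c, \<delta>). c) = av P (\<lambda>y. of_bool (A y) * 1 + of_bool (\<not> A y) * 2)"
    unfolding step_def iv.simps av_def[symmetric]
    by (rule av_cong) (simp add: A_def iv_asks leaf1_def leaf2_def leaf3_def leaf4_def if_distrib[of "\<lambda>t. iv t P _"] lav_const[OF cP] cong: if_cong)
  also have "\<dots> = f_last d w"
    unfolding av_add av_cmult_right F r_def[symmetric] r by (simp add: f_last_def rho_def)
  finally show "iv (step d P u) P (\<lambda>(D, c, \<delta>). c) = f_last d w" .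
qed

section \<open>Concentration around the solution\<close>

text \<open>For negative \<open>x\<close> the product
  \<open>(1 - x) * (1 + x + x^2) = 1 - x^3\<close> is at least 1, and
  \<open>1 - x <= exp (- x)\<close>. Only an upper bound on \<open>x\<close> is assumed, which suits
  \<open>\<theta> * X\<close> below.\<close>

lemma exp_le_quadratic:
  fixes x :: real
  assumes "x \<le> 1"
  shows "exp x \<le> 1 + x + x\<^sup>2"
proof (cases "0 \<le> x")
  case True
  then show ?thesis using exp_bound assms by blast
next
  case False
  have "1 \<le> (1 - x) * (1 + x + x\<^sup>2)"
  proof -
    have "(1 - x) * (1 + x + x\<^sup>2) = 1 - x * x\<^sup>2" by (simp add: algebra_simps power2_eq_square)
    moreover have "x * x\<^sup>2 \<le> 0" using False by (simp add: mult_nonpos_nonneg)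
    ultimately show ?thesis by simp
  qed
  also have "\<dots> \<le> exp (- x) * (1 + x + x\<^sup>2)"
  proof (rule mult_right_mono)
    show "1 - x \<le> exp (- x)" using exp_ge_add_one_self[of "- x"] by simp
    have "1 + x + x\<^sup>2 = (x + 1/2)\<^sup>2 + 3/4" by (simp add: power2_eq_square algebra_simps)
    then show "0 \<le> 1 + x + x\<^sup>2" by simp
  qed
  finally have "exp x * 1 \<le> exp x * (exp (- x) * (1 + x + x\<^sup>2))" by (intro mult_left_mono) auto
  then show ?thesis by (simp add: mult.assoc[symmetric] exp_add[symmetric])
qed

lemma expect_add: "expect E S \<Longrightarrow> E (\<lambda>s. f s + g s) = E f + E g"
  and expect_cmult: "expect E S \<Longrightarrow> E (\<lambda>s. c * f s) = c * E f"
  and expect_mono: "expect E S \<Longrightarrow> (\<And>s. s \<in> S \<Longrightarrow> f s \<le> g s) \<Longrightarrow> E f \<le> E g"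
  by (auto simp: expect_def)

lemma expect_const: "expect E S \<Longrightarrow> E (\<lambda>s. c) = c"
  using expect_cmult[of E S c "\<lambda>_. 1"] by (simp add: expect_def)

lemma expect_sum:
  assumes "expect E S"
  shows "E (\<lambda>s. \<Sum>j\<in>J. f j s) = (\<Sum>j\<in>J. E (f j))"
  by (induction J rule: infinite_finite_induct)
    (simp_all add: expect_const[OF assms] expect_add[OF assms])

text \<open>Let \<open>X\<close> be the change of \<open>n\<close> times the squared distance. By
  Cauchy-Schwarz both its mean and its second moment are at most constants times
  \<open>G + 1 / n\<close>: the fluctuation shrinks with the distance. Since
  \<open>exp x <= 1 + x + x^2\<close>, the exponent grows from \<open>\<theta> * n * G\<close> only
  to \<open>\<theta> * (n + K) * G\<close>, up to \<open>\<theta> * C / n\<close>. A merely bounded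
  second moment would cost a constant factor in every step.\<close>

lemma lyapunov_step:
  fixes a :: "nat \<Rightarrow> real" and D :: "'s \<Rightarrow> nat \<Rightarrow> real" and A L n \<theta> :: real
  assumes E: "expect E S" and J: "finite J" and n: "1 \<le> n" and "0 \<le> A" "0 \<le> L"
    and D: "\<And>s j. s \<in> S \<Longrightarrow> j \<in> J \<Longrightarrow> \<bar>D s j\<bar> \<le> A"
    and ED: "\<And>j. j \<in> J \<Longrightarrow> \<bar>E (\<lambda>s. D s j)\<bar> \<le> L * ((\<Sum>j\<in>J. \<bar>a j\<bar>) + 1 / n)"
    and a: "(\<Sum>j\<in>J. (a j)\<^sup>2) \<le> 1"
    and \<theta>: "0 \<le> \<theta>" "\<theta> \<le> 1" "\<theta> * (2 * A * real (card J) + real (card J) * A\<^sup>2) \<le> 1"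
  defines "m \<equiv> real (card J)" and "G \<equiv> \<Sum>j\<in>J. (a j)\<^sup>2"
  defines "K \<equiv> 4 * L * m + 8 * A\<^sup>2 * m" and "C \<equiv> 2 * L + m * A\<^sup>2 + 2 * m\<^sup>2 * A ^ 4"
  shows "E (\<lambda>s. exp (\<theta> * (n * (\<Sum>j\<in>J. (a j + D s j / n)\<^sup>2)))) \<le> exp (\<theta> * ((n + K) * G) + \<theta> * C / n)"
proof -
  define U where "U = (\<Sum>j\<in>J. \<bar>a j\<bar>)"
  have U0: "0 \<le> U" by (simp add: U_def sum_nonneg)
  have m0: "0 \<le> m" by (simp add: m_def)
  have "U\<^sup>2 \<le> (\<Sum>j\<in>J. 1\<^sup>2) * (\<Sum>j\<in>J. \<bar>a j\<bar>\<^sup>2)"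
    using Cauchy_Schwarz_ineq_sum[of "\<lambda>_. 1" "\<lambda>j. \<bar>a j\<bar>" J] by (simp add: U_def)
  then have U2: "U\<^sup>2 \<le> m * G" by (simp add: m_def G_def)
  have Um: "U \<le> m"
  proof -
    have "\<bar>a j\<bar> \<le> 1" if "j \<in> J" for j
    proof -
      have "(a j)\<^sup>2 \<le> 1"
        using member_le_sum[of j J "\<lambda>j. (a j)\<^sup>2"] that J a by auto
      then show ?thesis by (simp add: abs_square_le_1)
    qed
    then show ?thesis using sum_bounded_above[of J "\<lambda>j. \<bar>a j\<bar>" 1] by (simp add: U_def m_def)
  qed
  define X where "X s = (\<Sum>j\<in>J. 2 * a j * D s j + (1 / n) * (D s j)\<^sup>2)" for s
  have nG: "n * (\<Sum>j\<in>J. (a j + D s j / n)\<^sup>2) = n * G + X s" for s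
    using n unfolding G_def X_def sum_distrib_left sum.distrib[symmetric]
    by (intro sum.cong refl) (simp add: power2_eq_square field_simps)
  have X1: "\<bar>X s\<bar> \<le> 2 * A * U + m * A\<^sup>2 / n" if s: "s \<in> S" for s
  proof -
    have "\<bar>2 * a j * D s j + (1 / n) * (D s j)\<^sup>2\<bar> \<le> 2 * A * \<bar>a j\<bar> + A\<^sup>2 / n" if j: "j \<in> J" for j
    proof -
      have "\<bar>2 * a j * D s j\<bar> \<le> 2 * A * \<bar>a j\<bar>"
        using mult_left_mono[OF D[OF s j], of "2 * \<bar>a j\<bar>"] by (simp add: abs_mult mult_ac)
      moreover have "\<bar>(1 / n) * (D s j)\<^sup>2\<bar> \<le> A\<^sup>2 / n"
        using D[OF s j] n \<open>0 \<le> A\<close> abs_le_square_iff[of "D s j" A]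
        by (simp add: abs_mult divide_right_mono)
      ultimately show ?thesis by linarith
    qed
    then have "\<bar>X s\<bar> \<le> (\<Sum>j\<in>J. 2 * A * \<bar>a j\<bar> + A\<^sup>2 / n)"
      unfolding X_def by (intro order_trans[OF sum_abs] sum_mono)
    then show ?thesis by (simp add: sum.distrib U_def m_def sum_distrib_left)
  qed
  have EX: "E X \<le> 4 * L * m * G + (2 * L + m * A\<^sup>2) / n"
  proof -
    have "E X = (\<Sum>j\<in>J. 2 * a j * E (\<lambda>s. D s j) + (1 / n) * E (\<lambda>s. (D s j)\<^sup>2))"
      unfolding X_def expect_sum[OF E] expect_add[OF E] expect_cmult[OF E] ..
    also have "\<dots> \<le> (\<Sum>j\<in>J. 2 * \<bar>a j\<bar> * (L * (U + 1 / n)) + (1 / n) * A\<^sup>2)"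
    proof (intro sum_mono add_mono mult_left_mono)
      fix j assume j: "j \<in> J"
      have "2 * a j * E (\<lambda>s. D s j) \<le> \<bar>2 * a j * E (\<lambda>s. D s j)\<bar>" by simp
      also have "\<dots> \<le> 2 * \<bar>a j\<bar> * (L * (U + 1 / n))"
        unfolding abs_mult using ED[OF j] by (intro mult_mono) (auto simp: U_def)
      finally show "2 * a j * E (\<lambda>s. D s j) \<le> 2 * \<bar>a j\<bar> * (L * (U + 1 / n))" .
      have "E (\<lambda>s. (D s j)\<^sup>2) \<le> E (\<lambda>s. A\<^sup>2)"
        using D[OF _ j] \<open>0 \<le> A\<close> abs_le_square_iff[of _ A] by (intro expect_mono[OF E]) auto
      then show "E (\<lambda>s. (D s j)\<^sup>2) \<le> A\<^sup>2" by (simp add: expect_const[OF E])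
    qed (use n in auto)
    also have "\<dots> = 2 * L * U\<^sup>2 + 2 * L * (U / n) + m * A\<^sup>2 / n"
    proof -
      have "(\<Sum>j\<in>J. 2 * \<bar>a j\<bar> * c) = 2 * U * c" for c
        by (simp add: U_def sum_distrib_left sum_distrib_right)
      then have "(\<Sum>j\<in>J. 2 * \<bar>a j\<bar> * (L * (U + 1 / n)) + (1 / n) * A\<^sup>2)
          = 2 * U * (L * (U + 1 / n)) + m * A\<^sup>2 / n"
        unfolding sum.distrib by (simp add: m_def)
      then show ?thesis by (simp add: power2_eq_square algebra_simps)
    qed
    \<comment> \<open>The mixed term is split, so that only multiples of \<open>U^2\<close>, hence
      of \<open>G\<close>, and of \<open>1 / n\<close> remain.\<close>
    also have "U / n \<le> 1 / n + U\<^sup>2"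
    proof -
      have "U \<le> 1 + U\<^sup>2"
        using zero_le_power2[of "U - 1/2"] by (simp add: power2_eq_square algebra_simps)
      then have "U / n \<le> (1 + U\<^sup>2) / n" using n by (intro divide_right_mono) auto
      also have "\<dots> \<le> 1 / n + U\<^sup>2"
      proof -
        have "U\<^sup>2 / n \<le> U\<^sup>2 / 1" using n by (intro divide_left_mono) auto
        then show ?thesis by (simp add: add_divide_distrib)
      qed
      finally show ?thesis .
    qed
    finally have "E X \<le> 2 * L * U\<^sup>2 + 2 * L * (1 / n + U\<^sup>2) + m * A\<^sup>2 / n"
      using \<open>0 \<le> L\<close> by (simp add: mult_left_mono)
    also have "\<dots> = 4 * L * U\<^sup>2 + (2 * L + m * A\<^sup>2) / n" by (simp add: algebra_simps add_divide_distrib)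
    also have "4 * L * U\<^sup>2 \<le> 4 * L * (m * G)" using U2 \<open>0 \<le> L\<close> by (intro mult_left_mono) auto
    finally show ?thesis by (simp add: mult.assoc)
  qed
  have X2: "(X s)\<^sup>2 \<le> 8 * A\<^sup>2 * m * G + 2 * m\<^sup>2 * A ^ 4 / n" if s: "s \<in> S" for s
  proof -
    let ?b = "m * A\<^sup>2 / n"
    have "(X s)\<^sup>2 \<le> (2 * A * U + ?b)\<^sup>2" using X1[OF s] abs_le_square_iff by (metis abs_ge_self order_trans)
    also have "\<dots> \<le> 2 * (2 * A * U)\<^sup>2 + 2 * ?b\<^sup>2"
    proof -
      have "(x + y)\<^sup>2 \<le> 2 * x\<^sup>2 + 2 * y\<^sup>2" for x y :: real
        using zero_le_power2[of "x - y"] by (simp add: power2_eq_square algebra_simps)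
      then show ?thesis .
    qed
    also have "2 * (2 * A * U)\<^sup>2 = 8 * A\<^sup>2 * U\<^sup>2" by (simp add: power_mult_distrib)
    also have "8 * A\<^sup>2 * U\<^sup>2 \<le> 8 * A\<^sup>2 * (m * G)" using U2 by (intro mult_left_mono) auto
    also have "2 * ?b\<^sup>2 = 2 * m\<^sup>2 * A ^ 4 / n\<^sup>2" by (simp add: power_divide power_mult_distrib power_mult[symmetric])
    also have "\<dots> \<le> 2 * m\<^sup>2 * A ^ 4 / n"
      using n self_le_power[of n 2] by (intro divide_left_mono) auto
    finally show ?thesis by (simp add: mult.assoc)
  qed
  have \<theta>X: "\<theta> * X s \<le> 1" if s: "s \<in> S" for s
  proof -
    have "m * A\<^sup>2 / n \<le> m * A\<^sup>2 / 1" using n m0 by (intro divide_left_mono) auto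
    then have "m * A\<^sup>2 / n \<le> m * A\<^sup>2" by simp
    moreover have "2 * A * U \<le> 2 * A * m" using Um \<open>0 \<le> A\<close> by (intro mult_left_mono) auto
    ultimately have "X s \<le> 2 * A * m + m * A\<^sup>2" using X1[OF s] by linarith
    then have "\<theta> * X s \<le> \<theta> * (2 * A * m + m * A\<^sup>2)" using \<theta>(1) by (rule mult_left_mono)
    then show ?thesis using \<theta>(3) by (simp add: m_def)
  qed
  let ?q = "8 * A\<^sup>2 * m * G + 2 * m\<^sup>2 * A ^ 4 / n"
  have "E (\<lambda>s. exp (\<theta> * X s)) \<le> E (\<lambda>s. (1 + \<theta> * ?q) + \<theta> * X s)"
  proof (rule expect_mono[OF E])
    fix s assume s: "s \<in> S"
    have "(\<theta> * X s)\<^sup>2 = \<theta> * (\<theta> * (X s)\<^sup>2)" by (simp add: power2_eq_square)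
    also have "\<dots> \<le> \<theta> * (1 * (X s)\<^sup>2)" using \<theta> by (intro mult_left_mono mult_right_mono) auto
    also have "\<dots> \<le> \<theta> * ?q" using X2[OF s] \<theta> by (intro mult_left_mono) auto
    finally show "exp (\<theta> * X s) \<le> (1 + \<theta> * ?q) + \<theta> * X s"
      using exp_le_quadratic[OF \<theta>X[OF s]] by linarith
  qed
  also have "\<dots> = 1 + \<theta> * (?q + E X)"
    unfolding expect_add[OF E] expect_cmult[OF E] expect_const[OF E] by (simp add: algebra_simps)
  also have "\<dots> \<le> 1 + \<theta> * (K * G + C / n)"
    using EX \<theta>(1) by (intro add_left_mono mult_left_mono) (auto simp: K_def C_def algebra_simps add_divide_distrib)
  also have "\<dots> \<le> exp (\<theta> * (K * G + C / n))" by (rule exp_ge_add_one_self)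
  finally have "exp (\<theta> * n * G) * E (\<lambda>s. exp (\<theta> * X s)) \<le> exp (\<theta> * n * G) * exp (\<theta> * (K * G + C / n))"
    by (intro mult_left_mono) auto
  moreover have "E (\<lambda>s. exp (\<theta> * (n * (\<Sum>j\<in>J. (a j + D s j / n)\<^sup>2)))) = exp (\<theta> * n * G) * E (\<lambda>s. exp (\<theta> * X s))"
    unfolding nG expect_cmult[OF E, symmetric] by (simp add: algebra_simps exp_add[symmetric])
  moreover have "exp (\<theta> * n * G) * exp (\<theta> * (K * G + C / n)) = exp (\<theta> * ((n + K) * G) + \<theta> * C / n)"
    unfolding exp_add[symmetric] by (simp add: algebra_simps)
  ultimately show ?thesis by simp
qed

text \<open>
  The rate \<open>\<theta>\<close> is divided by \<open>1 + K / n\<close> in every step, which absorbs the growth of the exponential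
  moment in \<open>lyapunov_step\<close>.
\<close>

lemma lyapunov:
  fixes a :: "nat \<Rightarrow> 's \<Rightarrow> nat \<Rightarrow> real" and W :: "nat \<Rightarrow> 's \<Rightarrow> real" and A L n X \<epsilon> :: real
  assumes J: "finite J" and n: "1 \<le> n" and AL: "0 \<le> A" "0 \<le> L" and \<epsilon>: "0 < \<epsilon>" "\<epsilon> \<le> 1"
    and step: "\<And>t s. t < N \<Longrightarrow> Inv s \<Longrightarrow> (\<Sum>j\<in>J. (a t s j)\<^sup>2) \<le> \<epsilon>\<^sup>2 \<Longrightarrow>
       \<exists>E S. expect E S \<and> W t s \<le> E (W (Suc t)) \<and>
         (\<forall>s'\<in>S. Inv s' \<and> (\<forall>j\<in>J. \<bar>n * (a (Suc t) s' j - a t s j)\<bar> \<le> A)) \<and>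
         (\<forall>j\<in>J. \<bar>E (\<lambda>s'. n * (a (Suc t) s' j - a t s j))\<bar> \<le> L * ((\<Sum>j\<in>J. \<bar>a t s j\<bar>) + 1 / n))"
    and final: "\<And>s. Inv s \<Longrightarrow> (\<Sum>j\<in>J. (a N s j)\<^sup>2) \<le> \<epsilon>\<^sup>2 \<Longrightarrow> W N s \<le> 0"
    and W: "\<And>t s. Inv s \<Longrightarrow> W t s \<le> 1"
    and init: "Inv s0" "(\<Sum>j\<in>J. (a 0 s0 j)\<^sup>2) = 0" and N: "real N \<le> X * n"
  defines "m \<equiv> real (card J)"
  defines "K \<equiv> 4 * L * m + 8 * A\<^sup>2 * m" and "C \<equiv> 2 * L + m * A\<^sup>2 + 2 * m\<^sup>2 * A ^ 4"
    and "\<theta>0 \<equiv> 1 / (1 + (2 * A * m + m * A\<^sup>2))"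
  shows "W 0 s0 \<le> exp (C * X - \<theta>0 * exp (- K * X) * \<epsilon>\<^sup>2 * n)"
proof -
  define \<theta> where "\<theta> t = \<theta>0 / (1 + K / n) ^ t" for t :: nat
  have m0: "0 \<le> m" by (simp add: m_def)
  have K0: "0 \<le> K" and C0: "0 \<le> C" using AL m0 by (simp_all add: K_def C_def)
  have d0: "0 \<le> 2 * A * m + m * A\<^sup>2" using AL m0 by simp
  have \<theta>0: "0 < \<theta>0" "\<theta>0 \<le> 1" "\<theta>0 * (2 * A * m + m * A\<^sup>2) \<le> 1"
    using d0 unfolding \<theta>0_def by (auto simp: field_simps)
  have b: "1 \<le> 1 + K / n" using K0 n by simp
  have \<theta>pos: "0 < \<theta> t" for t using \<theta>0(1) b unfolding \<theta>_def by (intro divide_pos_pos zero_less_power) linarith+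
  have \<theta>le: "\<theta> t \<le> \<theta>0" for t
    using one_le_power[OF b, of t] \<theta>0(1) unfolding \<theta>_def by (simp add: divide_le_eq mult_le_cancel_left1)
  have \<theta>dec: "\<theta> N \<le> \<theta> t" if "t \<le> N" for t
    using power_increasing[OF that b] \<theta>0(1) b unfolding \<theta>_def by (intro divide_left_mono mult_pos_pos zero_less_power) linarith+
  have \<theta>Suc: "\<theta> (Suc t) * (n + K) = \<theta> t * n" for t
  proof -
    have "n + K = n * (1 + K / n)" using n by (simp add: field_simps)
    moreover have "(1 + K / n) ^ t \<noteq> 0" "1 + K / n \<noteq> 0" using b by simp_all
    ultimately show ?thesis unfolding \<theta>_def by simp
  qed
  let ?G = "\<lambda>t s. \<Sum>j\<in>J. (a t s j)\<^sup>2"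
  let ?c = "\<theta> N * n * \<epsilon>\<^sup>2"
  \<comment> \<open>Backward induction from the last step. Outside the
    \<open>\<epsilon>\<close>-ball the exponent is nonnegative and \<open>W\<close> is at most 1, so
    the claim is trivial there. Hence the process needs no control once it has left the ball, and no
    stopping time is introduced.\<close>
  have claim: "Inv s \<Longrightarrow> W (N - k) s \<le> exp (\<theta> (N - k) * n * ?G (N - k) s + C * k / n - ?c)" if "k \<le> N" for k s
    using that
  proof (induction k arbitrary: s)
    case (0 s)
    show ?case
    proof (cases "?G N s \<le> \<epsilon>\<^sup>2")
      case True
      then show ?thesis using final[of s] 0 by (simp add: order_trans[OF _ exp_ge_zero])
    next
      case False
      then have "?c \<le> \<theta> N * n * ?G N s" using \<theta>pos[of N] n by (intro mult_left_mono) auto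
      then have "1 \<le> exp (\<theta> N * n * ?G N s - ?c)" by simp
      then have "W N s \<le> exp (\<theta> N * n * ?G N s - ?c)" using W[of s N] 0 by linarith
      then show ?thesis by simp
    qed
  next
    case (Suc k s)
    define t where "t = N - Suc k"
    have t: "t < N" "N - k = Suc t" using Suc.prems by (auto simp: t_def)
    show ?case
    proof (cases "?G t s \<le> \<epsilon>\<^sup>2")
      case True
      from step[OF t(1) Suc.prems(1) this] obtain E S where E: "expect E S" and WE: "W t s \<le> E (W (Suc t))"
        and S: "\<And>s'. s' \<in> S \<Longrightarrow> Inv s'" "\<And>s' j. s' \<in> S \<Longrightarrow> j \<in> J \<Longrightarrow> \<bar>n * (a (Suc t) s' j - a t s j)\<bar> \<le> A"
        and ED: "\<And>j. j \<in> J \<Longrightarrow> \<bar>E (\<lambda>s'. n * (a (Suc t) s' j - a t s j))\<bar> \<le> L * ((\<Sum>j\<in>J. \<bar>a t s j\<bar>) + 1 / n)"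
        by blast
      let ?\<theta> = "\<theta> (Suc t)" and ?D = "\<lambda>s' j. n * (a (Suc t) s' j - a t s j)"
      have G1: "?G t s \<le> 1" using True \<epsilon> by (smt (verit) power_le_one)
      have th: "0 \<le> ?\<theta>" "?\<theta> \<le> 1" "?\<theta> * (2 * A * m + m * A\<^sup>2) \<le> 1"
        using \<theta>pos[of "Suc t"] \<theta>le[of "Suc t"] \<theta>0 d0 mult_right_mono[OF \<theta>le[of "Suc t"] d0] by linarith+
      have "W t s \<le> E (\<lambda>s'. exp (C * k / n - ?c) * exp (?\<theta> * (n * (\<Sum>j\<in>J. (a t s j + ?D s' j / n)\<^sup>2))))"
      proof (rule order_trans[OF WE], rule expect_mono[OF E])
        fix s' assume "s' \<in> S"
        have "W (Suc t) s' \<le> exp (?\<theta> * n * ?G (Suc t) s' + C * k / n - ?c)"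
          using Suc.IH[of s'] S(1)[OF \<open>s' \<in> S\<close>] Suc.prems t by simp
        also have "?G (Suc t) s' = (\<Sum>j\<in>J. (a t s j + ?D s' j / n)\<^sup>2)"
          using n by simp
        finally show "W (Suc t) s' \<le> exp (C * k / n - ?c) * exp (?\<theta> * (n * (\<Sum>j\<in>J. (a t s j + ?D s' j / n)\<^sup>2)))"
          unfolding exp_add[symmetric] by (simp add: algebra_simps)
      qed
      also have "\<dots> = exp (C * k / n - ?c) * E (\<lambda>s'. exp (?\<theta> * (n * (\<Sum>j\<in>J. (a t s j + ?D s' j / n)\<^sup>2))))"
        by (rule expect_cmult[OF E])
      also have "\<dots> \<le> exp (C * k / n - ?c) * exp (?\<theta> * ((n + K) * ?G t s) + ?\<theta> * C / n)"
      proof (rule mult_left_mono)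
        show "E (\<lambda>s'. exp (?\<theta> * (n * (\<Sum>j\<in>J. (a t s j + ?D s' j / n)\<^sup>2))))
            \<le> exp (?\<theta> * ((n + K) * ?G t s) + ?\<theta> * C / n)"
          unfolding K_def C_def m_def
          by (rule lyapunov_step[where D = ?D and a = "a t s", OF E J n AL S(2) ED G1 th(1,2) th(3)[unfolded m_def]])
      qed simp
      also have "\<dots> \<le> exp (C * k / n - ?c) * exp (\<theta> t * n * ?G t s + C / n)"
      proof -
        have "?\<theta> * ((n + K) * ?G t s) = \<theta> t * n * ?G t s" using \<theta>Suc[of t] by (metis mult.assoc)
        moreover have "?\<theta> * C / n \<le> C / n" using mult_right_mono[OF th(2) C0] n by (intro divide_right_mono) auto
        ultimately have "?\<theta> * ((n + K) * ?G t s) + ?\<theta> * C / n \<le> \<theta> t * n * ?G t s + C / n"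
          by linarith
        then show ?thesis by (intro mult_left_mono) (simp_all only: exp_le_cancel_iff exp_ge_zero)
      qed
      also have "\<dots> = exp (\<theta> t * n * ?G t s + C * real (Suc k) / n - ?c)"
        unfolding exp_add[symmetric] by (simp add: algebra_simps add_divide_distrib)
      finally show ?thesis by (simp add: t_def)
    next
      case False
      then have "\<theta> N * (n * \<epsilon>\<^sup>2) \<le> \<theta> t * (n * ?G t s)" using \<theta>pos[of t] \<theta>dec[of t] t n by (intro mult_mono) auto
      moreover have "0 \<le> C * real (Suc k) / n" using C0 n by (simp add: mult_nonneg_nonneg)
      ultimately have "0 \<le> \<theta> t * n * ?G t s + C * real (Suc k) / n - ?c" by (simp add: mult.assoc)
      then have "1 \<le> exp (\<theta> t * n * ?G t s + C * real (Suc k) / n - ?c)" by simp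
      then show ?thesis using W[OF Suc.prems(1), of t] unfolding t_def by linarith
    qed
  qed
  have "W 0 s0 \<le> exp (C * N / n - ?c)" using claim[of N s0] init by simp
  also have "\<dots> \<le> exp (C * X - \<theta>0 * exp (- K * X) * \<epsilon>\<^sup>2 * n)"
  proof -
    have N': "real N / n \<le> X" using N n by (simp add: field_simps)
    have "C * N / n \<le> C * X" using mult_left_mono[OF N' C0] by simp
    \<comment> \<open>At most \<open>X * n\<close> steps divide the rate by at most
      \<open>exp (K * X)\<close> altogether, so a positive rate independent of \<open>n\<close>
      survives.\<close>
    moreover have "\<theta>0 * exp (- K * X) \<le> \<theta> N"
    proof -
      have "(1 + K / n) ^ N \<le> exp (K / n) ^ N" using b exp_ge_add_one_self[of "K / n"] by (intro power_mono) auto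
      also have "\<dots> = exp (K * (N / n))" by (simp add: exp_of_nat_mult[symmetric] mult.commute)
      also have "\<dots> \<le> exp (K * X)" using mult_left_mono[OF N' K0] by simp
      finally have le: "(1 + K / n) ^ N \<le> exp (K * X)" .
      have "0 < (1 + K / n) ^ N" using b by (intro zero_less_power) linarith
      from divide_left_mono[OF le less_imp_le[OF \<theta>0(1)] mult_pos_pos[OF exp_gt_zero this]]
      have "\<theta>0 / exp (K * X) \<le> \<theta> N" unfolding \<theta>_def .
      then show ?thesis by (simp add: exp_minus divide_inverse)
    qed
    then have "\<theta>0 * exp (- K * X) * (\<epsilon>\<^sup>2 * n) \<le> \<theta> N * (\<epsilon>\<^sup>2 * n)" using n by (intro mult_right_mono) auto
    ultimately show ?thesis by (simp add: mult_ac)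
  qed
  finally show ?thesis .
qed

section \<open>Bounded Lipschitz functions\<close>

text \<open>Boundedness is part of the notion to make it closed under products. The distance looks
  at the first \<open>d\<close> coordinates only.\<close>

definition bounded_lipschitz :: "nat \<Rightarrow> (nat \<Rightarrow> real) set \<Rightarrow> ((nat \<Rightarrow> real) \<Rightarrow> real) \<Rightarrow> bool" where
  "bounded_lipschitz d S f \<longleftrightarrow> (\<exists>B L. 0 \<le> B \<and> 0 \<le> L \<and> (\<forall>w\<in>S. \<bar>f w\<bar> \<le> B) \<and>
     (\<forall>w\<in>S. \<forall>w'\<in>S. \<bar>f w - f w'\<bar> \<le> L * (\<Sum>i<d. \<bar>w i - w' i\<bar>)))"

lemma bounded_lipschitzI:
  assumes "0 \<le> B" "0 \<le> L" "\<And>w. w \<in> S \<Longrightarrow> \<bar>f w\<bar> \<le> B"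
    "\<And>w w'. w \<in> S \<Longrightarrow> w' \<in> S \<Longrightarrow> \<bar>f w - f w'\<bar> \<le> L * (\<Sum>i<d. \<bar>w i - w' i\<bar>)"
  shows "bounded_lipschitz d S f"
  using assms unfolding bounded_lipschitz_def by blast

lemma bounded_lipschitzE:
  assumes "bounded_lipschitz d S f"
  obtains B L where "0 \<le> B" "0 \<le> L" "\<And>w. w \<in> S \<Longrightarrow> \<bar>f w\<bar> \<le> B"
    "\<And>w w'. w \<in> S \<Longrightarrow> w' \<in> S \<Longrightarrow> \<bar>f w - f w'\<bar> \<le> L * (\<Sum>i<d. \<bar>w i - w' i\<bar>)"
  using assms unfolding bounded_lipschitz_def by blast

lemma bounded_lipschitz_const: "bounded_lipschitz d S (\<lambda>w. c)"
  by (rule bounded_lipschitzI[of "\<bar>c\<bar>" 0]) auto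

lemma bounded_lipschitz_coord:
  assumes "i < d" "\<And>w. w \<in> S \<Longrightarrow> \<bar>w i\<bar> \<le> B" shows "bounded_lipschitz d S (\<lambda>w. w i)"
proof (rule bounded_lipschitzI[of "\<bar>B\<bar>" 1])
  fix w w' :: "nat \<Rightarrow> real"
  show "\<bar>w i - w' i\<bar> \<le> 1 * (\<Sum>i<d. \<bar>w i - w' i\<bar>)"
    using member_le_sum[of i "{..<d}" "\<lambda>i. \<bar>w i - w' i\<bar>"] assms by auto
qed (use assms in force)+

lemma bounded_lipschitz_add:
  assumes "bounded_lipschitz d S f" "bounded_lipschitz d S g" shows "bounded_lipschitz d S (\<lambda>w. f w + g w)"
proof -
  obtain B L where f: "0 \<le> B" "0 \<le> L" "\<And>w. w \<in> S \<Longrightarrow> \<bar>f w\<bar> \<le> B"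
    "\<And>w w'. w \<in> S \<Longrightarrow> w' \<in> S \<Longrightarrow> \<bar>f w - f w'\<bar> \<le> L * (\<Sum>i<d. \<bar>w i - w' i\<bar>)"
    using bounded_lipschitzE[OF assms(1)] by blast
  obtain B' L' where g: "0 \<le> B'" "0 \<le> L'" "\<And>w. w \<in> S \<Longrightarrow> \<bar>g w\<bar> \<le> B'"
    "\<And>w w'. w \<in> S \<Longrightarrow> w' \<in> S \<Longrightarrow> \<bar>g w - g w'\<bar> \<le> L' * (\<Sum>i<d. \<bar>w i - w' i\<bar>)"
    using bounded_lipschitzE[OF assms(2)] by blast
  show ?thesis
  proof (rule bounded_lipschitzI[of "B + B'" "L + L'"])
    show "\<bar>f w + g w\<bar> \<le> B + B'" if "w \<in> S" for w
      using f(3)[OF that] g(3)[OF that] by linarith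
    show "\<bar>f w + g w - (f w' + g w')\<bar> \<le> (L + L') * (\<Sum>i<d. \<bar>w i - w' i\<bar>)" if "w \<in> S" "w' \<in> S" for w w'
      using f(4)[OF that] g(4)[OF that] unfolding distrib_right by linarith
  qed (use f g in auto)
qed

lemma bounded_lipschitz_mult:
  assumes "bounded_lipschitz d S f" "bounded_lipschitz d S g" shows "bounded_lipschitz d S (\<lambda>w. f w * g w)"
proof -
  obtain B L where f: "0 \<le> B" "0 \<le> L" "\<And>w. w \<in> S \<Longrightarrow> \<bar>f w\<bar> \<le> B"
    "\<And>w w'. w \<in> S \<Longrightarrow> w' \<in> S \<Longrightarrow> \<bar>f w - f w'\<bar> \<le> L * (\<Sum>i<d. \<bar>w i - w' i\<bar>)"
    using bounded_lipschitzE[OF assms(1)] by blast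
  obtain B' L' where g: "0 \<le> B'" "0 \<le> L'" "\<And>w. w \<in> S \<Longrightarrow> \<bar>g w\<bar> \<le> B'"
    "\<And>w w'. w \<in> S \<Longrightarrow> w' \<in> S \<Longrightarrow> \<bar>g w - g w'\<bar> \<le> L' * (\<Sum>i<d. \<bar>w i - w' i\<bar>)"
    using bounded_lipschitzE[OF assms(2)] by blast
  show ?thesis
  proof (rule bounded_lipschitzI[of "B * B'" "B * L' + B' * L"])
    show "\<bar>f w * g w\<bar> \<le> B * B'" if "w \<in> S" for w
      using f(3)[OF that] g(3)[OF that] f(1) unfolding abs_mult by (intro mult_mono) auto
    show "\<bar>f w * g w - f w' * g w'\<bar> \<le> (B * L' + B' * L) * (\<Sum>i<d. \<bar>w i - w' i\<bar>)" (is "_ \<le> _ * ?D")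
      if w: "w \<in> S" "w' \<in> S" for w w'
    proof -
      have "\<bar>f w\<bar> * \<bar>g w - g w'\<bar> \<le> B * (L' * ?D)" using f(3)[OF w(1)] g(4)[OF w] f(1) by (intro mult_mono) auto
      moreover have "\<bar>g w'\<bar> * \<bar>f w - f w'\<bar> \<le> B' * (L * ?D)" using g(3)[OF w(2)] f(4)[OF w] g(1) by (intro mult_mono) auto
      moreover have "f w * g w - f w' * g w' = f w * (g w - g w') + g w' * (f w - f w')" by (simp add: algebra_simps)
      then have "\<bar>f w * g w - f w' * g w'\<bar> \<le> \<bar>f w\<bar> * \<bar>g w - g w'\<bar> + \<bar>g w'\<bar> * \<bar>f w - f w'\<bar>"
        using abs_triangle_ineq[of "f w * (g w - g w')" "g w' * (f w - f w')"] by (simp only: abs_mult)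
      ultimately show ?thesis by (simp only: distrib_right mult.assoc)
    qed
  qed (use f g in auto)
qed

lemma bounded_lipschitz_minus: "bounded_lipschitz d S f \<Longrightarrow> bounded_lipschitz d S (\<lambda>w. - f w)"
  using bounded_lipschitz_mult[OF bounded_lipschitz_const[of d S "- 1"]] by simp

lemma bounded_lipschitz_diff: "bounded_lipschitz d S f \<Longrightarrow> bounded_lipschitz d S g \<Longrightarrow> bounded_lipschitz d S (\<lambda>w. f w - g w)"
  using bounded_lipschitz_add[OF _ bounded_lipschitz_minus] by fastforce

lemma bounded_lipschitz_power: "bounded_lipschitz d S f \<Longrightarrow> bounded_lipschitz d S (\<lambda>w. f w ^ n)"
  by (induction n) (auto intro: bounded_lipschitz_const bounded_lipschitz_mult)

lemma bounded_lipschitz_sum: "(\<And>i. i \<in> I \<Longrightarrow> bounded_lipschitz d S (f i)) \<Longrightarrow> bounded_lipschitz d S (\<lambda>w. \<Sum>i\<in>I. f i w)"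
  by (induction I rule: infinite_finite_induct) (auto intro: bounded_lipschitz_const bounded_lipschitz_add)

lemma bounded_lipschitz_inverse:
  assumes "bounded_lipschitz d S g" "0 < \<eta>" "\<And>w. w \<in> S \<Longrightarrow> \<eta> \<le> g w" shows "bounded_lipschitz d S (\<lambda>w. inverse (g w))"
proof -
  obtain B' L' where g: "0 \<le> B'" "0 \<le> L'" "\<And>w. w \<in> S \<Longrightarrow> \<bar>g w\<bar> \<le> B'"
    "\<And>w w'. w \<in> S \<Longrightarrow> w' \<in> S \<Longrightarrow> \<bar>g w - g w'\<bar> \<le> L' * (\<Sum>i<d. \<bar>w i - w' i\<bar>)"
    using bounded_lipschitzE[OF assms(1)] by blast
  show ?thesis
  proof (rule bounded_lipschitzI[of "inverse \<eta>" "inverse \<eta> * L' * inverse \<eta>"])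
    have pos: "0 < g w" if "w \<in> S" for w using assms(2) assms(3)[OF that] by linarith
    have inv: "inverse (g w) \<le> inverse \<eta>" if "w \<in> S" for w using assms(2) assms(3)[OF that] by (intro le_imp_inverse_le)
    show "\<bar>inverse (g w)\<bar> \<le> inverse \<eta>" if "w \<in> S" for w
      using inv[OF that] pos[OF that] by simp
    show "\<bar>inverse (g w) - inverse (g w')\<bar> \<le> inverse \<eta> * L' * inverse \<eta> * (\<Sum>i<d. \<bar>w i - w' i\<bar>)" (is "_ \<le> _ * ?D")
      if w: "w \<in> S" "w' \<in> S" for w w'
    proof -
      have "\<bar>inverse (g w) - inverse (g w')\<bar> = inverse (g w) * \<bar>g w - g w'\<bar> * inverse (g w')"
        using pos[OF w(1)] pos[OF w(2)] inverse_diff_inverse[of "g w" "g w'"] by (simp add: abs_mult)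
      also have "\<dots> \<le> inverse \<eta> * (L' * ?D) * inverse \<eta>"
        using inv[OF w(1)] inv[OF w(2)] g(4)[OF w] pos[OF w(1)] pos[OF w(2)] assms(2) g(2)
        by (intro mult_mono mult_nonneg_nonneg sum_nonneg) auto
      finally show ?thesis by (simp add: mult_ac)
    qed
  qed (use assms(2) g in auto)
qed

lemma bounded_lipschitz_divide:
  assumes "bounded_lipschitz d S f" "bounded_lipschitz d S g" "0 < \<eta>" "\<And>w. w \<in> S \<Longrightarrow> \<eta> \<le> g w" shows "bounded_lipschitz d S (\<lambda>w. f w / g w)"
  unfolding divide_inverse by (intro bounded_lipschitz_mult assms bounded_lipschitz_inverse[OF assms(2-4)])

text \<open>On this set the denominators of \<open>f_fun\<close> and \<open>f_last\<close> are at
  least \<open>\<eta>\<close> and the coordinates are bounded, so the right-hand sides are bounded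
  and Lipschitz there.\<close>

definition dom :: "nat \<Rightarrow> real \<Rightarrow> real \<Rightarrow> (nat \<Rightarrow> real) set" where
  "dom d \<eta> B = {w. \<eta> \<le> s_fun d 0 w \<and> (\<forall>i<d. \<bar>w i\<bar> \<le> B)}"

lemma bounded_lipschitz_s_fun: "0 < d \<Longrightarrow> bounded_lipschitz d (dom d \<eta> B) (s_fun d k)"
  unfolding s_fun_def by (intro bounded_lipschitz_sum bounded_lipschitz_mult bounded_lipschitz_const bounded_lipschitz_coord[of _ _ _ B]) (auto simp: dom_def)

lemma bounded_lipschitz_phi:
  assumes "0 < d" "j < d"
  shows "bounded_lipschitz d (dom d \<eta> B) (phi d k j)"
proof -
  have c: "bounded_lipschitz d (dom d \<eta> B) (\<lambda>w. w j)" "bounded_lipschitz d (dom d \<eta> B) (\<lambda>w. w (j - 1))"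
    using assms by (intro bounded_lipschitz_coord[of _ _ _ B]; auto simp: dom_def)+
  consider "j > k" | "j = k" | "j < k" by linarith
  then show ?thesis
  proof cases
    case 1
    then have "phi d k j = (\<lambda>w. (real d - real j + 1) * w (j - 1) - (real d - real j) * w j)"
      by (simp add: phi_def fun_eq_iff)
    then show ?thesis by (simp only:) (intro bounded_lipschitz_diff bounded_lipschitz_mult bounded_lipschitz_const c)
  next
    case 2
    then have "phi d k j = (\<lambda>w. - (real d - real j) * w j)" by (simp add: phi_def fun_eq_iff)
    then show ?thesis by (simp only:) (intro bounded_lipschitz_mult bounded_lipschitz_const c)
  next
    case 3
    then have "phi d k j = (\<lambda>w. 0)" by (simp add: phi_def fun_eq_iff)
    then show ?thesis by (simp only:) (intro bounded_lipschitz_const)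
  qed
qed

lemma bounded_lipschitz_f:
  assumes "0 < d" "0 < \<eta>"
  shows "j < d \<Longrightarrow> bounded_lipschitz d (dom d \<eta> B) (f_fun d j)" and "bounded_lipschitz d (dom d \<eta> B) (f_last d)"
proof -
  have dv: "bounded_lipschitz d (dom d \<eta> B) (\<lambda>w. f w / s_fun d 0 w)" if "bounded_lipschitz d (dom d \<eta> B) f" for f
    by (rule bounded_lipschitz_divide[OF that bounded_lipschitz_s_fun assms(2)]) (use assms in \<open>auto simp: dom_def\<close>)
  have c: "bounded_lipschitz d (dom d \<eta> B) (\<lambda>w. w i)" if "i < d" for i
    using that by (intro bounded_lipschitz_coord[of _ _ _ B]) (auto simp: dom_def)
  have r: "bounded_lipschitz d (dom d \<eta> B) (rho d)"
    unfolding rho_def by (intro dv bounded_lipschitz_s_fun assms)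
  show "bounded_lipschitz d (dom d \<eta> B) (f_last d)"
    unfolding f_last_def by (intro bounded_lipschitz_add dv bounded_lipschitz_s_fun bounded_lipschitz_mult bounded_lipschitz_const c assms)
  assume "j < d"
  note p = bounded_lipschitz_phi[OF assms(1) this]
  have zi: "bounded_lipschitz d (dom d \<eta> B) (\<lambda>w. (real d - real i) * w i / s_fun d 0 w)" if "i \<in> {1..d-1}" for i
    using that by (intro dv bounded_lipschitz_mult bounded_lipschitz_const c) auto
  have z0: "bounded_lipschitz d (dom d \<eta> B) (\<lambda>w. real d * w 0 / s_fun d 0 w)"
    by (intro dv bounded_lipschitz_mult bounded_lipschitz_const c assms)
  have q: "bounded_lipschitz d (dom d \<eta> B) (\<lambda>w. phi d k j w / s_fun d 0 w)" for k
    by (intro dv p)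
  have S1: "bounded_lipschitz d (dom d \<eta> B) (\<lambda>w. \<Sum>i=1..d-1. (real d - real i) * w i / s_fun d 0 w *
          (- of_bool (j = 0) + of_bool (j = 1) - of_bool (j = i) + (real d - real i - 1) * (phi d 0 j w / s_fun d 0 w)))"
    by (rule bounded_lipschitz_sum, rule bounded_lipschitz_mult, erule zi, intro bounded_lipschitz_add bounded_lipschitz_mult q bounded_lipschitz_const)
  have S2: "bounded_lipschitz d (dom d \<eta> B) (\<lambda>w. \<Sum>m=1..d-1. (real d - real m) * w m / s_fun d 0 w *
          (- of_bool (j = m) + (real d - real m - 1) * (phi d 0 j w / s_fun d 0 w)))"
    by (rule bounded_lipschitz_sum, rule bounded_lipschitz_mult, erule zi, intro bounded_lipschitz_add bounded_lipschitz_mult q bounded_lipschitz_const)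
  note rp = bounded_lipschitz_power[OF r]
  show "bounded_lipschitz d (dom d \<eta> B) (f_fun d j)"
    unfolding f_fun_def Let_def
    by (intro bounded_lipschitz_add[OF bounded_lipschitz_add[OF bounded_lipschitz_add]] S1 bounded_lipschitz_mult[OF z0])
      (intro bounded_lipschitz_add bounded_lipschitz_diff bounded_lipschitz_mult bounded_lipschitz_const S2 rp q)+
qed

section \<open>Size and mean of the changes in one step\<close>

lemma Zc_init: "0 < d \<Longrightarrow> Zc d n (pspace n d) j = (if j = 0 then real n else 0)"
proof -
  assume d: "0 < d"
  have c: "cnt (pspace n d) v = d" if "v < n" for v
  proof -
    have "{p \<in> pspace n d. fst p = v} = Pair v ` {..<d}" using that by (auto simp: pspace_def)
    then show ?thesis by (simp add: cnt_def card_image inj_on_def)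
  qed
  have "Zc d n (pspace n d) j = (\<Sum>v<n. of_bool (j = 0))"
    unfolding Zc_def using c by (intro sum.cong) auto
  then show ?thesis by simp
qed

text \<open>An abandoned step pays for all vertices it has visited, since all of them are put into
  the dominating set.\<close>

definition cost :: "leaf option \<times> history \<Rightarrow> real" where
  "cost s = (case fst s of None \<Rightarrow> real (card (vts (snd s))) | Some (D, c, \<delta>) \<Rightarrow> c)"

text \<open>One question for \<open>(u, 0)\<close>, then at most four lists of the form
  \<open>rest\<close>, each with at most \<open>d\<close> points.\<close>

lemma dep_step: "dep (step d P u) (1 + 4 * d)"
proof -
  have len: "length (rest d P y) \<le> d" for y by (rule length_rest_le)
  have asks: "dep (asks (rest d P y) k) (d + l)" if "\<And>ys. length ys = length (rest d P y) \<Longrightarrow> dep (k ys) l" for y l and k :: "point list \<Rightarrow> leaf dtree"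
    using dep_mono[OF dep_asks[OF that]] len by simp
  have 1: "dep (asks (rest d P y) (\<lambda>ws. Ret (f ws))) (d + 0)" for y and f :: "point list \<Rightarrow> leaf"
    by (rule asks) simp
  have 2: "dep (asks (rest d P y) (\<lambda>as. asks (rest d P y') (\<lambda>bs. Ret (f as bs)))) (d + (d + 0))" for y y' and f :: "point list \<Rightarrow> point list \<Rightarrow> leaf"
    by (rule asks) (rule 1)
  have "dep (if \<not> isf d P y then asks (rest d P y) (\<lambda>zs. Ret (leaf1 d P y zs))
     else asks (rest d P y) (\<lambda>ys. asks (rest d P (u, 0)) (\<lambda>us.
       if \<exists>p\<in>set ys. isf d P p then Ret (leaf2 d P u y ys us)
       else if \<exists>p\<in>set us. isf d P p
       then asks (rest d P (hd (filter (isf d P) us)))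
              (\<lambda>ws. Ret (leaf3 d P u (hd (filter (isf d P) us)) ys us ws))
       else asks (rest d P (hd ys)) (\<lambda>as. asks (rest d P (hd us)) (\<lambda>bs. Ret (leaf4 d P ys us as bs)))))) (4 * d)" for y
  proof (cases "isf d P y")
    case True
    have "dep (asks (rest d P y) (\<lambda>ys. asks (rest d P (u, 0)) (\<lambda>us.
       if \<exists>p\<in>set ys. isf d P p then Ret (leaf2 d P u y ys us)
       else if \<exists>p\<in>set us. isf d P p
       then asks (rest d P (hd (filter (isf d P) us)))
              (\<lambda>ws. Ret (leaf3 d P u (hd (filter (isf d P) us)) ys us ws))
       else asks (rest d P (hd ys)) (\<lambda>as. asks (rest d P (hd us)) (\<lambda>bs. Ret (leaf4 d P ys us as bs)))))) (d + (d + (d + (d + 0))))"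
      by (intro asks) (use dep_mono[OF 1, of "d + (d + 0)"] 2 in auto)
    then show ?thesis using True by (simp add: numeral_eq_Suc add_ac)
  next
    case False
    then show ?thesis using dep_mono[OF 1[of y "leaf1 d P y"], of "4 * d"] by simp
  qed
  then show ?thesis by (simp add: step_def)
qed

lemma abs_Ssum_le: "\<bar>Ssum d P j ys\<bar> \<le> real (length ys)"
proof -
  have "\<bar>ej d P j y\<bar> \<le> 1" for y by (auto simp: ej_def)
  then show ?thesis
    by (induction ys) (auto simp: Ssum_def intro: order_trans[OF abs_triangle_ineq] add_mono)
qed

lemma leaves_step:
  assumes "(D, c, \<delta>) \<in> set_dtree (step d P u)"
  shows "c = 1 \<or> c = 2" "\<bar>\<delta> j\<bar> \<le> 4 + 4 * real d"
proof -
  have len: "real (length (rest d P y)) \<le> real d" for y using length_rest_le by simp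
  have S: "Ssum d P j xs \<le> real (length xs)" "- real (length xs) \<le> Ssum d P j xs" for xs
    using abs_Ssum_le[of d P j xs] by auto
  have ob: "0 \<le> (of_bool b :: real)" "(of_bool b :: real) \<le> 1" for b by auto
  let ?Q = "\<lambda>(D, c, \<delta>). (c = 1 \<or> c = 2) \<and> \<bar>\<delta> j\<bar> \<le> 4 + 4 * real d"
  obtain y where y: "(D, c, \<delta>) \<in> set_dtree (if \<not> isf d P y then asks (rest d P y) (\<lambda>zs. Ret (leaf1 d P y zs))
     else asks (rest d P y) (\<lambda>ys. asks (rest d P (u, 0)) (\<lambda>us.
       if \<exists>p\<in>set ys. isf d P p then Ret (leaf2 d P u y ys us)
       else if \<exists>p\<in>set us. isf d P p
       then asks (rest d P (hd (filter (isf d P) us)))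
              (\<lambda>ws. Ret (leaf3 d P u (hd (filter (isf d P) us)) ys us ws))
       else asks (rest d P (hd ys)) (\<lambda>as. asks (rest d P (hd us)) (\<lambda>bs. Ret (leaf4 d P ys us as bs))))))"
    using assms unfolding step_def dtree.set by blast
  have "?Q (D, c, \<delta>)"
  proof (cases "isf d P y")
    case False
    then obtain zs where zs: "length zs = length (rest d P y)" "(D, c, \<delta>) = leaf1 d P y zs"
      using y set_dtree_asks by fastforce
    then have "c = 1" and \<delta>: "\<delta> j = - of_bool (j = 0) + of_bool (j = 1) - of_bool (j = dg d P y) + Ssum d P j zs"
      by (simp_all add: leaf1_def)
    moreover have "real (length zs) \<le> real d" using zs(1) len by simp
    ultimately have "\<bar>\<delta> j\<bar> \<le> 4 + 4 * real d"
      unfolding \<delta> abs_le_iff using S[of zs] ob[of "j = 0"] ob[of "j = 1"] ob[of "j = dg d P y"] by linarith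
    then show ?thesis using \<open>c = 1\<close> by simp
  next
    case True
    then obtain ys us where l: "length ys = length (rest d P y)" "length us = length (rest d P (u, 0))"
      and m: "(D, c, \<delta>) \<in> set_dtree (if \<exists>p\<in>set ys. isf d P p then Ret (leaf2 d P u y ys us)
       else if \<exists>p\<in>set us. isf d P p
       then asks (rest d P (hd (filter (isf d P) us)))
              (\<lambda>ws. Ret (leaf3 d P u (hd (filter (isf d P) us)) ys us ws))
       else asks (rest d P (hd ys)) (\<lambda>as. asks (rest d P (hd us)) (\<lambda>bs. Ret (leaf4 d P ys us as bs))))"
      using y by (auto dest!: set_dtree_asks)
    have ll: "real (length ys) \<le> real d" "real (length us) \<le> real d" using l len by simp_all
    consider (B) "\<exists>p\<in>set ys. isf d P p" | (C) "\<not> (\<exists>p\<in>set ys. isf d P p)" "\<exists>p\<in>set us. isf d P p"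
            | (D) "\<not> (\<exists>p\<in>set ys. isf d P p)" "\<not> (\<exists>p\<in>set us. isf d P p)" by blast
    then show ?thesis
    proof cases
      case B
      then have "(D, c, \<delta>) = leaf2 d P u y ys us" using m by simp
      then have "c = 2" "\<delta> j = - 2 * of_bool (j = 0) + Ssum d P j ys + Ssum d P j us"
        by (simp_all add: leaf2_def)
      moreover have "\<bar>\<delta> j\<bar> \<le> 4 + 4 * real d"
        unfolding calculation(2) abs_le_iff using S[of ys] S[of us] ll ob[of "j = 0"] by linarith
      ultimately show ?thesis by simp
    next
      case C
      then have "(D, c, \<delta>) \<in> set_dtree (asks (rest d P (hd (filter (isf d P) us)))
              (\<lambda>ws. Ret (leaf3 d P u (hd (filter (isf d P) us)) ys us ws)))" using m by simp
      from set_dtree_asks[OF this] obtain ws where ws: "length ws = length (rest d P (hd (filter (isf d P) us)))"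
        "(D, c, \<delta>) = leaf3 d P u (hd (filter (isf d P) us)) ys us ws" by auto
      have "real (length ws) \<le> real d" using ws(1) len by simp
      have "c = 2" and \<delta>: "\<delta> j = - 2 * of_bool (j = 0) - of_bool (j = 1) + Ssum d P j ys + Ssum d P j us + Ssum d P j ws"
        using ws(2) by (simp_all add: leaf3_def)
      moreover have "\<bar>\<delta> j\<bar> \<le> 4 + 4 * real d"
        unfolding \<delta> abs_le_iff using S[of ys] S[of us] S[of ws] ll \<open>real (length ws) \<le> real d\<close> ob[of "j = 0"] ob[of "j = 1"] by linarith
      ultimately show ?thesis by simp
    next
      case D
      then have "(D, c, \<delta>) \<in> set_dtree (asks (rest d P (hd ys)) (\<lambda>as. asks (rest d P (hd us)) (\<lambda>bs. Ret (leaf4 d P ys us as bs))))" using m by simp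
      then obtain as bs where ab: "length as = length (rest d P (hd ys))" "length bs = length (rest d P (hd us))"
        "(D, c, \<delta>) = leaf4 d P ys us as bs" by (auto dest!: set_dtree_asks)
      have "real (length as) \<le> real d" "real (length bs) \<le> real d" using ab(1,2) len by simp_all
      moreover have "real (length (tl ys)) \<le> real d" "real (length (tl us)) \<le> real d" using ll by simp_all
      moreover have "c = 2" and \<delta>: "\<delta> j = - 2 * of_bool (j = 0) + Ssum d P j (tl ys) + Ssum d P j (tl us)
          - of_bool (j = dg d P (hd ys)) - of_bool (j = dg d P (hd us)) + Ssum d P j as + Ssum d P j bs"
        using ab(3) by (simp_all add: leaf4_def)
      ultimately have "\<bar>\<delta> j\<bar> \<le> 4 + 4 * real d"
        unfolding \<delta> abs_le_iff using S[of "tl ys"] S[of "tl us"] S[of as] S[of bs] ob[of "j = 0"]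
          ob[of "j = dg d P (hd ys)"] ob[of "j = dg d P (hd us)"] by linarith
      then show ?thesis using \<open>c = 2\<close> by simp
    qed
  qed
  then show "c = 1 \<or> c = 2" "\<bar>\<delta> j\<bar> \<le> 4 + 4 * real d" by auto
qed

lemma outs_set_dtree: "(Some a, H') \<in> outs t P H \<Longrightarrow> a \<in> set_dtree t"
proof (induction t arbitrary: H)
  case (Ask x t)
  then obtain y where "(Some a, H') \<in> (if fst y \<in> insert (fst x) (vts H) then {(None, (x, y) # H)} else outs (t y) P ((x, y) # H))"
    by (auto simp only: outs.simps UN_iff)
  then have "(Some a, H') \<in> outs (t y) P ((x, y) # H)" by (auto split: if_splits)
  then show ?case using Ask.IH[of "t y"] by auto
qed simp

lemma abs_cost_le:
  assumes "s \<in> outs (step d P u) P []"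
  shows "\<bar>cost s\<bar> \<le> 2 * real (1 + 4 * d)"
proof (cases s)
  case (Pair r H)
  have "length H \<le> 1 + 4 * d" using outs_length[OF _ dep_step, of r H d P u P "[]"] assms Pair by simp
  then have "card (vts H) \<le> 2 * (1 + 4 * d)" by (rule order_trans[OF card_vts mult_le_mono2])
  then have "real (card (vts H)) \<le> real (2 * (1 + 4 * d))" by (simp only: of_nat_le_iff)
  then have "real (card (vts H)) \<le> 2 * real (1 + 4 * d)" by simp
  moreover have "\<bar>c\<bar> \<le> 2 * real (1 + 4 * d)" if "r = Some (D, c, \<delta>)" for D c \<delta>
    using leaves_step(1)[OF outs_set_dtree[of "(D, c, \<delta>)" H "step d P u" P "[]"]] assms that Pair by auto
  ultimately show ?thesis unfolding Pair cost_def by (auto split: option.split)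
qed

lemma abs_change_le:
  assumes "P \<subseteq> pspace n d" "3 \<le> d" "cnt P u = d" "s \<in> outs (step d P u) P []"
  shows "\<bar>Zc d n (P - pts (snd s)) j - Zc d n P j\<bar> \<le> 2 * real (1 + 4 * d)"
proof (cases s)
  case (Pair r H)
  have "length H \<le> 1 + 4 * d" using outs_length[OF _ dep_step, of r H d P u P "[]"] assms(4) Pair by simp
  moreover have "pts H \<subseteq> P"
    using outs_pts[OF wp_wft[OF wp_step[OF assms(1-3)]], of r H] assms(4) Pair by simp
  ultimately show ?thesis using abs_Zc_diff_le[OF _ assms(1), of H j] Pair by simp
qed

text \<open>\<open>M\<close> is the constant of \<open>rv_iv_close\<close> for
  \<open>k = K = 1 + 4 * d\<close>; its last factor bounds the cost and the changes both for true
  outcomes and for leaves.\<close>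

lemma step_drift:
  assumes P: "P \<subseteq> pspace n d" and d: "3 \<le> d" and u: "cnt P u = d" and n: "0 < n"
    and big: "2 * (1 + 4 * d) < card P"
  defines "w \<equiv> \<lambda>i. Zc d n P i / real n"
    and "M \<equiv> 3 * real (1 + 4 * d) * real (d * (2 * (1 + 4 * d) + 1)) * (2 * real (1 + 4 * d) + 4 + 4 * real d)"
  shows "j < d \<Longrightarrow> \<bar>rv (step d P u) P (\<lambda>s. Zc d n (P - pts (snd s)) j - Zc d n P j) [] - f_fun d j w\<bar> \<le> M / card P"
    and "\<bar>rv (step d P u) P cost [] - f_last d w\<bar> \<le> M / card P"
proof -
  have fin: "finite P" using finite_subset[OF P] by simp
  have ne: "P \<noteq> {}" using big by auto
  have deg: "card {p \<in> P. fst p = v} \<le> d" for v using cnt_le[OF P, of v] by (simp add: cnt_def)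
  note wp = wp_step[OF P d u]
  note close = rv_iv_close[OF fin deg big _ dep_step wp_wft[OF wp], where B = "2 * real (1 + 4 * d) + 4 + 4 * real d"]
  have "\<bar>rv (step d P u) P cost [] - iv (step d P u) P (\<lambda>(D, c, \<delta>). c)\<bar> \<le> M / card P"
    unfolding M_def
  proof (rule close)
    show "\<bar>cost s\<bar> \<le> 2 * real (1 + 4 * d) + 4 + 4 * real d" if "s \<in> outs (step d P u) P []" for s
      using abs_cost_le[OF that] by simp
    show "\<bar>case a of (D, c, \<delta>) \<Rightarrow> c\<bar> \<le> 2 * real (1 + 4 * d) + 4 + 4 * real d" if "a \<in> set_dtree (step d P u)" for a
      using leaves_step(1)[of "fst a" "fst (snd a)" "snd (snd a)" d P u] that by (cases a) auto
  qed (auto simp: cost_def split: prod.split)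
  then show "\<bar>rv (step d P u) P cost [] - f_last d w\<bar> \<le> M / card P"
    using iv_step(2)[OF P ne d n u, of 0] d by (simp add: w_def)
  assume j: "j < d"
  have "\<bar>rv (step d P u) P (\<lambda>s. Zc d n (P - pts (snd s)) j - Zc d n P j) [] - iv (step d P u) P (\<lambda>(D, c, \<delta>). \<delta> j)\<bar> \<le> M / card P"
    unfolding M_def
  proof (rule close)
    show "\<bar>Zc d n (P - pts (snd s)) j - Zc d n P j\<bar> \<le> 2 * real (1 + 4 * d) + 4 + 4 * real d" if "s \<in> outs (step d P u) P []" for s
      using abs_change_le[OF P d u that, of j] by simp
    show "\<bar>case a of (D, c, \<delta>) \<Rightarrow> \<delta> j\<bar> \<le> 2 * real (1 + 4 * d) + 4 + 4 * real d" if "a \<in> set_dtree (step d P u)" for a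
      using leaves_step(2)[of "fst a" "fst (snd a)" "snd (snd a)" d P u j] that by (cases a) auto
    show "Zc d n (P - pts (snd (Some a, H'))) j - Zc d n P j = (case a of (D, c, \<delta>) \<Rightarrow> \<delta> j)"
      if "(Some a, H') \<in> outs (step d P u) P []" for a H'
      using wp_outs[OF wp that] j by (auto simp: leafok_def)
  qed auto
  then show "\<bar>rv (step d P u) P (\<lambda>s. Zc d n (P - pts (snd s)) j - Zc d n P j) [] - f_fun d j w\<bar> \<le> M / card P"
    using iv_step(1)[OF P ne d n u j] by (simp add: w_def)
qed

lemma bounded_lipschitz_uniform:
  assumes "finite J" "\<And>j. j \<in> J \<Longrightarrow> bounded_lipschitz d S (F j)"
  shows "\<exists>B L. 0 \<le> B \<and> 0 \<le> L \<and> (\<forall>j\<in>J. \<forall>w\<in>S. \<bar>F j w\<bar> \<le> B) \<and>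
     (\<forall>j\<in>J. \<forall>w\<in>S. \<forall>w'\<in>S. \<bar>F j w - F j w'\<bar> \<le> L * (\<Sum>i<d. \<bar>w i - w' i\<bar>))"
  using assms
proof (induction J)
    case (insert j J)
    then obtain B L where 1: "0 \<le> B" "0 \<le> L" "\<And>j w. j \<in> J \<Longrightarrow> w \<in> S \<Longrightarrow> \<bar>F j w\<bar> \<le> B"
      "\<And>j w w'. j \<in> J \<Longrightarrow> w \<in> S \<Longrightarrow> w' \<in> S \<Longrightarrow> \<bar>F j w - F j w'\<bar> \<le> L * (\<Sum>i<d. \<bar>w i - w' i\<bar>)"
      by (auto simp: Ball_def)
    have "bounded_lipschitz d S (F j)" using insert.prems by simp
    from bounded_lipschitzE[OF this] obtain B' L' where 2: "0 \<le> B'" "0 \<le> L'" "\<And>w. w \<in> S \<Longrightarrow> \<bar>F j w\<bar> \<le> B'"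
      "\<And>w w'. w \<in> S \<Longrightarrow> w' \<in> S \<Longrightarrow> \<bar>F j w - F j w'\<bar> \<le> L' * (\<Sum>i<d. \<bar>w i - w' i\<bar>)" by blast
    have "\<bar>F i w - F i w'\<bar> \<le> (L + L') * (\<Sum>i<d. \<bar>w i - w' i\<bar>)"
      if "i \<in> insert j J" "w \<in> S" "w' \<in> S" for i w w'
    proof -
      have "0 \<le> L * (\<Sum>i<d. \<bar>w i - w' i\<bar>)" "0 \<le> L' * (\<Sum>i<d. \<bar>w i - w' i\<bar>)"
        using 1 2 by (auto intro!: mult_nonneg_nonneg sum_nonneg)
      then show ?thesis using 1(4)[of i w w'] 2(4)[of w w'] that unfolding distrib_right by auto
    qed
    moreover have "\<bar>F i w\<bar> \<le> B + B'" if "i \<in> insert j J" "w \<in> S" for i w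
      using 1(3)[of i w] 2(3)[of w] 1(1) 2(1) that by auto
    ultimately show ?case using 1(1,2) 2(1,2) by (intro exI[of _ "B + B'"] exI[of _ "L + L'"]) auto
qed auto

lemma expect_image:
  assumes "expect E S"
  shows "expect (\<lambda>f. E (\<lambda>x. f (g x))) (g ` S)"
  using assms unfolding expect_def by auto

lemma s_fun_close:
  assumes "\<And>i. i < d \<Longrightarrow> \<bar>w i - w' i\<bar> \<le> \<epsilon>" "0 < d"
  shows "\<bar>s_fun d 0 w - s_fun d 0 w'\<bar> \<le> real d * real d * \<epsilon>"
proof -
  have "\<bar>s_fun d 0 w - s_fun d 0 w'\<bar> = \<bar>\<Sum>i=0..d-1. (real d - real i) * (w i - w' i)\<bar>"
    unfolding s_fun_def sum_subtractf[symmetric] by (simp add: algebra_simps)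
  also have "\<dots> \<le> (\<Sum>i=0..d-1. real d * \<epsilon>)"
  proof (intro order_trans[OF sum_abs] sum_mono)
    fix i assume "i \<in> {0..d-1}"
    then have i: "i < d" using assms(2) by auto
    then show "\<bar>(real d - real i) * (w i - w' i)\<bar> \<le> real d * \<epsilon>"
      unfolding abs_mult using assms(1)[OF i] by (intro mult_mono) auto
  qed
  finally show ?thesis using assms(2) by (simp add: mult.assoc)
qed

lemma continuous_on_ivp:
  assumes "ivp_solution d T z q" "ereal X < T"
  shows "j < d \<Longrightarrow> continuous_on {0..X} (z j)" "continuous_on {0..X} q"
proof -
  have sub: "{0..X} \<subseteq> {t. 0 \<le> t \<and> ereal t < T}"
    using assms(2) by (auto intro: le_less_trans[OF ereal_less_eq(3)[THEN iffD2]])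
  show "continuous_on {0..X} q"
    unfolding continuous_on_eq_continuous_within
  proof
    fix x assume "x \<in> {0..X}"
    then have "(q has_real_derivative f_last d (\<lambda>i. z i x)) (at x within {t. 0 \<le> t \<and> ereal t < T})"
      using assms(1) sub unfolding ivp_solution_def by blast
    then show "continuous (at x within {0..X}) q"
      using sub by (blast intro: DERIV_continuous DERIV_subset)
  qed
  assume "j < d"
  show "continuous_on {0..X} (z j)"
    unfolding continuous_on_eq_continuous_within
  proof
    fix x assume "x \<in> {0..X}"
    then have "(z j has_real_derivative f_fun d j (\<lambda>i. z i x)) (at x within {t. 0 \<le> t \<and> ereal t < T})"
      using assms(1) sub \<open>j < d\<close> unfolding ivp_solution_def by blast
    then show "continuous (at x within {0..X}) (z j)"
      using sub by (blast intro: DERIV_continuous DERIV_subset)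
  qed
qed

lemma ivp_compact_bounds:
  assumes ivp: "ivp_solution d T z q" and X: "0 \<le> X" "ereal X < T" and d: "0 < d"
    and pos: "\<And>x. 0 \<le> x \<Longrightarrow> x \<le> X \<Longrightarrow> 0 < z 0 x"
  shows "\<exists>\<eta> m B. 0 < \<eta> \<and> 0 < m \<and> (\<forall>x\<in>{0..X}. 2 * \<eta> \<le> s_fun d 0 (\<lambda>i. z i x)) \<and>
    (\<forall>x\<in>{0..X}. m \<le> z 0 x) \<and> (\<forall>x\<in>{0..X}. \<forall>i<d. \<bar>z i x\<bar> \<le> B)"
proof -
  have cs: "continuous_on {0..X} (\<lambda>x. s_fun d 0 (\<lambda>i. z i x))"
    unfolding s_fun_def using d by (intro continuous_intros continuous_on_ivp(1)[OF ivp X(2)]) auto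
  have cB: "continuous_on {0..X} (\<lambda>x. \<Sum>i<d. \<bar>z i x\<bar>)"
    by (intro continuous_intros continuous_on_ivp(1)[OF ivp X(2)]) auto
  have ne: "{0..X} \<noteq> {}" using X by auto
  obtain x0 where x0: "x0 \<in> {0..X}" "\<And>x. x \<in> {0..X} \<Longrightarrow> s_fun d 0 (\<lambda>i. z i x0) \<le> s_fun d 0 (\<lambda>i. z i x)"
    using continuous_attains_inf[OF compact_Icc ne cs] by auto
  obtain x1 where x1: "x1 \<in> {0..X}" "\<And>x. x \<in> {0..X} \<Longrightarrow> z 0 x1 \<le> z 0 x"
    using continuous_attains_inf[OF compact_Icc ne continuous_on_ivp(1)[OF ivp X(2) d]] by auto
  obtain x2 where x2: "x2 \<in> {0..X}" "\<And>x. x \<in> {0..X} \<Longrightarrow> (\<Sum>i<d. \<bar>z i x\<bar>) \<le> (\<Sum>i<d. \<bar>z i x2\<bar>)"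
    using continuous_attains_sup[OF compact_Icc ne cB] by auto
  show ?thesis
  proof (rule exI[of _ "s_fun d 0 (\<lambda>i. z i x0) / 2"], rule exI[of _ "z 0 x1"], rule exI[of _ "\<Sum>i<d. \<bar>z i x2\<bar>"],
      intro conjI ballI allI impI)
    have "ereal x0 < T" using x0(1) X by (auto intro: le_less_trans[OF ereal_less_eq(3)[THEN iffD2]])
    then show "0 < s_fun d 0 (\<lambda>i. z i x0) / 2" using ivp x0(1) unfolding ivp_solution_def by auto
    show "0 < z 0 x1" using pos x1 by auto
    show "\<bar>z i x\<bar> \<le> (\<Sum>i<d. \<bar>z i x2\<bar>)" if "x \<in> {0..X}" "i < d" for x i
      using x2(2)[OF that(1)] member_le_sum[of i "{..<d}" "\<lambda>i. \<bar>z i x\<bar>"] that(2) by auto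
  qed (use x0 x1 in auto)
qed

text \<open>The function \<open>q\<close> becomes coordinate \<open>d\<close>, so that the size of
  the dominating set and the degree counts are treated alike.\<close>

definition comp :: "nat \<Rightarrow> (nat \<Rightarrow> real \<Rightarrow> real) \<Rightarrow> (real \<Rightarrow> real) \<Rightarrow> nat \<Rightarrow> real \<Rightarrow> real" where
  "comp d z q j = (if j < d then z j else q)"

definition rhs :: "nat \<Rightarrow> nat \<Rightarrow> (nat \<Rightarrow> real) \<Rightarrow> real" where
  "rhs d j = (if j < d then f_fun d j else f_last d)"

lemma comp_mvt:
  assumes ivp: "ivp_solution d T z q" and s: "0 \<le> s" "s < t" "ereal t < T"
  obtains \<xi> where "s < \<xi>" "\<xi> < t" "comp d z q j t - comp d z q j s = (t - s) * rhs d j (\<lambda>i. z i \<xi>)"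
proof -
  have "\<exists>\<xi>\<in>{s<..<t}. comp d z q j t - comp d z q j s = (\<lambda>h. h * rhs d j (\<lambda>i. z i \<xi>)) (t - s)"
  proof (rule mvt_simple[OF s(2), where f' = "\<lambda>x h. h * rhs d j (\<lambda>i. z i x)"])
    fix x assume "s \<le> x" "x \<le> t"
    then have x: "x \<in> {s..t}" by simp
    have sub: "{s..t} \<subseteq> {t. 0 \<le> t \<and> ereal t < T}"
      using s by (auto intro: le_less_trans[OF ereal_less_eq(3)[THEN iffD2]])
    have "(comp d z q j has_real_derivative rhs d j (\<lambda>i. z i x)) (at x within {t. 0 \<le> t \<and> ereal t < T})"
      using ivp sub x unfolding ivp_solution_def comp_def rhs_def by auto
    then have "(comp d z q j has_real_derivative rhs d j (\<lambda>i. z i x)) (at x within {s..t})"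
      using sub by (rule DERIV_subset)
    moreover have "(\<lambda>h. h * rhs d j (\<lambda>i. z i x)) = (*) (rhs d j (\<lambda>i. z i x))"
      by (simp add: fun_eq_iff)
    ultimately show "(comp d z q j has_derivative (\<lambda>h. h * rhs d j (\<lambda>i. z i x))) (at x within {s..t})"
      by (simp only: has_field_derivative_def)
  qed
  then show ?thesis using that by auto
qed


text \<open>
  \<open>W t (P, k)\<close> stands for the probability of failure after \<open>t\<close> steps, with unexposed points \<open>P\<close> and \<open>k\<close>
  vertices chosen so far.
\<close>

definition controlled ::
    "nat \<Rightarrow> (nat \<Rightarrow> real \<Rightarrow> real) \<Rightarrow> (real \<Rightarrow> real) \<Rightarrow> real \<Rightarrow> nat \<Rightarrow> nat \<Rightarrow> (nat \<Rightarrow> point set \<times> real \<Rightarrow> real) \<Rightarrow> bool" where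
  "controlled d z q \<epsilon> n N W \<longleftrightarrow>
     (\<forall>t P k. P \<subseteq> pspace n d \<longrightarrow> W t (P, k) \<le> 1) \<and>
     (\<forall>t P k u. t < N \<longrightarrow> P \<subseteq> pspace n d \<longrightarrow> cnt P u = d \<longrightarrow> 2 * (1 + 4 * d) < card P \<longrightarrow>
        W t (P, k) \<le> rv (step d P u) P (\<lambda>s. W (Suc t) (P - pts (snd s), k + cost s)) []) \<and>
     (\<forall>P k. P \<subseteq> pspace n d \<longrightarrow> (\<forall>j<d. \<bar>Zc d n P j / real n - z j (real N / real n)\<bar> \<le> \<epsilon>) \<longrightarrow>
        \<bar>k / real n - q (real N / real n)\<bar> \<le> \<epsilon> \<longrightarrow> W N (P, k) \<le> 0)"

text \<open>The constants are chosen before \<open>n\<close>, \<open>N\<close> and \<open>W\<close>,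
  so the failure probabilities for all large \<open>n\<close> obey one exponential bound.\<close>

definition tracked :: "nat \<Rightarrow> (nat \<Rightarrow> real \<Rightarrow> real) \<Rightarrow> (real \<Rightarrow> real) \<Rightarrow> real \<Rightarrow> real \<Rightarrow> bool" where
  "tracked d z q X \<epsilon> \<longleftrightarrow> (\<exists>C c n0. 0 < c \<and> (\<forall>n\<ge>n0. \<forall>N W. real N \<le> X * real n \<longrightarrow>
     controlled d z q \<epsilon> n N W \<longrightarrow> W 0 (pspace n d, 0) \<le> exp (C - c * real n)))"

text \<open>\<open>lyapunov\<close> is applied to the differences between the scaled process and the
  solution at time \<open>t / n\<close>. By compactness \<open>z 0\<close> is bounded away from 0 on
  \<open>[0, X]\<close>, so near the solution an untouched vertex exists and a step can be
  made.\<close>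

lemma fluid_limit:
  assumes ivp: "ivp_solution d T z q" and X: "0 \<le> X" "ereal X < T" and d: "3 \<le> d"
    and pos: "\<And>x. 0 \<le> x \<Longrightarrow> x \<le> X \<Longrightarrow> 0 < z 0 x"
  shows "\<exists>\<epsilon>1>0. \<forall>\<epsilon>. 0 < \<epsilon> \<longrightarrow> \<epsilon> \<le> \<epsilon>1 \<longrightarrow> tracked d z q X \<epsilon>"
proof -
  have d0: "0 < d" using d by simp
  have "\<exists>\<eta> m B. 0 < \<eta> \<and> 0 < m \<and> (\<forall>x\<in>{0..X}. 2 * \<eta> \<le> s_fun d 0 (\<lambda>i. z i x)) \<and>
    (\<forall>x\<in>{0..X}. m \<le> z 0 x) \<and> (\<forall>x\<in>{0..X}. \<forall>i<d. \<bar>z i x\<bar> \<le> B)"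
    by (rule ivp_compact_bounds[OF ivp X d0 pos])
  then obtain \<eta> m B where b': "0 < \<eta> \<and> 0 < m \<and> (\<forall>x\<in>{0..X}. 2 * \<eta> \<le> s_fun d 0 (\<lambda>i. z i x)) \<and>
    (\<forall>x\<in>{0..X}. m \<le> z 0 x) \<and> (\<forall>x\<in>{0..X}. \<forall>i<d. \<bar>z i x\<bar> \<le> B)"
    by (elim exE)
  have b: "0 < \<eta>" "0 < m" "\<And>x. x \<in> {0..X} \<Longrightarrow> 2 * \<eta> \<le> s_fun d 0 (\<lambda>i. z i x)"
    "\<And>x. x \<in> {0..X} \<Longrightarrow> m \<le> z 0 x" "\<And>x i. x \<in> {0..X} \<Longrightarrow> i < d \<Longrightarrow> \<bar>z i x\<bar> \<le> B"
    using b' by blast+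
  \<comment> \<open>The second bound keeps \<open>s_fun\<close> above \<open>\<eta>\<close>, by
    \<open>s_fun_close\<close>; the third keeps the number of untouched vertices positive.\<close>
  define \<epsilon>1 where "\<epsilon>1 = min 1 (min (\<eta> / (real d * real d)) (m / 2))"
  have \<epsilon>1: "0 < \<epsilon>1" "\<epsilon>1 \<le> 1" "real d * real d * \<epsilon>1 \<le> \<eta>" "\<epsilon>1 \<le> m / 2"
  proof -
    show "0 < \<epsilon>1" using b(1,2) d0 by (simp add: \<epsilon>1_def)
    show "\<epsilon>1 \<le> 1" "\<epsilon>1 \<le> m / 2" unfolding \<epsilon>1_def by linarith+
    have "\<epsilon>1 \<le> \<eta> / (real d * real d)" by (simp add: \<epsilon>1_def)
    then show "real d * real d * \<epsilon>1 \<le> \<eta>" using d0 by (simp add: field_simps)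
  qed
  let ?S = "dom d \<eta> (B + 1)"
  have near: "w \<in> ?S" if x: "x \<in> {0..X}" and w: "\<And>i. i < d \<Longrightarrow> \<bar>w i - z i x\<bar> \<le> \<epsilon>1" for w x
  proof -
    have "\<bar>s_fun d 0 w - s_fun d 0 (\<lambda>i. z i x)\<bar> \<le> real d * real d * \<epsilon>1"
      by (rule s_fun_close[OF w d0])
    then have "\<eta> \<le> s_fun d 0 w" using b(3)[OF x] \<epsilon>1(3) by linarith
    moreover have "\<bar>w i\<bar> \<le> B + 1" if "i < d" for i using w[OF that] b(5)[OF x that] \<epsilon>1(2) by linarith
    ultimately show ?thesis by (simp add: dom_def)
  qed
  have zS: "(\<lambda>i. z i x) \<in> ?S" if "x \<in> {0..X}" for x
    using near[OF that, of "\<lambda>i. z i x"] \<epsilon>1(1) by simp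
  let ?J = "{..d}"
  have lbr: "bounded_lipschitz d ?S (rhs d j)" if "j \<in> ?J" for j
    using bounded_lipschitz_f[OF d0 b(1)] that by (cases "j < d") (auto simp: rhs_def fun_eq_iff)
  have "\<exists>B L. 0 \<le> B \<and> 0 \<le> L \<and> (\<forall>j\<in>?J. \<forall>w\<in>?S. \<bar>rhs d j w\<bar> \<le> B) \<and>
     (\<forall>j\<in>?J. \<forall>w\<in>?S. \<forall>w'\<in>?S. \<bar>rhs d j w - rhs d j w'\<bar> \<le> L * (\<Sum>i<d. \<bar>w i - w' i\<bar>))"
    by (rule bounded_lipschitz_uniform[OF finite_atMost lbr])
  then obtain Bf Lf where F': "0 \<le> Bf \<and> 0 \<le> Lf \<and> (\<forall>j\<in>?J. \<forall>w\<in>?S. \<bar>rhs d j w\<bar> \<le> Bf) \<and>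
     (\<forall>j\<in>?J. \<forall>w\<in>?S. \<forall>w'\<in>?S. \<bar>rhs d j w - rhs d j w'\<bar> \<le> Lf * (\<Sum>i<d. \<bar>w i - w' i\<bar>))"
    by (elim exE)
  have F: "0 \<le> Bf" "0 \<le> Lf" "\<And>j w. j \<in> ?J \<Longrightarrow> w \<in> ?S \<Longrightarrow> \<bar>rhs d j w\<bar> \<le> Bf"
    "\<And>j w w'. j \<in> ?J \<Longrightarrow> w \<in> ?S \<Longrightarrow> w' \<in> ?S \<Longrightarrow> \<bar>rhs d j w - rhs d j w'\<bar> \<le> Lf * (\<Sum>i<d. \<bar>w i - w' i\<bar>)"
    using F' by blast+
  define K where "K = 2 * (1 + 4 * d)"
  define M where "M = 3 * real (1 + 4 * d) * real (d * (2 * (1 + 4 * d) + 1)) * (2 * real (1 + 4 * d) + 4 + 4 * real d)"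
  have M0: "0 \<le> M" by (simp add: M_def)
  \<comment> \<open>\<open>A\<close> bounds one step of the process plus one of the solution.
    \<open>L\<close> collects the Lipschitz constant of the right-hand sides, the error
    \<open>M / \<eta>\<close> from comparing with independent answers, and the discretisation error
    of the solution.\<close>
  define A where "A = real K + Bf"
  define L where "L = Lf + M / \<eta> + Lf * real d * Bf"
  have AL: "0 \<le> A" "0 \<le> L" using F b M0 by (simp_all add: A_def L_def)
  define mm where "mm = real (card ?J)"
  define C where "C = (2 * L + mm * A\<^sup>2 + 2 * mm\<^sup>2 * A ^ 4) * X"
  define \<theta> where "\<theta> = 1 / (1 + (2 * A * mm + mm * A\<^sup>2)) * exp (- (4 * L * mm + 8 * A\<^sup>2 * mm) * X)"
  have "0 < 1 + (2 * A * mm + mm * A\<^sup>2)" using AL by (intro add_pos_nonneg) (auto simp: mm_def)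
  then have \<theta>: "0 < \<theta>" by (simp add: \<theta>_def)
  \<comment> \<open>By the mean value theorem the scaled increment of the solution is the right-hand
    side at an intermediate time. A second application shows that the solution moves by at most
    \<open>Bf / n\<close> up to that time.\<close>
  have drift: "\<bar>real n * (comp d z q j ((real t + 1) / real n) - comp d z q j (real t / real n)) - rhs d j (\<lambda>i. z i (real t / real n))\<bar> \<le> Lf * real d * Bf / real n"
    "\<bar>real n * (comp d z q j ((real t + 1) / real n) - comp d z q j (real t / real n))\<bar> \<le> Bf"
    if t: "real t + 1 \<le> X * real n" and n: "0 < n" and j: "j \<in> ?J" for t n j
  proof -
    let ?s = "real t / real n" and ?t = "(real t + 1) / real n"
    have st: "0 \<le> ?s" "?s < ?t" "?t \<le> X" "?t - ?s = 1 / real n"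
      using t n by (auto simp: divide_strict_right_mono field_simps)
    have tT: "ereal x < T" if "x \<le> ?t" for x
      using X(2) that st(3) by (auto intro: le_less_trans[OF ereal_less_eq(3)[THEN iffD2]])
    obtain \<xi> where \<xi>: "?s < \<xi>" "\<xi> < ?t" "comp d z q j ?t - comp d z q j ?s = (?t - ?s) * rhs d j (\<lambda>i. z i \<xi>)"
      using comp_mvt[OF ivp st(1,2) tT] by blast
    have eq: "real n * (comp d z q j ?t - comp d z q j ?s) = rhs d j (\<lambda>i. z i \<xi>)"
      using n unfolding \<xi>(3) st(4) by simp
    have in1: "\<xi> \<in> {0..X}" "?s \<in> {0..X}"
      unfolding atLeastAtMost_iff using \<xi>(1,2) st(1-3) by linarith+
    show "\<bar>real n * (comp d z q j ?t - comp d z q j ?s)\<bar> \<le> Bf"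
      unfolding eq by (rule F(3)[OF j zS[OF in1(1)]])
    have "\<bar>z i \<xi> - z i ?s\<bar> \<le> Bf / real n" if i: "i < d" for i
    proof -
      obtain \<zeta> where \<zeta>: "?s < \<zeta>" "\<zeta> < \<xi>" "comp d z q i \<xi> - comp d z q i ?s = (\<xi> - ?s) * rhs d i (\<lambda>i. z i \<zeta>)"
        using comp_mvt[OF ivp st(1) \<xi>(1) tT] \<xi>(2) by (metis less_imp_le)
      have "\<bar>(\<xi> - ?s) * rhs d i (\<lambda>i. z i \<zeta>)\<bar> \<le> (1 / real n) * Bf"
        unfolding abs_mult
      proof (intro mult_mono)
        show "\<bar>\<xi> - ?s\<bar> \<le> 1 / real n" using \<xi>(1,2) st(4) by linarith
        have "\<zeta> \<in> {0..X}" unfolding atLeastAtMost_iff using \<zeta>(1,2) \<xi>(1,2) st(1-3) by linarith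
        then show "\<bar>rhs d i (\<lambda>i. z i \<zeta>)\<bar> \<le> Bf" using F(3)[OF _ zS] i by simp
      qed auto
      then show ?thesis using \<zeta>(3) i by (simp add: comp_def)
    qed
    then have "(\<Sum>i<d. \<bar>z i \<xi> - z i ?s\<bar>) \<le> real d * (Bf / real n)"
      using sum_bounded_above[of "{..<d}" "\<lambda>i. \<bar>z i \<xi> - z i ?s\<bar>" "Bf / real n"] by simp
    then have "Lf * (\<Sum>i<d. \<bar>z i \<xi> - z i ?s\<bar>) \<le> Lf * (real d * (Bf / real n))"
      using F(2) by (rule mult_left_mono)
    then show "\<bar>real n * (comp d z q j ?t - comp d z q j ?s) - rhs d j (\<lambda>i. z i ?s)\<bar> \<le> Lf * real d * Bf / real n"
      unfolding eq using F(4)[OF j zS[OF in1(1)] zS[OF in1(2)]] by simp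
  qed
  have main: "tracked d z q X \<epsilon>" if \<epsilon>: "0 < \<epsilon>" "\<epsilon> \<le> \<epsilon>1" for \<epsilon>
  unfolding tracked_def
  \<comment> \<open>The last witness ensures \<open>K < \<eta> * n\<close>; then more than
    \<open>K\<close> points are unexposed near the solution, as \<open>step_drift\<close>
    requires.\<close>
  proof (rule exI[of _ C], rule exI[of _ "\<theta> * \<epsilon>\<^sup>2"], rule exI[of _ "nat \<lceil>(real K + 1) / \<eta>\<rceil> + 1"], intro conjI allI impI)
    show "0 < \<theta> * \<epsilon>\<^sup>2" using \<theta> \<epsilon> by simp
    fix n N :: nat and W :: "nat \<Rightarrow> point set \<times> real \<Rightarrow> real"
    assume n0: "nat \<lceil>(real K + 1) / \<eta>\<rceil> + 1 \<le> n" and N: "real N \<le> X * real n"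
      and ctrl: "controlled d z q \<epsilon> n N W"
    have W1: "\<forall>t P k. P \<subseteq> pspace n d \<longrightarrow> W t (P, k) \<le> 1"
      and Wstep: "\<forall>t P k u. t < N \<longrightarrow> P \<subseteq> pspace n d \<longrightarrow> cnt P u = d \<longrightarrow> 2 * (1 + 4 * d) < card P \<longrightarrow>
          W t (P, k) \<le> rv (step d P u) P (\<lambda>s. W (Suc t) (P - pts (snd s), k + cost s)) []"
      and WN: "\<forall>P k. P \<subseteq> pspace n d \<longrightarrow> (\<forall>j<d. \<bar>Zc d n P j / real n - z j (real N / real n)\<bar> \<le> \<epsilon>) \<longrightarrow>
          \<bar>k / real n - q (real N / real n)\<bar> \<le> \<epsilon> \<longrightarrow> W N (P, k) \<le> 0"
    by (rule ctrl[unfolded controlled_def, THEN conjunct1] ctrl[unfolded controlled_def, THEN conjunct2, THEN conjunct1]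
        ctrl[unfolded controlled_def, THEN conjunct2, THEN conjunct2])+
    have n: "0 < n" "1 \<le> real n" and nK: "real K < \<eta> * real n"
    proof -
      show "0 < n" "1 \<le> real n" using n0 by auto
      have "(real K + 1) / \<eta> \<le> real (nat \<lceil>(real K + 1) / \<eta>\<rceil>)" by (rule real_nat_ceiling_ge)
      also have "nat \<lceil>(real K + 1) / \<eta>\<rceil> \<le> n" using n0 by linarith
      then have "real (nat \<lceil>(real K + 1) / \<eta>\<rceil>) \<le> real n" by (simp only: of_nat_le_iff)
      finally show "real K < \<eta> * real n" using b(1) by (simp add: field_simps)
    qed
    define Y where "Y s j = (if j < d then Zc d n (fst s) j else snd s)" for s :: "point set \<times> real" and j
    define a where "a t s j = Y s j / real n - comp d z q j (real t / real n)" for t s j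
    define Inv where "Inv s = (fst s \<subseteq> pspace n d)" for s :: "point set \<times> real"
    have small: "\<bar>a t s j\<bar> \<le> \<epsilon>" if "(\<Sum>j\<in>?J. (a t s j)\<^sup>2) \<le> \<epsilon>\<^sup>2" "j \<in> ?J" for t s j
    proof -
      have "(a t s j)\<^sup>2 \<le> (\<Sum>j\<in>?J. (a t s j)\<^sup>2)" using that(2) by (intro member_le_sum) auto
      then have "(a t s j)\<^sup>2 \<le> \<epsilon>\<^sup>2" using that(1) by linarith
      then show ?thesis using \<epsilon>(1) by (metis abs_le_square_iff abs_of_pos)
    qed
    have "W 0 (pspace n d, 0) \<le> exp ((2 * L + real (card ?J) * A\<^sup>2 + 2 * (real (card ?J))\<^sup>2 * A ^ 4) * X -
        1 / (1 + (2 * A * real (card ?J) + real (card ?J) * A\<^sup>2)) * exp (- (4 * L * real (card ?J) + 8 * A\<^sup>2 * real (card ?J)) * X) * \<epsilon>\<^sup>2 * real n)"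
    proof (rule lyapunov[where a = a and Inv = Inv and N = N and W = W and J = ?J, OF _ n(2) AL \<epsilon>(1)])
      show "\<epsilon> \<le> 1" using \<epsilon> \<epsilon>1 by linarith
      show "W t s \<le> 1" if "Inv s" for t s using W1 that by (cases s) (auto simp: Inv_def)
      show "Inv (pspace n d, 0)" by (simp add: Inv_def)
      show "real N \<le> X * real n" by (rule N)
      have "a 0 (pspace n d, 0) j = 0" for j
        using ivp n d0 unfolding a_def Y_def comp_def ivp_solution_def by (auto simp: Zc_init[OF d0])
      then show "(\<Sum>j\<in>?J. (a 0 (pspace n d, 0) j)\<^sup>2) = 0" by simp
      show "W N s \<le> 0" if s: "Inv s" "(\<Sum>j\<in>?J. (a N s j)\<^sup>2) \<le> \<epsilon>\<^sup>2" for s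
      proof -
        have "\<bar>Zc d n (fst s) j / real n - z j (real N / real n)\<bar> \<le> \<epsilon>" if "j < d" for j
          using small[OF s(2), of j] that by (simp add: a_def Y_def comp_def)
        moreover have "\<bar>snd s / real n - q (real N / real n)\<bar> \<le> \<epsilon>"
          using small[OF s(2), of d] by (simp add: a_def Y_def comp_def)
        ultimately show ?thesis using WN s(1) by (cases s) (auto simp: Inv_def)
      qed
      show "\<exists>E S. expect E S \<and> W t s \<le> E (W (Suc t)) \<and>
         (\<forall>s'\<in>S. Inv s' \<and> (\<forall>j\<in>?J. \<bar>real n * (a (Suc t) s' j - a t s j)\<bar> \<le> A)) \<and>
         (\<forall>j\<in>?J. \<bar>E (\<lambda>s'. real n * (a (Suc t) s' j - a t s j))\<bar> \<le> L * ((\<Sum>j\<in>?J. \<bar>a t s j\<bar>) + 1 / real n))"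
        if t: "t < N" and s: "Inv s" "(\<Sum>j\<in>?J. (a t s j)\<^sup>2) \<le> \<epsilon>\<^sup>2" for t s
      proof -
        obtain P k where sPk: "s = (P, k)" by (cases s)
        have P: "P \<subseteq> pspace n d" using s(1) sPk by (simp add: Inv_def)
        have fin: "finite P" using finite_subset[OF P] by simp
        define x where "x = real t / real n"
        have tN: "real t + 1 \<le> X * real n" using t N by linarith
        have x: "x \<in> {0..X}" using tN n by (auto simp: x_def field_simps)
        define w where "w i = Zc d n P i / real n" for i
        have wz: "\<bar>w i - z i x\<bar> = \<bar>a t s i\<bar>" if "i < d" for i
          using that by (simp add: w_def a_def Y_def comp_def x_def sPk)
        have wz1: "\<bar>w i - z i x\<bar> \<le> \<epsilon>1" if "i < d" for i
          using small[OF s(2), of i] that \<epsilon>(2) by (simp add: wz)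
        have wS: "w \<in> ?S" by (rule near[OF x wz1])
        have "real (card P) = real n * s_fun d 0 w"
          using card_eq_s_fun[OF P d0 n(1)] by (simp add: w_def[abs_def])
        moreover have "\<eta> \<le> s_fun d 0 w" using wS by (simp add: dom_def)
        ultimately have cP: "\<eta> * real n \<le> real (card P)" using n by (simp add: mult.commute)
        then have big: "2 * (1 + 4 * d) < card P" using nK unfolding K_def[symmetric] by linarith
        have "0 < w 0" using wz1[of 0] d0 b(4)[OF x] \<epsilon>1(4) b(2) by linarith
        then have "Zc d n P 0 \<noteq> 0" using n by (auto simp: w_def)
        moreover have "Zc d n P 0 = 0" if "\<nexists>u. cnt P u = d" using that by (simp add: Zc_def)
        ultimately obtain u where u: "cnt P u = d" by blast
        let ?R = "\<lambda>f. rv (step d P u) P f []"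
        let ?g = "\<lambda>ro. (P - pts (snd ro), k + cost ro)"
        have ex: "expect ?R (outs (step d P u) P [])"
          by (rule expect_rv[OF fin dep_step]) (use big in simp)
        define \<beta> where "\<beta> j = real n * (comp d z q j ((real t + 1) / real n) - comp d z q j (real t / real n))" for j
        have dif: "real n * (a (Suc t) (?g ro) j - a t s j)
            = (if j < d then Zc d n (P - pts (snd ro)) j - Zc d n P j else cost ro) + (- \<beta> j)" for ro j
          using n by (simp add: a_def Y_def sPk \<beta>_def field_simps)
        have \<beta>: "\<bar>\<beta> j - rhs d j (\<lambda>i. z i x)\<bar> \<le> Lf * real d * Bf / real n" "\<bar>\<beta> j\<bar> \<le> Bf" if "j \<in> ?J" for j
          using drift[OF tN n(1) that] by (simp_all add: \<beta>_def x_def)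
        show ?thesis
        proof (intro exI conjI ballI)
          show "expect (\<lambda>f. ?R (\<lambda>ro. f (?g ro))) (?g ` outs (step d P u) P [])"
            by (rule expect_image[OF ex])
          show "W t s \<le> ?R (\<lambda>ro. W (Suc t) (?g ro))" using Wstep t P u big sPk by auto
          show "Inv s'" if "s' \<in> ?g ` outs (step d P u) P []" for s'
            using that P by (auto simp: Inv_def)
          show "\<bar>real n * (a (Suc t) s' j - a t s j)\<bar> \<le> A" if s': "s' \<in> ?g ` outs (step d P u) P []" and jJ: "j \<in> ?J" for s' j
          proof -
            obtain ro where ro: "ro \<in> outs (step d P u) P []" "s' = ?g ro" using s' unfolding image_iff by blast
            have "\<bar>if j < d then Zc d n (P - pts (snd ro)) j - Zc d n P j else cost ro\<bar> \<le> real K"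
              using abs_change_le[OF P d u ro(1), of j] abs_cost_le[OF ro(1)] by (simp add: K_def)
            then show ?thesis unfolding ro(2) dif A_def using \<beta>(2)[OF jJ] by linarith
          qed
          show "\<bar>?R (\<lambda>ro. real n * (a (Suc t) (?g ro) j - a t s j))\<bar> \<le> L * ((\<Sum>j\<in>?J. \<bar>a t s j\<bar>) + 1 / real n)"
            if j: "j \<in> ?J" for j
          proof -
            let ?e = "?R (\<lambda>ro. if j < d then Zc d n (P - pts (snd ro)) j - Zc d n P j else cost ro)"
            have "?R (\<lambda>ro. real n * (a (Suc t) (?g ro) j - a t s j)) = ?e + (- \<beta> j)"
              unfolding dif expect_add[OF ex] expect_const[OF ex] ..
            moreover have "\<bar>?e - rhs d j w\<bar> \<le> M / real (card P)"
              using step_drift(1)[OF P d u n(1) big, of j] step_drift(2)[OF P d u n(1) big] unfolding M_def w_def[abs_def] rhs_def by (cases "j < d") auto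
            moreover have "M / real (card P) \<le> M / (\<eta> * real n)"
              using cP b(1) n M0 big by (intro divide_left_mono) (auto intro!: mult_pos_pos)
            moreover have "\<bar>rhs d j w - rhs d j (\<lambda>i. z i x)\<bar> \<le> Lf * (\<Sum>i<d. \<bar>w i - z i x\<bar>)"
              by (rule F(4)[OF j wS zS[OF x]])
            moreover have "(\<Sum>i<d. \<bar>w i - z i x\<bar>) \<le> (\<Sum>j\<in>?J. \<bar>a t s j\<bar>)"
            proof -
              have "(\<Sum>i<d. \<bar>w i - z i x\<bar>) = (\<Sum>i<d. \<bar>a t s i\<bar>)" using wz by simp
              also have "\<dots> \<le> (\<Sum>j\<in>?J. \<bar>a t s j\<bar>)" by (intro sum_mono2) auto
              finally show ?thesis .
            qed
            then have "Lf * (\<Sum>i<d. \<bar>w i - z i x\<bar>) \<le> Lf * (\<Sum>j\<in>?J. \<bar>a t s j\<bar>)"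
              using F(2) by (rule mult_left_mono)
            ultimately have "\<bar>?R (\<lambda>ro. real n * (a (Suc t) (?g ro) j - a t s j))\<bar>
                \<le> M / (\<eta> * real n) + Lf * (\<Sum>j\<in>?J. \<bar>a t s j\<bar>) + Lf * real d * Bf / real n"
              using \<beta>(1)[OF j] by linarith
            also have "\<dots> = Lf * (\<Sum>j\<in>?J. \<bar>a t s j\<bar>) + (M / \<eta> + Lf * real d * Bf) * (1 / real n)"
              by (simp add: algebra_simps)
            also have "\<dots> \<le> L * (\<Sum>j\<in>?J. \<bar>a t s j\<bar>) + L * (1 / real n)"
              using F M0 b(1) n unfolding L_def by (intro add_mono mult_right_mono) (auto simp: sum_nonneg)
            finally show ?thesis by (simp only: distrib_left)
          qed
        qed
      qed
    qed simp
    then show "W 0 (pspace n d, 0) \<le> exp (C - (\<theta> * \<epsilon>\<^sup>2) * real n)"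
      unfolding C_def \<theta>_def mm_def .
  qed
  show ?thesis using \<epsilon>1(1) main by blast
qed

section \<open>A priori bounds for the solution\<close>

lemma Zc_bounds: "0 \<le> Zc d n P j" "Zc d n P j \<le> real n"
proof -
  show "0 \<le> Zc d n P j" unfolding Zc_def by (intro sum_nonneg) auto
  have "Zc d n P j \<le> (\<Sum>v<n. 1)" unfolding Zc_def by (intro sum_mono) auto
  then show "Zc d n P j \<le> real n" by simp
qed

text \<open>
  The trivial choice \<open>W = 1\<close> in \<open>fluid_limit\<close> shows that the process reaches every
  neighbourhood of the solution, so the solution inherits the bounds of the process.
\<close>

lemma ivp_unit_interval:
  assumes ivp: "ivp_solution d T z q" and d: "3 \<le> d" and x: "0 \<le> x" "ereal x < T"
    and pos: "\<And>y. 0 \<le> y \<Longrightarrow> y \<le> x \<Longrightarrow> 0 < z 0 y" and j: "j < d"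
  shows "0 \<le> z j x" "z j x \<le> 1"
proof -
  have "z j x \<in> {0..1}"
  proof (rule ccontr)
    assume nin: "z j x \<notin> {0..1}"
    have "x \<noteq> 0"
    proof
      assume "x = 0"
      then have "z j x = 1 \<or> z j x = 0" using ivp j unfolding ivp_solution_def by (cases "j = 0") auto
      then show False using nin by auto
    qed
    then have x0: "0 < x" using x by simp
    have "open (- {0..1::real})" by (intro open_Compl closed_atLeastAtMost)
    then obtain e where e: "0 < e" "ball (z j x) e \<subseteq> - {0..1}"
      using nin open_contains_ball by (metis ComplI)
    have "continuous (at x within {0..x}) (z j)"
      using continuous_on_ivp(1)[OF ivp x(2) j] x by (auto simp: continuous_on_eq_continuous_within)
    then obtain \<delta> where \<delta>: "0 < \<delta>" "\<And>y. y \<in> {0..x} \<Longrightarrow> dist y x < \<delta> \<Longrightarrow> dist (z j y) (z j x) < e / 2"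
      unfolding continuous_within_eps_delta using e(1) by (meson half_gt_zero)
    obtain \<epsilon>1 where \<epsilon>1: "0 < \<epsilon>1" "\<And>\<epsilon>. 0 < \<epsilon> \<Longrightarrow> \<epsilon> \<le> \<epsilon>1 \<Longrightarrow> tracked d z q x \<epsilon>"
      using fluid_limit[OF ivp x d] pos by blast
    define \<epsilon> where "\<epsilon> = min \<epsilon>1 (e / 4)"
    have \<epsilon>: "0 < \<epsilon>" "\<epsilon> \<le> \<epsilon>1" "\<epsilon> < e / 2" using \<epsilon>1(1) e(1) by (auto simp: \<epsilon>_def min_def)
    obtain C c n0 where c: "0 < c" and fl: "\<And>n N W. n \<ge> n0 \<Longrightarrow> real N \<le> x * real n \<Longrightarrow>
        controlled d z q \<epsilon> n N W \<Longrightarrow> W 0 (pspace n d, 0) \<le> exp (C - c * real n)"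
      using \<epsilon>1(2)[OF \<epsilon>(1,2)] unfolding tracked_def by blast
    obtain n1 :: nat where n1: "C / c < real n1" using reals_Archimedean2 by blast
    obtain n2 :: nat where n2: "1 / \<delta> < real n2" using reals_Archimedean2 by blast
    define n where "n = n0 + n1 + n2 + 1"
    have n: "n0 \<le> n" "C < c * real n" "1 < \<delta> * real n" "0 < n"
    proof -
      have "C / c < real n" using n1 by (simp add: n_def)
      then show "C < c * real n" using c by (simp add: field_simps)
      have "1 / \<delta> < real n" using n2 by (simp add: n_def)
      then show "1 < \<delta> * real n" using \<delta>(1) by (simp add: field_simps)
    qed (auto simp: n_def)
    define N where "N = nat \<lfloor>x * real n\<rfloor>"
    have N: "real N \<le> x * real n" "x * real n < real N + 1" using x0 by (auto simp: N_def)
    let ?y = "real N / real n"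
    have y: "?y \<in> {0..x}" "dist ?y x < \<delta>"
    proof -
      have "x - ?y < \<delta>" "?y \<le> x"
        using N n by (simp_all add: field_simps)
      then show "?y \<in> {0..x}" "dist ?y x < \<delta>" by (auto simp: dist_real_def)
    qed
    have far: "\<not> \<bar>Zc d n P j / real n - z j ?y\<bar> \<le> \<epsilon>" for P
    proof
      assume "\<bar>Zc d n P j / real n - z j ?y\<bar> \<le> \<epsilon>"
      then have "dist (Zc d n P j / real n) (z j x) < e"
        using \<delta>(2)[OF y] \<epsilon>(3) unfolding dist_real_def by linarith
      then have "Zc d n P j / real n \<in> ball (z j x) e" by (simp add: dist_commute)
      then have "Zc d n P j / real n \<notin> {0..1}" using e(2) by blast
      moreover have "Zc d n P j / real n \<in> {0..1}" using Zc_bounds[of d n P j] n by auto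
      ultimately show False by blast
    qed
    \<comment> \<open>If \<open>z j x\<close> lay outside \<open>[0, 1]\<close>, no state could be
      close to the solution at time \<open>N / n\<close>, and the terminal condition of
      \<open>controlled\<close> would be vacuous. Then \<open>W = 1\<close> is admissible, against
      the exponential bound.\<close>
    have "(1::real) \<le> exp (C - c * real n)"
    proof (rule fl[where W = "\<lambda>t s. 1", OF n(1) N(1)], unfold controlled_def, intro conjI)
      show "\<forall>t P k u. t < N \<longrightarrow> P \<subseteq> pspace n d \<longrightarrow> cnt P u = d \<longrightarrow> 2 * (1 + 4 * d) < card P \<longrightarrow>
          (1::real) \<le> rv (step d P u) P (\<lambda>s. 1) []"
      proof (intro allI impI)
        fix P u assume P: "P \<subseteq> pspace n d" "2 * (1 + 4 * d) < card P"
        have "expect (\<lambda>f. rv (step d P u) P f []) (outs (step d P u) P [])"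
          by (rule expect_rv[OF finite_subset[OF P(1)] dep_step]) (use P in simp_all)
        then show "(1::real) \<le> rv (step d P u) P (\<lambda>s. 1) []" by (simp add: expect_def)
      qed
    qed (use far j in blast)+
    then show False using n(2) by simp
  qed
  then show "0 \<le> z j x" "z j x \<le> 1" by auto
qed

text \<open>If \<open>p\<close> is the fraction of unexposed points at untouched vertices, then
  \<open>f_last\<close> equals \<open>1 + p\<close>.\<close>

lemma f_last_bounds:
  assumes w: "\<And>i. i < d \<Longrightarrow> 0 \<le> w i" and s: "0 < s_fun d 0 w" and d: "3 \<le> d"
  shows "1 \<le> f_last d w" "f_last d w \<le> 2"
proof -
  have split: "s_fun d 0 w = real d * w 0 + s_fun d 1 w"
    unfolding s_fun_def by (subst sum.atLeast_Suc_atMost) auto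
  have s1: "0 \<le> s_fun d 1 w" unfolding s_fun_def using w d by (intro sum_nonneg mult_nonneg_nonneg) auto
  have w0: "0 \<le> real d * w 0" using w[of 0] d by simp
  have "f_last d w = (s_fun d 1 w + 2 * (real d * w 0)) / s_fun d 0 w"
    by (simp add: f_last_def add_divide_distrib)
  then show "1 \<le> f_last d w" "f_last d w \<le> 2"
    using s s1 w0 split by (simp_all add: le_divide_eq divide_le_eq)
qed

text \<open>A step uses up at least as many untouched vertices as it chooses: one if the partner is
  touched, two otherwise. All further contributions to the change of \<open>z 0\<close> are
  nonpositive and are dropped.\<close>

lemma f_0_le:
  assumes w: "\<And>i. i < d \<Longrightarrow> 0 \<le> w i" and s: "0 < s_fun d 0 w" and d: "3 \<le> d"
  shows "f_fun d 0 w \<le> - f_last d w"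
proof -
  define p where "p = - (real d * w 0 / s_fun d 0 w)"
  define r where "r = rho d w"
  define R where "R = r ^ (d - 1)"
  have split: "s_fun d 0 w = real d * w 0 + s_fun d 1 w"
    unfolding s_fun_def by (subst sum.atLeast_Suc_atMost) auto
  have s1: "0 \<le> s_fun d 1 w" unfolding s_fun_def using w d by (intro sum_nonneg mult_nonneg_nonneg) auto
  have w0: "0 \<le> real d * w 0" using w[of 0] d by simp
  have p: "p \<le> 0" using w0 s by (simp add: p_def)
  have r: "0 \<le> r" "r \<le> 1" using s1 w0 s split by (simp_all add: r_def rho_def divide_le_eq)
  have R: "0 \<le> R" "R \<le> 1" using r by (simp_all add: R_def power_le_one)
  have p0: "phi d 0 0 w / s_fun d 0 w = p" "phi d 1 0 w = 0" by (simp_all add: phi_def p_def)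
  have R2: "r ^ (2 * d - 2) = R * R" unfolding R_def power_add[symmetric] by (rule arg_cong[where f = "(^) r"]) (use d in simp)
  have di: "0 \<le> real d - real i - 1" if "i \<in> {1..d-1}" for i using that d by auto
  have tm: "(real d - real i) * w i / s_fun d 0 w * (- c + (real d - real i - 1) * p) \<le> - (c * ((real d - real i) * w i / s_fun d 0 w))"
    if "i \<in> {1..d-1}" for i c
  proof -
    have "0 \<le> (real d - real i) * w i / s_fun d 0 w" using w[of i] s that by auto
    moreover have "(real d - real i - 1) * p \<le> 0" using di[OF that] p by (simp add: mult_nonneg_nonpos)
    ultimately have "(real d - real i) * w i / s_fun d 0 w * (- c + (real d - real i - 1) * p) \<le> (real d - real i) * w i / s_fun d 0 w * (- c)"
      by (intro mult_left_mono) auto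
    then show ?thesis by (simp add: mult.commute)
  qed
  have "(\<Sum>i=1..d-1. (real d - real i) * w i / s_fun d 0 w * (- of_bool ((0::nat) = 0) + of_bool ((0::nat) = 1) - of_bool (0 = i) + (real d - real i - 1) * p))
      \<le> (\<Sum>i=1..d-1. - ((real d - real i) * w i / s_fun d 0 w))"
  proof (rule sum_mono)
    fix i assume i: "i \<in> {1..d-1}"
    then have "- of_bool ((0::nat) = 0) + of_bool ((0::nat) = 1) - of_bool (0 = i) = - (1::real)" by simp
    then show "(real d - real i) * w i / s_fun d 0 w * (- of_bool ((0::nat) = 0) + of_bool ((0::nat) = 1) - of_bool (0 = i) + (real d - real i - 1) * p)
      \<le> - ((real d - real i) * w i / s_fun d 0 w)"
      using tm[OF i, of 1] by (simp only: mult_1)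
  qed
  also have "\<dots> = - (s_fun d 1 w / s_fun d 0 w)"
    by (simp add: s_fun_def sum_negf sum_divide_distrib)
  finally have S1: "(\<Sum>i=1..d-1. (real d - real i) * w i / s_fun d 0 w * (- of_bool ((0::nat) = 0) + of_bool ((0::nat) = 1) - of_bool (0 = i) + (real d - real i - 1) * p)) \<le> - (s_fun d 1 w / s_fun d 0 w)" .
  have S2: "(\<Sum>m=1..d-1. (real d - real m) * w m / s_fun d 0 w * (- of_bool (0 = m) + (real d - real m - 1) * p)) \<le> 0"
  proof (rule sum_nonpos)
    fix i assume i: "i \<in> {1..d-1}"
    then have "- of_bool (0 = i) = - (0::real)" by simp
    then show "(real d - real i) * w i / s_fun d 0 w * (- of_bool (0 = i) + (real d - real i - 1) * p) \<le> 0"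
      using tm[OF i, of 0] by (simp only: mult_zero_left minus_zero)
  qed
  have dp: "(real d - 1) * p \<le> 0" using p d by (simp add: mult_nonneg_nonpos)
  have A1: "(1 - R) * (- 2 + (real d - 1) * p) + (real d - 1) * p \<le> (1 - R) * (- 2)"
    using mult_left_mono[of "- 2 + (real d - 1) * p" "- 2" "1 - R"] R dp by simp
  have A2: "R * (1 - R) * (- 2 + (real d - 1) * p) + (real d - 1) * R * p \<le> R * (1 - R) * (- 2)"
  proof -
    have "R * (1 - R) * (- 2 + (real d - 1) * p) \<le> R * (1 - R) * (- 2)"
      using R dp by (intro mult_left_mono) auto
    moreover have "R * ((real d - 1) * p) \<le> 0" using R dp by (simp add: mult_nonneg_nonpos)
    ultimately show ?thesis by (simp add: mult_ac)
  qed
  have A3: "- 2 * (R * R) + 2 * r ^ (2 * d - 3) * (\<Sum>m=1..d-1. (real d - real m) * w m / s_fun d 0 w * (- of_bool (0 = m) + (real d - real m - 1) * p)) \<le> - 2 * (R * R)"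
    using mult_nonneg_nonpos[OF _ S2, of "2 * r ^ (2 * d - 3)"] r by simp
  have "f_fun d 0 w \<le> - (s_fun d 1 w / s_fun d 0 w) + real d * w 0 / s_fun d 0 w * ((1 - R) * (- 2))
      + real d * w 0 / s_fun d 0 w * (R * (1 - R) * (- 2)) + real d * w 0 / s_fun d 0 w * (- 2 * (R * R))"
    unfolding f_fun_def Let_def p0 r_def[symmetric] R_def[symmetric] R2
    using A1 A2 A3 S1 w0 s by (intro add_mono mult_left_mono) auto
  also have "\<dots> = - f_last d w"
  proof -
    \<comment> \<open>The weights of the three cases with an untouched partner add up to 1:
      \<open>(1 - R) + R * (1 - R) + R * R = 1\<close>.\<close>
    have "- S + V * ((1 - R) * - 2) + V * (R * (1 - R) * - 2) + V * (- 2 * (R * R)) = - (S + 2 * V)" for S V :: real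
      by (simp add: algebra_simps)
    moreover have "f_last d w = s_fun d 1 w / s_fun d 0 w + 2 * (real d * w 0 / s_fun d 0 w)"
      by (simp add: f_last_def)
    ultimately show ?thesis by (simp only:)
  qed
  finally show ?thesis .
qed

lemma bounded_mono_limit_at_left:
  fixes g :: "real \<Rightarrow> real"
  assumes "0 < X" "\<And>x y. 0 \<le> x \<Longrightarrow> x \<le> y \<Longrightarrow> y < X \<Longrightarrow> g x \<le> g y" "\<And>x. 0 \<le> x \<Longrightarrow> x < X \<Longrightarrow> g x \<le> B"
  obtains L where "(g \<longlongrightarrow> L) (at_left X)" "\<And>x. 0 \<le> x \<Longrightarrow> x < X \<Longrightarrow> g x \<le> L" "L \<le> B"
proof -
  define L where "L = Sup (g ` {0..<X})"
  have bdd: "bdd_above (g ` {0..<X})" using assms(3) by (intro bdd_aboveI[of _ B]) auto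
  have le: "g x \<le> L" if "0 \<le> x" "x < X" for x
    unfolding L_def using that bdd by (intro cSup_upper) auto
  have "(g \<longlongrightarrow> L) (at_left X)"
  proof (rule increasing_tendsto)
    show "\<forall>\<^sub>F x in at_left X. g x \<le> L"
      unfolding eventually_at_left[OF assms(1)] using le assms(1) by (intro exI[of _ 0]) auto
    fix l assume "l < L"
    then obtain y where y: "0 \<le> y" "y < X" "l < g y"
      unfolding L_def using less_cSup_iff[OF _ bdd] assms(1) by auto
    then show "\<forall>\<^sub>F x in at_left X. l < g x"
      unfolding eventually_at_left[OF assms(1)] using assms(2) by (intro exI[of _ y]) (auto intro: less_le_trans)
  qed
  moreover have "L \<le> B" unfolding L_def using assms(1,3) by (intro cSup_least) auto
  ultimately show ?thesis using that le by blast
qed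

lemma continuous_on_Lipschitz_comp:
  fixes G :: "(nat \<Rightarrow> real) \<Rightarrow> real"
  assumes G: "\<And>w w'. \<bar>G w - G w'\<bar> \<le> L * (\<Sum>i<d. \<bar>w i - w' i\<bar>)"
    and u: "\<And>i. i < d \<Longrightarrow> continuous_on A (u i)"
  shows "continuous_on A (\<lambda>s. G (\<lambda>i. u i s))"
  unfolding continuous_on_def
proof
  fix s assume s: "s \<in> A"
  have "((\<lambda>t. L * (\<Sum>i<d. \<bar>u i t - u i s\<bar>)) \<longlongrightarrow> L * (\<Sum>i<d. \<bar>u i s - u i s\<bar>)) (at s within A)"
    using u s unfolding continuous_on_def by (intro tendsto_intros) auto
  then have "((\<lambda>t. L * (\<Sum>i<d. \<bar>u i t - u i s\<bar>)) \<longlongrightarrow> 0) (at s within A)" by simp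
  then have "((\<lambda>t. G (\<lambda>i. u i t) - G (\<lambda>i. u i s)) \<longlongrightarrow> 0) (at s within A)"
    by (rule Lim_null_comparison[rotated]) (simp add: G)
  then show "((\<lambda>t. G (\<lambda>i. u i t)) \<longlongrightarrow> G (\<lambda>i. u i s)) (at s within A)"
    by (simp add: LIM_zero_iff)
qed

section \<open>The solution near the end of its interval of existence\<close>

text \<open>Picard iteration: since \<open>L * d * h <= 1 / 2\<close>, consecutive iterates differ
  by at most \<open>M * h / 2 ^ k\<close>, so they converge uniformly and the limit solves the
  integral equation. Coordinate \<open>d\<close> is carried along, although \<open>G\<close> depends
  only on the coordinates below \<open>d\<close>.\<close>

lemma picard:
  fixes G :: "nat \<Rightarrow> (nat \<Rightarrow> real) \<Rightarrow> real" and a :: "nat \<Rightarrow> real"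
  assumes GM: "\<And>j w. j \<le> d \<Longrightarrow> \<bar>G j w\<bar> \<le> M"
    and GL: "\<And>j w w'. j \<le> d \<Longrightarrow> \<bar>G j w - G j w'\<bar> \<le> L * (\<Sum>i<d. \<bar>w i - w' i\<bar>)"
    and nn: "0 \<le> M" "0 \<le> L" and h: "0 < h" "L * real d * h \<le> 1 / 2"
  shows "\<exists>y. \<forall>j\<le>d. y j 0 = a j \<and> (\<forall>x\<in>{0..h}. \<bar>y j x - a j\<bar> \<le> M * h \<and>
           (y j has_real_derivative G j (\<lambda>i. y i x)) (at x within {0..h}))"
proof -
  define Y :: "nat \<Rightarrow> nat \<Rightarrow> real \<Rightarrow> real" where "Y = rec_nat (\<lambda>j x. a j) (\<lambda>k f j x. a j + integral {0..x} (\<lambda>s. G j (\<lambda>i. f i s)))"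
  have Y0: "Y 0 j x = a j" and YS: "Y (Suc k) j x = a j + integral {0..x} (\<lambda>s. G j (\<lambda>i. Y k i s))" for k j x
    by (simp_all add: Y_def)
  note Gc = continuous_on_Lipschitz_comp[OF GL]
  have Yc: "j \<le> d \<Longrightarrow> continuous_on {0..h} (Y k j)" for k j
  proof (induction k arbitrary: j)
    case 0
    then show ?case by (simp add: Y0[abs_def])
  next
    case (Suc k)
    have "continuous_on {0..h} (\<lambda>s. G j (\<lambda>i. Y k i s))"
      using Suc by (intro Gc) auto
    then show ?case unfolding YS[abs_def]
      by (intro continuous_intros indefinite_integral_continuous_1 integrable_continuous_interval)
  qed
  have GYc: "continuous_on {0..x} (\<lambda>s. G j (\<lambda>i. Y k i s))" if "j \<le> d" "x \<le> h" for j k x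
    using that by (intro Gc continuous_on_subset[OF Yc]) auto
  have dif: "j \<le> d \<Longrightarrow> x \<in> {0..h} \<Longrightarrow> \<bar>Y (Suc k) j x - Y k j x\<bar> \<le> M * h * (1 / 2) ^ k" for k j x
  proof (induction k arbitrary: j x)
    case 0
    have "norm (integral {0..x} (\<lambda>s. G j (\<lambda>i. Y 0 i s))) \<le> M * (x - 0)"
      using 0 GM by (intro integral_bound GYc) auto
    also have "\<dots> \<le> M * h" using 0 nn by (intro mult_left_mono) auto
    finally show ?case by (simp add: YS Y0)
  next
    case (Suc k)
    have "Y (Suc (Suc k)) j x - Y (Suc k) j x = integral {0..x} (\<lambda>s. G j (\<lambda>i. Y (Suc k) i s) - G j (\<lambda>i. Y k i s))"
    proof -
      have int: "(\<lambda>s. G j (\<lambda>i. Y m i s)) integrable_on {0..x}" for m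
        using Suc.prems by (intro integrable_continuous_interval GYc) auto
      show ?thesis
        by (simp only: integral_diff[OF int int] YS[of "Suc k" j x] YS[of k j x] add_diff_cancel_left)
    qed
    also have "norm \<dots> \<le> (L * (real d * (M * h * (1 / 2) ^ k))) * (x - 0)"
    proof (rule integral_bound)
      show "continuous_on {0..x} (\<lambda>s. G j (\<lambda>i. Y (Suc k) i s) - G j (\<lambda>i. Y k i s))"
        using Suc.prems by (intro continuous_intros GYc) auto
      fix s assume s: "s \<in> {0..x}"
      have "(\<Sum>i<d. \<bar>Y (Suc k) i s - Y k i s\<bar>) \<le> real d * (M * h * (1 / 2) ^ k)"
        using sum_bounded_above[of "{..<d}" "\<lambda>i. \<bar>Y (Suc k) i s - Y k i s\<bar>" "M * h * (1 / 2) ^ k"] Suc.IH s Suc.prems by simp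
      then have "L * (\<Sum>i<d. \<bar>Y (Suc k) i s - Y k i s\<bar>) \<le> L * (real d * (M * h * (1 / 2) ^ k))"
        by (rule mult_left_mono) (rule nn(2))
      then show "norm (G j (\<lambda>i. Y (Suc k) i s) - G j (\<lambda>i. Y k i s)) \<le> L * (real d * (M * h * (1 / 2) ^ k))"
        unfolding real_norm_def by (rule order_trans[OF GL[OF Suc.prems(1)]])
    qed (use Suc.prems in auto)
    also have "\<dots> \<le> (L * (real d * (M * h * (1 / 2) ^ k))) * h"
      using Suc.prems nn h by (intro mult_left_mono) auto
    also have "\<dots> = (L * real d * h) * (M * h * (1 / 2) ^ k)" by simp
    also have "\<dots> \<le> (1 / 2) * (M * h * (1 / 2) ^ k)" using h nn by (intro mult_right_mono) auto
    finally show ?case by simp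
  qed
  define y where "y j x = a j + (\<Sum>k. Y (Suc k) j x - Y k j x)" for j x
  have ulim: "uniform_limit {0..h} (\<lambda>n. Y n j) (y j) sequentially" if j: "j \<le> d" for j
  proof -
    have "uniform_limit {0..h} (\<lambda>n x. \<Sum>k<n. Y (Suc k) j x - Y k j x) (\<lambda>x. \<Sum>k. Y (Suc k) j x - Y k j x) sequentially"
    proof (rule Weierstrass_m_test)
      show "norm (Y (Suc k) j x - Y k j x) \<le> M * h * (1 / 2) ^ k" if "x \<in> {0..h}" for k x
        using dif[OF j that] by simp
      show "summable (\<lambda>k. M * h * (1 / 2 :: real) ^ k)" by (intro summable_mult summable_geometric) simp
    qed
    from uniform_limit_add[OF uniform_limit_const this, of "\<lambda>x. a j"]
    have "uniform_limit {0..h} (\<lambda>n x. a j + (\<Sum>k<n. Y (Suc k) j x - Y k j x)) (y j) sequentially"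
      by (simp only: y_def[abs_def])
    moreover have "a j + (\<Sum>k<n. Y (Suc k) j x - Y k j x) = Y n j x" for n x
      by (induction n) (simp_all add: Y0)
    ultimately show ?thesis by simp
  qed
  have yc: "continuous_on {0..h} (y j)" if "j \<le> d" for j
    by (rule uniform_limit_theorem[OF _ ulim[OF that]]) (use Yc that in auto)
  have Gyc: "continuous_on {0..x} (\<lambda>s. G j (\<lambda>i. y i s))" if "j \<le> d" "x \<le> h" for j x
    using that by (intro Gc continuous_on_subset[OF yc]) auto
  have Glim: "uniform_limit {0..x} (\<lambda>n s. G j (\<lambda>i. Y n i s)) (\<lambda>s. G j (\<lambda>i. y i s)) sequentially"
    if j: "j \<le> d" and x: "x \<le> h" for j x
  proof (rule uniform_limitI)
    fix e :: real assume e: "0 < e"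
    define e' where "e' = e / (L * real d + 1)"
    have Ld: "0 < L * real d + 1" using nn(2) by (intro add_nonneg_pos mult_nonneg_nonneg) auto
    have e': "0 < e'" "L * (real d * e') < e"
    proof -
      show "0 < e'" using e Ld by (simp add: e'_def)
      have "L * real d * e < (L * real d + 1) * e" using e by (simp add: algebra_simps)
      then show "L * (real d * e') < e" unfolding e'_def using Ld by (simp add: field_simps)
    qed
    have "\<forall>\<^sub>F n in sequentially. \<forall>i\<in>{..<d}. \<forall>s\<in>{0..h}. dist (Y n i s) (y i s) < e'"
      by (intro eventually_ball_finite ballI uniform_limitD[OF ulim e'(1)]) auto
    then show "\<forall>\<^sub>F n in sequentially. \<forall>s\<in>{0..x}. dist (G j (\<lambda>i. Y n i s)) (G j (\<lambda>i. y i s)) < e"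
    proof (rule eventually_mono, intro ballI)
      fix n s assume n: "\<forall>i\<in>{..<d}. \<forall>s\<in>{0..h}. dist (Y n i s) (y i s) < e'" and s: "s \<in> {0..x}"
      have sh: "s \<in> {0..h}" using s x by auto
      have "(\<Sum>i<d. \<bar>Y n i s - y i s\<bar>) \<le> real d * e'"
        using sum_bounded_above[of "{..<d}" "\<lambda>i. \<bar>Y n i s - y i s\<bar>" e'] n sh by (force simp: dist_real_def)
      then have "L * (\<Sum>i<d. \<bar>Y n i s - y i s\<bar>) \<le> L * (real d * e')" using nn(2) by (rule mult_left_mono)
      then show "dist (G j (\<lambda>i. Y n i s)) (G j (\<lambda>i. y i s)) < e"
        using GL[OF j, of "\<lambda>i. Y n i s" "\<lambda>i. y i s"] e'(2) unfolding dist_real_def by linarith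
    qed
  qed
  have yint: "y j x = a j + integral {0..x} (\<lambda>s. G j (\<lambda>i. y i s))" if j: "j \<le> d" and x: "x \<in> {0..h}" for j x
  proof -
    have xh: "x \<le> h" using x by simp
    obtain I J where IJ: "\<And>n. ((\<lambda>s. G j (\<lambda>i. Y n i s)) has_integral I n) {0..x}"
      "((\<lambda>s. G j (\<lambda>i. y i s)) has_integral J) {0..x}" "I \<longlonglongrightarrow> J"
      by (rule uniform_limit_integral[OF Glim[OF j xh] GYc[OF j xh]]) auto
    have "(\<lambda>n. a j + I n) \<longlonglongrightarrow> a j + J" by (intro tendsto_intros IJ(3))
    moreover have "a j + I n = Y (Suc n) j x" for n using integral_unique[OF IJ(1)] by (simp add: YS)
    moreover have "(\<lambda>n. Y (Suc n) j x) \<longlonglongrightarrow> y j x"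
      using tendsto_uniform_limitI[OF ulim[OF j] x] by (rule LIMSEQ_Suc)
    ultimately have "y j x = a j + J" using LIMSEQ_unique by auto
    then show ?thesis using integral_unique[OF IJ(2)] by simp
  qed
  show ?thesis
  proof (intro exI[of _ y] allI impI conjI ballI)
    fix j assume j: "j \<le> d"
    show "y j 0 = a j" using yint[OF j, of 0] h by simp
    fix x assume x: "x \<in> {0..h}"
    have "norm (integral {0..x} (\<lambda>s. G j (\<lambda>i. y i s))) \<le> M * (x - 0)"
      using x GM[OF j] by (intro integral_bound Gyc j) auto
    also have "\<dots> \<le> M * h" using x nn by (intro mult_left_mono) auto
    finally show "\<bar>y j x - a j\<bar> \<le> M * h" by (simp add: yint[OF j x])
    have "((\<lambda>x. integral {0..x} (\<lambda>s. G j (\<lambda>i. y i s))) has_real_derivative G j (\<lambda>i. y i x)) (at x within {0..h})"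
      by (rule integral_has_real_derivative[OF Gyc[OF j order_refl] x])
    from DERIV_add[OF DERIV_const this, of "a j"]
    have "((\<lambda>x. a j + integral {0..x} (\<lambda>s. G j (\<lambda>i. y i s))) has_real_derivative G j (\<lambda>i. y i x)) (at x within {0..h})"
      by (simp only: add_0)
    then show "(y j has_real_derivative G j (\<lambda>i. y i x)) (at x within {0..h})"
      by (rule has_field_derivative_transform_within[OF _ zero_less_one x]) (simp only: yint[OF j])
  qed
qed

text \<open>The right-hand sides are controlled only near \<open>a\<close>, so the argument is first
  clamped by \<open>cl\<close> to a box of radius \<open>r\<close> around \<open>a\<close>; this
  gives globally bounded Lipschitz functions for \<open>picard\<close>. As
  \<open>M * h <= r\<close>, the solution stays in the box and the clamp has no effect on
  it.\<close>

lemma local_solution: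
  assumes d: "0 < d" and \<eta>: "0 < \<eta>" "2 * \<eta> \<le> s_fun d 0 a" and B: "\<And>i. i < d \<Longrightarrow> \<bar>a i\<bar> \<le> B"
  shows "\<exists>h>0. \<exists>y. \<forall>x\<in>{0..h}. 0 < s_fun d 0 (\<lambda>i. y i x) \<and>
     (\<forall>j\<le>d. y j 0 = a j \<and> (y j has_real_derivative rhs d j (\<lambda>i. y i x)) (at x within {0..h}))"
proof -
  define r where "r = min 1 (\<eta> / (real d * real d))"
  have r: "0 < r" "r \<le> 1" "real d * real d * r \<le> \<eta>"
  proof -
    show "0 < r" "r \<le> 1" using \<eta> d by (auto simp: r_def)
    have "r \<le> \<eta> / (real d * real d)" by (simp add: r_def)
    then show "real d * real d * r \<le> \<eta>" using d by (simp add: field_simps)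
  qed
  let ?S = "dom d \<eta> (B + 1)"
  define cl where "cl w = (\<lambda>i. min (max (w i) (a i - r)) (a i + r))" for w :: "nat \<Rightarrow> real"
  have near: "w \<in> ?S" if w: "\<And>i. i < d \<Longrightarrow> \<bar>w i - a i\<bar> \<le> r" for w
  proof -
    have "\<bar>s_fun d 0 w - s_fun d 0 a\<bar> \<le> real d * real d * r" by (rule s_fun_close[OF w d])
    then have "\<eta> \<le> s_fun d 0 w" using \<eta>(2) r(3) by linarith
    moreover have "\<bar>w i\<bar> \<le> B + 1" if "i < d" for i using w[OF that] B[OF that] r(2) by linarith
    ultimately show ?thesis by (simp add: dom_def)
  qed
  have clS: "cl w \<in> ?S" for w
    using r(1) by (intro near) (auto simp: cl_def)
  have cl_le: "\<bar>cl w i - cl w' i\<bar> \<le> \<bar>w i - w' i\<bar>" for w w' i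
    by (auto simp: cl_def min_def max_def)
  have lbr: "bounded_lipschitz d ?S (rhs d j)" if "j \<in> {..d}" for j
    using bounded_lipschitz_f[OF d \<eta>(1)] that by (cases "j < d") (auto simp: rhs_def fun_eq_iff)
  have "\<exists>B' L. 0 \<le> B' \<and> 0 \<le> L \<and> (\<forall>j\<in>{..d}. \<forall>w\<in>?S. \<bar>rhs d j w\<bar> \<le> B') \<and>
     (\<forall>j\<in>{..d}. \<forall>w\<in>?S. \<forall>w'\<in>?S. \<bar>rhs d j w - rhs d j w'\<bar> \<le> L * (\<Sum>i<d. \<bar>w i - w' i\<bar>))"
    by (rule bounded_lipschitz_uniform[OF finite_atMost lbr])
  then obtain M L where F': "0 \<le> M \<and> 0 \<le> L \<and> (\<forall>j\<in>{..d}. \<forall>w\<in>?S. \<bar>rhs d j w\<bar> \<le> M) \<and>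
     (\<forall>j\<in>{..d}. \<forall>w\<in>?S. \<forall>w'\<in>?S. \<bar>rhs d j w - rhs d j w'\<bar> \<le> L * (\<Sum>i<d. \<bar>w i - w' i\<bar>))"
    by (elim exE)
  have F: "0 \<le> M" "0 \<le> L" "\<And>j w. j \<le> d \<Longrightarrow> w \<in> ?S \<Longrightarrow> \<bar>rhs d j w\<bar> \<le> M"
    "\<And>j w w'. j \<le> d \<Longrightarrow> w \<in> ?S \<Longrightarrow> w' \<in> ?S \<Longrightarrow> \<bar>rhs d j w - rhs d j w'\<bar> \<le> L * (\<Sum>i<d. \<bar>w i - w' i\<bar>)"
    using F' by (auto simp: Ball_def)
  define h where "h = min (r / (M + 1)) (1 / (2 * (L * real d + 1)))"
  have Ld: "0 \<le> L * real d" using F(2) by simp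
  have h: "0 < h" "M * h \<le> r" "L * real d * h \<le> 1 / 2"
  proof -
    show "0 < h" using r(1) F(1) Ld by (simp add: h_def)
    have "h \<le> r / (M + 1)" by (simp add: h_def)
    then have "(M + 1) * h \<le> r" using F(1) by (simp add: field_simps)
    then show "M * h \<le> r" using \<open>0 < h\<close> by (simp add: algebra_simps)
    have "h \<le> 1 / (2 * (L * real d + 1))" by (simp add: h_def)
    then have "2 * (L * real d + 1) * h \<le> 1" using Ld by (simp add: field_simps)
    then show "L * real d * h \<le> 1 / 2" using \<open>0 < h\<close> by (simp add: algebra_simps)
  qed
  have "\<exists>y. \<forall>j\<le>d. y j 0 = a j \<and> (\<forall>x\<in>{0..h}. \<bar>y j x - a j\<bar> \<le> M * h \<and>
           (y j has_real_derivative rhs d j (cl (\<lambda>i. y i x))) (at x within {0..h}))"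
  proof (rule picard[where G = "\<lambda>j w. rhs d j (cl w)" and L = L])
    show "\<bar>rhs d j (cl w)\<bar> \<le> M" if "j \<le> d" for j w by (rule F(3)[OF that clS])
    show "\<bar>rhs d j (cl w) - rhs d j (cl w')\<bar> \<le> L * (\<Sum>i<d. \<bar>w i - w' i\<bar>)" if "j \<le> d" for j w w'
      by (rule order_trans[OF F(4)[OF that clS clS]], intro mult_left_mono sum_mono cl_le F(2))
  qed (use F h in auto)
  then obtain y where y: "\<And>j. j \<le> d \<Longrightarrow> y j 0 = a j" "\<And>j x. j \<le> d \<Longrightarrow> x \<in> {0..h} \<Longrightarrow> \<bar>y j x - a j\<bar> \<le> M * h"
    "\<And>j x. j \<le> d \<Longrightarrow> x \<in> {0..h} \<Longrightarrow> (y j has_real_derivative rhs d j (cl (\<lambda>i. y i x))) (at x within {0..h})"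
    by blast
  have yS: "(\<lambda>i. y i x) \<in> ?S" if "x \<in> {0..h}" for x
    using y(2)[OF _ that] h(2) by (intro near) (meson less_imp_le order_trans)
  have "rhs d j (cl (\<lambda>i. y i x)) = rhs d j (\<lambda>i. y i x)" if j: "j \<le> d" and x: "x \<in> {0..h}" for j x
  proof -
    have "cl (\<lambda>i. y i x) i = y i x" if "i < d" for i
      using y(2)[of i x] that x h(2) by (auto simp: cl_def min_def max_def abs_le_iff)
    then have "(\<Sum>i<d. \<bar>cl (\<lambda>i. y i x) i - y i x\<bar>) = 0" by simp
    then show ?thesis using F(4)[OF j clS yS[OF x], of "\<lambda>i. y i x"] by simp
  qed
  then have "\<forall>x\<in>{0..h}. 0 < s_fun d 0 (\<lambda>i. y i x) \<and>
     (\<forall>j\<le>d. y j 0 = a j \<and> (y j has_real_derivative rhs d j (\<lambda>i. y i x)) (at x within {0..h}))"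
    using y(1,3) yS \<eta>(1) unfolding dom_def by force
  then show ?thesis using h(1) by blast
qed

lemma s_fun_cong: "0 < d \<Longrightarrow> (\<And>i. i < d \<Longrightarrow> w i = w' i) \<Longrightarrow> s_fun d 0 w = s_fun d 0 w'"
  unfolding s_fun_def by (intro sum.cong) auto

lemma bounded_lipschitz_rhs: "0 < d \<Longrightarrow> 0 < \<eta> \<Longrightarrow> bounded_lipschitz d (dom d \<eta> B) (rhs d j)"
  using bounded_lipschitz_f[of d \<eta>] by (cases "j < d") (auto simp: rhs_def fun_eq_iff)

text \<open>Agreement below \<open>d\<close> is distance 0 in the Lipschitz estimate.\<close>

lemma rhs_cong:
  assumes d: "0 < d" and eq: "\<And>i. i < d \<Longrightarrow> w i = w' i" and s: "0 < s_fun d 0 w"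
  shows "rhs d j w = rhs d j w'"
proof -
  have "\<bar>w i\<bar> \<le> (\<Sum>i<d. \<bar>w i\<bar>)" if "i < d" for i
    using member_le_sum[of i "{..<d}" "\<lambda>i. \<bar>w i\<bar>"] that by auto
  then have D: "w \<in> dom d (s_fun d 0 w) (\<Sum>i<d. \<bar>w i\<bar>)" "w' \<in> dom d (s_fun d 0 w) (\<Sum>i<d. \<bar>w i\<bar>)"
    using eq s_fun_cong[OF d eq] by (auto simp: dom_def)
  obtain L where "\<bar>rhs d j w - rhs d j w'\<bar> \<le> L * (\<Sum>i<d. \<bar>w i - w' i\<bar>)"
    using bounded_lipschitz_rhs[OF d s, of "\<Sum>i<d. \<bar>w i\<bar>" j] D unfolding bounded_lipschitz_def by blast
  then show ?thesis using eq by simp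
qed

lemma tendsto_s_fun:
  assumes "0 < d" "\<And>i. i < d \<Longrightarrow> (u i \<longlongrightarrow> a i) F"
  shows "((\<lambda>t. s_fun d 0 (\<lambda>i. u i t)) \<longlongrightarrow> s_fun d 0 a) F"
  unfolding s_fun_def using assms by (intro tendsto_intros) auto

lemma tendsto_rhs:
  assumes d: "0 < d" and u: "\<And>i. i < d \<Longrightarrow> (u i \<longlongrightarrow> a i) F" and s: "0 < s_fun d 0 a"
  shows "((\<lambda>t. rhs d j (\<lambda>i. u i t)) \<longlongrightarrow> rhs d j a) F"
proof -
  define B where "B = (\<Sum>i<d. \<bar>a i\<bar>) + 1"
  let ?S = "dom d (s_fun d 0 a / 2) B"
  have s2: "0 < s_fun d 0 a / 2" using s by simp
  have aB: "\<bar>a i\<bar> < B" if "i < d" for i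
    using member_le_sum[of i "{..<d}" "\<lambda>i. \<bar>a i\<bar>"] that by (auto simp: B_def)
  have aS: "a \<in> ?S" using s aB by (auto simp: dom_def less_imp_le)
  have "\<forall>\<^sub>F t in F. s_fun d 0 a / 2 < s_fun d 0 (\<lambda>i. u i t)"
    by (rule order_tendstoD(1)[OF tendsto_s_fun[OF d u]]) (use s in auto)
  moreover have "\<forall>\<^sub>F t in F. \<forall>i\<in>{..<d}. \<bar>u i t\<bar> < B"
    using u aB by (intro eventually_ball_finite ballI order_tendstoD(2)[OF tendsto_rabs]) auto
  ultimately have ev: "\<forall>\<^sub>F t in F. (\<lambda>i. u i t) \<in> ?S"
    by eventually_elim (auto simp: dom_def less_imp_le)
  obtain L where L: "\<forall>w\<in>?S. \<forall>w'\<in>?S. \<bar>rhs d j w - rhs d j w'\<bar> \<le> L * (\<Sum>i<d. \<bar>w i - w' i\<bar>)"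
    using bounded_lipschitz_rhs[OF d s2, of B j] unfolding bounded_lipschitz_def by blast
  have "((\<lambda>t. L * (\<Sum>i<d. \<bar>u i t - a i\<bar>)) \<longlongrightarrow> L * (\<Sum>i<d. \<bar>a i - a i\<bar>)) F"
    using u by (intro tendsto_intros) auto
  then have "((\<lambda>t. L * (\<Sum>i<d. \<bar>u i t - a i\<bar>)) \<longlongrightarrow> 0) F" by simp
  moreover have "\<forall>\<^sub>F t in F. norm (rhs d j (\<lambda>i. u i t) - rhs d j a) \<le> L * (\<Sum>i<d. \<bar>u i t - a i\<bar>)"
    using ev by (rule eventually_mono) (use L aS in simp)
  ultimately have "((\<lambda>t. rhs d j (\<lambda>i. u i t) - rhs d j a) \<longlongrightarrow> 0) F"
    by (rule Lim_null_comparison[rotated])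
  then show ?thesis by (simp add: LIM_zero_iff)
qed

text \<open>A local solution started at the limit \<open>a\<close> is glued to the given one at
  \<open>X\<close>. Apart from the seam the derivatives are inherited.\<close>

lemma ivp_extension:
  assumes ivp: "ivp_solution d (ereal X) z q" and X: "0 < X" and d: "0 < d"
    and lim: "\<And>j. j \<le> d \<Longrightarrow> (comp d z q j \<longlongrightarrow> a j) (at_left X)" and s: "0 < s_fun d 0 a"
  shows "\<exists>T' z' q'. ereal X < T' \<and> ivp_solution d T' z' q' \<and>
          (\<forall>x. 0 \<le> x \<and> ereal x < ereal X \<longrightarrow> (\<forall>j<d. z' j x = z j x) \<and> q' x = q x)"
proof -
  have aB: "\<bar>a i\<bar> \<le> (\<Sum>i<d. \<bar>a i\<bar>)" if "i < d" for i
    using member_le_sum[of i "{..<d}" "\<lambda>i. \<bar>a i\<bar>"] that by auto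
  have "0 < s_fun d 0 a / 2" "2 * (s_fun d 0 a / 2) \<le> s_fun d 0 a" using s by auto
  from local_solution[OF d this aB] obtain h y where h: "0 < h"
    and y: "\<And>x. x \<in> {0..h} \<Longrightarrow> 0 < s_fun d 0 (\<lambda>i. y i x)" "\<And>j. j \<le> d \<Longrightarrow> y j 0 = a j"
      "\<And>j x. j \<le> d \<Longrightarrow> x \<in> {0..h} \<Longrightarrow> (y j has_real_derivative rhs d j (\<lambda>i. y i x)) (at x within {0..h})"
    by (metis atLeastAtMost_iff less_eq_real_def order_refl)
  have zl: "(z i \<longlongrightarrow> a i) (at_left X)" if "i < d" for i
    using lim[of i] that by (simp add: comp_def)
  define Z where "Z j x = (if x < X then comp d z q j x else y j (x - X))" for j x
  let ?S = "{t. 0 \<le> t \<and> ereal t < ereal (X + h)}"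
  have DS: "(comp d z q j has_real_derivative rhs d j (\<lambda>i. z i x)) (at x within {t. 0 \<le> t \<and> ereal t < ereal X})"
    if "0 \<le> x" "x < X" for x j
    using ivp that unfolding ivp_solution_def comp_def rhs_def by auto
  have sz: "0 < s_fun d 0 (\<lambda>i. z i x)" if "0 \<le> x" "x < X" for x
    using ivp that unfolding ivp_solution_def by auto
  have Zz: "Z i x = z i x" if "i < d" "x < X" for i x using that by (simp add: Z_def comp_def)
  have sZ: "0 < s_fun d 0 (\<lambda>i. Z i x)" if x: "0 \<le> x" "x < X + h" for x
  proof (cases "x < X")
    case True
    then have "s_fun d 0 (\<lambda>i. Z i x) = s_fun d 0 (\<lambda>i. z i x)" by (intro s_fun_cong d) (simp add: Zz)
    then show ?thesis using sz True x by simp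
  next
    case False
    then have "(\<lambda>i. Z i x) = (\<lambda>i. y i (x - X))" by (simp add: Z_def)
    then show ?thesis using y(1)[of "x - X"] False x by simp
  qed
  have right: "((\<lambda>t. y j (t - X)) has_real_derivative rhs d j (\<lambda>i. y i (x - X))) (at x within {X..X + h})"
    if j: "j \<le> d" and x: "X \<le> x" "x < X + h" for j x
  proof -
    have im: "(\<lambda>t. t - X) ` {X..X + h} = {0..h}"
      by (auto simp: image_iff intro!: bexI[of _ "_ + X"])
    have "(y j \<circ> (\<lambda>t. t - X) has_real_derivative rhs d j (\<lambda>i. y i (x - X)) * (1 - 0)) (at x within {X..X + h})"
      by (rule DERIV_image_chain) (use y(3)[OF j, of "x - X"] x in \<open>auto simp: im intro!: derivative_eq_intros\<close>)
    then show ?thesis by (simp add: comp_def o_def)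
  qed
  have DZ: "(Z j has_real_derivative rhs d j (\<lambda>i. Z i x)) (at x within ?S)" if j: "j \<le> d" and x: "0 \<le> x" "x < X + h" for j x
  proof -
    consider "x < X" | "x = X" | "X < x" by linarith
    then show ?thesis
    proof cases
      case 1
      have eq: "at x within ?S = at x within {t. 0 \<le> t \<and> ereal t < ereal X}"
        by (rule at_within_nhd[of _ "{..<X}"]) (use 1 h in auto)
      have "rhs d j (\<lambda>i. Z i x) = rhs d j (\<lambda>i. z i x)"
        by (rule rhs_cong[OF d Zz sZ[OF x]]) (use 1 in auto)
      then show ?thesis unfolding eq
        using DS[OF x(1) 1, of j] by (auto intro: has_field_derivative_transform_within[OF _ zero_less_one] simp: Z_def x 1)
    next
      case 3
      have eq: "at x within ?S = at x within {X..X + h}"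
        by (rule at_within_nhd[of _ "{X<..<X + h}"]) (use 3 x X in auto)
      have Zy: "(\<lambda>i. Z i x) = (\<lambda>i. y i (x - X))" using 3 by (simp add: Z_def)
      show ?thesis unfolding eq Zy
        by (rule has_field_derivative_transform_within[OF right[OF j] zero_less_one]) (use 3 x in \<open>auto simp: Z_def\<close>)
    next
      case 2
      have ZX: "Z i X = a i" if "i \<le> d" for i using y(2)[OF that] by (simp add: Z_def)
      have rX: "rhs d j (\<lambda>i. Z i X) = rhs d j a"
        by (rule rhs_cong[OF d ZX sZ]) (use X h in auto)
      have ya: "rhs d j (\<lambda>i. y i (X - X)) = rhs d j a"
        by (rule rhs_cong[OF d]) (use y(2) y(1)[of 0] h in auto)
      \<comment> \<open>The left derivative at the seam comes from l'Hopital's rule: the derivatives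
        to the left converge, by continuity of the right-hand side at \<open>a\<close>.\<close>
      have "((\<lambda>t. (comp d z q j t - a j) / (t - X)) \<longlongrightarrow> rhs d j a) (at_left X)"
      proof (rule lhopital_left[where f' = "\<lambda>t. rhs d j (\<lambda>i. z i t)" and g' = "\<lambda>t. 1"])
        show "((\<lambda>t. comp d z q j t - a j) \<longlongrightarrow> 0) (at_left X)"
          using tendsto_diff[OF lim[OF j] tendsto_const[of "a j"]] by simp
        show "((\<lambda>t. t - X) \<longlongrightarrow> 0) (at_left X)" by (auto intro!: tendsto_eq_intros)
        show "\<forall>\<^sub>F t in at_left X. t - X \<noteq> 0" using X by (auto simp: eventually_at_left[OF X] intro!: exI[of _ 0])
        show "\<forall>\<^sub>F t in at_left X. DERIV (\<lambda>t. comp d z q j t - a j) t :> rhs d j (\<lambda>i. z i t)"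
          unfolding eventually_at_left[OF X]
        proof (intro exI[of _ 0] conjI allI impI X)
          fix t assume t: "0 < t" "t < X"
          have "at t within {t. 0 \<le> t \<and> ereal t < ereal X} = at t within UNIV"
            by (rule at_within_nhd[of _ "{0<..<X}"]) (use t in auto)
          then show "DERIV (\<lambda>t. comp d z q j t - a j) t :> rhs d j (\<lambda>i. z i t)"
            using DERIV_diff[OF DS[of t j] DERIV_const[of "a j"]] t by simp
        qed
        show "\<forall>\<^sub>F t in at_left X. DERIV (\<lambda>t. t - X) t :> 1"
          by (intro always_eventually allI) (auto intro!: derivative_eq_intros)
        have "((\<lambda>t. rhs d j (\<lambda>i. z i t)) \<longlongrightarrow> rhs d j a) (at_left X)"
          by (rule tendsto_rhs[OF d zl s])
        then show "((\<lambda>t. rhs d j (\<lambda>i. z i t) / 1) \<longlongrightarrow> rhs d j a) (at_left X)" by simp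
      qed auto
      then have "((\<lambda>t. (Z j t - Z j X) / (t - X)) \<longlongrightarrow> rhs d j a) (at_left X)"
        by (rule Lim_transform_eventually)
          (auto simp: eventually_at_left[OF X] Z_def y(2)[OF j] intro!: exI[of _ 0] X)
      then have L: "((\<lambda>t. (Z j t - Z j X) / (t - X)) \<longlongrightarrow> rhs d j a) (at X within {0..<X})"
        by (rule tendsto_within_subset) auto
      have "(Z j has_real_derivative rhs d j (\<lambda>i. y i (X - X))) (at X within {X..X + h})"
        by (rule has_field_derivative_transform_within[OF right[OF j] zero_less_one]) (use h in \<open>auto simp: Z_def\<close>)
      then have R: "((\<lambda>t. (Z j t - Z j X) / (t - X)) \<longlongrightarrow> rhs d j a) (at X within {X..X + h})"
        unfolding ya has_field_derivative_iff .
      have "((\<lambda>t. (Z j t - Z j X) / (t - X)) \<longlongrightarrow> rhs d j a) (at X within {0..<X} \<union> {X..X + h})"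
        unfolding at_within_union by (rule filterlim_sup[OF L R])
      then have "((\<lambda>t. (Z j t - Z j X) / (t - X)) \<longlongrightarrow> rhs d j a) (at X within ?S)"
        by (rule tendsto_within_subset) auto
      then show ?thesis unfolding 2 rX has_field_derivative_iff .
    qed
  qed
  show ?thesis
  proof (intro exI conjI allI impI)
    show "ereal X < ereal (X + h)" using h by simp
    show "ivp_solution d (ereal (X + h)) Z (Z d)"
      unfolding ivp_solution_def
    proof (intro conjI allI ballI impI)
      show "0 < ereal (X + h)" using X h by simp
      show "Z 0 0 = 1" "Z d 0 = 0" using ivp X d unfolding ivp_solution_def by (auto simp: Z_def comp_def)
      show "Z j 0 = 0" if "j \<in> {1..d-1}" for j
        using ivp X that unfolding ivp_solution_def by (auto simp: Z_def comp_def)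
      fix x assume "0 \<le> x \<and> ereal x < ereal (X + h)"
      then have x: "0 \<le> x" "x < X + h" by auto
      show "0 < s_fun d 0 (\<lambda>i. Z i x)" by (rule sZ[OF x])
      show "(Z j has_real_derivative f_fun d j (\<lambda>i. Z i x)) (at x within ?S)" if "j < d" for j
        using DZ[of j x] x that by (simp add: rhs_def)
      show "(Z d has_real_derivative f_last d (\<lambda>i. Z i x)) (at x within ?S)"
        using DZ[of d x] x by (simp add: rhs_def)
    qed
    fix x assume "0 \<le> x \<and> ereal x < ereal X"
    then show "Z d x = q x" "\<And>j. j < d \<Longrightarrow> Z j x = z j x" by (auto simp: Z_def comp_def)
  qed
qed

section \<open>The zero of \<open>z 0\<close>\<close>

lemma bounded_mono_limit_ex:
  fixes g :: "real \<Rightarrow> real"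
  assumes "0 < X" "\<And>x y. 0 \<le> x \<Longrightarrow> x \<le> y \<Longrightarrow> y < X \<Longrightarrow> g x \<le> g y" "\<And>x. 0 \<le> x \<Longrightarrow> x < X \<Longrightarrow> g x \<le> B"
  shows "\<exists>L. (g \<longlongrightarrow> L) (at_left X) \<and> (\<forall>x. 0 \<le> x \<longrightarrow> x < X \<longrightarrow> g x \<le> L) \<and> L \<le> B"
  by (rule bounded_mono_limit_at_left[of X g B, OF assms]) auto

text \<open>\<open>X\<close> is the end of the interval on which \<open>z 0\<close> is positive. By
  \<open>f_0_le\<close> and \<open>f_last_bounds\<close>, \<open>z 0 x <= 1 - x\<close> there, so
  \<open>X\<close> is at most 1. If \<open>X\<close> lies inside the interval of existence,
  \<open>z 0\<close> vanishes there by continuity. Otherwise \<open>X\<close> is its endpoint, where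
  monotonicity gives limits of \<open>q\<close> and \<open>z 0\<close>, and maximality excludes a
  positive limit of \<open>z 0\<close>.\<close>

lemma ivp_end:
  assumes max: "maximal_ivp_solution d T z q" and d: "3 \<le> d"
  shows "\<exists>X>0. (\<forall>y<X. ereal y < T) \<and> (\<forall>y. 0 \<le> y \<longrightarrow> y < X \<longrightarrow> 0 < z 0 y) \<and>
    (z 0 \<longlongrightarrow> 0) (at_left X) \<and> (q \<longlongrightarrow> q_star T z q) (at_left X)"
proof -
  have ivp: "ivp_solution d T z q" using max by (simp add: maximal_ivp_solution_def)
  have d0: "0 < d" using d by simp
  have T0: "0 < T" and z00: "z 0 0 = 1" and q0: "q 0 = 0" using ivp by (simp_all add: ivp_solution_def)
  define S where "S = {x. 0 \<le> x \<and> ereal x < T \<and> (\<forall>y. 0 \<le> y \<longrightarrow> y \<le> x \<longrightarrow> 0 < z 0 y)}"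
  have unit: "0 \<le> z j x \<and> z j x \<le> 1" if "x \<in> S" "j < d" for x j
    using ivp_unit_interval[OF ivp d, of x j] that by (auto simp: S_def)
  have Sdown: "y \<in> S" if "x \<in> S" "0 \<le> y" "y \<le> x" for x y
  proof -
    have "ereal y \<le> ereal x" using that by simp
    moreover have "ereal x < T" using that by (simp add: S_def)
    ultimately have "ereal y < T" by (rule le_less_trans)
    then show ?thesis using that by (auto simp: S_def)
  qed
  have slope: "z 0 t - z 0 s \<le> - (q t - q s)" "t - s \<le> q t - q s" "q t - q s \<le> 2 * (t - s)"
    if st: "0 \<le> s" "s \<le> t" "t \<in> S" for s t
  proof -
    have "z 0 t - z 0 s \<le> - (q t - q s) \<and> t - s \<le> q t - q s \<and> q t - q s \<le> 2 * (t - s)"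
    proof (cases "s = t")
      case False
      then have st': "s < t" using st by simp
      let ?g = "\<lambda>x. (z 0 x + q x)"
      have tT: "ereal t < T" using st by (simp add: S_def)
      have sub: "{s..t} \<subseteq> {t. 0 \<le> t \<and> ereal t < T}"
        using st(1) tT by (auto intro: le_less_trans[OF ereal_less_eq(3)[THEN iffD2]])
      have dz: "(z 0 has_real_derivative f_fun d 0 (\<lambda>i. z i x)) (at x within {s..t})"
        and dq: "(q has_real_derivative f_last d (\<lambda>i. z i x)) (at x within {s..t})" if "x \<in> {s..t}" for x
        using ivp sub that d0 unfolding ivp_solution_def by (blast intro: DERIV_subset)+
      have fx: "f_fun d 0 (\<lambda>i. z i x) \<le> - f_last d (\<lambda>i. z i x)" "1 \<le> f_last d (\<lambda>i. z i x)" "f_last d (\<lambda>i. z i x) \<le> 2"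
        if "x \<in> {s..t}" for x
      proof -
        have xS: "x \<in> S" using Sdown[OF st(3), of x] that st by auto
        have "0 < s_fun d 0 (\<lambda>i. z i x)" using ivp xS unfolding ivp_solution_def S_def by auto
        then show "f_fun d 0 (\<lambda>i. z i x) \<le> - f_last d (\<lambda>i. z i x)" "1 \<le> f_last d (\<lambda>i. z i x)" "f_last d (\<lambda>i. z i x) \<le> 2"
          using f_0_le[of d "\<lambda>i. z i x"] f_last_bounds[of d "\<lambda>i. z i x"] unit[OF xS] d by auto
      qed
      have "\<exists>x\<in>{s<..<t}. ?g t - ?g s = (f_fun d 0 (\<lambda>i. z i x) + f_last d (\<lambda>i. z i x)) * (t - s)"
        by (rule mvt_simple[OF st', where f' = "\<lambda>x. (*) (f_fun d 0 (\<lambda>i. z i x) + f_last d (\<lambda>i. z i x))"])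
          (use DERIV_add[OF dz dq] in \<open>simp add: has_field_derivative_def\<close>)
      then obtain x where x: "x \<in> {s<..<t}" "?g t - ?g s = (f_fun d 0 (\<lambda>i. z i x) + f_last d (\<lambda>i. z i x)) * (t - s)" by blast
      have "?g t - ?g s \<le> 0" unfolding x(2) using fx(1)[of x] x(1) st' by (intro mult_nonpos_nonneg) auto
      moreover have "\<exists>x\<in>{s<..<t}. q t - q s = f_last d (\<lambda>i. z i x) * (t - s)"
        by (rule mvt_simple[OF st', where f' = "\<lambda>x. (*) (f_last d (\<lambda>i. z i x))"])
          (use dq in \<open>simp add: has_field_derivative_def\<close>)
      then obtain x where x: "x \<in> {s<..<t}" "q t - q s = f_last d (\<lambda>i. z i x) * (t - s)" by blast
      have "1 * (t - s) \<le> q t - q s" "q t - q s \<le> 2 * (t - s)"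
        unfolding x(2) using fx(2,3)[of x] x(1) st' by (intro mult_right_mono; simp)+
      ultimately show ?thesis by simp
    qed simp
    then show "z 0 t - z 0 s \<le> - (q t - q s)" "t - s \<le> q t - q s" "q t - q s \<le> 2 * (t - s)" by auto
  qed
  have S0: "0 \<in> S" using T0 z00 by (auto simp: S_def zero_ereal_def)
  have S1: "x < 1" if "x \<in> S" for x
  proof -
    have "0 \<le> x" "0 < z 0 x" using that by (auto simp: S_def)
    then show ?thesis using slope(1,2)[of 0 x] that z00 by simp
  qed
  define X where "X = Sup S"
  have bdd: "bdd_above S" by (rule bdd_aboveI[of _ 1]) (rule less_imp_le[OF S1])
  have XS: "y \<in> S" if "0 \<le> y" "y < X" for y
  proof -
    have "S \<noteq> {}" using S0 by blast
    from less_cSup_iff[OF this bdd, of y] that obtain x where "x \<in> S" "y < x" by (auto simp: X_def)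
    then show ?thesis using Sdown[of x y] that by simp
  qed
  have grow: "\<exists>e>0. x + e \<in> S" if x: "x \<in> S" for x
  proof -
    have "ereal x < T" using x by (simp add: S_def)
    then obtain b where b: "x < b" "ereal b < T" using ereal_dense2[of "ereal x" T] by auto
    have x0: "0 \<le> x" "0 < z 0 x" using x by (auto simp: S_def)
    have "continuous (at x within {0..b}) (z 0)"
      using continuous_on_ivp(1)[OF ivp b(2) d0] x0 b by (auto simp: continuous_on_eq_continuous_within)
    then obtain \<delta> where \<delta>: "0 < \<delta>" "\<And>y. y \<in> {0..b} \<Longrightarrow> dist y x < \<delta> \<Longrightarrow> dist (z 0 y) (z 0 x) < z 0 x"
      unfolding continuous_within_eps_delta using x0(2) by meson
    define e where "e = min (\<delta> / 2) (b - x)"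
    have e: "0 < e" "x + e \<le> b" "e < \<delta>" using \<delta>(1) b by (auto simp: e_def min_def)
    have "0 < z 0 y" if "0 \<le> y" "y \<le> x + e" for y
    proof (cases "y \<le> x")
      case False
      then have "dist (z 0 y) (z 0 x) < z 0 x" using that e by (intro \<delta>(2)) (auto simp: dist_real_def)
      then show ?thesis by (simp add: dist_real_def abs_less_iff)
    qed (use x that in \<open>auto simp: S_def\<close>)
    moreover have "ereal (x + e) < T" using e(2) b(2) by (metis ereal_less_eq(3) le_less_trans)
    ultimately show ?thesis using e(1) x0 by (intro exI[of _ e]) (auto simp: S_def)
  qed
  have X0: "0 < X"
  proof -
    obtain e where "0 < e" "0 + e \<in> S" using grow[OF S0] by blast
    then show ?thesis using cSup_upper[OF _ bdd, of e] by (simp add: X_def)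
  qed
  have XnS: "X \<notin> S"
  proof
    assume "X \<in> S"
    then obtain e where "0 < e" "X + e \<in> S" using grow by blast
    then show False using cSup_upper[OF _ bdd, of "X + e"] by (simp add: X_def)
  qed
  have ltT: "ereal y < T" if "y < X" for y
  proof -
    have "max 0 y \<in> S" using XS[of "max 0 y"] that X0 by auto
    then have "ereal (max 0 y) < T" by (simp add: S_def)
    then show ?thesis by (metis ereal_less_eq(3) le_less_trans max.cobounded2)
  qed
  have zpos: "0 < z 0 y" if "0 \<le> y" "y < X" for y using XS[OF that] that by (simp add: S_def)
  have xstar: "x_star T z = X" if "extended_value T (z 0) X 0" and XT: "ereal X \<le> T"
    unfolding x_star_def
  proof (rule cInf_eq_minimum)
    show "X \<in> {x. 0 < x \<and> extended_value T (z 0) x 0}" using that X0 by simp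
    fix x assume x: "x \<in> {x. 0 < x \<and> extended_value T (z 0) x 0}"
    show "X \<le> x"
    proof (rule ccontr)
      assume "\<not> X \<le> x"
      then have "ereal x < T" "z 0 x \<noteq> 0" using ltT[of x] zpos[of x] x by auto
      then show False using x by (auto simp: extended_value_def)
    qed
  qed
  have leftne: "at_left X \<noteq> bot" by (rule trivial_limit_at_left_real)
  show ?thesis
  proof (cases "ereal X < T")
    case True
    have cont: "(g \<longlongrightarrow> g X) (at_left X)" if "continuous_on {0..X} g" for g :: "real \<Rightarrow> real"
      using that X0 unfolding continuous_on_def by (metis at_within_Icc_at_left atLeastAtMost_iff less_imp_le order_refl)
    note cz = cont[OF continuous_on_ivp(1)[OF ivp True d0]] and cq = cont[OF continuous_on_ivp(2)[OF ivp True]]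
    have "0 \<le> z 0 X"
      by (rule tendsto_lowerbound[OF cz _ leftne])
        (auto simp: eventually_at_left[OF X0] intro!: exI[of _ 0] X0 less_imp_le[OF zpos])
    moreover have "\<not> 0 < z 0 X"
    proof
      assume "0 < z 0 X"
      then have "X \<in> S" using True X0 zpos unfolding S_def by (auto simp: le_less)
      then show False using XnS by simp
    qed
    ultimately have zX: "z 0 X = 0" by simp
    have xs: "x_star T z = X" using xstar True zX by (auto simp: extended_value_def)
    have "q_star T z q = q X" unfolding q_star_def xs using True by (auto simp: extended_value_def)
    then show ?thesis using X0 ltT zpos cz cq zX by (intro exI[of _ X]) auto
  next
    case False
    have "\<not> T < ereal X"
    proof
      assume "T < ereal X"
      then obtain y where "T < ereal y" "y < X" using ereal_dense2[of T "ereal X"] by auto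
      then show False using ltT[of y] by simp
    qed
    then have TX: "T = ereal X" using False by auto
    have qmono: "q s \<le> q t" if "0 \<le> s" "s \<le> t" "t < X" for s t
      using slope(2)[of s t] XS[of t] that by auto
    have qbd: "q t \<le> 2 * X" if "0 \<le> t" "t < X" for t
      using slope(3)[of 0 t] XS[OF that] that q0 by auto
    have "\<exists>L. (q \<longlongrightarrow> L) (at_left X) \<and> (\<forall>x. 0 \<le> x \<longrightarrow> x < X \<longrightarrow> q x \<le> L) \<and> L \<le> 2 * X"
      by (rule bounded_mono_limit_ex[OF X0 qmono qbd])
    then obtain Q where Q: "(q \<longlongrightarrow> Q) (at_left X)" by blast
    have zmono: "- z 0 s \<le> - z 0 t" if "0 \<le> s" "s \<le> t" "t < X" for s t
      using slope(1)[of s t] slope(2)[of s t] XS[of t] that by auto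
    have zbd: "- z 0 t \<le> 0" if "0 \<le> t" "t < X" for t using zpos[OF that] by simp
    have "\<exists>L. ((\<lambda>t. - z 0 t) \<longlongrightarrow> L) (at_left X) \<and> (\<forall>x. 0 \<le> x \<longrightarrow> x < X \<longrightarrow> - z 0 x \<le> L) \<and> L \<le> 0"
      by (rule bounded_mono_limit_ex[OF X0 zmono zbd])
    then obtain l where l: "((\<lambda>t. - z 0 t) \<longlongrightarrow> l) (at_left X)" "\<And>x. 0 \<le> x \<Longrightarrow> x < X \<Longrightarrow> - z 0 x \<le> l" "l \<le> 0"
      by auto
    \<comment> \<open>A positive limit of \<open>z 0\<close> would keep \<open>s_fun\<close> away
      from 0 and hence all derivatives bounded; then every coordinate converges at \<open>X\<close>,
      and \<open>ivp_extension\<close> contradicts maximality.\<close>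
    have "l = 0"
    proof (rule ccontr)
      assume "l \<noteq> 0"
      then have l0: "l < 0" using l(3) by simp
      have dl: "0 < real d * - l" using l0 d0 by (intro mult_pos_pos) auto
      let ?S = "dom d (real d * - l) 1"
      have zS: "(\<lambda>i. z i x) \<in> ?S" if x: "0 \<le> x" "x < X" for x
      proof -
        have u: "0 \<le> z i x \<and> z i x \<le> 1" if "i < d" for i by (rule unit[OF XS[OF x] that])
        have "real d * - l \<le> real d * z 0 x" using l(2)[OF x] by (intro mult_left_mono) auto
        also have "\<dots> = (real d - real 0) * z 0 x" by simp
        also have "\<dots> \<le> s_fun d 0 (\<lambda>i. z i x)"
          unfolding s_fun_def using u d0 by (intro member_le_sum) (auto intro!: mult_nonneg_nonneg)
        finally show ?thesis using u by (auto simp: dom_def)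
      qed
      have "\<exists>M L. 0 \<le> M \<and> 0 \<le> L \<and> (\<forall>j\<in>{..d}. \<forall>w\<in>?S. \<bar>rhs d j w\<bar> \<le> M) \<and>
        (\<forall>j\<in>{..d}. \<forall>w\<in>?S. \<forall>w'\<in>?S. \<bar>rhs d j w - rhs d j w'\<bar> \<le> L * (\<Sum>i<d. \<bar>w i - w' i\<bar>))"
        by (rule bounded_lipschitz_uniform[OF finite_atMost bounded_lipschitz_rhs[OF d0 dl]])
      then obtain M where M: "0 \<le> M" "\<And>j w. j \<le> d \<Longrightarrow> w \<in> ?S \<Longrightarrow> \<bar>rhs d j w\<bar> \<le> M" by (auto simp: Ball_def)
      have "\<exists>a. (comp d z q j \<longlongrightarrow> a) (at_left X)" if j: "j \<le> d" for j
      proof (cases "j < d")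
        case True
        \<comment> \<open>Adding \<open>M * t\<close> makes a function with derivative at least
          \<open>- M\<close> monotone, so its limit at the endpoint exists.\<close>
        have gm: "comp d z q j s + M * s \<le> comp d z q j t + M * t" if st: "0 \<le> s" "s \<le> t" "t < X" for s t
        proof (cases "s = t")
          case False
          then obtain \<xi> where \<xi>: "s < \<xi>" "\<xi> < t" "comp d z q j t - comp d z q j s = (t - s) * rhs d j (\<lambda>i. z i \<xi>)"
            using comp_mvt[OF ivp st(1), of t j] st ltT[OF st(3)] by (metis order_le_less)
          have "(t - s) * (- M) \<le> (t - s) * rhs d j (\<lambda>i. z i \<xi>)"
            using M(2)[OF j zS[of \<xi>]] \<xi> st by (intro mult_left_mono) auto
          then show ?thesis using \<xi>(3) by (simp add: algebra_simps)
        qed simp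
        have gb: "comp d z q j t + M * t \<le> 1 + M * X" if "0 \<le> t" "t < X" for t
        proof -
          have "z j t \<le> 1" using unit[OF XS[OF that] True] by simp
          moreover have "M * t \<le> M * X" using M(1) that by (intro mult_left_mono) auto
          ultimately show ?thesis using True by (simp add: comp_def)
        qed
        have "\<exists>L. ((\<lambda>t. comp d z q j t + M * t) \<longlongrightarrow> L) (at_left X) \<and> (\<forall>x. 0 \<le> x \<longrightarrow> x < X \<longrightarrow> comp d z q j x + M * x \<le> L) \<and> L \<le> 1 + M * X"
          by (rule bounded_mono_limit_ex[OF X0 gm gb])
        then obtain a where "((\<lambda>t. comp d z q j t + M * t) \<longlongrightarrow> a) (at_left X)" by blast
        then have "((\<lambda>t. (comp d z q j t + M * t) - M * t) \<longlongrightarrow> a - M * X) (at_left X)"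
          by (intro tendsto_intros)
        then show ?thesis by auto
      next
        case False
        then show ?thesis using Q by (auto simp: comp_def)
      qed
      then obtain a where a: "\<And>j. j \<le> d \<Longrightarrow> (comp d z q j \<longlongrightarrow> a j) (at_left X)" by metis
      have "((\<lambda>t. s_fun d 0 (\<lambda>i. z i t)) \<longlongrightarrow> s_fun d 0 a) (at_left X)"
        using a by (intro tendsto_s_fun[OF d0]) (metis comp_def less_imp_le)
      then have "real d * - l \<le> s_fun d 0 a"
      proof (rule tendsto_lowerbound[OF _ _ leftne])
        show "\<forall>\<^sub>F t in at_left X. real d * - l \<le> s_fun d 0 (\<lambda>i. z i t)"
          unfolding eventually_at_left[OF X0] using zS X0 by (intro exI[of _ 0]) (auto simp: dom_def)
      qed
      then have "0 < s_fun d 0 a" using dl by linarith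
      from ivp_extension[OF ivp[unfolded TX] X0 d0 a this] max show False
        unfolding maximal_ivp_solution_def TX by blast
    qed
    then have z0: "(z 0 \<longlongrightarrow> 0) (at_left X)" using tendsto_minus[OF l(1)] by simp
    have xs: "x_star T z = X" using xstar z0 TX by (auto simp: extended_value_def)
    have "q_star T z q = Q"
      unfolding q_star_def xs
    proof (rule the_equality)
      show "extended_value T q X Q" using Q TX by (simp add: extended_value_def)
      show "y = Q" if "extended_value T q X y" for y
        using that Q TX tendsto_unique[OF leftne] by (auto simp: extended_value_def)
    qed
    then show ?thesis using X0 ltT zpos z0 Q by (intro exI[of _ X]) auto
  qed
qed

section \<open>Simple matchings and regular graphs\<close>

text \<open>The first conjunct excludes loops, the second parallel edges.\<close>

definition simple_m :: "point set set \<Rightarrow> bool" where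
  "simple_m M \<longleftrightarrow> (\<forall>e\<in>M. card (fst ` e) = 2) \<and> inj_on (\<lambda>e. fst ` e) M"

definition graph_of :: "point set set \<Rightarrow> nat set set" where
  "graph_of M = (\<lambda>e. fst ` e) ` M"

definition nbrs :: "nat set set \<Rightarrow> nat \<Rightarrow> nat set" where
  "nbrs E v = {u. {u, v} \<in> E}"

text \<open>Perfect matchings are handled as fixed-point-free involutions, which send each point to
  its partner.\<close>

definition involution :: "'a set \<Rightarrow> ('a \<Rightarrow> 'a) \<Rightarrow> bool" where
  "involution P f \<longleftrightarrow> (\<forall>p\<in>P. f p \<in> P \<and> f p \<noteq> p \<and> f (f p) = p)"

lemma involution_pmatching:
  assumes "involution P f"
  shows "(\<lambda>p. {p, f p}) ` P \<in> pmatchings P"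
proof -
  have eq: "{p, f p} = {q, f q}" if "p \<in> P" "q \<in> {p, f p}" for p q
    using assms that unfolding involution_def by auto
  have f: "p \<in> P \<Longrightarrow> f p \<in> P \<and> f p \<noteq> p" for p using assms by (simp add: involution_def)
  have "e = e'" if e: "e \<in> (\<lambda>p. {p, f p}) ` P" "e' \<in> (\<lambda>p. {p, f p}) ` P" "q \<in> e" "q \<in> e'" for e e' q
  proof -
    obtain p p' where p: "p \<in> P" "e = {p, f p}" "p' \<in> P" "e' = {p', f p'}" using e(1,2) by blast
    then show ?thesis using eq[of p q] eq[of p' q] e(3,4) by simp
  qed
  then have "disjoint ((\<lambda>p. {p, f p}) ` P)"
    unfolding pairwise_def disjnt_def by blast
  moreover have "\<Union> ((\<lambda>p. {p, f p}) ` P) = P" using f by blast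
  moreover have "card e = 2" if e: "e \<in> (\<lambda>p. {p, f p}) ` P" for e
  proof -
    obtain p where p: "p \<in> P" "e = {p, f p}" using e by blast
    then show ?thesis using f[OF p(1)] by (simp add: card_insert_if eq_commute[of p])
  qed
  ultimately show ?thesis by (simp add: pmatchings_def)
qed

lemma pmatching_involution:
  assumes "M \<in> pmatchings P"
  obtains f where "involution P f" "M = (\<lambda>p. {p, f p}) ` P"
proof -
  have un: "\<Union>M = P" and c2: "\<And>e. e \<in> M \<Longrightarrow> card e = 2"
    and dj: "\<And>e e'. e \<in> M \<Longrightarrow> e' \<in> M \<Longrightarrow> e \<inter> e' \<noteq> {} \<Longrightarrow> e = e'"
    using assms by (auto simp: pmatchings_def pairwise_def disjnt_def)
  have ex: "\<exists>q. q \<noteq> p \<and> {p, q} \<in> M" if p: "p \<in> P" for p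
  proof -
    obtain e where e: "e \<in> M" "p \<in> e" using p un by blast
    then obtain q where "e = {p, q}" "p \<noteq> q" using c2[OF e(1)] by (auto simp: card_2_iff doubleton_eq_iff)
    then show ?thesis using e by (intro exI[of _ q]) auto
  qed
  define f where "f p = (SOME q. q \<noteq> p \<and> {p, q} \<in> M)" for p
  have f: "f p \<noteq> p" "{p, f p} \<in> M" if "p \<in> P" for p
    using someI_ex[OF ex[OF that]] by (auto simp: f_def)
  have fP: "f p \<in> P" if "p \<in> P" for p using f(2)[OF that] un by blast
  have "f (f p) = p" if p: "p \<in> P" for p
  proof -
    have "{f p, f (f p)} = {p, f p}" using f(2)[OF p] f(2)[OF fP[OF p]] by (intro dj) auto
    then show ?thesis using f(1)[OF fP[OF p]] by (auto simp: doubleton_eq_iff)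
  qed
  then have inv: "involution P f" using f fP by (auto simp: involution_def)
  have "e \<in> (\<lambda>p. {p, f p}) ` P" if e: "e \<in> M" for e
  proof -
    obtain p where p: "p \<in> e" using c2[OF e] by fastforce
    then have "p \<in> P" using un e by blast
    then have "{p, f p} = e" using dj[OF f(2) e] p by blast
    then show ?thesis using \<open>p \<in> P\<close> by blast
  qed
  then have "M = (\<lambda>p. {p, f p}) ` P" using f(2) by blast
  then show ?thesis using inv that by blast
qed

context
  fixes n d :: nat and E :: "nat set set"
  assumes E: "E \<in> regular_graphs n d"
begin

lemma nbrs_sym: "u \<in> nbrs E v \<longleftrightarrow> v \<in> nbrs E u"
  by (simp add: nbrs_def insert_commute)

lemma nbrs_props:
  assumes "u \<in> nbrs E v"
  shows "u \<noteq> v" "u < n" "v < n"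
proof -
  have "{u, v} \<subseteq> {..<n}" "card {u, v} = 2" using assms E by (auto simp: nbrs_def regular_graphs_def)
  then show "u \<noteq> v" "u < n" "v < n" by (auto simp: card_insert_if split: if_splits)
qed

lemma finite_nbrs: "finite (nbrs E v)"
  by (rule finite_subset[of _ "{..<n}"]) (auto dest: nbrs_props)

lemma card_nbrs: "v < n \<Longrightarrow> card (nbrs E v) = d"
  using E by (simp add: regular_graphs_def nbrs_def)

text \<open>
  A matching over the graph \<open>E\<close> amounts to an ordering of the neighbours of every vertex.
\<close>

definition labelings :: "(nat \<Rightarrow> nat list) set" where
  "labelings = PiE {..<n} (\<lambda>v. permutations_of_set (nbrs E v))"

lemma card_labelings: "card labelings = fact d ^ n"
  unfolding labelings_def by (subst card_PiE) (simp_all add: finite_nbrs card_nbrs)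

lemma labelings_props:
  assumes "\<sigma> \<in> labelings" "v < n"
  shows "distinct (\<sigma> v)" "set (\<sigma> v) = nbrs E v" "length (\<sigma> v) = d"
proof -
  have s: "\<sigma> v \<in> permutations_of_set (nbrs E v)" using assms by (auto simp: labelings_def)
  then show "distinct (\<sigma> v)" "set (\<sigma> v) = nbrs E v" by (simp_all add: permutations_of_set_def)
  then show "length (\<sigma> v) = d" using card_nbrs[OF assms(2)] distinct_card by metis
qed

lemma label_inj:
  assumes "\<sigma> \<in> labelings" "v < n" "i < d" "j < d" "\<sigma> v ! i = \<sigma> v ! j"
  shows "i = j"
  using labelings_props[OF assms(1,2)] assms(3-5) by (simp add: nth_eq_iff_index_eq)

text \<open>A point \<open>(u, i)\<close> is joined to the point of the \<open>i\<close>-th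
  neighbour of \<open>u\<close> whose own label is \<open>u\<close>. The label occurs only once
  there, so the description is definite.\<close>

definition partner :: "(nat \<Rightarrow> nat list) \<Rightarrow> point \<Rightarrow> point" where
  "partner \<sigma> p = (\<sigma> (fst p) ! snd p, THE j. j < d \<and> \<sigma> (\<sigma> (fst p) ! snd p) ! j = fst p)"

lemma partner_eq:
  assumes s: "\<sigma> \<in> labelings" and "u < n" "i < d" "v < n" "j < d" "\<sigma> u ! i = v" "\<sigma> v ! j = u"
  shows "partner \<sigma> (u, i) = (v, j)"
proof -
  have "(THE j. j < d \<and> \<sigma> v ! j = u) = j"
  proof (rule the_equality)
    show "j < d \<and> \<sigma> v ! j = u" using assms by blast
    show "k = j" if "k < d \<and> \<sigma> v ! k = u" for k
      using label_inj[OF s \<open>v < n\<close>, of k j] that assms(5,7) by simp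
  qed
  then show ?thesis using assms by (simp add: partner_def)
qed

lemma partner_ex:
  assumes s: "\<sigma> \<in> labelings" and "u < n" "i < d"
  shows "\<exists>v j. v < n \<and> j < d \<and> u \<noteq> v \<and> \<sigma> u ! i = v \<and> \<sigma> v ! j = u"
proof -
  define v where "v = \<sigma> u ! i"
  have "v \<in> nbrs E u" using labelings_props[OF s \<open>u < n\<close>] assms(3) nth_mem unfolding v_def by metis
  note v = nbrs_props[OF this] and u = this[unfolded nbrs_sym[of v]]
  then obtain j where "j < length (\<sigma> v)" "\<sigma> v ! j = u"
    using labelings_props(2)[OF s v(2)] by (metis in_set_conv_nth)
  then show ?thesis using v labelings_props(3)[OF s v(2)]
    by (intro exI[of _ v] exI[of _ j]) (simp add: v_def[symmetric])
qed

lemma partner_cases: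
  assumes s: "\<sigma> \<in> labelings" and p: "p \<in> pspace n d"
  obtains u i v j where "p = (u, i)" "partner \<sigma> p = (v, j)" "u < n" "i < d" "v < n" "j < d" "u \<noteq> v"
    "\<sigma> u ! i = v" "\<sigma> v ! j = u"
proof -
  obtain u i where u: "p = (u, i)" "u < n" "i < d" using p by (auto simp: pspace_def)
  obtain v j where v: "v < n" "j < d" "u \<noteq> v" "\<sigma> u ! i = v" "\<sigma> v ! j = u"
    using partner_ex[OF s u(2,3)] by blast
  show ?thesis by (rule that[OF u(1) _ u(2,3) v]) (use partner_eq[OF s u(2,3) v(1,2,4,5)] u in simp)
qed

lemma involution_partner: "\<sigma> \<in> labelings \<Longrightarrow> involution (pspace n d) (partner \<sigma>)"
  unfolding involution_def
proof
  fix p assume s: "\<sigma> \<in> labelings" and p: "p \<in> pspace n d"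
  obtain u i v j where *: "p = (u, i)" "partner \<sigma> p = (v, j)" "u < n" "i < d" "v < n" "j < d" "u \<noteq> v"
    "\<sigma> u ! i = v" "\<sigma> v ! j = u" using partner_cases[OF s p] .
  show "partner \<sigma> p \<in> pspace n d \<and> partner \<sigma> p \<noteq> p \<and> partner \<sigma> (partner \<sigma> p) = p"
    using partner_eq[OF s *(5,6,3,4,9,8)] * by (auto simp: pspace_def)
qed

definition matching_of :: "(nat \<Rightarrow> nat list) \<Rightarrow> point set set" where
  "matching_of \<sigma> = (\<lambda>p. {p, partner \<sigma> p}) ` pspace n d"

definition fibre :: "point set set set" where
  "fibre = {M \<in> pmatchings (pspace n d). simple_m M \<and> graph_of M = E}"

lemma matching_of_in_fibre:
  assumes s: "\<sigma> \<in> labelings"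
  shows "matching_of \<sigma> \<in> fibre"
proof -
  have pm: "matching_of \<sigma> \<in> pmatchings (pspace n d)"
    unfolding matching_of_def by (rule involution_pmatching[OF involution_partner[OF s]])
  have c: "card (fst ` {p, partner \<sigma> p}) = 2" if p: "p \<in> pspace n d" for p
    by (rule partner_cases[OF s p]) auto
  have inj: "{p, partner \<sigma> p} = {p', partner \<sigma> p'}"
    if p: "p \<in> pspace n d" "p' \<in> pspace n d" and eq: "fst ` {p, partner \<sigma> p} = fst ` {p', partner \<sigma> p'}" for p p'
  proof -
    obtain u i v j where *: "p = (u, i)" "partner \<sigma> p = (v, j)" "u < n" "i < d" "v < n" "j < d" "u \<noteq> v"
      "\<sigma> u ! i = v" "\<sigma> v ! j = u" using partner_cases[OF s p(1)] .
    obtain u' i' v' j' where **: "p' = (u', i')" "partner \<sigma> p' = (v', j')" "u' < n" "i' < d" "v' < n" "j' < d" "u' \<noteq> v'"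
      "\<sigma> u' ! i' = v'" "\<sigma> v' ! j' = u'" using partner_cases[OF s p(2)] .
    have "u = u' \<and> v = v' \<or> u = v' \<and> v = u'" using eq * ** by (auto simp: doubleton_eq_iff)
    then show ?thesis
    proof
      assume "u = u' \<and> v = v'"
      then have "i = i'" "j = j'"
        using label_inj[OF s *(3,4), of i'] label_inj[OF s *(5,6), of j'] * ** by simp_all
      then show ?thesis using * ** \<open>u = u' \<and> v = v'\<close> by simp
    next
      assume "u = v' \<and> v = u'"
      then have "i = j'" "j = i'"
        using label_inj[OF s *(3,4), of j'] label_inj[OF s *(5,6), of i'] * ** by simp_all
      then show ?thesis using * ** \<open>u = v' \<and> v = u'\<close> by auto
    qed
  qed
  have simple: "simple_m (matching_of \<sigma>)"
    unfolding simple_m_def matching_of_def inj_on_def using c inj by blast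
  have "graph_of (matching_of \<sigma>) = E"
  proof (intro set_eqI iffI)
    fix e assume "e \<in> graph_of (matching_of \<sigma>)"
    then obtain p where p: "p \<in> pspace n d" "e = fst ` {p, partner \<sigma> p}" by (auto simp: graph_of_def matching_of_def)
    obtain u i v j where *: "p = (u, i)" "partner \<sigma> p = (v, j)" "u < n" "i < d" "v < n" "j < d" "u \<noteq> v"
      "\<sigma> u ! i = v" "\<sigma> v ! j = u" using partner_cases[OF s p(1)] .
    have "v \<in> nbrs E u" using labelings_props[OF s *(3)] * nth_mem by metis
    then show "e \<in> E" using p(2) * by (simp add: nbrs_def insert_commute)
  next
    fix e assume e: "e \<in> E"
    then have "card e = 2" using E by (auto simp: regular_graphs_def)
    then obtain u v where uv: "e = {v, u}" by (auto simp: card_2_iff)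
    then have v: "v \<in> nbrs E u" using e by (simp add: nbrs_def)
    note un = nbrs_props[OF v]
    obtain i where i: "i < d" "\<sigma> u ! i = v"
      using v labelings_props[OF s un(3)] by (metis in_set_conv_nth)
    then have "fst ` {(u, i), partner \<sigma> (u, i)} = e" using uv by (auto simp: partner_def)
    moreover have "(u, i) \<in> pspace n d" using i un by (simp add: pspace_def)
    ultimately show "e \<in> graph_of (matching_of \<sigma>)" unfolding graph_of_def matching_of_def image_image by blast
  qed
  then show ?thesis using pm simple by (simp add: fibre_def)
qed

lemma inj_matching_of: "inj_on matching_of labelings"
proof (rule inj_onI)
  fix \<sigma> \<tau> assume s: "\<sigma> \<in> labelings" "\<tau> \<in> labelings" and eq: "matching_of \<sigma> = matching_of \<tau>"
  have pe: "partner \<sigma> p = partner \<tau> p" if p: "p \<in> pspace n d" for p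
  proof -
    have "{p, partner \<sigma> p} \<in> matching_of \<tau>" unfolding eq[symmetric] using p by (auto simp: matching_of_def)
    then obtain p' where p': "p' \<in> pspace n d" "{p, partner \<sigma> p} = {p', partner \<tau> p'}" by (auto simp: matching_of_def)
    have "partner \<tau> (partner \<tau> p') = p'" using involution_partner[OF s(2)] p'(1) by (auto simp: involution_def)
    then show ?thesis using p'(2) by (auto simp: doubleton_eq_iff)
  qed
  have "\<sigma> v = \<tau> v" if v: "v < n" for v
  proof (rule nth_equalityI)
    show "length (\<sigma> v) = length (\<tau> v)" using labelings_props(3) s v by simp
    fix i assume "i < length (\<sigma> v)"
    then have "(v, i) \<in> pspace n d" using labelings_props(3)[OF s(1) v] v by (simp add: pspace_def)
    from pe[OF this] show "\<sigma> v ! i = \<tau> v ! i" by (simp add: partner_def)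
  qed
  then show "\<sigma> = \<tau>" using s unfolding labelings_def by (intro PiE_ext[of _ "{..<n}"]) auto
qed

text \<open>The ordering at \<open>u\<close> is read off from the vertices of the partners of
  \<open>(u, 0)\<close>, ..., \<open>(u, d - 1)\<close>. It has no repetition because the matching
  has no parallel edges.\<close>

lemma fibre_in_image:
  assumes M: "M \<in> fibre"
  shows "M \<in> matching_of ` labelings"
proof -
  have pm: "M \<in> pmatchings (pspace n d)" and sm: "simple_m M" and gr: "graph_of M = E"
    using M by (auto simp: fibre_def)
  obtain f where f: "involution (pspace n d) f" and Mf: "M = (\<lambda>p. {p, f p}) ` pspace n d"
    using pmatching_involution[OF pm] .
  have fP: "f p \<in> pspace n d" "f (f p) = p" if "p \<in> pspace n d" for p
    using f that by (auto simp: involution_def)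
  have edge: "{p, f p} \<in> M" if "p \<in> pspace n d" for p using that Mf by blast
  have ne: "fst p \<noteq> fst (f p)" if "p \<in> pspace n d" for p
    using sm edge[OF that] unfolding simple_m_def by fastforce
  have eqM: "{p, f p} = {p', f p'}" if "p \<in> pspace n d" "p' \<in> pspace n d" "fst ` {p, f p} = fst ` {p', f p'}" for p p'
    using sm edge[OF that(1)] edge[OF that(2)] that(3) unfolding simple_m_def inj_on_def by blast
  define \<sigma> where "\<sigma> = restrict (\<lambda>u. map (\<lambda>i. fst (f (u, i))) [0..<d]) {..<n}"
  have su: "\<sigma> u = map (\<lambda>i. fst (f (u, i))) [0..<d]" if "u < n" for u using that by (simp add: \<sigma>_def)
  have s: "\<sigma> \<in> labelings"
    unfolding labelings_def
  proof (rule PiE_I)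
    fix u assume "u \<in> {..<n}"
    then have u: "u < n" by simp
    have P: "(u, i) \<in> pspace n d" if "i < d" for i using u that by (simp add: pspace_def)
    have "distinct (\<sigma> u)"
      unfolding su[OF u] distinct_map
    proof (intro conjI inj_onI)
      fix i i' assume i: "i \<in> set [0..<d]" "i' \<in> set [0..<d]" and eq: "fst (f (u, i)) = fst (f (u, i'))"
      then have P': "(u, i) \<in> pspace n d" "(u, i') \<in> pspace n d" using P by auto
      have "{(u, i), f (u, i)} = {(u, i'), f (u, i')}" using eqM[OF P'] eq by simp
      then show "i = i'" using ne[OF P'(1)] ne[OF P'(2)] eq by (auto simp: doubleton_eq_iff)
    qed simp
    moreover have "set (\<sigma> u) = nbrs E u"
    proof (intro set_eqI iffI)
      fix v assume "v \<in> set (\<sigma> u)"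
      then obtain i where i: "i < d" "v = fst (f (u, i))" by (auto simp: su[OF u])
      have "fst ` {(u, i), f (u, i)} \<in> E" unfolding gr[symmetric] graph_of_def using edge[OF P[OF i(1)]] by (rule imageI)
      then show "v \<in> nbrs E u" using i by (simp add: nbrs_def insert_commute)
    next
      fix v assume v: "v \<in> nbrs E u"
      then have "{v, u} \<in> graph_of M" by (simp add: gr nbrs_def)
      then obtain p where p: "p \<in> pspace n d" "{v, u} = {fst p, fst (f p)}" by (auto simp: graph_of_def Mf)
      have "\<exists>p'\<in>pspace n d. fst p' = u \<and> fst (f p') = v"
      proof (cases "fst p = u")
        case True
        then show ?thesis using p nbrs_props(1)[OF v] by (auto simp: doubleton_eq_iff)
      next
        case False
        then have "fst p = v \<and> fst (f p) = u" using p(2) by (auto simp: doubleton_eq_iff)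
        then show ?thesis using fP[OF p(1)] by (intro bexI[of _ "f p"]) auto
      qed
      then obtain i where "i < d" "fst (f (u, i)) = v" by (auto simp: pspace_def)
      then show "v \<in> set (\<sigma> u)" by (auto simp: su[OF u])
    qed
    ultimately show "\<sigma> u \<in> permutations_of_set (nbrs E u)" by (simp add: permutations_of_set_def)
  qed (simp add: \<sigma>_def)
  have "partner \<sigma> p = f p" if p: "p \<in> pspace n d" for p
  proof -
    obtain u i where ui: "p = (u, i)" by (cases p)
    obtain v j where vj: "f p = (v, j)" by (cases "f p")
    have b: "u < n" "i < d" "v < n" "j < d" using p fP(1)[OF p] ui vj by (auto simp: pspace_def)
    have "f (v, j) = (u, i)" using fP(2)[OF p] ui vj by simp
    then show ?thesis using partner_eq[OF s b] ui vj b by (simp add: su)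
  qed
  then have "M = matching_of \<sigma>" unfolding Mf matching_of_def by (intro image_cong) auto
  then show ?thesis using s by blast
qed

lemma card_fibre: "card fibre = fact d ^ n"
proof -
  have "fibre = matching_of ` labelings" using matching_of_in_fibre fibre_in_image by blast
  then show ?thesis using card_image[OF inj_matching_of] card_labelings by simp
qed

end

text \<open>The \<open>d\<close> points of a vertex lead to \<open>d\<close> different vertices, as
  two equal ones would give parallel edges.\<close>

lemma graph_of_regular:
  assumes "M \<in> pmatchings (pspace n d)" "simple_m M"
  shows "graph_of M \<in> regular_graphs n d"
proof -
  obtain f where f: "involution (pspace n d) f" and Mf: "M = (\<lambda>p. {p, f p}) ` pspace n d"
    using pmatching_involution[OF assms(1)] .
  have fP: "f p \<in> pspace n d" "f (f p) = p" if "p \<in> pspace n d" for p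
    using f that by (auto simp: involution_def)
  have edge: "{p, f p} \<in> M" if "p \<in> pspace n d" for p using that Mf by blast
  have ne: "fst p \<noteq> fst (f p)" if "p \<in> pspace n d" for p
    using assms(2) edge[OF that] unfolding simple_m_def by fastforce
  have eqM: "{p, f p} = {p', f p'}" if "p \<in> pspace n d" "p' \<in> pspace n d" "fst ` {p, f p} = fst ` {p', f p'}" for p p'
    using assms(2) edge[OF that(1)] edge[OF that(2)] that(3) unfolding simple_m_def inj_on_def by blast
  have sub: "e \<subseteq> {..<n} \<and> card e = 2" if e: "e \<in> graph_of M" for e
  proof -
    obtain p where p: "p \<in> pspace n d" "e = {fst p, fst (f p)}" using e by (auto simp: graph_of_def Mf)
    then show ?thesis using fP(1)[OF p(1)] ne[OF p(1)] by (auto simp: pspace_def)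
  qed
  have "card {u. {u, v} \<in> graph_of M} = d" if v: "v < n" for v
  proof -
    have P: "(v, i) \<in> pspace n d" if "i < d" for i using v that by (simp add: pspace_def)
    have "{u. {u, v} \<in> graph_of M} = (\<lambda>i. fst (f (v, i))) ` {..<d}"
    proof (intro set_eqI iffI)
      fix u assume "u \<in> (\<lambda>i. fst (f (v, i))) ` {..<d}"
      then obtain i where i: "i < d" "u = fst (f (v, i))" by auto
      have "fst ` {(v, i), f (v, i)} \<in> graph_of M" unfolding graph_of_def using edge[OF P[OF i(1)]] by (rule imageI)
      then show "u \<in> {u. {u, v} \<in> graph_of M}" using i by (simp add: insert_commute)
    next
      fix u assume "u \<in> {u. {u, v} \<in> graph_of M}"
      then obtain p where p: "p \<in> pspace n d" "{u, v} = {fst p, fst (f p)}" by (auto simp: graph_of_def Mf)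
      have "\<exists>p'\<in>pspace n d. fst p' = v \<and> fst (f p') = u"
      proof (cases "fst p = v")
        case True
        then show ?thesis using p ne[OF p(1)] by (auto simp: doubleton_eq_iff)
      next
        case False
        then have "fst p = u \<and> fst (f p) = v" using p(2) by (auto simp: doubleton_eq_iff)
        then show ?thesis using fP[OF p(1)] by (intro bexI[of _ "f p"]) auto
      qed
      then show "u \<in> (\<lambda>i. fst (f (v, i))) ` {..<d}" by (auto simp: pspace_def)
    qed
    moreover have "inj_on (\<lambda>i. fst (f (v, i))) {..<d}"
    proof (rule inj_onI)
      fix i i' assume i: "i \<in> {..<d}" "i' \<in> {..<d}" and eq: "fst (f (v, i)) = fst (f (v, i'))"
      then have P': "(v, i) \<in> pspace n d" "(v, i') \<in> pspace n d" using P by auto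
      have "{(v, i), f (v, i)} = {(v, i'), f (v, i')}" using eqM[OF P'] eq by simp
      then show "i = i'" using ne[OF P'(1)] ne[OF P'(2)] eq by (auto simp: doubleton_eq_iff)
    qed
    ultimately show ?thesis by (simp add: card_image)
  qed
  then show ?thesis using sub by (auto simp: regular_graphs_def)
qed

section \<open>Simple matchings are not too rare\<close>

definition smk :: "nat \<Rightarrow> nat \<Rightarrow> nat \<Rightarrow> point set set set" where
  "smk n d k = {M. (\<forall>e\<in>M. card e = 2) \<and> disjoint M \<and> \<Union>M \<subseteq> pspace n d \<and> card M = k \<and> simple_m M}"

lemma finite_smk: "finite (smk n d k)"
  by (rule finite_subset[of _ "Pow (Pow (pspace n d))"]) (auto simp: smk_def)

lemma smk_finite: "M \<in> smk n d k \<Longrightarrow> finite M"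
  by (rule finite_subset[of _ "Pow (pspace n d)"]) (auto simp: smk_def)

lemma card_pspace: "card (pspace n d) = n * d"
  by (simp add: pspace_def)

lemma card_Union_smk: "M \<in> smk n d k \<Longrightarrow> card (\<Union>M) = 2 * k"
proof -
  assume M: "M \<in> smk n d k"
  have "card (\<Union>M) = (\<Sum>e\<in>M. card e)"
    using M by (intro card_Union_disjoint) (auto simp: smk_def intro: card_ge_0_finite)
  also have "\<dots> = (\<Sum>e\<in>M. 2)" using M by (intro sum.cong) (auto simp: smk_def)
  finally show ?thesis using M by (simp add: smk_def)
qed

lemma card_unmatched: "M \<in> smk n d k \<Longrightarrow> card (pspace n d - \<Union>M) = n * d - 2 * k"
  using card_Union_smk[of M n d k] card_Diff_subset[of "\<Union>M" "pspace n d"] finite_subset[of "\<Union>M" "pspace n d"]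
  by (auto simp: smk_def card_pspace)

lemma smk_insert:
  assumes M: "M \<in> smk n d k" and x: "x \<in> pspace n d - \<Union>M" and y: "y \<in> pspace n d - \<Union>M"
    and ne: "fst x \<noteq> fst y" and new: "{fst x, fst y} \<notin> graph_of M"
  shows "insert {x, y} M \<in> smk n d (Suc k)"
proof -
  have "{x, y} \<notin> M" using x by blast
  have xy: "x \<noteq> y" using ne by auto
  have "disjoint (insert {x, y} M)"
    unfolding pairwise_insert
  proof (intro conjI allI impI)
    show "disjoint M" using M by (simp add: smk_def)
    fix e assume "e \<in> M \<and> e \<noteq> {x, y}"
    then show "disjnt {x, y} e" "disjnt e {x, y}" using x y by (auto simp: disjnt_def)
  qed
  moreover have "card (insert {x, y} M) = Suc k"
    using M \<open>{x, y} \<notin> M\<close> smk_finite[OF M] by (simp add: smk_def)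
  moreover have "simple_m (insert {x, y} M)"
    using M new ne unfolding simple_m_def smk_def graph_of_def by (auto simp: card_insert_if)
  ultimately show ?thesis using M x y xy by (auto simp: smk_def)
qed

lemma smk_remove:
  assumes M: "M \<in> smk n d (Suc k)" and e: "e \<in> M"
  shows "M - {e} \<in> smk n d k"
  using M e smk_finite[OF M] unfolding smk_def simple_m_def
  by (auto simp: pairwise_def intro: inj_on_subset)

text \<open>Choosing on each such edge a point of \<open>v\<close> is injective because the edges
  are disjoint, and \<open>v\<close> owns only \<open>d\<close> points.\<close>

lemma card_touching:
  assumes M: "M \<in> smk n d k"
  shows "card {e \<in> M. v \<in> fst ` e} \<le> d"
proof -
  define g where "g e = (SOME p. p \<in> e \<and> fst p = v)" for e :: "point set"
  have g: "g e \<in> e \<and> fst (g e) = v" if "v \<in> fst ` e" for e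
    unfolding g_def by (rule someI_ex) (use that in auto)
  have "inj_on g {e \<in> M. v \<in> fst ` e}"
  proof (rule inj_onI)
    fix e e' assume e: "e \<in> {e \<in> M. v \<in> fst ` e}" "e' \<in> {e \<in> M. v \<in> fst ` e}" and eq: "g e = g e'"
    then have "e \<inter> e' \<noteq> {}" using g[of e] g[of e'] by auto
    then show "e = e'" using M e by (auto simp: smk_def pairwise_def disjnt_def)
  qed
  moreover have "g ` {e \<in> M. v \<in> fst ` e} \<subseteq> Pair v ` {..<d}"
  proof
    fix p assume "p \<in> g ` {e \<in> M. v \<in> fst ` e}"
    then obtain e where e: "e \<in> M" "v \<in> fst ` e" "p = g e" by auto
    then have "p \<in> pspace n d" "fst p = v" using g[OF e(2)] M by (auto simp: smk_def)
    then show "p \<in> Pair v ` {..<d}" by (auto simp: pspace_def)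
  qed
  ultimately have "card {e \<in> M. v \<in> fst ` e} \<le> card (Pair v ` {..<d})"
    by (intro card_inj_on_le) auto
  also have "\<dots> \<le> d" using card_image_le[of "{..<d}" "Pair v"] by simp
  finally show ?thesis .
qed

text \<open>The vertices that a new partner of a point at \<open>v\<close> must avoid for the
  matching to stay simple.\<close>

definition near :: "point set set \<Rightarrow> nat \<Rightarrow> nat set" where
  "near M v = insert v {u. {v, u} \<in> graph_of M}"

lemma card_near:
  assumes M: "M \<in> smk n d k"
  shows "finite (near M v)" "card (near M v) \<le> Suc d"
proof -
  let ?T = "{e \<in> M. v \<in> fst ` e}"
  have fin: "finite ?T" using smk_finite[OF M] by simp
  have c: "card (fst ` e) = 2" if "e \<in> M" for e using M that by (simp add: smk_def simple_m_def)
  have sub: "near M v \<subseteq> insert v (\<Union>e\<in>?T. fst ` e - {v})"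
  proof
    fix u assume "u \<in> near M v"
    then consider "u = v" | e where "e \<in> M" "{v, u} = fst ` e" by (auto simp: near_def graph_of_def)
    then show "u \<in> insert v (\<Union>e\<in>?T. fst ` e - {v})"
    proof cases
      case 2
      have "v \<in> fst ` e" "u \<in> fst ` e" unfolding 2(2)[symmetric] by simp_all
      then show ?thesis using 2(1) by (cases "u = v") auto
    qed simp
  qed
  have f1: "finite (fst ` e - {v})" if "e \<in> ?T" for e
    using c[of e] that by (intro finite_Diff) (auto intro: card_ge_0_finite)
  have c1: "card (fst ` e - {v}) \<le> 1" if "e \<in> ?T" for e
    using c[of e] that by (subst card_Diff_singleton) auto
  have finU: "finite (insert v (\<Union>e\<in>?T. fst ` e - {v}))" using fin f1 by blast
  then show "finite (near M v)" using sub finite_subset by blast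
  have "card (near M v) \<le> card (insert v (\<Union>e\<in>?T. fst ` e - {v}))" using sub finU by (rule card_mono[rotated])
  also have "\<dots> \<le> Suc (card (\<Union>e\<in>?T. fst ` e - {v}))" by (rule card_insert_le_m1) simp_all
  also have "card (\<Union>e\<in>?T. fst ` e - {v}) \<le> (\<Sum>e\<in>?T. card (fst ` e - {v}))" by (rule card_UN_le[OF fin])
  also have "\<dots> \<le> (\<Sum>e\<in>?T. 1)" using c1 by (rule sum_mono)
  also have "\<dots> \<le> d" using card_touching[OF M, of v] by simp
  finally show "card (near M v) \<le> Suc d" by simp
qed

lemma card_points_at:
  assumes "finite Q"
  shows "card {p \<in> pspace n d. fst p \<in> Q} \<le> card Q * d"
proof -
  have "card {p \<in> pspace n d. fst p \<in> Q} \<le> card (Q \<times> {..<d})"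
    using assms by (intro card_mono) (auto simp: pspace_def)
  then show ?thesis by (simp add: card_cartesian_product)
qed

text \<open>Double counting of the ways to add an ordered edge. There are
  \<open>n * d - 2 * k\<close> choices for the first end and, as \<open>near\<close> excludes at
  most \<open>Suc d\<close> vertices, at most \<open>Suc d * d\<close> fewer for the second.
  Conversely, a matching with \<open>Suc k\<close> edges has only \<open>2 * Suc k\<close> ordered
  edges that may have been added.\<close>

lemma smk_grow:
  assumes "Suc d * d \<le> n * d - 2 * k"
  shows "card (smk n d k) * ((n * d - 2 * k) * (n * d - 2 * k - Suc d * d)) \<le> card (smk n d (Suc k)) * (2 * Suc k)"
proof -
  let ?V = "pspace n d" and ?m = "n * d - 2 * k" and ?c = "Suc d * d"
  define good where "good M x = {y \<in> ?V - \<Union>M. fst y \<notin> near M (fst x)}" for M and x :: point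
  define T where "T = (SIGMA M:smk n d k. SIGMA x:?V - \<Union>M. good M x)"
  define U where "U = (SIGMA M:smk n d (Suc k). {(x, y). {x, y} \<in> M})"
  have goodc: "?m - ?c \<le> card (good M x)" if M: "M \<in> smk n d k" for M x
  proof -
    have "good M x = (?V - \<Union>M) - {p \<in> ?V. fst p \<in> near M (fst x)}" by (auto simp: good_def)
    then have "card (?V - \<Union>M) - card {p \<in> ?V. fst p \<in> near M (fst x)} \<le> card (good M x)"
      using diff_card_le_card_Diff[of "{p \<in> ?V. fst p \<in> near M (fst x)}" "?V - \<Union>M"] by simp
    moreover have "card {p \<in> ?V. fst p \<in> near M (fst x)} \<le> ?c"
      using card_points_at[OF card_near(1)[OF M], of n d "fst x"] card_near(2)[OF M, of "fst x"]
      by (meson le_trans mult_le_mono1)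
    ultimately show ?thesis using card_unmatched[OF M] by linarith
  qed
  have fin2: "finite {(x, y). {x, y} \<in> M}" if M: "M \<in> smk n d (Suc k)" for M
  proof (rule finite_subset)
    show "{(x, y). {x, y} \<in> M} \<subseteq> \<Union>M \<times> \<Union>M" by blast
    have "finite (\<Union>M)" using M by (intro finite_subset[of "\<Union>M" ?V]) (simp_all add: smk_def)
    then show "finite (\<Union>M \<times> \<Union>M)" by simp
  qed
  have finU: "finite U"
    unfolding U_def by (rule finite_SigmaI[OF finite_smk fin2])
  have "card (smk n d k) * (?m * (?m - ?c)) = (\<Sum>M\<in>smk n d k. \<Sum>x\<in>?V - \<Union>M. ?m - ?c)"
    by (simp add: card_unmatched)
  also have "\<dots> \<le> (\<Sum>M\<in>smk n d k. \<Sum>x\<in>?V - \<Union>M. card (good M x))"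
    using goodc by (intro sum_mono) auto
  also have "\<dots> = card T"
    unfolding T_def by (subst card_SigmaI) (auto simp: finite_smk good_def)
  also have "card T \<le> card U"
  proof (rule card_inj_on_le[OF _ _ finU])
    let ?f = "\<lambda>(M, x, y). (insert {x, y} M, x, y)"
    show "inj_on ?f T"
    proof (rule inj_onI)
      fix t t' assume t: "t \<in> T" "t' \<in> T" and eq: "?f t = ?f t'"
      obtain M x y where t1: "t = (M, x, y)" by (cases t) auto
      obtain M' x' y' where t2: "t' = (M', x', y')" by (cases t') auto
      have "x \<notin> \<Union>M" "x' \<notin> \<Union>M'" using t t1 t2 by (auto simp: T_def)
      then have "{x, y} \<notin> M" "{x', y'} \<notin> M'" by auto
      then show "t = t'" using eq t1 t2 by (auto simp: insert_ident)
    qed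
    show "?f ` T \<subseteq> U"
    proof
      fix s assume "s \<in> ?f ` T"
      then obtain M x y where s: "s = (insert {x, y} M, x, y)" "M \<in> smk n d k" "x \<in> ?V - \<Union>M" "y \<in> good M x"
        by (auto simp: T_def)
      have "insert {x, y} M \<in> smk n d (Suc k)"
        using s by (intro smk_insert) (auto simp: good_def near_def)
      then show "s \<in> U" using s(1) by (simp add: U_def)
    qed
  qed
  also have "card U = (\<Sum>M\<in>smk n d (Suc k). card {(x, y). {x, y} \<in> M})"
    unfolding U_def
    by (rule card_SigmaI[OF finite_smk]) (use fin2 in blast)
  also have "\<dots> \<le> (\<Sum>M\<in>smk n d (Suc k). 2 * Suc k)"
  proof (rule sum_mono)
    fix M assume M: "M \<in> smk n d (Suc k)"
    have "{(x, y). {x, y} \<in> M} = (\<Union>e\<in>M. {(x, y). {x, y} = e})" by auto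
    also have "card \<dots> \<le> (\<Sum>e\<in>M. card {(x, y). {x, y} = e})" by (rule card_UN_le[OF smk_finite[OF M]])
    also have "\<dots> \<le> (\<Sum>e\<in>M. 2)"
    proof (rule sum_mono)
      fix e assume "e \<in> M"
      then have "card e = 2" using M by (simp add: smk_def)
      then obtain a b where ab: "e = {a, b}" by (auto simp: card_2_iff)
      have "{(x, y). {x, y} = e} \<subseteq> {(a, b), (b, a)}" unfolding ab by (auto simp: doubleton_eq_iff)
      then have "card {(x, y). {x, y} = e} \<le> card {(a, b), (b, a)}" by (intro card_mono) auto
      also have "\<dots> \<le> 2" by (rule card_insert_le_m1) simp_all
      finally show "card {(x, y). {x, y} = e} \<le> 2" .
    qed
    also have "\<dots> = 2 * Suc k" using M by (simp add: smk_def)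
    finally show "card {(x, y). {x, y} \<in> M} \<le> 2 * Suc k" .
  qed
  finally show ?thesis by simp
qed

text \<open>
  Switching: an edge far away from two unmatched points is replaced by two edges that match them.
\<close>

lemma smk_switch:
  assumes N: "2 * k + 2 \<le> n * d" and k: "d * (2 * Suc d) < k"
  shows "card (smk n d k) \<le> card (smk n d (Suc k)) * (n * d) ^ 4"
proof -
  let ?V = "pspace n d"
  \<comment> \<open>The inverse of a switching: the old matching is recovered from the new one, its
    two new edges and the two ends of the removed edge. This leaves at most
    \<open>(n * d) ^ 4\<close> possibilities.\<close>
  let ?g = "\<lambda>M' (f1, f2, a, b). insert {a, b} (M' - {f1, f2})"
  have "M \<in> (\<Union>M'\<in>smk n d (Suc k). ?g M' ` (M' \<times> M' \<times> ?V \<times> ?V))" if M: "M \<in> smk n d k" for M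
  proof -
    have m2: "2 \<le> card (?V - \<Union>M)" using card_unmatched[OF M] N by linarith
    obtain S where S: "S \<subseteq> ?V - \<Union>M" "card S = 2" "finite S" by (rule obtain_subset_with_card_n[OF m2])
    obtain x y where Sxy: "S = {x, y}" "x \<noteq> y" using S(2) unfolding card_2_iff by blast
    then have xy: "x \<noteq> y" "x \<in> ?V - \<Union>M" "y \<in> ?V - \<Union>M" using S(1) by blast+
    \<comment> \<open>An edge avoiding \<open>Q\<close> can be switched without creating loops or
      parallel edges. It exists because at most \<open>d * (2 * Suc d)\<close> edges meet
      \<open>Q\<close>, which is less than \<open>k\<close>.\<close>
    define Q where "Q = near M (fst x) \<union> near M (fst y)"
    have Q: "finite Q" "card Q \<le> 2 * Suc d"
    proof -
      show "finite Q" using card_near(1)[OF M] by (simp add: Q_def)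
      have "card Q \<le> card (near M (fst x)) + card (near M (fst y))"
        unfolding Q_def by (rule card_Un_le)
      also have "\<dots> \<le> Suc d + Suc d"
        using card_near(2)[OF M] by (intro add_mono)
      finally show "card Q \<le> 2 * Suc d" by (simp only: mult_2)
    qed
    have "{e \<in> M. fst ` e \<inter> Q \<noteq> {}} = (\<Union>v\<in>Q. {e \<in> M. v \<in> fst ` e})" by auto
    also have "card \<dots> \<le> (\<Sum>v\<in>Q. card {e \<in> M. v \<in> fst ` e})" by (rule card_UN_le[OF Q(1)])
    also have "\<dots> \<le> (\<Sum>v\<in>Q. d)" using card_touching[OF M] by (intro sum_mono)
    also have "\<dots> = d * card Q" by (simp add: mult.commute)
    also have "\<dots> \<le> d * (2 * Suc d)" using Q(2) by (rule mult_le_mono2)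
    also have "\<dots> < card M" using k M by (simp add: smk_def)
    finally have lt: "card {e \<in> M. fst ` e \<inter> Q \<noteq> {}} < card M" .
    have "\<exists>e\<in>M. fst ` e \<inter> Q = {}"
    proof (rule ccontr)
      assume "\<not> (\<exists>e\<in>M. fst ` e \<inter> Q = {})"
      then have "{e \<in> M. fst ` e \<inter> Q \<noteq> {}} = M" by blast
      then show False using lt by simp
    qed
    then obtain e where e: "e \<in> M" "fst ` e \<inter> Q = {}" by (elim bexE)
    have "card e = 2" using M e(1) by (simp add: smk_def)
    then obtain a b where ab: "e = {a, b}" "a \<noteq> b" unfolding card_2_iff by blast
    have abf: "fst a \<noteq> fst b" using M e(1) ab by (auto simp: smk_def simple_m_def)
    have abV: "a \<in> ?V" "b \<in> ?V" "a \<in> \<Union>M" "b \<in> \<Union>M" using M e(1) ab by (auto simp: smk_def)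
    have far: "fst a \<notin> Q" "fst b \<notin> Q" using e(2) ab by auto
    obtain l where l: "k = Suc l" using k by (cases k) auto
    let ?M0 = "M - {e}"
    have M0: "?M0 \<in> smk n d l" using smk_remove[of M n d l e] M e(1) l by simp
    have dj: "e \<inter> e' = {}" if "e' \<in> ?M0" for e'
      using M e(1) that by (auto simp: smk_def pairwise_def disjnt_def)
    have un: "x \<notin> \<Union>?M0" "y \<notin> \<Union>?M0" "a \<notin> \<Union>?M0" "b \<notin> \<Union>?M0" using xy dj ab by auto
    have gsub: "graph_of ?M0 \<subseteq> graph_of M" by (auto simp: graph_of_def)
    have M1: "insert {x, a} ?M0 \<in> smk n d (Suc l)"
    proof (rule smk_insert[OF M0])
      show "fst x \<noteq> fst a" "{fst x, fst a} \<notin> graph_of ?M0"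
        using far gsub by (auto simp: Q_def near_def)
    qed (use xy abV un in auto)
    have M2: "insert {y, b} (insert {x, a} ?M0) \<in> smk n d (Suc (Suc l))"
    proof (rule smk_insert[OF M1])
      show "fst y \<noteq> fst b" using far by (auto simp: Q_def near_def)
      have "{fst y, fst b} \<noteq> {fst x, fst a}" using far abf by (auto simp: Q_def near_def doubleton_eq_iff)
      then show "{fst y, fst b} \<notin> graph_of (insert {x, a} ?M0)"
        using far gsub by (auto simp: Q_def near_def graph_of_def)
      show "y \<in> ?V - \<Union> (insert {x, a} ?M0)" using xy abV un by auto
      show "b \<in> ?V - \<Union> (insert {x, a} ?M0)" using xy abV un ab by auto
    qed
    let ?M' = "insert {y, b} (insert {x, a} ?M0)"
    have "{x, a} \<notin> M" "{y, b} \<notin> M" using xy by auto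
    then have "M = ?g ?M' ({x, a}, {y, b}, a, b)" using e(1) ab by auto
    then show ?thesis using M2 l abV by (intro UN_I[of ?M'] image_eqI[of _ _ "({x, a}, {y, b}, a, b)"]) auto
  qed
  then have sub: "smk n d k \<subseteq> (\<Union>M'\<in>smk n d (Suc k). ?g M' ` (M' \<times> M' \<times> ?V \<times> ?V))" by blast
  have fin: "finite (M' \<times> M' \<times> ?V \<times> ?V)" if "M' \<in> smk n d (Suc k)" for M' using smk_finite[OF that] by simp
  have "card (smk n d k) \<le> card (\<Union>M'\<in>smk n d (Suc k). ?g M' ` (M' \<times> M' \<times> ?V \<times> ?V))"
    using sub fin by (intro card_mono) (auto simp: finite_smk)
  also have "\<dots> \<le> (\<Sum>M'\<in>smk n d (Suc k). card (?g M' ` (M' \<times> M' \<times> ?V \<times> ?V)))"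
    by (rule card_UN_le[OF finite_smk])
  also have "\<dots> \<le> (\<Sum>M'\<in>smk n d (Suc k). (n * d) ^ 4)"
  proof (rule sum_mono)
    fix M' assume M': "M' \<in> smk n d (Suc k)"
    have "card (?g M' ` (M' \<times> M' \<times> ?V \<times> ?V)) \<le> card (M' \<times> M' \<times> ?V \<times> ?V)" by (rule card_image_le[OF fin[OF M']])
    also have "\<dots> = Suc k * (Suc k * ((n * d) * (n * d)))"
      using M' by (simp add: card_cartesian_product card_pspace smk_def)
    also have "\<dots> \<le> (n * d) * ((n * d) * ((n * d) * (n * d)))" using N by (intro mult_le_mono) auto
    finally show "card (?g M' ` (M' \<times> M' \<times> ?V \<times> ?V)) \<le> (n * d) ^ 4" by (simp add: power4_eq_xxxx mult.assoc)
  qed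
  finally show ?thesis by simp
qed


text \<open>
  The number of partial matchings with \<open>k\<close> edges on \<open>N\<close> points.
\<close>

fun pmk :: "nat \<Rightarrow> nat \<Rightarrow> real" where
  "pmk N 0 = 1"
| "pmk N (Suc k) = pmk N k * (real N - 2 * real k) * (real N - 2 * real k - 1) / (2 * real (Suc k))"

lemma pmk_pos: "2 * k \<le> N \<Longrightarrow> 0 < pmk N k"
  by (induction k) (auto intro!: divide_pos_pos mult_pos_pos)

lemma pmk_fact: "2 * k \<le> N \<Longrightarrow> 2 ^ k * fact k * fact (N - 2 * k) * pmk N k = fact N"
proof (induction k)
  case (Suc k)
  define m where "m = N - 2 * Suc k"
  have m: "N - 2 * k = Suc (Suc m)" "real N - 2 * real k = real m + 2" using Suc.prems by (auto simp: m_def)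
  have "2 ^ Suc k * fact (Suc k) * fact m * pmk N (Suc k)
      = 2 ^ k * fact k * ((real m + 2) * (real m + 1) * fact m) * pmk N k"
    unfolding pmk.simps m(2) by (simp add: field_simps)
  also have "(real m + 2) * (real m + 1) * fact m = fact (N - 2 * k)" unfolding m(1) by (simp add: algebra_simps)
  finally show ?case using Suc unfolding m_def by simp
qed simp

lemma pmc_fact: "real (pmc (2 * K)) * (2 ^ K * fact K) = fact (2 * K)"
proof (induction K)
  case (Suc K)
  have "pmc (2 * Suc K) = Suc (2 * K) * pmc (2 * K)" by simp
  then have "real (pmc (2 * Suc K)) * (2 ^ Suc K * fact (Suc K))
      = (real (2 * K) + 1) * (real (2 * K) + 2) * (real (pmc (2 * K)) * (2 ^ K * fact K))"
    by (simp add: algebra_simps)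
  also have "\<dots> = fact (2 * Suc K)" unfolding Suc by (simp add: algebra_simps)
  finally show ?case .
qed simp

lemma pmk_full: "pmk (2 * K) K = real (pmc (2 * K))"
proof -
  have "(2 ^ K * fact K) * pmk (2 * K) K = (2 ^ K * fact K) * real (pmc (2 * K))"
    using pmk_fact[of K "2 * K"] pmc_fact[of K] by (simp add: mult_ac)
  then show ?thesis by simp
qed

text \<open>
  With \<open>m\<close> free points, this is the step of the induction showing that partial matchings with \<open>k\<close>
  edges are simple with probability at least \<open>((N - 2 * k) / N) ^ c\<close>.
\<close>

lemma telescoping_bound:
  fixes m :: real
  assumes "2 * real c \<le> m" "1 \<le> c"
  shows "(m - 1) * ((m - 2) / m) ^ c \<le> m - real c"
proof -
  have m: "2 \<le> m" using assms by simp
  define t where "t = 2 / m"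
  have t: "0 \<le> t" "t \<le> 1" using m by (auto simp: t_def)
  have "(1 - t) ^ c * (1 + real c * t) \<le> (1 - t) ^ c * (1 + t) ^ c"
    using t Bernoulli_inequality[of t c] by (intro mult_left_mono) auto
  also have "\<dots> = ((1 - t) * (1 + t)) ^ c" by (simp add: power_mult_distrib)
  also have "\<dots> \<le> 1" using t by (intro power_le_one) (auto simp: algebra_simps mult_le_one)
  finally have le: "(1 - t) ^ c * (1 + real c * t) \<le> 1" .
  have eq: "(m - 2) / m = 1 - t" "1 + real c * t = (m + 2 * real c) / m" using m by (auto simp: t_def field_simps)
  have "(1 - t) ^ c * ((m + 2 * real c) / m) \<le> 1" using le unfolding eq(2) .
  then have "(1 - t) ^ c \<le> m / (m + 2 * real c)" using m assms by (simp add: field_simps)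
  then have "(m - 1) * (1 - t) ^ c \<le> (m - 1) * (m / (m + 2 * real c))" using m by (intro mult_left_mono) auto
  also have "\<dots> \<le> m - real c"
  proof -
    \<comment> \<open>Since \<open>(m - c) * (m + 2 * c) = m^2 + c * m - 2 * c^2\<close>, the
      assumption \<open>2 * c <= m\<close> makes this at least \<open>m^2\<close>.\<close>
    have "real c * (2 * real c) \<le> real c * m" using assms by (intro mult_left_mono) auto
    then have "(m - 1) * m \<le> (m - real c) * (m + 2 * real c)" using m by (simp add: algebra_simps)
    then show ?thesis using m by (simp add: divide_le_eq)
  qed
  finally show ?thesis unfolding eq(1) .
qed

text \<open>Induction with \<open>smk_grow\<close> and \<open>telescoping_bound\<close>. The
  \<open>k\<close>-th edge is added while \<open>n * d - 2 * (k - 1)\<close> points are free, whence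
  the index in the assumption.\<close>

lemma smk_lower_bound_1:
  assumes c: "c = Suc d * d" "1 \<le> c" and k: "k = 0 \<or> 2 * c \<le> n * d - 2 * (k - 1)" and pos: "0 < n * d"
  shows "pmk (n * d) k * ((real (n * d) - 2 * real k) / real (n * d)) ^ c \<le> real (card (smk n d k))"
  using k
proof (induction k)
  case 0
  have "{} \<in> smk n d 0" by (simp add: smk_def simple_m_def)
  then have "1 \<le> card (smk n d 0)" using finite_smk by (metis One_nat_def Suc_leI card_gt_0_iff empty_iff)
  then show ?case using pos by simp
next
  case (Suc k)
  let ?N = "n * d"
  have k2: "2 * c \<le> ?N - 2 * k" using Suc.prems by simp
  define m where "m = real ?N - 2 * real k"
  have m: "real (?N - 2 * k) = m" "2 * real c \<le> m" "real (?N - 2 * k - c) = m - real c"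
  proof -
    have kN: "2 * k \<le> ?N" "c \<le> ?N - 2 * k" using k2 c(2) by linarith+
    show eq: "real (?N - 2 * k) = m" unfolding m_def of_nat_diff[OF kN(1)] by simp
    have "real (2 * c) \<le> real (?N - 2 * k)" using k2 by (simp only: of_nat_le_iff)
    then show "2 * real c \<le> m" unfolding eq by simp
    show "real (?N - 2 * k - c) = m - real c" unfolding of_nat_diff[OF kN(2)] eq ..
  qed
  have m0: "0 < m" using m(2) c(2) by linarith
  have N0: "0 < real ?N" using pos by simp
  have IH: "pmk ?N k * (m / real ?N) ^ c \<le> real (card (smk n d k))"
  proof -
    have "k = 0 \<or> 2 * c \<le> ?N - 2 * (k - 1)" using k2 by auto
    from Suc.IH[OF this] show ?thesis by (simp add: m_def)
  qed
  have g: "real (card (smk n d k)) * (m * (m - real c)) \<le> real (card (smk n d (Suc k))) * (2 * real (Suc k))"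
  proof -
    have "card (smk n d k) * ((?N - 2 * k) * (?N - 2 * k - c)) \<le> card (smk n d (Suc k)) * (2 * Suc k)"
      using smk_grow[of d n k] k2 c by simp
    then have "real (card (smk n d k) * ((?N - 2 * k) * (?N - 2 * k - c))) \<le> real (card (smk n d (Suc k)) * (2 * Suc k))"
      by (simp only: of_nat_le_iff)
    then show ?thesis unfolding of_nat_mult m(1,3) by simp
  qed
  have p0: "0 \<le> pmk ?N k" using pmk_pos[of k ?N] k2 c by (simp add: less_imp_le)
  have "(m - 1) * ((m - 2) / real ?N) ^ c = (m - 1) * ((m - 2) / m) ^ c * (m / real ?N) ^ c"
    using m0 by (simp add: power_mult_distrib[symmetric])
  also have "\<dots> \<le> (m - real c) * (m / real ?N) ^ c"
    using telescoping_bound[OF m(2) c(2)] m0 N0 by (intro mult_right_mono) auto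
  finally have "pmk ?N k * m * ((m - 1) * ((m - 2) / real ?N) ^ c) \<le> pmk ?N k * m * ((m - real c) * (m / real ?N) ^ c)"
    using p0 m0 by (intro mult_left_mono) auto
  also have "\<dots> = (pmk ?N k * (m / real ?N) ^ c) * (m * (m - real c))" by simp
  also have "\<dots> \<le> real (card (smk n d k)) * (m * (m - real c))"
    using IH m0 m(2) by (intro mult_right_mono) auto
  also note g
  finally have fin: "pmk ?N k * m * ((m - 1) * ((m - 2) / real ?N) ^ c) \<le> real (card (smk n d (Suc k))) * (2 * real (Suc k))" .
  have "pmk ?N (Suc k) * ((m - 2) / real ?N) ^ c = pmk ?N k * m * ((m - 1) * ((m - 2) / real ?N) ^ c) / (2 * real (Suc k))"
    by (simp add: m_def)
  also have "\<dots> \<le> real (card (smk n d (Suc k)))"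
    using fin by (simp only: pos_divide_le_eq mult_pos_pos zero_less_numeral of_nat_0_less_iff zero_less_Suc)
  finally show ?case by (simp add: m_def algebra_simps)
qed

text \<open>With \<open>N = n * d\<close>, the growth bound costs a factor \<open>N ^ c\<close>
  until \<open>2 * c - 2\<close> points are free. Each of the remaining \<open>c - 1\<close> edges
  costs \<open>N ^ 4\<close> by switching and \<open>N ^ 2\<close> for the ratio of consecutive
  values of \<open>pmk\<close>. Together this is at most \<open>N ^ (7 * c)\<close>.\<close>

lemma many_simple_matchings:
  assumes d: "3 \<le> d" and ev: "even (n * d)" and n: "2 * (d * (2 * Suc d) + Suc d * d) \<le> n * d"
  shows "real (card (pmatchings (pspace n d)))
      \<le> real (n * d) ^ (7 * (Suc d * d)) * real (card {M \<in> pmatchings (pspace n d). simple_m M})"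
proof -
  obtain K where K: "n * d = 2 * K" using ev by (elim evenE)
  define c where "c = Suc d * d"
  have c: "2 \<le> c" "c \<le> K" "d * (2 * Suc d) + c \<le> K"
  proof -
    show "d * (2 * Suc d) + c \<le> K" using n unfolding c_def[symmetric] K by simp
    then show "c \<le> K" by simp
    have "2 * 1 \<le> Suc d * d" using d by (intro mult_le_mono) auto
    then show "2 \<le> c" by (simp add: c_def)
  qed
  let ?N = "real (2 * K)"
  have N1: "1 \<le> ?N" using c by simp
  \<comment> \<open>The largest number of edges that \<open>smk_lower_bound_1\<close> reaches. As
    \<open>c\<close> is at least 2, some points are still free there and its power of a fraction is
    at least \<open>(1 / N) ^ c\<close>.\<close>
  define k1 where "k1 = K + 1 - c"
  have k1: "k1 + (c - 1) = K" "2 * c \<le> 2 * K - 2 * (k1 - 1)" "real (2 * K) - 2 * real k1 = 2 * real c - 2"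
    using c by (auto simp: k1_def of_nat_diff)
  have base: "pmk (2 * K) k1 \<le> ?N ^ c * real (card (smk n d k1))"
  proof -
    have "pmk (2 * K) k1 * ((2 * real c - 2) / ?N) ^ c \<le> real (card (smk n d k1))"
      using smk_lower_bound_1[of c d k1 n] k1(2,3) c unfolding K by (simp add: c_def)
    moreover have "pmk (2 * K) k1 * (1 / ?N) ^ c \<le> pmk (2 * K) k1 * ((2 * real c - 2) / ?N) ^ c"
    proof (intro mult_left_mono power_mono divide_right_mono)
      have "2 * k1 \<le> 2 * K" using k1(1) by linarith
      then show "0 \<le> pmk (2 * K) k1" using pmk_pos less_imp_le by blast
    qed (use c N1 in auto)
    ultimately have "pmk (2 * K) k1 * (1 / ?N) ^ c \<le> real (card (smk n d k1))" by linarith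
    then show ?thesis using N1 by (simp add: power_one_over field_simps)
  qed
  have "i \<le> c - 1 \<Longrightarrow> pmk (2 * K) (k1 + i) \<le> ?N ^ (c + 6 * i) * real (card (smk n d (k1 + i)))" for i
  proof (induction i)
    case 0
    then show ?case using base by simp
  next
    case (Suc i)
    let ?k = "k1 + i"
    have kK: "?k < K" using Suc.prems k1(1) by linarith
    have "card (smk n d ?k) \<le> card (smk n d (Suc ?k)) * (2 * K) ^ 4"
      using smk_switch[of ?k n d] kK c(3) unfolding K by (simp add: k1_def)
    then have "real (card (smk n d ?k)) \<le> real (card (smk n d (Suc ?k)) * (2 * K) ^ 4)" by (simp only: of_nat_le_iff)
    then have s: "real (card (smk n d ?k)) \<le> real (card (smk n d (Suc ?k))) * ?N ^ 4" by simp
    have "pmk (2 * K) (Suc ?k) = pmk (2 * K) ?k * ((?N - 2 * real ?k) * (?N - 2 * real ?k - 1) / (2 * real (Suc ?k)))" by simp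
    also have "\<dots> \<le> pmk (2 * K) ?k * ?N ^ 2"
    proof (rule mult_left_mono)
      have "(?N - 2 * real ?k) * (?N - 2 * real ?k - 1) \<le> ?N * ?N" using kK by (intro mult_mono) auto
      moreover have "?N * ?N * 1 \<le> ?N * ?N * (2 * real (Suc ?k))" by (intro mult_left_mono) auto
      ultimately show "(?N - 2 * real ?k) * (?N - 2 * real ?k - 1) / (2 * real (Suc ?k)) \<le> ?N ^ 2"
        by (simp add: divide_le_eq power2_eq_square)
    qed (use pmk_pos[of ?k "2 * K"] kK in auto)
    also have "\<dots> \<le> (?N ^ (c + 6 * i) * real (card (smk n d ?k))) * ?N ^ 2"
      using Suc by (intro mult_right_mono) auto
    also have "\<dots> \<le> (?N ^ (c + 6 * i) * (real (card (smk n d (Suc ?k))) * ?N ^ 4)) * ?N ^ 2"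
      using s by (intro mult_right_mono mult_left_mono) auto
    also have "\<dots> = ?N ^ (c + 6 * i + 4 + 2) * real (card (smk n d (Suc ?k)))" by (simp only: power_add mult_ac)
    finally show ?case by (simp add: add.commute add.left_commute)
  qed
  from this[of "c - 1"] have "pmk (2 * K) K \<le> ?N ^ (c + 6 * (c - 1)) * real (card (smk n d K))" using k1(1) by simp
  also have "\<dots> \<le> ?N ^ (7 * c) * real (card (smk n d K))"
    using N1 by (intro mult_right_mono power_increasing) auto
  also have "\<dots> \<le> ?N ^ (7 * c) * real (card {M \<in> pmatchings (pspace n d). simple_m M})"
  proof (intro mult_left_mono of_nat_mono card_mono)
    show "finite {M \<in> pmatchings (pspace n d). simple_m M}" using finite_pmatchings[of "pspace n d"] by simp
    show "smk n d K \<subseteq> {M \<in> pmatchings (pspace n d). simple_m M}"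
    proof
      fix M assume M: "M \<in> smk n d K"
      have "\<Union>M = pspace n d"
        using M card_Union_smk[OF M] by (intro card_subset_eq) (auto simp: smk_def card_pspace K)
      then show "M \<in> {M \<in> pmatchings (pspace n d). simple_m M}" using M by (auto simp: smk_def pmatchings_def)
    qed
  qed simp
  finally show ?thesis by (simp add: card_pmatchings card_pspace K pmk_full c_def)
qed

section \<open>Total dominating sets from the greedy algorithm\<close>

text \<open>The budget \<open>b\<close> is what is left for the untouched vertices of
  \<open>P\<close>; the touched ones are dominated already.\<close>

definition lowcost :: "nat \<Rightarrow> nat \<Rightarrow> point set \<Rightarrow> point set set \<Rightarrow> real \<Rightarrow> bool" where
  "lowcost d n P M b \<longleftrightarrow> (\<exists>D. D \<subseteq> {..<n} \<and> real (card D) \<le> b \<and>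
     (\<forall>v. cnt P v = d \<longrightarrow> (\<exists>p p'. {p, p'} \<in> M \<and> fst p = v \<and> fst p' \<in> D)))"

lemma lowcost_union:
  assumes low: "lowcost d n (P - pts H) M b"
    and D: "D \<subseteq> {..<n}" "real (card D) \<le> c" "\<forall>v\<in>vts H. cnt P v = d \<longrightarrow> covers H D v"
  shows "lowcost d n P (M \<union> edges H) (b + c)"
proof -
  obtain D' where D': "D' \<subseteq> {..<n}" "real (card D') \<le> b"
    "\<And>v. cnt (P - pts H) v = d \<Longrightarrow> \<exists>p p'. {p, p'} \<in> M \<and> fst p = v \<and> fst p' \<in> D'"
    using low unfolding lowcost_def by (elim exE conjE) blast
  have "\<exists>p p'. {p, p'} \<in> M \<union> edges H \<and> fst p = v \<and> fst p' \<in> D \<union> D'" if v: "cnt P v = d" for v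
  proof (cases "v \<in> vts H")
    case True
    then show ?thesis using D(3) v unfolding covers_def by blast
  next
    case False
    then have "cnt (P - pts H) v = d" using v by (simp add: cnt_outside)
    from D'(3)[OF this] show ?thesis by blast
  qed
  moreover have "real (card (D \<union> D')) \<le> b + c"
    using card_Un_le[of D D'] D(2) D'(2) by linarith
  moreover have "D \<union> D' \<subseteq> {..<n}" using D(1) D'(1) by blast
  ultimately show ?thesis unfolding lowcost_def by (intro exI[of _ "D \<union> D'"] conjI allI impI) auto
qed

text \<open>The other end of a revealed edge at a visited vertex is visited as well, so abandoned
  steps cover what they touch.\<close>

lemma covers_vts: "v \<in> vts H \<Longrightarrow> covers H (vts H) v"
proof -
  assume "v \<in> vts H"
  then obtain x y where xy: "(x, y) \<in> set H" "v = fst x \<or> v = fst y"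
    unfolding vts_def pts_def by fastforce
  then have "x \<in> pts H" "y \<in> pts H" by (force simp: pts_def)+
  then have "fst x \<in> vts H" "fst y \<in> vts H" by (simp_all add: vts_def)
  then show ?thesis using xy covers_fst covers_snd by blast
qed

lemma lowcost_step:
  assumes P: "P \<subseteq> pspace n d" and d: "3 \<le> d" and u: "cnt P u = d"
    and out: "(r, H) \<in> outs (step d P u) P []"
    and low: "lowcost d n (P - pts H) M (b - cost (r, H))"
  shows "lowcost d n P (M \<union> edges H) b"
proof -
  note wp = wp_step[OF P d u]
  have pH: "pts H \<subseteq> P" by (rule outs_pts[OF wp_wft[OF wp] _ out]) simp
  have "\<exists>D. D \<subseteq> {..<n} \<and> real (card D) \<le> cost (r, H) \<and> (\<forall>v\<in>vts H. cnt P v = d \<longrightarrow> covers H D v)"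
  proof (cases r)
    case None
    then show ?thesis
      using vts_subset[OF pH P] covers_vts by (intro exI[of _ "vts H"]) (simp add: cost_def)
  next
    case (Some a)
    obtain D c \<delta> where a: "a = (D, c, \<delta>)" by (cases a) auto
    have "leafok d n P a H" by (rule wp_outs[OF wp]) (use out Some in simp)
    then show ?thesis unfolding Some a by (intro exI[of _ D]) (simp add: leafok_def cost_def)
  qed
  then obtain D where D: "D \<subseteq> {..<n}" "real (card D) \<le> cost (r, H)" "\<forall>v\<in>vts H. cnt P v = d \<longrightarrow> covers H D v"
    by (elim exE conjE)
  from lowcost_union[OF low D] show ?thesis by simp
qed

lemma lowcost_direct:
  assumes P: "P \<subseteq> pspace n d" and d: "0 < d" and M: "M \<in> pmatchings P" and b: "Zc d n P 0 \<le> b"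
  shows "lowcost d n P M b"
proof -
  define F where "F = {v. v < n \<and> cnt P v = d}"
  have F: "v \<in> F" "(v, 0) \<in> P" if "cnt P v = d" for v
  proof -
    show v0: "(v, 0) \<in> P" by (rule cnt_full[OF P that d])
    then have "(v, 0) \<in> pspace n d" using P by blast
    then show "v \<in> F" using that by (simp add: F_def pspace_def)
  qed
  have "\<exists>y. y \<in> P \<and> {(v, 0), y} \<in> M" if v: "cnt P v = d" for v
    by (rule pmatchings_remove[OF F(2)[OF v] M]) blast
  then obtain g where g: "\<And>v. cnt P v = d \<Longrightarrow> g v \<in> P \<and> {(v, 0), g v} \<in> M" by metis
  let ?D = "(\<lambda>v. fst (g v)) ` F"
  have "real (card ?D) \<le> real (card F)"
    by (intro of_nat_mono card_image_le) (simp add: F_def)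
  also have "\<dots> = Zc d n P 0"
    by (simp add: Zc_def F_def of_bool_def sum.If_cases Collect_conj_eq Int_commute lessThan_def)
  also note b
  finally have "real (card ?D) \<le> b" .
  moreover have "?D \<subseteq> {..<n}"
  proof
    fix w assume "w \<in> ?D"
    then obtain v where "v \<in> F" "w = fst (g v)" by blast
    then have "g v \<in> pspace n d" using g P by (auto simp: F_def)
    then show "w \<in> {..<n}" using \<open>w = fst (g v)\<close> by (auto simp: pspace_def)
  qed
  moreover have "\<exists>p p'. {p, p'} \<in> M \<and> fst p = v \<and> fst p' \<in> ?D" if v: "cnt P v = d" for v
    using g[OF v] F(1)[OF v] by (intro exI[of _ "(v, 0)"] exI[of _ "g v"]) auto
  ultimately show ?thesis unfolding lowcost_def by (intro exI[of _ ?D] conjI allI impI) auto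
qed

text \<open>The failure probability with remaining budget \<open>b - k\<close> satisfies the
  one-step inequality by \<open>fr_le_rv\<close> and \<open>lowcost_step\<close>. Near the solution
  at the final time the budget suffices for one neighbour per untouched vertex, so failure is
  impossible.\<close>

lemma controlled_lowcost:
  assumes d: "3 \<le> d" and n: "0 < n"
    and b: "real n * (z 0 (real N / real n) + q (real N / real n) + 2 * \<epsilon>) \<le> b"
  shows "controlled d z q \<epsilon> n N (\<lambda>t s. fr (pmatchings (fst s)) (\<lambda>M. \<not> lowcost d n (fst s) M (b - snd s)))"
  unfolding controlled_def fst_conv snd_conv
proof (intro conjI allI impI)
  fix P :: "point set" and k :: real
  assume P: "P \<subseteq> pspace n d"
  have fin: "finite P" by (rule finite_subset[OF P]) simp
  show "fr (pmatchings P) (\<lambda>M. \<not> lowcost d n P M (b - k)) \<le> 1"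
    by (rule fr_le_1[OF finite_pmatchings[OF fin]])
  show "fr (pmatchings P) (\<lambda>M. \<not> lowcost d n P M (b - k)) \<le> 0"
    if Z: "\<forall>j<d. \<bar>Zc d n P j / real n - z j (real N / real n)\<bar> \<le> \<epsilon>"
      and K: "\<bar>k / real n - q (real N / real n)\<bar> \<le> \<epsilon>"
  proof -
    have "\<bar>Zc d n P 0 / real n - z 0 (real N / real n)\<bar> \<le> \<epsilon>" using Z d by simp
    then have "Zc d n P 0 / real n + k / real n \<le> z 0 (real N / real n) + q (real N / real n) + 2 * \<epsilon>"
      using K by linarith
    then have "real n * (Zc d n P 0 / real n + k / real n) \<le> b"
      using b mult_left_mono[of _ _ "real n"] by (meson of_nat_0_le_iff order_trans)
    moreover have "real n * (Zc d n P 0 / real n + k / real n) = Zc d n P 0 + k"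
      using n by (simp add: distrib_left)
    ultimately have "Zc d n P 0 \<le> b - k" by simp
    then have "lowcost d n P M (b - k)" if "M \<in> pmatchings P" for M
      using lowcost_direct[OF P _ that] d by simp
    then have e: "{M \<in> pmatchings P. \<not> lowcost d n P M (b - k)} = {}" by blast
    show ?thesis unfolding fr_def e by simp
  qed
next
  fix P :: "point set" and k :: real and u
  assume P: "P \<subseteq> pspace n d" and u: "cnt P u = d"
  have fin: "finite P" by (rule finite_subset[OF P]) simp
  have "fr (pmatchings (P - pts [])) (\<lambda>M. \<not> lowcost d n P (M \<union> edges []) (b - k))
      \<le> rv (step d P u) P (\<lambda>s. fr (pmatchings (P - pts (snd s)))
           (\<lambda>M. \<not> lowcost d n (P - pts (snd s)) M (b - (k + cost s)))) []"
  proof (rule fr_le_rv[OF fin wp_wft[OF wp_step[OF P d u]]])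
    fix r H assume out: "(r, H) \<in> outs (step d P u) P []"
    show "fr (pmatchings (P - pts H)) (\<lambda>M. \<not> lowcost d n P (M \<union> edges H) (b - k))
        \<le> fr (pmatchings (P - pts (snd (r, H))))
           (\<lambda>M. \<not> lowcost d n (P - pts (snd (r, H))) M (b - (k + cost (r, H))))"
      unfolding snd_conv
      using lowcost_step[OF P d u out, of _ "b - k"] fin
      by (intro fr_mono finite_pmatchings) (auto simp: algebra_simps)
  qed
  then show "fr (pmatchings P) (\<lambda>M. \<not> lowcost d n P M (b - k))
      \<le> rv (step d P u) P (\<lambda>s. fr (pmatchings (P - pts (snd s)))
           (\<lambda>M. \<not> lowcost d n (P - pts (snd s)) M (b - (k + cost s)))) []" by simp
qed

section \<open>Transfer to random regular graphs\<close>

lemma finite_regular_graphs: "finite (regular_graphs n d)"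
  by (rule finite_subset[of _ "Pow (Pow {..<n})"]) (auto simp: regular_graphs_def)

lemma card_simple_matchings:
  assumes B: "B \<subseteq> regular_graphs n d"
  shows "card {M \<in> pmatchings (pspace n d). simple_m M \<and> graph_of M \<in> B} = card B * fact d ^ n"
proof -
  have fib: "fibre n d E = {M \<in> pmatchings (pspace n d). simple_m M \<and> graph_of M = E}" if "E \<in> B" for E
    using that B by (intro fibre_def) blast
  have "{M \<in> pmatchings (pspace n d). simple_m M \<and> graph_of M \<in> B} = (\<Union>E\<in>B. fibre n d E)"
    using fib by auto
  moreover have "finite (fibre n d E)" if "E \<in> B" for E
    unfolding fib[OF that] using finite_pmatchings[of "pspace n d"] by simp
  moreover have "finite B" by (rule finite_subset[OF B finite_regular_graphs])
  ultimately have "card {M \<in> pmatchings (pspace n d). simple_m M \<and> graph_of M \<in> B} = (\<Sum>E\<in>B. card (fibre n d E))"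
    by (simp add: card_UN_disjoint fib disjoint_iff)
  also have "\<dots> = (\<Sum>E\<in>B. fact d ^ n)" using B by (intro sum.cong refl card_fibre) blast
  finally show ?thesis by simp
qed

lemma total_dominating_lowcost:
  assumes "lowcost d n (pspace n d) M b"
  shows "\<exists>D. total_dominating {..<n} (graph_of M) D \<and> real (card D) \<le> b"
proof -
  obtain D where D: "D \<subseteq> {..<n}" "real (card D) \<le> b"
    "\<And>v. cnt (pspace n d) v = d \<Longrightarrow> \<exists>p p'. {p, p'} \<in> M \<and> fst p = v \<and> fst p' \<in> D"
    using assms unfolding lowcost_def by (elim exE conjE) blast
  have "\<exists>w\<in>D. {w, v} \<in> graph_of M" if v: "v < n" for v
  proof -
    have "{p \<in> pspace n d. fst p = v} = Pair v ` {..<d}" using v by (auto simp: pspace_def)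
    then have "cnt (pspace n d) v = d" by (simp add: cnt_def card_image inj_on_def)
    from D(3)[OF this] obtain p p' where p: "{p, p'} \<in> M" "fst p = v" "fst p' \<in> D" by blast
    have "fst ` {p, p'} \<in> graph_of M" unfolding graph_of_def using p(1) by (rule imageI)
    then show ?thesis using p(2,3) by (intro bexI[of _ "fst p'"]) (simp_all add: insert_commute)
  qed
  then show ?thesis using D(1,2) by (intro exI[of _ D]) (simp add: total_dominating_def)
qed

text \<open>Each bad graph is the projection of exactly \<open>fact d ^ n\<close> simple matchings,
  all of which fail. By \<open>many_simple_matchings\<close> the total number of matchings is at
  most the polynomial factor times \<open>card ?R * fact d ^ n\<close>, so \<open>fact d ^ n\<close>
  cancels. The same estimate shows that regular graphs exist.\<close>

lemma prob_small_total_dominating: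
  assumes d: "3 \<le> d" and ev: "even (n * d)" and n: "2 * (d * (2 * Suc d) + Suc d * d) \<le> n * d"
  shows "1 - real (n * d) ^ (7 * (Suc d * d)) * fr (pmatchings (pspace n d)) (\<lambda>M. \<not> lowcost d n (pspace n d) M b)
    \<le> measure_pmf.prob (random_regular_graph n d) {E. \<exists>D. total_dominating {..<n} E D \<and> real (card D) \<le> b}"
proof -
  let ?R = "regular_graphs n d" and ?pm = "pmatchings (pspace n d)" and ?N = "real (n * d) ^ (7 * (Suc d * d))"
  let ?W = "fr ?pm (\<lambda>M. \<not> lowcost d n (pspace n d) M b)"
  define G where "G = {E. \<exists>D. total_dominating {..<n} E D \<and> real (card D) \<le> b}"
  define B where "B = ?R - G"
  have finpm: "finite ?pm" by (simp add: finite_pmatchings)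
  obtain K where K: "n * d = 2 * K" using ev by (elim evenE)
  have "real (card ?pm) = pmk (2 * K) K" by (simp add: card_pmatchings card_pspace K pmk_full)
  then have pm0: "0 < real (card ?pm)" using pmk_pos[of K "2 * K"] by simp
  have simp_eq: "{M \<in> ?pm. simple_m M} = {M \<in> ?pm. simple_m M \<and> graph_of M \<in> ?R}"
    using graph_of_regular by blast
  have simp_card: "card {M \<in> ?pm. simple_m M} = card ?R * fact d ^ n"
    unfolding simp_eq by (rule card_simple_matchings) simp
  have le: "real (card ?pm) \<le> ?N * (real (card ?R) * fact d ^ n)"
    using many_simple_matchings[OF d ev n] unfolding simp_card by simp
  have R0: "card ?R \<noteq> 0"
  proof
    assume "card ?R = 0"
    then show False using le pm0 by simp
  qed
  then have Rne: "?R \<noteq> {}" by auto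
  have "card B * fact d ^ n = card {M \<in> ?pm. simple_m M \<and> graph_of M \<in> B}"
    by (rule card_simple_matchings[symmetric]) (auto simp: B_def)
  also have "\<dots> \<le> card {M \<in> ?pm. \<not> lowcost d n (pspace n d) M b}"
    using finpm by (intro card_mono) (auto simp: B_def G_def dest: total_dominating_lowcost)
  finally have "real (card B * fact d ^ n) \<le> real (card {M \<in> ?pm. \<not> lowcost d n (pspace n d) M b})"
    by (simp only: of_nat_le_iff)
  also have "\<dots> = ?W * real (card ?pm)" using pm0 by (simp add: fr_def)
  also have "\<dots> \<le> ?W * (?N * (real (card ?R) * fact d ^ n))"
    using le by (intro mult_left_mono fr_nonneg)
  finally have "real (card B) * fact d ^ n \<le> (?N * ?W * real (card ?R)) * fact d ^ n" by (simp add: mult_ac)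
  then have Bb: "real (card B) \<le> ?N * ?W * real (card ?R)"
    by (rule mult_right_le_imp_le) simp
  have "card (?R \<inter> G) + card B = card ?R"
    unfolding B_def using finite_regular_graphs[of n d]
    by (metis card_Int_Diff)
  then have "real (card (?R \<inter> G)) = real (card ?R) - real (card B)" by linarith
  then have "measure_pmf.prob (random_regular_graph n d) G = (real (card ?R) - real (card B)) / real (card ?R)"
    unfolding random_regular_graph_def measure_pmf_of_set[OF Rne finite_regular_graphs] by simp
  also have "\<dots> = 1 - real (card B) / real (card ?R)" using R0 by (simp add: diff_divide_distrib)
  finally have eq: "measure_pmf.prob (random_regular_graph n d) G = 1 - real (card B) / real (card ?R)" .
  have "real (card B) / real (card ?R) \<le> ?N * ?W" using Bb R0 by (simp add: pos_divide_le_eq)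
  then show ?thesis unfolding G_def[symmetric] eq by simp
qed

section \<open>Stopping time and conclusion\<close>

text \<open>A whole interval of stopping times is provided, because the number \<open>N\<close> of
  steps is an integer and \<open>N / n\<close> can only be placed between given bounds. The process
  must stop before the zero of \<open>z 0\<close>, where \<open>fluid_limit\<close> ceases to
  apply.\<close>

lemma stopping_interval:
  assumes max: "maximal_ivp_solution d T z q" and d: "3 \<le> d" and \<delta>: "0 < \<delta>"
  shows "\<exists>x1 x2. 0 \<le> x1 \<and> x1 < x2 \<and> ereal x2 < T \<and> (\<forall>x. 0 \<le> x \<longrightarrow> x \<le> x2 \<longrightarrow> 0 < z 0 x) \<and>
    (\<forall>x. x1 \<le> x \<longrightarrow> x \<le> x2 \<longrightarrow> z 0 x + q x \<le> q_star T z q + \<delta>)"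
proof -
  have "\<exists>X>0. (\<forall>y<X. ereal y < T) \<and> (\<forall>y. 0 \<le> y \<longrightarrow> y < X \<longrightarrow> 0 < z 0 y) \<and>
    (z 0 \<longlongrightarrow> 0) (at_left X) \<and> (q \<longlongrightarrow> q_star T z q) (at_left X)"
    by (rule ivp_end[OF max d])
  then obtain X where X: "0 < X" "\<forall>y<X. ereal y < T" "\<forall>y. 0 \<le> y \<longrightarrow> y < X \<longrightarrow> 0 < z 0 y"
    and lim: "(z 0 \<longlongrightarrow> 0) (at_left X)" "(q \<longlongrightarrow> q_star T z q) (at_left X)"
    by (elim exE conjE)
  have "((\<lambda>x. z 0 x + q x) \<longlongrightarrow> 0 + q_star T z q) (at_left X)" by (intro tendsto_add lim)
  then have "eventually (\<lambda>x. z 0 x + q x < q_star T z q + \<delta>) (at_left X)"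
    using \<delta> by (intro order_tendstoD(2)) auto
  then obtain b where b: "b < X" "\<And>y. b < y \<Longrightarrow> y < X \<Longrightarrow> z 0 y + q y < q_star T z q + \<delta>"
    unfolding eventually_at_left[OF X(1)] by blast
  obtain x1 where x1: "max b 0 < x1" "x1 < X" using dense[of "max b 0" X] b(1) X(1) by auto
  obtain x2 where x2: "x1 < x2" "x2 < X" using dense[OF x1(2)] by blast
  show ?thesis
  proof (rule exI[of _ x1], rule exI[of _ x2], intro conjI allI impI)
    show "ereal x2 < T" using X(2) x2 by blast
    show "0 < z 0 x" if "0 \<le> x" "x \<le> x2" for x using X(3) that x2 by auto
    show "z 0 x + q x \<le> q_star T z q + \<delta>" if "x1 \<le> x" "x \<le> x2" for x
      using b(2)[of x] that x1 x2 by simp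
  qed (use x1 x2 in auto)
qed

lemma polynomial_times_exp_decay:
  fixes c :: real
  assumes "0 < c" "0 < d"
  shows "(\<lambda>n. real (n * d) ^ k * exp (C - c * real n)) \<longlonglongrightarrow> 0"
proof -
  have "(\<lambda>n. (real d / c) ^ k * exp C * ((c * real n) ^ k * exp (- (c * real n)))) \<longlonglongrightarrow> (real d / c) ^ k * exp C * 0"
  proof (intro tendsto_mult tendsto_const)
    have l: "LIM n sequentially. c * real n :> at_top"
      using assms(1) filterlim_real_sequentially by (intro filterlim_tendsto_pos_mult_at_top[OF tendsto_const]) auto
    have "((\<lambda>x::real. x ^ k / exp x) \<longlongrightarrow> 0) at_top" by (rule tendsto_power_div_exp_0)
    from filterlim_compose[OF this l] show "(\<lambda>n. (c * real n) ^ k * exp (- (c * real n))) \<longlonglongrightarrow> 0"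
      by (simp add: exp_minus divide_inverse)
  qed
  moreover have "real (n * d) ^ k * exp (C - c * real n)
      = (real d / c) ^ k * exp C * ((c * real n) ^ k * exp (- (c * real n)))" for n
  proof -
    have "real (n * d) ^ k = (real d / c) ^ k * (c * real n) ^ k"
      using assms by (simp add: power_mult_distrib[symmetric] mult.commute)
    moreover have "exp (C - c * real n) = exp C * exp (- (c * real n))" by (simp add: exp_add[symmetric])
    ultimately show ?thesis by simp
  qed
  ultimately show ?thesis by simp
qed

theorem theorem1p3:
  fixes d :: nat and \<delta> :: real
    and T :: ereal and z :: "nat \<Rightarrow> real \<Rightarrow> real" and q :: "real \<Rightarrow> real"
  assumes "d \<ge> 3" and "\<delta> > 0"
    and "maximal_ivp_solution d T z q"
  shows "asymptotically_almost_surely d (\<lambda>n E.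
           \<exists>D. total_dominating {..<n} E D \<and>
               real (card D) \<le> real n * (q_star T z q + \<delta>))"
proof -
  note d = assms(1) and \<delta> = assms(2) and max = assms(3)
  have ivp: "ivp_solution d T z q" using max by (simp add: maximal_ivp_solution_def)
  let ?Q = "q_star T z q" and ?k = "7 * (Suc d * d)"
  have \<delta>2: "0 < \<delta> / 2" using \<delta> by simp
  obtain x1 x2 where x12: "0 \<le> x1" "x1 < x2" "ereal x2 < T" "\<forall>x. 0 \<le> x \<longrightarrow> x \<le> x2 \<longrightarrow> 0 < z 0 x"
    and stop: "\<forall>x. x1 \<le> x \<longrightarrow> x \<le> x2 \<longrightarrow> z 0 x + q x \<le> ?Q + \<delta> / 2"
    using stopping_interval[OF max d \<delta>2] by (elim exE conjE)
  have x2: "0 \<le> x2" using x12 by simp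
  have "\<exists>\<epsilon>1>0. \<forall>\<epsilon>. 0 < \<epsilon> \<longrightarrow> \<epsilon> \<le> \<epsilon>1 \<longrightarrow> tracked d z q x2 \<epsilon>"
    by (rule fluid_limit[OF ivp x2 x12(3) d]) (use x12(4) in blast)
  then obtain \<epsilon>1 where \<epsilon>1: "0 < \<epsilon>1" "\<forall>\<epsilon>. 0 < \<epsilon> \<longrightarrow> \<epsilon> \<le> \<epsilon>1 \<longrightarrow> tracked d z q x2 \<epsilon>" by (elim exE conjE)
  \<comment> \<open>Half of \<open>\<delta>\<close> is spent on stopping early; the deviations of
    \<open>z 0\<close> and \<open>q\<close>, each at most \<open>\<epsilon>\<close>, use at most the
    other half.\<close>
  define \<epsilon> where "\<epsilon> = min \<epsilon>1 (\<delta> / 4)"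
  have \<epsilon>: "0 < \<epsilon>" "\<epsilon> \<le> \<epsilon>1" "2 * \<epsilon> \<le> \<delta> / 2" using \<epsilon>1(1) \<delta> by (auto simp: \<epsilon>_def)
  have "tracked d z q x2 \<epsilon>" using \<epsilon>1(2) \<epsilon> by blast
  then obtain C c n0 where c: "0 < c"
    and track: "\<forall>n\<ge>n0. \<forall>N W. real N \<le> x2 * real n \<longrightarrow> controlled d z q \<epsilon> n N W \<longrightarrow>
      W 0 (pspace n d, 0) \<le> exp (C - c * real n)"
    unfolding tracked_def by (elim exE conjE)
  let ?b = "\<lambda>n. real n * (?Q + \<delta>)"
  let ?p = "\<lambda>n. measure_pmf.prob (random_regular_graph n d)
    {E. \<exists>D. total_dominating {..<n} E D \<and> real (card D) \<le> ?b n}"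
  \<comment> \<open>The summand with \<open>x2 - x1\<close> makes \<open>[x1 * n, x2 * n]\<close>
    long enough to contain an integer; the last summand serves
    \<open>many_simple_matchings\<close>.\<close>
  define n1 where "n1 = Suc (n0 + nat \<lceil>1 / (x2 - x1)\<rceil> + 2 * (d * (2 * Suc d) + Suc d * d))"
  have lower: "1 - real (n * d) ^ ?k * exp (C - c * real n) \<le> ?p n" if n: "n1 \<le> n" and ev: "even (n * d)" for n
  proof -
    have n0: "n0 \<le> n" "0 < n" using n by (simp_all add: n1_def)
    have nd: "2 * (d * (2 * Suc d) + Suc d * d) \<le> n * d"
    proof -
      have "2 * (d * (2 * Suc d) + Suc d * d) \<le> n" using n by (simp add: n1_def)
      also have "n * 1 \<le> n * d" using d by (intro mult_le_mono2) simp
      finally show ?thesis by simp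
    qed
    define N where "N = nat \<lceil>x1 * real n\<rceil>"
    have ceil: "0 \<le> x1 * real n" using x12 by simp
    have N: "x1 * real n \<le> real N" "real N \<le> x1 * real n + 1" using ceil unfolding N_def by linarith+
    have "nat \<lceil>1 / (x2 - x1)\<rceil> \<le> n" using n unfolding n1_def by linarith
    then have "real (nat \<lceil>1 / (x2 - x1)\<rceil>) \<le> real n" by (simp only: of_nat_le_iff)
    moreover have "1 / (x2 - x1) \<le> real (nat \<lceil>1 / (x2 - x1)\<rceil>)" by linarith
    ultimately have "1 / (x2 - x1) \<le> real n" by linarith
    then have "1 \<le> (x2 - x1) * real n" using x12(2) by (simp add: pos_divide_le_eq mult.commute)
    then have N2: "real N \<le> x2 * real n" using N(2) by (simp add: algebra_simps)
    have nr: "0 < real n" using n0 by simp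
    have "x1 \<le> real N / real n" "real N / real n \<le> x2"
      using N(1) N2 nr by (simp_all add: pos_le_divide_eq pos_divide_le_eq)
    then have "z 0 (real N / real n) + q (real N / real n) \<le> ?Q + \<delta> / 2" using stop by blast
    then have "z 0 (real N / real n) + q (real N / real n) + 2 * \<epsilon> \<le> ?Q + \<delta>" using \<epsilon>(3) by linarith
    then have "real n * (z 0 (real N / real n) + q (real N / real n) + 2 * \<epsilon>) \<le> ?b n"
      by (rule mult_left_mono) simp
    then have "controlled d z q \<epsilon> n N (\<lambda>t s. fr (pmatchings (fst s)) (\<lambda>M. \<not> lowcost d n (fst s) M (?b n - snd s)))"
      by (rule controlled_lowcost[where z = z and q = q, OF d n0(2)])
    from track[rule_format, OF n0(1) N2 this]
    have "fr (pmatchings (pspace n d)) (\<lambda>M. \<not> lowcost d n (pspace n d) M (?b n)) \<le> exp (C - c * real n)"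
      by (simp only: fst_conv snd_conv diff_zero)
    then have "real (n * d) ^ ?k * fr (pmatchings (pspace n d)) (\<lambda>M. \<not> lowcost d n (pspace n d) M (?b n))
        \<le> real (n * d) ^ ?k * exp (C - c * real n)"
      by (rule mult_left_mono) simp
    then show ?thesis using prob_small_total_dominating[OF d ev nd, of "?b n"] by linarith
  qed
  have "(\<lambda>n. 1 - real (n * d) ^ ?k * exp (C - c * real n)) \<longlonglongrightarrow> 1 - 0"
    using c d by (intro tendsto_diff tendsto_const polynomial_times_exp_decay) auto
  then have "((\<lambda>n. 1 - real (n * d) ^ ?k * exp (C - c * real n)) \<longlongrightarrow> 1) (inf sequentially (principal {n. even (n * d)}))"
    by (intro tendsto_mono[OF inf_le1]) simp
  moreover have "eventually (\<lambda>n. 1 - real (n * d) ^ ?k * exp (C - c * real n) \<le> ?p n)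
      (inf sequentially (principal {n. even (n * d)}))"
    unfolding eventually_inf_principal eventually_sequentially using lower by blast
  moreover have "eventually (\<lambda>n. ?p n \<le> 1) (inf sequentially (principal {n. even (n * d)}))"
    by (intro always_eventually allI) simp
  ultimately show ?thesis
    unfolding asymptotically_almost_surely_def
    by (intro tendsto_sandwich[of _ ?p _ "\<lambda>_. 1"]) auto
qed

end
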